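(* Let $k$ be an integer and define \[ d^\star_k = \frac{\ln k}{(k-1)\bigl(-\ln(1-1/k)\bigr)} + 1 . \] Then for any $k > 3$ and any integer $d$, \[ \lim_{n\to\infty} \Pr[\,F_{n,d,k} \text{ is satisfiable}\,] = \begin{cases} 0 & \text{if } d > d^\star_k,\\ 1 & \text{if } d < d^\star_k. \end{cases} \]
   Context: Fix positive integers $d$ (variable degree) and $k$ (clause size). For $n$ such that $k$ divides $dn$, set $m = dn/k$. The random formula $F_{n,d,k}$ (a $k$-uniform $d$-regular instance of Exact Cover, equivalently of Positive 1-in-$k$ SAT) is generated by the configuration model: there are $n$ variables and $m$ clauses; make $d$ copies of each variable and $k$ copies of each clause, and choose a uniformly random perfect matching between the $dn$ variable-copies and the $km$ clause-copies. The result is a bipartite multigraph in which each variable has degree $d$ and each clause has degree $k$. A satisfying assignment is a subset $T$ of the variables such that every clause is matched to exactly one copy of a variable in $T$ (i.e. exactly one of the $k$ variable slots of each clause is true). $F_{n,d,k}$ is satisfiable if such a $T$ exists. The limit is taken over $n$ with $k \mid dn$.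
   Formalization: For d < d*_k the limit 1 is taken over n divisible by k, not over all n with k | dn: a satisfying T has exactly n/k elements, so if k does not divide n the probability is 0 (e.g. k = 4, d = 2, n ≡ 2 mod 4). The case d > d*_k is as stated, with d positive. *)

theory Defs
  imports "HOL-Probability.Probability"
begin

definition var_copies :: "nat \<Rightarrow> nat \<Rightarrow> (nat \<times> nat) set" where
  "var_copies n d = {..<n} \<times> {..<d}"

definition clause_copies :: "nat \<Rightarrow> nat \<Rightarrow> (nat \<times> nat) set" where
  "clause_copies m k = {..<m} \<times> {..<k}"

definition num_clauses :: "nat \<Rightarrow> nat \<Rightarrow> nat \<Rightarrow> nat" where
  "num_clauses n d k = d * n div k"

text \<open>A perfect matching between the copies is a bijection from variable copies to clause copies;
  extensionality makes different functions represent different matchings. The first component of a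
  copy is the variable (clause) it belongs to.\<close>

definition matchings :: "nat \<Rightarrow> nat \<Rightarrow> nat \<Rightarrow> (nat \<times> nat \<Rightarrow> nat \<times> nat) set" where
  "matchings n d k =
     {\<sigma> \<in> extensional (var_copies n d).
        bij_betw \<sigma> (var_copies n d) (clause_copies (num_clauses n d k) k)}"

text \<open>The formula determined by a matching is the multigraph that it induces, and satisfaction is
  read off from the matching itself, with multiplicities: a clause that meets two copies of the same
  true variable is violated.\<close>

definition random_formula :: "nat \<Rightarrow> nat \<Rightarrow> nat \<Rightarrow> (nat \<times> nat \<Rightarrow> nat \<times> nat) pmf" where
  "random_formula n d k = pmf_of_set (matchings n d k)"

definition satisfying_assignment ::
    "nat \<Rightarrow> nat \<Rightarrow> nat \<Rightarrow> (nat \<times> nat \<Rightarrow> nat \<times> nat) \<Rightarrow> nat set \<Rightarrow> bool" where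
  "satisfying_assignment n d k \<sigma> T \<longleftrightarrow>
     T \<subseteq> {..<n} \<and>
     (\<forall>c < num_clauses n d k. \<exists>!v. v \<in> var_copies n d \<and> fst v \<in> T \<and> fst (\<sigma> v) = c)"

definition satisfiable :: "nat \<Rightarrow> nat \<Rightarrow> nat \<Rightarrow> (nat \<times> nat \<Rightarrow> nat \<times> nat) \<Rightarrow> bool" where
  "satisfiable n d k \<sigma> \<longleftrightarrow> (\<exists>T. satisfying_assignment n d k \<sigma> T)"

definition prob_satisfiable :: "nat \<Rightarrow> nat \<Rightarrow> nat \<Rightarrow> real" where
  "prob_satisfiable n d k = measure_pmf.prob (random_formula n d k) {\<sigma>. satisfiable n d k \<sigma>}"

definition d_star :: "nat \<Rightarrow> real" where
  "d_star k = ln (real k) / ((real k - 1) * (- ln (1 - 1 / real k))) + 1"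

lemma finite_matchings: "finite (matchings n d k)"
proof (rule finite_subset)
  show "matchings n d k \<subseteq>
      (var_copies n d \<rightarrow>\<^sub>E clause_copies (num_clauses n d k) k)"
    by (auto simp: matchings_def PiE_def bij_betw_def)
  show "finite (var_copies n d \<rightarrow>\<^sub>E clause_copies (num_clauses n d k) k)"
    by (rule finite_PiE) (auto simp: var_copies_def clause_copies_def)
qed

lemma matchings_nonempty:
  assumes "k dvd d * n"
  shows "matchings n d k \<noteq> {}"
proof -
  have "card (var_copies n d) = card (clause_copies (num_clauses n d k) k)"
    using assms by (simp add: var_copies_def clause_copies_def num_clauses_def mult.commute)
  then obtain f where f: "bij_betw f (var_copies n d) (clause_copies (num_clauses n d k) k)"
    by (metis finite_same_card_bij finite_SigmaI finite_lessThan var_copies_def clause_copies_def)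
  have "restrict f (var_copies n d) \<in> matchings n d k"
    using f by (simp add: matchings_def bij_betw_restrict_eq)
  then show ?thesis by blast
qed

lemma admissible_frequently:
  assumes "k > 0"
  shows "inf sequentially (principal {n. k dvd d * n}) \<noteq> bot"
    and "inf sequentially (principal {n. k dvd n}) \<noteq> bot"
proof -
  have *: "\<exists>n\<ge>N. k dvd n" for N
    using assms by (intro exI[of _ "k * N"]) auto
  show "inf sequentially (principal {n. k dvd n}) \<noteq> bot"
    by (auto simp: trivial_limit_def eventually_inf_principal eventually_sequentially)
      (meson *)
  show "inf sequentially (principal {n. k dvd d * n}) \<noteq> bot"
    by (auto simp: trivial_limit_def eventually_inf_principal eventually_sequentially)
      (meson * dvd_mult)
qed

text \<open>A satisfying assignment has exactly \<open>n / k\<close> true variables. Hence if \<open>k\<close> divides \<open>d n\<close> but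
  not \<open>n\<close>, every formula is unsatisfiable, and a limit equal to 1 can only be taken along
  multiples of \<open>k\<close>.\<close>

lemma satisfying_assignment_card:
  assumes "d > 0" "k dvd d * n" and \<sigma>: "\<sigma> \<in> matchings n d k"
    and T: "satisfying_assignment n d k \<sigma> T"
  shows "k * card T = n"
proof -
  let ?m = "num_clauses n d k"
  have sub: "T \<subseteq> {..<n}"
    and ex1: "\<And>c. c < ?m \<Longrightarrow> \<exists>!v. v \<in> var_copies n d \<and> fst v \<in> T \<and> fst (\<sigma> v) = c"
    using T by (auto simp: satisfying_assignment_def)
  have mem: "v \<in> T \<times> {..<d} \<longleftrightarrow> v \<in> var_copies n d \<and> fst v \<in> T" for v
    using sub by (cases v) (auto simp: var_copies_def)
  have into: "fst (\<sigma> v) < ?m" if "v \<in> var_copies n d" for v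
  proof -
    have "\<sigma> v \<in> clause_copies ?m k"
      using \<sigma> that by (auto simp: matchings_def bij_betw_def)
    then show ?thesis by (auto simp: clause_copies_def)
  qed
  have "bij_betw (\<lambda>v. fst (\<sigma> v)) (T \<times> {..<d}) {..<?m}"
    unfolding bij_betw_def
  proof
    show "inj_on (\<lambda>v. fst (\<sigma> v)) (T \<times> {..<d})"
      unfolding inj_on_def using mem into ex1 by metis
    show "(\<lambda>v. fst (\<sigma> v)) ` (T \<times> {..<d}) = {..<?m}"
    proof (intro equalityI subsetI)
      fix c assume "c \<in> (\<lambda>v. fst (\<sigma> v)) ` (T \<times> {..<d})"
      then show "c \<in> {..<?m}" using mem into by blast
    next
      fix c assume "c \<in> {..<?m}"
      then obtain v where "v \<in> var_copies n d" "fst v \<in> T" "fst (\<sigma> v) = c"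
        using ex1 by blast
      then show "c \<in> (\<lambda>v. fst (\<sigma> v)) ` (T \<times> {..<d})" using mem by blast
    qed
  qed
  then have "card (T \<times> {..<d}) = card {..<?m}"
    by (rule bij_betw_same_card)
  then have "card T * d = ?m"
    by (simp add: card_cartesian_product)
  then have "d * (k * card T) = d * n"
    using assms(2) unfolding num_clauses_def
    by (metis dvd_mult_div_cancel mult.assoc mult.commute)
  then show ?thesis using assms(1) by simp
qed

lemma prob_satisfiable_eq_0:
  assumes "d > 0" "k dvd d * n" "\<not> k dvd n"
  shows "prob_satisfiable n d k = 0"
proof -
  have "matchings n d k \<inter> {\<sigma>. satisfiable n d k \<sigma>} = {}"
    using satisfying_assignment_card[OF assms(1,2)] assms(3)
    unfolding satisfiable_def by (blast intro: dvdI[OF sym])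
  then show ?thesis
    unfolding prob_satisfiable_def random_formula_def
    by (subst measure_pmf_of_set[OF matchings_nonempty[OF assms(2)] finite_matchings]) simp
qed

end

theory Submission
  imports Defs "HOL-Real_Asymp.Real_Asymp"
begin

text \<open>Let \<open>X\<close> be the number of satisfying assignments; all of them have \<open>n / k\<close> true variables. Above
  the threshold, \<open>E X\<close> tends to 0 exponentially fast. Below it, Laplace's method gives that
  \<open>E X\<^sup>2 / (E X)\<^sup>2\<close> tends to \<open>S = sqrt ((k - 1) / (k - d))\<close>, which is larger than 1, so Chebyshev's
  inequality does not suffice. The excess is explained by the short cycles of the formula (small subgraph
  conditioning). Let \<open>Y\<close> be the product of \<open>1 + (- 1 / (k - 1)) ^ l\<close> over the cycles of length \<open>2 l\<close>
  with \<open>l \<le> L\<close>, divided by its mean. In the limit both \<open>E (X Y) / E X\<close> and \<open>E Y\<^sup>2\<close> are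
  \<open>exp (\<Sum>l=1..L. ((d - 1) / (k - 1)) ^ l / (2 * l))\<close>, which tends to \<open>S\<close> as \<open>L\<close> grows. Hence
  \<open>X / E X - Y\<close> is small in the mean square, while \<open>Y\<close> is bounded away from 0 with high probability.
  To keep all moments polynomial, \<open>Y\<close> is replaced by its expansion into disjoint families of at most
  \<open>K\<close> cycles. Throughout, \<open>n = k * a\<close>, and the limits are those of \<open>a\<close> tending to infinity.\<close>

section \<open>Counting matchings\<close>

text \<open>The exponential rate of \<open>E X\<close> is
  \<open>ln k - (d - 1) * (k - 1) * (ln k - ln (k - 1))\<close>, and \<open>d_star k\<close> is
  where it changes sign. The same number is the value of \<open>overlap_rate\<close> at overlap 1,
  where the second moment counts every solution once: pairs of equal assignments are negligible
  exactly where \<open>E X\<close> grows. The other danger, an intermediate overlap that beats the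
  independent value \<open>1 / k\<close>, is excluded because the rate has at most one inflection
  point. The number \<open>- 1 / (k - 1)\<close> is the ratio of the two eigenvalues of the transfer
  matrix of truth values along a cycle of a formula with a planted solution; for unplanted formulas
  only the larger eigenvalue is seen. The order of the parameters matters: the lower bound for
  \<open>Y\<close> is fixed from the admissible error alone, since it rests on a variance that stays
  bounded in \<open>L\<close>; then \<open>L\<close> is chosen to make the mean square small against
  the square of that bound, then \<open>K\<close>, and only then does \<open>a\<close> tend to
  infinity.\<close>

lemma card_labelled_bijections:
  fixes f :: "'a \<Rightarrow> 'l" and g :: "'b \<Rightarrow> 'l"
  assumes "finite V" "finite C" "finite L" "f ` V \<subseteq> L"
    and "\<And>x. card {v \<in> V. f v = x} = card {c \<in> C. g c = x}"
  shows "card {\<sigma> \<in> extensional V. bij_betw \<sigma> V C \<and> (\<forall>v\<in>V. g (\<sigma> v) = f v)}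
         = (\<Prod>x\<in>L. fact (card {v \<in> V. f v = x}))"
  using assms
proof (induction V arbitrary: C rule: finite_induct)
  case empty
  have "C = {}"
  proof (rule ccontr)
    assume "C \<noteq> {}"
    then obtain c where "c \<in> C" by blast
    then have "card {c' \<in> C. g c' = g c} > 0"
      using empty by (auto simp: card_gt_0_iff)
    then show False using empty(4)[of "g c"] by simp
  qed
  then show ?case by (simp add: bij_betw_def)
next
  case (insert v0 V C)
  let ?S = "\<lambda>V C. {\<sigma> \<in> extensional V. bij_betw \<sigma> V C \<and> (\<forall>v\<in>V. g (\<sigma> v) = f v)}"
  let ?C0 = "{c \<in> C. g c = f v0}"
  have finC: "finite C" by fact
  \<comment> \<open>Split by the image of \<open>v0\<close>: it is a point of \<open>C\<close> with
    the same label, and the rest of the map is a label-preserving bijection onto \<open>C\<close>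
    without that point.\<close>
  have eq: "?S (insert v0 V) C = (\<Union>c\<in>?C0. (\<lambda>\<sigma>. \<sigma>(v0 := c)) ` ?S V (C - {c}))"
  proof (intro equalityI subsetI)
    fix \<sigma> assume s: "\<sigma> \<in> ?S (insert v0 V) C"
    have bij: "bij_betw \<sigma> (insert v0 V) C" using s by simp
    have "bij_betw \<sigma> V (C - {\<sigma> v0})"
      using bij insert.hyps by (auto simp: bij_betw_def) (metis image_eqI)
    then have "bij_betw (\<sigma>(v0 := undefined)) V (C - {\<sigma> v0})"
      using insert.hyps by (subst bij_betw_cong[of _ _ \<sigma>]) auto
    then have "\<sigma>(v0 := undefined) \<in> ?S V (C - {\<sigma> v0})"
      using s insert.hyps by (auto simp: extensional_def)
    moreover have "\<sigma> = (\<sigma>(v0 := undefined))(v0 := \<sigma> v0)" by simp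
    moreover have "\<sigma> v0 \<in> ?C0" using s bij by (auto simp: bij_betw_def)
    ultimately show "\<sigma> \<in> (\<Union>c\<in>?C0. (\<lambda>\<sigma>. \<sigma>(v0 := c)) ` ?S V (C - {c}))" by blast
  next
    fix \<sigma> assume "\<sigma> \<in> (\<Union>c\<in>?C0. (\<lambda>\<sigma>. \<sigma>(v0 := c)) ` ?S V (C - {c}))"
    then obtain c \<tau> where c: "c \<in> ?C0" and t: "\<tau> \<in> ?S V (C - {c})" and e: "\<sigma> = \<tau>(v0 := c)" by blast
    have "bij_betw \<sigma> V (C - {c})"
      unfolding e using t insert.hyps by (subst bij_betw_cong[of _ _ \<tau>]) auto
    then have "bij_betw \<sigma> (insert v0 V) C"
      using c insert.hyps e by (auto simp: bij_betw_def)
    then show "\<sigma> \<in> ?S (insert v0 V) C"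
      using t c insert.hyps unfolding e by (auto simp: extensional_def)
  qed
  have fin: "finite (?S V C')" if "finite C'" for C'
  proof (rule finite_subset)
    show "?S V C' \<subseteq> V \<rightarrow>\<^sub>E C'" by (auto simp: PiE_def bij_betw_def)
    show "finite (V \<rightarrow>\<^sub>E C')" using that insert.hyps by (intro finite_PiE) auto
  qed
  have inj: "inj_on (\<lambda>\<sigma>. \<sigma>(v0 := c)) (?S V (C - {c}))" for c
  proof (rule inj_onI)
    fix \<sigma> \<tau> assume a: "\<sigma> \<in> ?S V (C - {c})" "\<tau> \<in> ?S V (C - {c})" "\<sigma>(v0 := c) = \<tau>(v0 := c)"
    then have "\<sigma> v0 = undefined" "\<tau> v0 = undefined" using insert.hyps by (auto simp: extensional_def)
    then show "\<sigma> = \<tau>" using a(3) by (metis fun_upd_triv fun_upd_upd)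
  qed
  have cardc: "card (?S V (C - {c})) = (\<Prod>x\<in>L. fact (card {v \<in> V. f v = x}))" if c: "c \<in> ?C0" for c
  proof (rule insert.IH)
    show "finite (C - {c})" "finite L" "f ` V \<subseteq> L" using insert.prems by auto
    fix x
    have 1: "card {v \<in> insert v0 V. f v = x} = card {v \<in> V. f v = x} + (if f v0 = x then 1 else 0)"
    proof (cases "f v0 = x")
      case True
      then have "{v \<in> insert v0 V. f v = x} = insert v0 {v \<in> V. f v = x}" by auto
      then show ?thesis using True insert.hyps by simp
    next
      case False
      then have "{v \<in> insert v0 V. f v = x} = {v \<in> V. f v = x}" by auto
      then show ?thesis using False by simp
    qed
    have 2: "card {c' \<in> C. g c' = x} = card {c' \<in> C - {c}. g c' = x} + (if f v0 = x then 1 else 0)"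
    proof (cases "f v0 = x")
      case True
      then have "{c' \<in> C. g c' = x} = insert c {c' \<in> C - {c}. g c' = x}" using c by auto
      then show ?thesis using True finC by simp
    next
      case False
      then have "{c' \<in> C. g c' = x} = {c' \<in> C - {c}. g c' = x}" using c by auto
      then show ?thesis using False by simp
    qed
    show "card {v \<in> V. f v = x} = card {c' \<in> C - {c}. g c' = x}"
      using 1 2 insert.prems(4)[of x] by simp
  qed
  have "card (?S (insert v0 V) C) = (\<Sum>c\<in>?C0. card ((\<lambda>\<sigma>. \<sigma>(v0 := c)) ` ?S V (C - {c})))"
    unfolding eq
  proof (rule card_UN_disjoint)
    show "finite ?C0" using finC by simp
    show "\<forall>c\<in>?C0. finite ((\<lambda>\<sigma>. \<sigma>(v0 := c)) ` ?S V (C - {c}))" using fin finC by simp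
    show "\<forall>i\<in>?C0. \<forall>j\<in>?C0. i \<noteq> j \<longrightarrow>
        (\<lambda>\<sigma>. \<sigma>(v0 := i)) ` ?S V (C - {i}) \<inter> (\<lambda>\<sigma>. \<sigma>(v0 := j)) ` ?S V (C - {j}) = {}"
    proof (intro ballI impI)
      fix i j :: 'b assume "i \<noteq> j"
      have "x v0 = i" if "x \<in> (\<lambda>\<sigma>. \<sigma>(v0 := i)) ` Z" for x i and Z :: "('a \<Rightarrow> 'b) set" using that by auto
      then show "(\<lambda>\<sigma>. \<sigma>(v0 := i)) ` ?S V (C - {i}) \<inter> (\<lambda>\<sigma>. \<sigma>(v0 := j)) ` ?S V (C - {j}) = {}"
        using \<open>i \<noteq> j\<close> by (metis (no_types, lifting) disjoint_iff)
    qed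
  qed
  also have "\<dots> = (\<Sum>c\<in>?C0. \<Prod>x\<in>L. fact (card {v \<in> V. f v = x}))"
    using inj cardc by (intro sum.cong) (auto simp: card_image)
  also have "\<dots> = card ?C0 * (\<Prod>x\<in>L. fact (card {v \<in> V. f v = x}))" by simp
  also have "card ?C0 = card {v \<in> insert v0 V. f v = f v0}" using insert.prems(4) by metis
  also have "{v \<in> insert v0 V. f v = f v0} = insert v0 {v \<in> V. f v = f v0}" by auto
  also have "card \<dots> = Suc (card {v \<in> V. f v = f v0})" using insert.hyps by simp
  also have "Suc (card {v \<in> V. f v = f v0}) * (\<Prod>x\<in>L. fact (card {v \<in> V. f v = x}))
     = (\<Prod>x\<in>L. fact (card {v \<in> insert v0 V. f v = x}))"
  proof -
    have mem: "f v0 \<in> L" using insert.prems by simp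
    have r: "(\<Prod>x\<in>L - {f v0}. fact (card {v \<in> V. f v = x}))
        = (\<Prod>x\<in>L - {f v0}. fact (card {v \<in> insert v0 V. f v = x}) :: nat)"
      by (intro prod.cong refl arg_cong[where f = fact] arg_cong[where f = card]) auto
    have i: "{v \<in> insert v0 V. f v = f v0} = insert v0 {v \<in> V. f v = f v0}" by auto
    show ?thesis
      unfolding prod.remove[OF \<open>finite L\<close> mem] r i using insert.hyps by (simp add: algebra_simps)
  qed
  finally show ?case by simp
qed

text \<open>Reduced to the plain count by relabelling. Both ends of each prescribed edge get a
  private label \<open>Inr v\<close>, which forces the edge; all other points keep their label as
  \<open>Inl\<close>. A private class contributes \<open>fact 1\<close>, and an old class loses its
  edges of \<open>E\<close>.\<close>

lemma card_labelled_bijections_extending: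
  fixes f :: "'a \<Rightarrow> 'l" and g :: "'b \<Rightarrow> 'l"
  assumes "finite V" "finite C" "finite L" "f ` V \<subseteq> L"
    and card: "\<And>x. card {v \<in> V. f v = x} = card {c \<in> C. g c = x}"
    and E: "E \<subseteq> V \<times> C" "inj_on fst E" "inj_on snd E" "\<And>v c. (v, c) \<in> E \<Longrightarrow> g c = f v"
  shows "card {\<sigma> \<in> extensional V. bij_betw \<sigma> V C \<and> (\<forall>v\<in>V. g (\<sigma> v) = f v) \<and> (\<forall>(v, c)\<in>E. \<sigma> v = c)}
         = (\<Prod>x\<in>L. fact (card {v \<in> V. f v = x} - card {e \<in> E. f (fst e) = x}))"
proof -
  have finE: "finite E" using E(1) assms(1,2) by (meson finite_SigmaI finite_subset)
  define h where "h c = (THE v. (v, c) \<in> E)" for c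
  have h: "h c = v" if "(v, c) \<in> E" for v c
  proof -
    have "u = v" if uc: "(u, c) \<in> E" for u
      using inj_onD[OF E(3) _ uc \<open>(v, c) \<in> E\<close>] by simp
    then show ?thesis unfolding h_def using that by (rule the_equality[rotated])
  qed
  define f' where "f' v = (if v \<in> fst ` E then Inr v else Inl (f v))" for v
  define g' where "g' c = (if c \<in> snd ` E then Inr (h c) else Inl (g c))" for c
  have *: "{\<sigma> \<in> extensional V. bij_betw \<sigma> V C \<and> (\<forall>v\<in>V. g (\<sigma> v) = f v) \<and> (\<forall>(v, c)\<in>E. \<sigma> v = c)}
     = {\<sigma> \<in> extensional V. bij_betw \<sigma> V C \<and> (\<forall>v\<in>V. g' (\<sigma> v) = f' v)}" (is "?A = ?B")
  proof (intro equalityI subsetI)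
    fix \<sigma> assume s: "\<sigma> \<in> ?A"
    have "g' (\<sigma> v) = f' v" if v: "v \<in> V" for v
    proof (cases "v \<in> fst ` E")
      case True
      then obtain c where c: "(v, c) \<in> E" by auto
      then have "\<sigma> v = c" using s by auto
      then show ?thesis using c h[OF c] True by (auto simp: f'_def g'_def rev_image_eqI)
    next
      case False
      have "\<sigma> v \<notin> snd ` E"
      proof
        assume "\<sigma> v \<in> snd ` E"
        then obtain u where u: "(u, \<sigma> v) \<in> E" by auto
        then have "\<sigma> u = \<sigma> v" "u \<in> V" using s E(1) by auto
        then have "u = v" using s v by (auto simp: bij_betw_def dest: inj_onD)
        then show False using u False by force
      qed
      then show ?thesis using False s v by (simp add: f'_def g'_def)
    qed
    then show "\<sigma> \<in> ?B" using s by simp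
  next
    fix \<sigma> assume s: "\<sigma> \<in> ?B"
    have ext: "\<sigma> v = c" if vc: "(v, c) \<in> E" for v c
    proof -
      have "v \<in> V" "v \<in> fst ` E" using vc E(1) by force+
      then have "g' (\<sigma> v) = Inr v" using s by (auto simp: f'_def)
      then have "\<sigma> v \<in> snd ` E" "h (\<sigma> v) = v" by (auto simp: g'_def split: if_splits)
      then obtain u where u: "(u, \<sigma> v) \<in> E" by auto
      then have "u = v" using h \<open>h (\<sigma> v) = v\<close> by blast
      then show ?thesis using u vc inj_onD[OF E(2), of "(v, \<sigma> v)" "(v, c)"] by simp
    qed
    have "g (\<sigma> v) = f v" if v: "v \<in> V" for v
    proof (cases "v \<in> fst ` E")
      case True
      then obtain c where c: "(v, c) \<in> E" by auto
      then show ?thesis using ext[OF c] E(4) by simp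
    next
      case False
      then have "g' (\<sigma> v) = Inl (f v)" using s v by (auto simp: f'_def)
      then show ?thesis by (auto simp: g'_def split: if_splits)
    qed
    then show "\<sigma> \<in> ?A" using s ext by auto
  qed
  have l: "card {v \<in> V. f' v = Inl x} = card {v \<in> V. f v = x} - card {e \<in> E. f (fst e) = x}" for x
  proof -
    have "{v \<in> V. f' v = Inl x} = {v \<in> V. f v = x} - fst ` {e \<in> E. f (fst e) = x}"
      by (auto simp: f'_def split: if_splits)
    moreover have "fst ` {e \<in> E. f (fst e) = x} \<subseteq> {v \<in> V. f v = x}" using E(1) by auto
    ultimately have "card {v \<in> V. f' v = Inl x} = card {v \<in> V. f v = x} - card (fst ` {e \<in> E. f (fst e) = x})"
      using finE by (simp add: card_Diff_subset)
    then show ?thesis using E(2) by (simp add: card_image inj_on_subset)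
  qed
  have r: "card {c \<in> C. g' c = Inl x} = card {c \<in> C. g c = x} - card {e \<in> E. f (fst e) = x}" for x
  proof -
    have "{c \<in> C. g' c = Inl x} = {c \<in> C. g c = x} - snd ` {e \<in> E. f (fst e) = x}"
    proof (intro set_eqI iffI)
      fix c assume c: "c \<in> {c \<in> C. g' c = Inl x}"
      then have "c \<notin> snd ` E" by (auto simp: g'_def split: if_splits)
      then show "c \<in> {c \<in> C. g c = x} - snd ` {e \<in> E. f (fst e) = x}" using c by (auto simp: g'_def)
    next
      fix c assume c: "c \<in> {c \<in> C. g c = x} - snd ` {e \<in> E. f (fst e) = x}"
      have "c \<notin> snd ` E"
      proof
        assume "c \<in> snd ` E"
        then obtain v where v: "(v, c) \<in> E" by auto
        then have "f v = x" using E(4) c by auto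
        then show False using c v by force
      qed
      then show "c \<in> {c \<in> C. g' c = Inl x}" using c by (auto simp: g'_def)
    qed
    moreover have "snd ` {e \<in> E. f (fst e) = x} \<subseteq> {c \<in> C. g c = x}" using E(1,4) by auto
    ultimately have "card {c \<in> C. g' c = Inl x} = card {c \<in> C. g c = x} - card (snd ` {e \<in> E. f (fst e) = x})"
      using finE by (simp add: card_Diff_subset)
    then show ?thesis using E(3) by (simp add: card_image inj_on_subset)
  qed
  have l': "{v \<in> V. f' v = Inr u} = (if u \<in> fst ` E then {u} else {})" for u
    using E(1) by (auto simp: f'_def split: if_splits)
  have r': "card {c \<in> C. g' c = Inr u} = (if u \<in> fst ` E then 1 else 0)" for u
  proof (cases "u \<in> fst ` E")
    case True
    then obtain c where c: "(u, c) \<in> E" by auto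
    have "{c \<in> C. g' c = Inr u} = {c}"
    proof (intro equalityI subsetI)
      fix c' assume "c' \<in> {c \<in> C. g' c = Inr u}"
      then have "c' \<in> snd ` E" "h c' = u" by (auto simp: g'_def split: if_splits)
      then have "(u, c') \<in> E" using h by force
      then show "c' \<in> {c}" using c inj_onD[OF E(2), of "(u, c')" "(u, c)"] by simp
    next
      fix c' assume "c' \<in> {c}"
      then show "c' \<in> {c \<in> C. g' c = Inr u}" using c h[OF c] E(1) by (force simp: g'_def)
    qed
    then show ?thesis using True by simp
  next
    case False
    have "g' c \<noteq> Inr u" for c
    proof
      assume "g' c = Inr u"
      then have "c \<in> snd ` E" "h c = u" by (auto simp: g'_def split: if_splits)
      then have "(u, c) \<in> E" using h by force
      then show False using False by force
    qed
    then show ?thesis using False by simp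
  qed
  have "card ?B = (\<Prod>x\<in>L <+> fst ` E. fact (card {v \<in> V. f' v = x}))"
  proof (rule card_labelled_bijections)
    show "finite V" "finite C" "finite (L <+> fst ` E)" using assms finE by auto
    show "f' ` V \<subseteq> L <+> fst ` E" using assms(4) by (auto simp: f'_def)
    fix x show "card {v \<in> V. f' v = x} = card {c \<in> C. g' c = x}"
      by (cases x) (simp_all add: l r l' r' card)
  qed
  also have "\<dots> = (\<Prod>x\<in>L. fact (card {v \<in> V. f' v = Inl x})) * (\<Prod>x\<in>fst ` E. fact (card {v \<in> V. f' v = Inr x}))"
    using assms(3) finE by (subst prod.Plus) auto
  also have "\<dots> = (\<Prod>x\<in>L. fact (card {v \<in> V. f v = x} - card {e \<in> E. f (fst e) = x}))"
    by (simp add: l l')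
  finally show ?thesis unfolding * .
qed

section \<open>Matchings, and matchings satisfied by a given assignment\<close>

locale regular_cover =
  fixes k d :: nat
  assumes k_gt: "k > 3" and d_pos: "d > 0"
begin

abbreviation "V a \<equiv> var_copies (k * a) d"
abbreviation "C a \<equiv> clause_copies (d * a) k"
abbreviation "Mt a \<equiv> matchings (k * a) d k"
abbreviation "sat a \<equiv> satisfying_assignment (k * a) d k"

lemma num_clauses_eq [simp]: "num_clauses (k * a) d k = d * a"
  using k_gt by (simp add: num_clauses_def)

lemma finite_copies [simp]: "finite (V a)" "finite (C a)"
  by (auto simp: var_copies_def clause_copies_def)

lemma card_V: "card (V a) = d * k * a" and card_C: "card (C a) = d * k * a"
  by (auto simp: var_copies_def clause_copies_def)

lemma Mt_eq: "Mt a = {\<sigma> \<in> extensional (V a). bij_betw \<sigma> (V a) (C a)}"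
  by (simp add: matchings_def)

lemma finite_Mt [simp]: "finite (Mt a)" by (rule finite_matchings)

lemma card_Mt_extending:
  assumes "E \<subseteq> V a \<times> C a" "inj_on fst E" "inj_on snd E"
  shows "card {\<sigma> \<in> Mt a. \<forall>(v, c)\<in>E. \<sigma> v = c} = fact (d * k * a - card E)"
proof -
  have "card {\<sigma> \<in> extensional (V a). bij_betw \<sigma> (V a) (C a) \<and> (\<forall>v\<in>V a. () = ()) \<and> (\<forall>(v, c)\<in>E. \<sigma> v = c)}
     = (\<Prod>x\<in>{()}. fact (card {v \<in> V a. () = x} - card {e \<in> E. () = x}))"
    by (rule card_labelled_bijections_extending) (use assms in \<open>auto simp: card_V card_C\<close>)
  then show ?thesis by (simp add: Mt_eq card_V conj_ac)
qed

lemma card_Mt: "card (Mt a) = fact (d * k * a)"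
  using card_Mt_extending[of "{}" a] by simp

lemma card_Mt_extending_le:
  assumes "E \<subseteq> V a \<times> C a"
  shows "card {\<sigma> \<in> Mt a. \<forall>(v, c)\<in>E. \<sigma> v = c} \<le> fact (d * k * a - card E)"
proof (cases "inj_on fst E \<and> inj_on snd E")
  case True
  then show ?thesis using card_Mt_extending[OF assms] by simp
next
  case False
  have "{\<sigma> \<in> Mt a. \<forall>(v, c)\<in>E. \<sigma> v = c} = {}"
  proof (rule equals0I)
    fix \<sigma> assume "\<sigma> \<in> {\<sigma> \<in> Mt a. \<forall>(v, c)\<in>E. \<sigma> v = c}"
    then have s: "\<sigma> \<in> Mt a" "\<And>v c. (v, c) \<in> E \<Longrightarrow> \<sigma> v = c" by auto
    have sn: "\<sigma> (fst e) = snd e" if "e \<in> E" for e using s(2)[of "fst e" "snd e"] that by simp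
    have "inj_on fst E" by (rule inj_onI) (metis sn prod_eqI)
    moreover have "inj_on snd E"
    proof (rule inj_onI)
      fix e e' assume e: "e \<in> E" "e' \<in> E" "snd e = snd e'"
      then have "\<sigma> (fst e) = \<sigma> (fst e')" using sn by metis
      moreover have "fst e \<in> V a" "fst e' \<in> V a" using e assms by auto
      ultimately have "fst e = fst e'" using s(1) by (auto simp: Mt_eq bij_betw_def dest: inj_onD)
      then show "e = e'" using e by (simp add: prod_eq_iff)
    qed
    ultimately show False using False by simp
  qed
  then show ?thesis by (simp only: card.empty le0)
qed

text \<open>Fixing the true slot of every clause in advance, by \<open>\<rho>\<close>, turns satisfaction into a prescription
  of which copies are matched to which slots.\<close>

definition hits :: "nat \<Rightarrow> (nat \<Rightarrow> nat) \<Rightarrow> nat set \<Rightarrow> (nat \<times> nat \<Rightarrow> nat \<times> nat) \<Rightarrow> bool" where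
  "hits a \<rho> T \<sigma> \<longleftrightarrow> (\<forall>v\<in>V a. (snd (\<sigma> v) = \<rho> (fst (\<sigma> v))) = (fst v \<in> T))"

lemma hitsD: "hits a \<rho> T \<sigma> \<Longrightarrow> v \<in> V a \<Longrightarrow> (snd (\<sigma> v) = \<rho> (fst (\<sigma> v))) = (fst v \<in> T)"
  by (simp add: hits_def)

abbreviation "slots a \<equiv> {..<d * a} \<rightarrow>\<^sub>E {..<k}"

lemma slots_in_C: "\<rho> \<in> slots a \<Longrightarrow> c < d * a \<Longrightarrow> (c, \<rho> c) \<in> C a"
  by (auto simp: clause_copies_def PiE_def Pi_def)

lemma Mt_image: "\<sigma> \<in> Mt a \<Longrightarrow> v \<in> V a \<Longrightarrow> \<sigma> v \<in> C a"
  by (auto simp: Mt_eq bij_betw_def)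

lemma Mt_inj: "\<sigma> \<in> Mt a \<Longrightarrow> v \<in> V a \<Longrightarrow> w \<in> V a \<Longrightarrow> \<sigma> v = \<sigma> w \<Longrightarrow> v = w"
  by (auto simp: Mt_eq bij_betw_def dest: inj_onD)

lemma Mt_surj: "\<sigma> \<in> Mt a \<Longrightarrow> c \<in> C a \<Longrightarrow> \<exists>v\<in>V a. \<sigma> v = c"
  unfolding Mt_eq bij_betw_def by (metis (mono_tags, lifting) imageE mem_Collect_eq)

lemma C_D: "c \<in> C a \<Longrightarrow> fst c < d * a \<and> snd c < k"
  by (auto simp: clause_copies_def)

text \<open>The copy matched to slot \<open>\<rho> c\<close> of clause \<open>c\<close> is true,
  hence under \<open>\<rho>'\<close> it must sit in slot \<open>\<rho>' c\<close>. Uniqueness makes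
  the decomposition of the satisfied matchings over \<open>\<rho>\<close> disjoint.\<close>

lemma hits_unique:
  assumes "\<sigma> \<in> Mt a" "\<rho> \<in> slots a" "\<rho>' \<in> slots a" "hits a \<rho> T \<sigma>" "hits a \<rho>' T \<sigma>"
  shows "\<rho> = \<rho>'"
proof (rule PiE_ext[OF assms(2,3)])
  fix c assume c: "c \<in> {..<d * a}"
  then obtain v where v: "v \<in> V a" "\<sigma> v = (c, \<rho> c)"
    using Mt_surj[OF assms(1) slots_in_C[OF assms(2)]] by blast
  then have "fst v \<in> T" using hitsD[OF assms(4) v(1)] by simp
  then have "snd (\<sigma> v) = \<rho>' (fst (\<sigma> v))" using hitsD[OF assms(5) v(1)] by simp
  then show "\<rho> c = \<rho>' c" using v by simp
qed

text \<open>The witness \<open>\<rho>\<close> records for every clause the slot of its unique true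
  copy. Conversely, the copy matched to \<open>(c, \<rho> c)\<close> is the unique true one at
  \<open>c\<close>.\<close>

lemma sat_iff_hits:
  assumes \<sigma>: "\<sigma> \<in> Mt a" and T: "T \<subseteq> {..<k * a}"
  shows "sat a \<sigma> T \<longleftrightarrow> (\<exists>\<rho>\<in>slots a. hits a \<rho> T \<sigma>)"
proof
  assume "sat a \<sigma> T"
  then have ex: "\<exists>!v. v \<in> V a \<and> fst v \<in> T \<and> fst (\<sigma> v) = c" if "c < d * a" for c
    using that by (simp add: satisfying_assignment_def)
  define u where "u c = (THE v. v \<in> V a \<and> fst v \<in> T \<and> fst (\<sigma> v) = c)" for c
  have u: "u c \<in> V a" "fst (u c) \<in> T" "fst (\<sigma> (u c)) = c" if "c < d * a" for c
    using theI'[OF ex[OF that]] unfolding u_def by auto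
  have uu: "v = u c" if "c < d * a" "v \<in> V a" "fst v \<in> T" "fst (\<sigma> v) = c" for v c
    using u[OF that(1)] ex[OF that(1)] that by blast
  define \<rho> where "\<rho> = restrict (\<lambda>c. snd (\<sigma> (u c))) {..<d * a}"
  have "\<rho> \<in> slots a"
    unfolding \<rho>_def by (rule restrict_PiE_iff[THEN iffD2]) (use C_D[OF Mt_image[OF \<sigma> u(1)]] in auto)
  moreover have "hits a \<rho> T \<sigma>"
    unfolding hits_def
  proof (intro ballI)
    fix v assume v: "v \<in> V a"
    let ?c = "fst (\<sigma> v)"
    have c: "?c < d * a" using C_D[OF Mt_image[OF \<sigma> v]] by simp
    show "(snd (\<sigma> v) = \<rho> ?c) = (fst v \<in> T)"
    proof
      assume "snd (\<sigma> v) = \<rho> ?c"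
      then have "\<sigma> v = \<sigma> (u ?c)" using c u(3)[OF c] by (simp add: \<rho>_def prod_eq_iff)
      then have "v = u ?c" using Mt_inj[OF \<sigma> v u(1)[OF c]] by simp
      then show "fst v \<in> T" using u(2)[OF c] by simp
    next
      assume "fst v \<in> T"
      then have "v = u ?c" using uu[OF c v] by simp
      then show "snd (\<sigma> v) = \<rho> ?c" using c by (simp add: \<rho>_def)
    qed
  qed
  ultimately show "\<exists>\<rho>\<in>slots a. hits a \<rho> T \<sigma>" by blast
next
  assume "\<exists>\<rho>\<in>slots a. hits a \<rho> T \<sigma>"
  then obtain \<rho> where \<rho>: "\<rho> \<in> slots a" and h: "hits a \<rho> T \<sigma>" by blast
  have "\<exists>!v. v \<in> V a \<and> fst v \<in> T \<and> fst (\<sigma> v) = c" if c: "c < d * a" for c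
  proof -
    obtain v where v: "v \<in> V a" "\<sigma> v = (c, \<rho> c)"
      using Mt_surj[OF \<sigma> slots_in_C[OF \<rho> c]] by blast
    show ?thesis
    proof (rule ex1I[of _ v])
      show "v \<in> V a \<and> fst v \<in> T \<and> fst (\<sigma> v) = c" using v hitsD[OF h v(1)] by simp
      fix w assume w: "w \<in> V a \<and> fst w \<in> T \<and> fst (\<sigma> w) = c"
      then have "snd (\<sigma> w) = \<rho> c" using hitsD[OF h, of w] by simp
      then have "\<sigma> w = \<sigma> v" using v w by (simp add: prod_eq_iff)
      then show "w = v" using Mt_inj[OF \<sigma>] w v by blast
    qed
  qed
  then show "sat a \<sigma> T" using T by (simp add: satisfying_assignment_def)
qed

lemma finite_slots [simp]: "finite (slots a)" by (intro finite_PiE) auto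

text \<open>The predicate \<open>P\<close> is carried along for two uses: prescribed edges, and
  satisfaction of a second assignment.\<close>

lemma card_sat_conv:
  assumes T: "T \<subseteq> {..<k * a}"
  shows "card {\<sigma> \<in> Mt a. sat a \<sigma> T \<and> P \<sigma>} = (\<Sum>\<rho>\<in>slots a. card {\<sigma> \<in> Mt a. hits a \<rho> T \<sigma> \<and> P \<sigma>})"
proof -
  have "{\<sigma> \<in> Mt a. sat a \<sigma> T \<and> P \<sigma>} = (\<Union>\<rho>\<in>slots a. {\<sigma> \<in> Mt a. hits a \<rho> T \<sigma> \<and> P \<sigma>})"
    using sat_iff_hits[OF _ T] by auto
  moreover have "card (\<Union>\<rho>\<in>slots a. {\<sigma> \<in> Mt a. hits a \<rho> T \<sigma> \<and> P \<sigma>})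
      = (\<Sum>\<rho>\<in>slots a. card {\<sigma> \<in> Mt a. hits a \<rho> T \<sigma> \<and> P \<sigma>})"
    by (rule card_UN_disjoint) (auto dest: hits_unique)
  ultimately show ?thesis by simp
qed

lemma card_V_T:
  assumes "T \<subseteq> {..<k * a}"
  shows "card {v \<in> V a. fst v \<in> T} = d * card T"
proof -
  have "{v \<in> V a. fst v \<in> T} = T \<times> {..<d}" using assms by (auto simp: var_copies_def)
  then show ?thesis by (simp add: card_cartesian_product)
qed

lemma card_C_slots:
  assumes "\<rho> \<in> slots a"
  shows "card {c \<in> C a. snd c = \<rho> (fst c)} = d * a"
proof -
  have "{c \<in> C a. snd c = \<rho> (fst c)} = (\<lambda>c. (c, \<rho> c)) ` {..<d * a}"
    using slots_in_C[OF assms] by (auto simp: clause_copies_def image_iff)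
  moreover have "inj_on (\<lambda>c. (c, \<rho> c)) {..<d * a}" by (auto simp: inj_on_def)
  ultimately show ?thesis by (simp add: card_image)
qed

lemma card_compl:
  assumes "finite A" "card {x \<in> A. P x} = q"
  shows "card {x \<in> A. \<not> P x} = card A - q"
proof -
  have "{x \<in> A. \<not> P x} = A - {x \<in> A. P x}" by auto
  then show ?thesis using assms by (simp add: card_Diff_subset)
qed

text \<open>The labelled count with truth values as labels: true copies go to the slots selected by
  \<open>\<rho>\<close>, false copies to the others. The classes have \<open>d * a\<close> and
  \<open>d * k * a - d * a\<close> elements, and each factorial is what the prescribed edges leave
  of its class.\<close>

lemma card_hits_extending:
  assumes T: "T \<subseteq> {..<k * a}" "card T = a" and \<rho>: "\<rho> \<in> slots a"
    and E: "E \<subseteq> V a \<times> C a" "inj_on fst E" "inj_on snd E"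
    and comp: "\<And>v c. (v, c) \<in> E \<Longrightarrow> (snd c = \<rho> (fst c)) = (fst v \<in> T)"
  shows "card {\<sigma> \<in> Mt a. hits a \<rho> T \<sigma> \<and> (\<forall>(v, c)\<in>E. \<sigma> v = c)}
    = fact (d * a - card {e \<in> E. fst (fst e) \<in> T}) * fact (d * k * a - d * a - card {e \<in> E. fst (fst e) \<notin> T})"
proof -
  have "card {\<sigma> \<in> extensional (V a). bij_betw \<sigma> (V a) (C a) \<and>
        (\<forall>v\<in>V a. (\<lambda>c. snd c = \<rho> (fst c)) (\<sigma> v) = (\<lambda>v. fst v \<in> T) v) \<and> (\<forall>(v, c)\<in>E. \<sigma> v = c)}
     = (\<Prod>x\<in>UNIV. fact (card {v \<in> V a. (\<lambda>v. fst v \<in> T) v = x} - card {e \<in> E. (\<lambda>v. fst v \<in> T) (fst e) = x}))"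
  proof (rule card_labelled_bijections_extending)
    fix x
    show "card {v \<in> V a. (fst v \<in> T) = x} = card {c \<in> C a. (snd c = \<rho> (fst c)) = x}"
      using card_V_T[OF T(1)] card_C_slots[OF \<rho>] T(2)
      by (cases x) (simp_all add: card_compl[OF _ refl] card_V card_C)
  qed (use E comp in auto)
  also have "\<dots> = fact (d * a - card {e \<in> E. fst (fst e) \<in> T}) * fact (d * k * a - d * a - card {e \<in> E. fst (fst e) \<notin> T})"
    using card_V_T[OF T(1)] T(2) by (simp add: UNIV_bool card_compl[OF _ refl] card_V)
  finally show ?thesis by (simp add: Mt_eq hits_def conj_ac)
qed

lemma card_sat:
  assumes "T \<subseteq> {..<k * a}" "card T = a"
  shows "card {\<sigma> \<in> Mt a. sat a \<sigma> T} = k ^ (d * a) * fact (d * a) * fact (d * k * a - d * a)"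
proof -
  have "card {\<sigma> \<in> Mt a. hits a \<rho> T \<sigma>} = fact (d * a) * fact (d * k * a - d * a)" if "\<rho> \<in> slots a" for \<rho>
    using card_hits_extending[OF assms that, of "{}"] by simp
  then have "card {\<sigma> \<in> Mt a. sat a \<sigma> T \<and> True} = card (slots a) * (fact (d * a) * fact (d * k * a - d * a))"
    unfolding card_sat_conv[OF assms(1)] by simp
  then show ?thesis by (simp add: card_PiE)
qed

text \<open>Compatible slot choices factor over the clauses.\<close>

definition free_slots :: "nat set \<Rightarrow> ((nat \<times> nat) \<times> nat \<times> nat) set \<Rightarrow> nat \<Rightarrow> nat" where
  "free_slots T E c = card {i \<in> {..<k}. \<forall>e\<in>E. fst (snd e) = c \<longrightarrow> (snd (snd e) = i) = (fst (fst e) \<in> T)}"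

text \<open>A choice \<open>\<rho>\<close> that contradicts some edge of \<open>E\<close> leaves no
  matching, and for a compatible one the count does not depend on \<open>\<rho>\<close>. So only the
  number of compatible \<open>\<rho>\<close> matters, and compatibility is a separate condition on
  each clause.\<close>

lemma card_sat_extending:
  assumes T: "T \<subseteq> {..<k * a}" "card T = a"
    and E: "E \<subseteq> V a \<times> C a" "inj_on fst E" "inj_on snd E"
  shows "card {\<sigma> \<in> Mt a. sat a \<sigma> T \<and> (\<forall>(v, c)\<in>E. \<sigma> v = c)}
    = (\<Prod>c<d * a. free_slots T E c) * fact (d * a - card {e \<in> E. fst (fst e) \<in> T})
       * fact (d * k * a - d * a - card {e \<in> E. fst (fst e) \<notin> T})" (is "_ = _ * ?f1 * ?f2")
proof -
  let ?ok = "\<lambda>\<rho>. \<forall>e\<in>E. (snd (snd e) = \<rho> (fst (snd e))) = (fst (fst e) \<in> T)"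
  have "card {\<sigma> \<in> Mt a. hits a \<rho> T \<sigma> \<and> (\<forall>(v, c)\<in>E. \<sigma> v = c)} = (if ?ok \<rho> then ?f1 * ?f2 else 0)"
    if \<rho>: "\<rho> \<in> slots a" for \<rho>
  proof (cases "?ok \<rho>")
    case True
    then show ?thesis using card_hits_extending[OF T \<rho> E] by force
  next
    case False
    then obtain v c where e: "(v, c) \<in> E" "(snd c = \<rho> (fst c)) \<noteq> (fst v \<in> T)" by (metis prod.collapse)
    then have v: "v \<in> V a" using E(1) by auto
    have "{\<sigma> \<in> Mt a. hits a \<rho> T \<sigma> \<and> (\<forall>(v, c)\<in>E. \<sigma> v = c)} = {}"
    proof (rule equals0I)
      fix \<sigma> assume "\<sigma> \<in> {\<sigma> \<in> Mt a. hits a \<rho> T \<sigma> \<and> (\<forall>(v, c)\<in>E. \<sigma> v = c)}"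
      then have "\<sigma> v = c" "(snd (\<sigma> v) = \<rho> (fst (\<sigma> v))) = (fst v \<in> T)" using e v hitsD[of a \<rho> T \<sigma> v] by auto
      then show False using e by simp
    qed
    then show ?thesis using False by (simp only: card.empty if_False)
  qed
  then have "card {\<sigma> \<in> Mt a. sat a \<sigma> T \<and> (\<forall>(v, c)\<in>E. \<sigma> v = c)} = (\<Sum>\<rho>\<in>slots a. if ?ok \<rho> then ?f1 * ?f2 else 0)"
    unfolding card_sat_conv[OF T(1)] by (intro sum.cong) auto
  also have "\<dots> = card {\<rho> \<in> slots a. ?ok \<rho>} * (?f1 * ?f2)"
    by (simp add: sum.If_cases Int_def)
  also have "{\<rho> \<in> slots a. ?ok \<rho>}
      = (\<Pi>\<^sub>E c\<in>{..<d * a}. {i \<in> {..<k}. \<forall>e\<in>E. fst (snd e) = c \<longrightarrow> (snd (snd e) = i) = (fst (fst e) \<in> T)})"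
  proof (intro set_eqI iffI)
    fix \<rho> assume "\<rho> \<in> {\<rho> \<in> slots a. ?ok \<rho>}"
    then show "\<rho> \<in> (\<Pi>\<^sub>E c\<in>{..<d * a}. {i \<in> {..<k}. \<forall>e\<in>E. fst (snd e) = c \<longrightarrow> (snd (snd e) = i) = (fst (fst e) \<in> T)})"
      by (auto simp: PiE_iff)
  next
    fix \<rho> assume r: "\<rho> \<in> (\<Pi>\<^sub>E c\<in>{..<d * a}. {i \<in> {..<k}. \<forall>e\<in>E. fst (snd e) = c \<longrightarrow> (snd (snd e) = i) = (fst (fst e) \<in> T)})"
    have "fst (snd e) < d * a" if "e \<in> E" for e using E(1) that by (auto simp: clause_copies_def)
    then have "?ok \<rho>" using r by (auto simp: PiE_iff)
    then show "\<rho> \<in> {\<rho> \<in> slots a. ?ok \<rho>}" using r by (auto simp: PiE_iff)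
  qed
  also have "card \<dots> = (\<Prod>c<d * a. free_slots T E c)"
    by (simp add: card_PiE free_slots_def)
  finally show ?thesis by (simp add: mult.assoc)
qed

end

section \<open>First and second moment\<close>

lemma card_subsets_inter:
  assumes "finite U" "T \<subseteq> U" "card T = a" "s \<le> a"
  shows "card {T'. T' \<subseteq> U \<and> card T' = a \<and> card (T \<inter> T') = s} = (a choose s) * ((card U - a) choose (a - s))"
proof -
  have fT: "finite T" "finite (U - T)" using assms finite_subset by auto
  let ?A = "{A. A \<subseteq> T \<and> card A = s}" and ?B = "{B. B \<subseteq> U - T \<and> card B = a - s}"
    have 1: "(\<lambda>(A, B). A \<union> B) ` (?A \<times> ?B) \<subseteq> {T'. T' \<subseteq> U \<and> card T' = a \<and> card (T \<inter> T') = s}"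
    proof (rule image_subsetI)
      fix AB assume "AB \<in> ?A \<times> ?B"
      then obtain A B where AB: "AB = (A, B)" and h: "A \<subseteq> T" "card A = s" "B \<subseteq> U - T" "card B = a - s" by blast
      have "finite A" "finite B" "A \<inter> B = {}" using h(1,3) fT by (auto intro: finite_subset)
      then have "card (A \<union> B) = card A + card B" by (rule card_Un_disjoint)
      moreover have "T \<inter> (A \<union> B) = A" using h(1,3) by blast
      moreover have "A \<union> B \<subseteq> U" using h(1,3) assms(2) by blast
      ultimately show "(\<lambda>(A, B). A \<union> B) AB \<in> {T'. T' \<subseteq> U \<and> card T' = a \<and> card (T \<inter> T') = s}"
        using h(2,4) assms(4) AB by simp
    qed
    have 2: "(\<lambda>T'. (T \<inter> T', T' - T)) ` {T'. T' \<subseteq> U \<and> card T' = a \<and> card (T \<inter> T') = s} \<subseteq> ?A \<times> ?B"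
    proof (rule image_subsetI)
      fix T' assume "T' \<in> {T'. T' \<subseteq> U \<and> card T' = a \<and> card (T \<inter> T') = s}"
      then have h: "T' \<subseteq> U" "card T' = a" "card (T \<inter> T') = s" by blast+
      have "T' - T = T' - (T \<inter> T')" by blast
      then have "card (T' - T) = card T' - card (T \<inter> T')"
        using fT by (simp add: card_Diff_subset)
      moreover have "T' - T \<subseteq> U - T" using h(1) by blast
      ultimately show "(T \<inter> T', T' - T) \<in> ?A \<times> ?B" using h by simp
    qed
    have 3: "fst (T \<inter> (A \<union> B), A \<union> B - T) = A \<and> snd (T \<inter> (A \<union> B), A \<union> B - T) = B" if "A \<subseteq> T" "B \<subseteq> U - T" for A B
      using that by auto
  have "bij_betw (\<lambda>(A, B). A \<union> B) (?A \<times> ?B) {T'. T' \<subseteq> U \<and> card T' = a \<and> card (T \<inter> T') = s}"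
    using 3 by (intro bij_betw_byWitness[OF _ _ 1 2]) (auto simp: Int_Diff_Un)
  then have "card {T'. T' \<subseteq> U \<and> card T' = a \<and> card (T \<inter> T') = s} = card (?A \<times> ?B)"
    by (simp add: bij_betw_same_card)
  also have "\<dots> = (a choose s) * ((card U - a) choose (a - s))"
    using fT assms by (simp add: card_cartesian_product n_subsets card_Diff_subset)
  finally show ?thesis .
qed

text \<open>Sort by the agreement set \<open>J\<close>: on \<open>J\<close> the function is forced,
  and at each point off \<open>J\<close> there remain \<open>card B - 1\<close> values.\<close>

lemma card_PiE_agreeing:
  assumes "finite I" "finite B" "\<rho> \<in> I \<rightarrow>\<^sub>E B"
  shows "card {\<rho>' \<in> I \<rightarrow>\<^sub>E B. card {c \<in> I. \<rho> c = \<rho>' c} = j} = (card I choose j) * (card B - 1) ^ (card I - j)"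
proof -
  let ?J = "{J. J \<subseteq> I \<and> card J = j}"
  let ?P = "\<lambda>J. (\<Pi>\<^sub>E c\<in>I. if c \<in> J then {\<rho> c} else B - {\<rho> c})"
  have mem: "\<rho>' \<in> ?P J \<longleftrightarrow> \<rho>' \<in> I \<rightarrow>\<^sub>E B \<and> {c \<in> I. \<rho> c = \<rho>' c} = J" if "J \<subseteq> I" for J \<rho>'
  proof
    assume r: "\<rho>' \<in> ?P J"
    have *: "\<rho>' c \<in> (if c \<in> J then {\<rho> c} else B - {\<rho> c})" if "c \<in> I" for c using r that by (rule PiE_mem)
    have "\<rho>' c \<in> B" if "c \<in> I" for c using *[OF that] assms(3) that by (auto split: if_splits)
    moreover have "\<rho>' c = \<rho> c \<longleftrightarrow> c \<in> J" if "c \<in> I" for c using *[OF that] by (auto split: if_splits)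
    then have "{c \<in> I. \<rho> c = \<rho>' c} = J" using \<open>J \<subseteq> I\<close> by fastforce
    ultimately show "\<rho>' \<in> I \<rightarrow>\<^sub>E B \<and> {c \<in> I. \<rho> c = \<rho>' c} = J" using r by (auto simp: PiE_iff)
  next
    assume "\<rho>' \<in> I \<rightarrow>\<^sub>E B \<and> {c \<in> I. \<rho> c = \<rho>' c} = J"
    then show "\<rho>' \<in> ?P J" by (auto simp: PiE_iff)
  qed
  have eq: "{\<rho>' \<in> I \<rightarrow>\<^sub>E B. card {c \<in> I. \<rho> c = \<rho>' c} = j} = (\<Union>J\<in>?J. ?P J)"
  proof (intro set_eqI iffI)
    fix \<rho>' assume r: "\<rho>' \<in> {\<rho>' \<in> I \<rightarrow>\<^sub>E B. card {c \<in> I. \<rho> c = \<rho>' c} = j}"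
    let ?D = "{c \<in> I. \<rho> c = \<rho>' c}"
    have "?D \<subseteq> I" by auto
    then have "\<rho>' \<in> ?P ?D" "?D \<in> ?J" using r mem[of ?D \<rho>'] by simp_all
    then show "\<rho>' \<in> (\<Union>J\<in>?J. ?P J)" by (rule UN_I[rotated])
  next
    fix \<rho>' assume "\<rho>' \<in> (\<Union>J\<in>?J. ?P J)"
    then obtain J where "J \<in> ?J" "\<rho>' \<in> ?P J" by (rule UN_E)
    then show "\<rho>' \<in> {\<rho>' \<in> I \<rightarrow>\<^sub>E B. card {c \<in> I. \<rho> c = \<rho>' c} = j}" using mem[of J \<rho>'] by simp
  qed
  have cP: "card (?P J) = (card B - 1) ^ (card I - j)" if "J \<in> ?J" for J
  proof -
    have "card (?P J) = (\<Prod>c\<in>I. card (if c \<in> J then {\<rho> c} else B - {\<rho> c}))"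
      using assms by (simp add: card_PiE)
    also have "\<dots> = (\<Prod>c\<in>I. if c \<in> J then 1 else card B - 1)"
      using assms by (intro prod.cong) (auto simp: PiE_iff)
    also have "\<dots> = (\<Prod>c\<in>I - J. card B - 1)"
      using assms(1) that by (simp add: prod.If_cases Diff_eq)
    also have "\<dots> = (card B - 1) ^ (card I - j)"
      using that assms(1) by (simp add: card_Diff_subset finite_subset[of J I])
    finally show ?thesis .
  qed
  have "card (\<Union>J\<in>?J. ?P J) = (\<Sum>J\<in>?J. card (?P J))"
  proof (rule card_UN_disjoint)
    show "finite ?J" using assms(1) by simp
    show "\<forall>J\<in>?J. finite (?P J)" using assms by (auto intro!: finite_PiE)
    show "\<forall>J\<in>?J. \<forall>J'\<in>?J. J \<noteq> J' \<longrightarrow> ?P J \<inter> ?P J' = {}"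
    proof (intro ballI impI)
      fix J J' assume J: "J \<in> ?J" "J' \<in> ?J" "J \<noteq> J'"
      show "?P J \<inter> ?P J' = {}"
      proof (rule equals0I)
        fix \<rho>' assume "\<rho>' \<in> ?P J \<inter> ?P J'"
        then have "\<rho>' \<in> ?P J" "\<rho>' \<in> ?P J'" by (rule IntD1, rule IntD2)
        then show False using mem[of J \<rho>'] mem[of J' \<rho>'] J by simp
      qed
    qed
  qed
  also have "\<dots> = card ?J * (card B - 1) ^ (card I - j)" using cP by simp
  also have "card ?J = (card I choose j)" using assms(1) by (simp add: n_subsets)
  finally show ?thesis unfolding eq .
qed

context regular_cover
begin

text \<open>The labelled count with four labels, the truth values under \<open>T\<close> and under
  \<open>T'\<close>. The classes of copies have sizes governed by \<open>s\<close>, those of slots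
  by \<open>j\<close>. A matching that hits both maps the \<open>d * s\<close> doubly true copies
  onto the \<open>j\<close> doubly true slots, which forces \<open>j = d * s\<close>.\<close>

lemma card_hits_pair:
  assumes T: "T \<subseteq> {..<k * a}" "card T = a" and T': "T' \<subseteq> {..<k * a}" "card T' = a"
    and \<rho>: "\<rho> \<in> slots a" and \<rho>': "\<rho>' \<in> slots a"
  defines "s \<equiv> card (T \<inter> T')" and "j \<equiv> card {c \<in> {..<d * a}. \<rho> c = \<rho>' c}"
  shows "card {\<sigma> \<in> Mt a. hits a \<rho> T \<sigma> \<and> hits a \<rho>' T' \<sigma>}
    = (if j = d * s then fact (d * s) * fact (d * a - d * s) * fact (d * a - d * s) * fact (d * k * a - 2 * d * a + d * s) else 0)"
proof -
  let ?f = "\<lambda>v::nat \<times> nat. (fst v \<in> T, fst v \<in> T')" and ?g = "\<lambda>c. (snd c = \<rho> (fst c), snd c = \<rho>' (fst c))"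
  have bsplit: "card {x \<in> A. P x \<and> \<not> Q x} = card {x \<in> A. P x} - card {x \<in> A. P x \<and> Q x}"
    if "finite A" for A :: "(nat \<times> nat) set" and P Q
  proof -
    have "{x \<in> A. P x \<and> \<not> Q x} = {x \<in> A. P x} - {x \<in> A. P x \<and> Q x}" by auto
    then show ?thesis using that by (simp add: card_Diff_subset Collect_mono)
  qed
  have bsplit': "card {x \<in> A. \<not> P x \<and> \<not> Q x} = card A - card {x \<in> A. P x} - (card {x \<in> A. Q x} - card {x \<in> A. P x \<and> Q x})"
    if "finite A" for A :: "(nat \<times> nat) set" and P Q
  proof -
    have "{x \<in> A. \<not> P x \<and> \<not> Q x} = (A - {x \<in> A. P x}) - {x \<in> A. Q x \<and> \<not> P x}" by auto
    moreover have "card \<dots> = card (A - {x \<in> A. P x}) - card {x \<in> A. Q x \<and> \<not> P x}"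
      using that by (intro card_Diff_subset) auto
    moreover have "card (A - {x \<in> A. P x}) = card A - card {x \<in> A. P x}"
      using that by (intro card_Diff_subset) auto
    ultimately show ?thesis using bsplit[OF that, of Q P] by (simp add: conj_commute)
  qed
  have v1: "card {v \<in> V a. fst v \<in> T} = d * a" "card {v \<in> V a. fst v \<in> T'} = d * a"
    using card_V_T T T' by simp_all
  have v2: "card {v \<in> V a. fst v \<in> T \<and> fst v \<in> T'} = d * s"
    using card_V_T[of "T \<inter> T'" a] T unfolding s_def by (simp add: le_infI1)
  have c1: "card {c \<in> C a. snd c = \<rho> (fst c)} = d * a" "card {c \<in> C a. snd c = \<rho>' (fst c)} = d * a"
    using card_C_slots \<rho> \<rho>' by auto
  have c2: "card {c \<in> C a. snd c = \<rho> (fst c) \<and> snd c = \<rho>' (fst c)} = j"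
  proof -
    have "{c \<in> C a. snd c = \<rho> (fst c) \<and> snd c = \<rho>' (fst c)} = (\<lambda>c. (c, \<rho> c)) ` {c \<in> {..<d * a}. \<rho> c = \<rho>' c}"
      using slots_in_C[OF \<rho>] slots_in_C[OF \<rho>'] by (auto simp: clause_copies_def image_iff)
    moreover have "card ((\<lambda>c. (c, \<rho> c)) ` {c \<in> {..<d * a}. \<rho> c = \<rho>' c}) = j"
      unfolding j_def by (rule card_image) (auto simp: inj_on_def)
    ultimately show ?thesis by simp
  qed
  have v3: "card {v \<in> V a. fst v \<in> T \<and> fst v \<notin> T'} = d * a - d * s"
    "card {v \<in> V a. fst v \<notin> T \<and> fst v \<in> T'} = d * a - d * s"
    "card {v \<in> V a. fst v \<notin> T \<and> fst v \<notin> T'} = d * k * a - d * a - (d * a - d * s)"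
    using v1 v2 bsplit[of "V a" "\<lambda>v. fst v \<in> T" "\<lambda>v. fst v \<in> T'"] bsplit[of "V a" "\<lambda>v. fst v \<in> T'" "\<lambda>v. fst v \<in> T"]
      bsplit'[of "V a" "\<lambda>v. fst v \<in> T" "\<lambda>v. fst v \<in> T'"]
    by (simp_all only: conj_commute finite_copies simp_thms card_V)
  have c3: "card {c \<in> C a. snd c = \<rho> (fst c) \<and> snd c \<noteq> \<rho>' (fst c)} = d * a - j"
    "card {c \<in> C a. snd c \<noteq> \<rho> (fst c) \<and> snd c = \<rho>' (fst c)} = d * a - j"
    "card {c \<in> C a. snd c \<noteq> \<rho> (fst c) \<and> snd c \<noteq> \<rho>' (fst c)} = d * k * a - d * a - (d * a - j)"
    using c1 c2 bsplit[of "C a" "\<lambda>c. snd c = \<rho> (fst c)" "\<lambda>c. snd c = \<rho>' (fst c)"]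
      bsplit[of "C a" "\<lambda>c. snd c = \<rho>' (fst c)" "\<lambda>c. snd c = \<rho> (fst c)"]
      bsplit'[of "C a" "\<lambda>c. snd c = \<rho> (fst c)" "\<lambda>c. snd c = \<rho>' (fst c)"]
    by (simp_all only: conj_commute finite_copies simp_thms card_C)
  have set_eq: "{\<sigma> \<in> Mt a. hits a \<rho> T \<sigma> \<and> hits a \<rho>' T' \<sigma>}
    = {\<sigma> \<in> extensional (V a). bij_betw \<sigma> (V a) (C a) \<and> (\<forall>v\<in>V a. ?g (\<sigma> v) = ?f v)}"
    by (auto simp: Mt_eq hits_def)
  show ?thesis
  proof (cases "j = d * s")
    case True
    have "s \<le> a" unfolding s_def using T by (metis card_mono finite_lessThan finite_subset inf_le1)
    then have le: "d * s \<le> d * a" by simp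
    \<comment> \<open>Subtraction on naturals is truncated; the size of the doubly false class may
      be rearranged only because \<open>2 * d * a \<le> d * k * a\<close>.\<close>
    have "2 * a \<le> k * a" using k_gt by simp
    then have "2 * (d * a) \<le> d * k * a" by (metis mult.assoc mult.left_commute mult_le_mono2)
    then have ar: "d * k * a - d * a - (d * a - d * s) = d * k * a - 2 * d * a + d * s"
      using le by (simp only: mult.assoc[of 2])
    have "card {\<sigma> \<in> extensional (V a). bij_betw \<sigma> (V a) (C a) \<and> (\<forall>v\<in>V a. ?g (\<sigma> v) = ?f v)}
      = (\<Prod>x\<in>UNIV. fact (card {v \<in> V a. ?f v = x}))"
    proof (rule card_labelled_bijections)
      fix x :: "bool \<times> bool"
      show "card {v \<in> V a. ?f v = x} = card {c \<in> C a. ?g c = x}"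
        using True v2 v3 c2 c3
        by (cases x; cases "fst x"; cases "snd x") simp_all
    qed auto
    also have "\<dots> = fact (d * s) * fact (d * a - d * s) * fact (d * a - d * s) * fact (d * k * a - 2 * d * a + d * s)"
      using v2 v3 unfolding UNIV_Times_UNIV[symmetric] UNIV_bool by (simp add: ar del: diff_diff_left)
    finally show ?thesis using True set_eq by simp
  next
    case False
    have "{\<sigma> \<in> Mt a. hits a \<rho> T \<sigma> \<and> hits a \<rho>' T' \<sigma>} = {}"
    proof (rule equals0I)
      fix \<sigma> assume s: "\<sigma> \<in> {\<sigma> \<in> Mt a. hits a \<rho> T \<sigma> \<and> hits a \<rho>' T' \<sigma>}"
      then have m: "\<sigma> \<in> Mt a" "hits a \<rho> T \<sigma>" "hits a \<rho>' T' \<sigma>" by auto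
      have im: "\<sigma> ` {v \<in> V a. fst v \<in> T \<and> fst v \<in> T'} = {c \<in> C a. snd c = \<rho> (fst c) \<and> snd c = \<rho>' (fst c)}"
      proof (intro equalityI subsetI)
        fix c assume "c \<in> \<sigma> ` {v \<in> V a. fst v \<in> T \<and> fst v \<in> T'}"
        then obtain v where "v \<in> V a" "fst v \<in> T" "fst v \<in> T'" "c = \<sigma> v" by auto
        then show "c \<in> {c \<in> C a. snd c = \<rho> (fst c) \<and> snd c = \<rho>' (fst c)}"
          using hitsD[OF m(2), of v] hitsD[OF m(3), of v] Mt_image[OF m(1), of v] by simp
      next
        fix c assume c: "c \<in> {c \<in> C a. snd c = \<rho> (fst c) \<and> snd c = \<rho>' (fst c)}"
        then obtain v where "v \<in> V a" "\<sigma> v = c" using Mt_surj[OF m(1)] by blast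
        then show "c \<in> \<sigma> ` {v \<in> V a. fst v \<in> T \<and> fst v \<in> T'}"
          using hitsD[OF m(2), of v] hitsD[OF m(3), of v] c by auto
      qed
      have inj: "inj_on \<sigma> {v \<in> V a. fst v \<in> T \<and> fst v \<in> T'}"
        using Mt_inj[OF m(1)] by (auto intro!: inj_onI)
      show False using card_image[OF inj] False unfolding im v2 c2 by simp
    qed
    then show ?thesis using False by (simp only: card.empty if_False)
  qed
qed

text \<open>The factors are: the choices of \<open>\<rho>\<close>, the set of \<open>d * s\<close>
  clauses where \<open>\<rho>'\<close> agrees with it, the \<open>k - 1\<close> other slots at each
  remaining clause, and the factorials of the four classes of copies.\<close>

definition pair_count :: "nat \<Rightarrow> nat \<Rightarrow> nat" where
  "pair_count a s = k ^ (d * a) * ((d * a) choose (d * s)) * (k - 1) ^ (d * a - d * s) *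
     (fact (d * s) * fact (d * a - d * s) * fact (d * a - d * s) * fact (d * k * a - 2 * d * a + d * s))"

lemma card_sat_pair:
  assumes T: "T \<subseteq> {..<k * a}" "card T = a" and T': "T' \<subseteq> {..<k * a}" "card T' = a"
  shows "card {\<sigma> \<in> Mt a. sat a \<sigma> T \<and> sat a \<sigma> T'} = pair_count a (card (T \<inter> T'))"
proof -
  let ?s = "card (T \<inter> T')"
  let ?f = "fact (d * ?s) * fact (d * a - d * ?s) * fact (d * a - d * ?s) * fact (d * k * a - 2 * d * a + d * ?s) :: nat"
  have "card {\<sigma> \<in> Mt a. sat a \<sigma> T \<and> sat a \<sigma> T'} = (\<Sum>\<rho>\<in>slots a. card {\<sigma> \<in> Mt a. sat a \<sigma> T' \<and> hits a \<rho> T \<sigma>})"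
    unfolding card_sat_conv[OF T(1)] by (simp add: conj_commute)
  also have "\<dots> = (\<Sum>\<rho>\<in>slots a. \<Sum>\<rho>'\<in>slots a. card {\<sigma> \<in> Mt a. hits a \<rho> T \<sigma> \<and> hits a \<rho>' T' \<sigma>})"
    unfolding card_sat_conv[OF T'(1)] by (simp add: conj_commute)
  also have "\<dots> = (\<Sum>\<rho>\<in>slots a. \<Sum>\<rho>'\<in>slots a. if card {c \<in> {..<d * a}. \<rho> c = \<rho>' c} = d * ?s then ?f else 0)"
    using card_hits_pair[OF T T'] by (intro sum.cong refl) simp
  also have "\<dots> = (\<Sum>\<rho>\<in>slots a. card {\<rho>' \<in> slots a. card {c \<in> {..<d * a}. \<rho> c = \<rho>' c} = d * ?s} * ?f)"
    by (intro sum.cong refl) (simp add: sum.If_cases Int_def)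
  also have "\<dots> = (\<Sum>\<rho>\<in>slots a. ((d * a) choose (d * ?s)) * (k - 1) ^ (d * a - d * ?s) * ?f)"
    by (intro sum.cong refl) (subst card_PiE_agreeing, auto)
  also have "\<dots> = pair_count a ?s" by (simp add: card_PiE pair_count_def)
  finally show ?thesis .
qed

section \<open>Exact moments of the number of satisfying assignments\<close>

definition balanced_sets :: "nat \<Rightarrow> nat set set" where "balanced_sets a = {T. T \<subseteq> {..<k * a} \<and> card T = a}"

definition X :: "nat \<Rightarrow> (nat \<times> nat \<Rightarrow> nat \<times> nat) \<Rightarrow> real" where
  "X a \<sigma> = real (card {T. sat a \<sigma> T})"

text \<open>Expectation under the uniform matching, with the number of matchings written out as
  \<open>fact (d * k * a)\<close>.\<close>

definition avg :: "nat \<Rightarrow> ((nat \<times> nat \<Rightarrow> nat \<times> nat) \<Rightarrow> real) \<Rightarrow> real" where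
  "avg a f = (\<Sum>\<sigma>\<in>Mt a. f \<sigma>) / fact (d * k * a)"

lemma finite_balanced_sets [simp]: "finite (balanced_sets a)" by (simp add: balanced_sets_def)

lemma card_balanced_sets: "card (balanced_sets a) = (k * a choose a)" by (simp add: balanced_sets_def n_subsets)

lemma sat_in_balanced_sets: "\<sigma> \<in> Mt a \<Longrightarrow> sat a \<sigma> T \<Longrightarrow> T \<in> balanced_sets a"
  using satisfying_assignment_card[OF d_pos _, of k "k * a" \<sigma> T] k_gt
  by (auto simp: balanced_sets_def satisfying_assignment_def)

lemma X_eq: "\<sigma> \<in> Mt a \<Longrightarrow> X a \<sigma> = (\<Sum>T\<in>balanced_sets a. of_bool (sat a \<sigma> T))"
proof -
  assume "\<sigma> \<in> Mt a"
  then have "{T. sat a \<sigma> T} = {T \<in> balanced_sets a. sat a \<sigma> T}" using sat_in_balanced_sets by blast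
  then show ?thesis by (simp add: X_def Int_def)
qed

lemma avg_of_bool: "avg a (\<lambda>\<sigma>. of_bool (P \<sigma>)) = real (card {\<sigma> \<in> Mt a. P \<sigma>}) / fact (d * k * a)"
  by (simp add: avg_def Int_def)

definition mean_X :: "nat \<Rightarrow> real" where
  "mean_X a = real (k * a choose a) * real k ^ (d * a) * fact (d * a) * fact (d * k * a - d * a) / fact (d * k * a)"

lemma avg_X: "avg a (X a) = mean_X a"
proof -
  have "(\<Sum>\<sigma>\<in>Mt a. X a \<sigma>) = (\<Sum>\<sigma>\<in>Mt a. \<Sum>T\<in>balanced_sets a. of_bool (sat a \<sigma> T))" using X_eq by simp
  also have "\<dots> = (\<Sum>T\<in>balanced_sets a. \<Sum>\<sigma>\<in>Mt a. of_bool (sat a \<sigma> T))" by (rule sum.swap)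
  also have "\<dots> = (\<Sum>T\<in>balanced_sets a. real (card {\<sigma> \<in> Mt a. sat a \<sigma> T}))" by (simp add: Int_def)
  also have "\<dots> = (\<Sum>T\<in>balanced_sets a. real (k ^ (d * a) * fact (d * a) * fact (d * k * a - d * a)))"
    by (intro sum.cong refl) (simp add: balanced_sets_def card_sat)
  finally show ?thesis by (simp add: avg_def mean_X_def card_balanced_sets)
qed

text \<open>Pairs are grouped by their overlap \<open>s\<close>. The inner sum over the second
  assignment is the same for every first one, so the outer sum is only the factor
  \<open>k * a choose a\<close>.\<close>

lemma avg_X_sq:
  "avg a (\<lambda>\<sigma>. (X a \<sigma>)\<^sup>2) = real (k * a choose a) *
     (\<Sum>s\<le>a. real (a choose s) * real ((k * a - a) choose (a - s)) * real (pair_count a s)) / fact (d * k * a)"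
proof -
  have "(\<Sum>\<sigma>\<in>Mt a. (X a \<sigma>)\<^sup>2) = (\<Sum>\<sigma>\<in>Mt a. \<Sum>T\<in>balanced_sets a. \<Sum>T'\<in>balanced_sets a. of_bool (sat a \<sigma> T \<and> sat a \<sigma> T'))"
    by (intro sum.cong refl) (simp only: X_eq power2_eq_square sum_product of_bool_conj)
  also have "\<dots> = (\<Sum>T\<in>balanced_sets a. \<Sum>\<sigma>\<in>Mt a. \<Sum>T'\<in>balanced_sets a. of_bool (sat a \<sigma> T \<and> sat a \<sigma> T'))" by (rule sum.swap)
  also have "\<dots> = (\<Sum>T\<in>balanced_sets a. \<Sum>T'\<in>balanced_sets a. \<Sum>\<sigma>\<in>Mt a. of_bool (sat a \<sigma> T \<and> sat a \<sigma> T'))"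
    by (intro sum.cong refl) (rule sum.swap)
  also have "\<dots> = (\<Sum>T\<in>balanced_sets a. \<Sum>T'\<in>balanced_sets a. real (card {\<sigma> \<in> Mt a. sat a \<sigma> T \<and> sat a \<sigma> T'}))"
    by (simp add: Int_def)
  also have "\<dots> = (\<Sum>T\<in>balanced_sets a. \<Sum>T'\<in>balanced_sets a. real (pair_count a (card (T \<inter> T'))))"
    by (intro sum.cong refl) (simp add: balanced_sets_def card_sat_pair)
  also have "\<dots> = (\<Sum>T\<in>balanced_sets a. \<Sum>s\<le>a. real (a choose s) * real ((k * a - a) choose (a - s)) * real (pair_count a s))"
  proof (intro sum.cong refl)
    fix T assume T: "T \<in> balanced_sets a"
    then have fT: "finite T" "card T = a" "T \<subseteq> {..<k * a}" by (auto simp: balanced_sets_def intro: finite_subset)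
    have "(\<Sum>T'\<in>balanced_sets a. real (pair_count a (card (T \<inter> T'))))
        = (\<Sum>s\<le>a. \<Sum>T'\<in>{T' \<in> balanced_sets a. card (T \<inter> T') = s}. real (pair_count a (card (T \<inter> T'))))"
      by (rule sum.group[symmetric]) (use fT in \<open>auto intro!: card_mono[of T, THEN order_trans]\<close>)
    also have "\<dots> = (\<Sum>s\<le>a. real (card {T' \<in> balanced_sets a. card (T \<inter> T') = s}) * real (pair_count a s))"
      by (intro sum.cong refl) simp
    also have "\<dots> = (\<Sum>s\<le>a. real (a choose s) * real ((k * a - a) choose (a - s)) * real (pair_count a s))"
    proof (intro sum.cong refl)
      fix s assume "s \<in> {..a}"
      then show "real (card {T' \<in> balanced_sets a. card (T \<inter> T') = s}) * real (pair_count a s)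
        = real (a choose s) * real ((k * a - a) choose (a - s)) * real (pair_count a s)"
        using card_subsets_inter[OF _ fT(3,2), of s] by (simp add: balanced_sets_def conj_assoc)
    qed
    finally show "(\<Sum>T'\<in>balanced_sets a. real (pair_count a (card (T \<inter> T'))))
      = (\<Sum>s\<le>a. real (a choose s) * real ((k * a - a) choose (a - s)) * real (pair_count a s))" .
  qed
  finally show ?thesis by (simp add: avg_def card_balanced_sets)
qed

end

section \<open>Stirling's formula and Gaussian sums\<close>

text \<open>The logarithm of \<open>n!\<close> divided by
  \<open>n powr (n + 1/2) * exp (- n)\<close>; Stirling's formula says that it tends to
  \<open>ln (2 * pi) / 2\<close>. Since \<open>ln 0 = 0\<close>, the value at 0 is 0.\<close>

definition stirling_defect :: "nat \<Rightarrow> real" where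
  "stirling_defect n = ln (fact n) - (real n + 1/2) * ln (real n) + real n"

text \<open>Consecutive differences are \<open>O(1 / n ^ 2)\<close>, so the telescoping series
  converges. The index is shifted to start at 1, away from the conventional value at 0.\<close>

lemma stirling_defect_convergent: "convergent stirling_defect"
proof -
  let ?g = "\<lambda>n. stirling_defect (Suc (Suc n)) - stirling_defect (Suc n)"
  have g: "?g n = 1 - (real n + 3/2) * ln ((real n + 2) / (real n + 1))" for n
  proof -
    have "ln (fact (Suc (Suc n)) :: real) = ln (real n + 2) + ln (fact (Suc n))"
      by (subst fact_Suc) (simp add: ln_mult add.commute del: fact_Suc)
    then show ?thesis by (simp add: stirling_defect_def ln_div algebra_simps del: fact_Suc)
  qed
  have O: "?g \<in> O(\<lambda>n. 1 / real (Suc n) ^ 2)"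
    unfolding g by real_asymp
  have S: "summable (\<lambda>n. 1 / real (Suc n) ^ 2)"
    by (subst summable_Suc_iff) (use inverse_power_summable[of 2, where ?'a = real] in \<open>simp add: field_simps\<close>)
  have "summable (\<lambda>n. norm (1 / real (Suc n) ^ 2))"
    using S by (simp add: norm_divide norm_power del: of_nat_Suc)
  then have "summable ?g" by (rule summable_comparison_test_bigo[OF _ O])
  then have "convergent (\<lambda>n. \<Sum>i<n. ?g i)" by (simp add: summable_iff_convergent)
  then have "convergent (\<lambda>n. stirling_defect (Suc n) - stirling_defect (Suc 0))"
    by (subst (asm) sum_lessThan_telescope)
  then have "convergent (\<lambda>n. (stirling_defect (Suc n) - stirling_defect (Suc 0)) + stirling_defect (Suc 0))"
    by (intro convergent_add convergent_const)
  then show ?thesis by (simp add: convergent_Suc_iff)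
qed

text \<open>Expresses the Wallis product through factorials, so that its limit \<open>pi / 2\<close>
  becomes an equation for the limit of \<open>stirling_defect\<close>.\<close>

lemma wallis_fact:
  "(\<Prod>k=1..n. (4*real k^2) / (4*real k^2 - 1)) = 2 ^ (4*n) * fact n ^ 4 / (fact (2*n) ^ 2 * (2 * real n + 1))"
proof (induction n)
  case (Suc n)
  have "(\<Prod>k=1..Suc n. (4*real k^2) / (4*real k^2 - 1))
     = 2 ^ (4*n) * fact n ^ 4 / (fact (2*n) ^ 2 * (2 * real n + 1)) * (4 * (real n + 1)^2 / ((2 * real n + 1) * (2 * real n + 3)))"
    using Suc by (simp add: power2_eq_square algebra_simps)
  also have "\<dots> = 2 ^ (4*Suc n) * fact (Suc n) ^ 4 / (fact (2*Suc n) ^ 2 * (2 * real (Suc n) + 1))"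
  proof -
    have f: "fact (2 * Suc n) = (2 * real n + 2) * ((2 * real n + 1) * fact (2 * n) :: real)"
      by (simp add: algebra_simps)
    have f': "fact (Suc n) = (real n + 1) * (fact n :: real)" by simp
    have p: "(2::real) ^ (4 * Suc n) = 16 * 2 ^ (4 * n)" by (simp add: power_add)
    have nz: "2 * real n + 1 \<noteq> 0" "2 * real n + 3 \<noteq> 0" "real n + 1 \<noteq> 0" "fact (2*n) \<noteq> (0::real)" by auto
    show ?thesis unfolding f f' p using nz
      by (simp add: divide_simps) (simp add: power2_eq_square power4_eq_xxxx algebra_simps)
  qed
  finally show ?case .
qed simp

text \<open>Convergence is known, only the value \<open>l\<close> is missing. The logarithm of the
  Wallis product is \<open>4 * stirling_defect n - 2 * stirling_defect (2 * n)\<close> plus a term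
  tending to \<open>- 2 * ln 2\<close>, hence \<open>2 * l - 2 * ln 2 = ln (pi / 2)\<close>.\<close>

lemma stirling_defect_limit: "stirling_defect \<longlonglongrightarrow> ln (2 * pi) / 2"
proof -
  obtain l where l: "stirling_defect \<longlonglongrightarrow> l" using stirling_defect_convergent by (auto simp: convergent_def)
  have l2: "(\<lambda>n. stirling_defect (2 * n)) \<longlonglongrightarrow> l"
    by (rule filterlim_compose[OF l]) (rule filterlim_subseq, simp add: strict_mono_def)
  have "(\<lambda>n. ln (\<Prod>k=1..n. (4*real k^2) / (4*real k^2 - 1))) \<longlonglongrightarrow> ln (pi / 2)"
    by (intro tendsto_ln wallis) simp
  moreover have "eventually (\<lambda>n. ln (\<Prod>k=1..n. (4*real k^2) / (4*real k^2 - 1))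
      = 4 * stirling_defect n - 2 * stirling_defect (2 * n) + (ln (real n) - ln 2 - ln (2 * real n + 1))) sequentially"
    using eventually_gt_at_top[of 0]
  proof eventually_elim
    case (elim n)
    have "ln (2 ^ (4*n) * fact n ^ 4 / (fact (2*n) ^ 2 * (2 * real n + 1)))
       = 4 * real n * ln 2 + 4 * ln (fact n) - (2 * ln (fact (2 * n)) + ln (2 * real n + 1))"
      by (simp add: ln_mult ln_div ln_realpow)
    then show ?case
      unfolding wallis_fact using elim by (simp add: stirling_defect_def ln_mult algebra_simps)
  qed
  ultimately have "(\<lambda>n. 4 * stirling_defect n - 2 * stirling_defect (2 * n) + (ln (real n) - ln 2 - ln (2 * real n + 1))) \<longlonglongrightarrow> ln (pi / 2)"
    by (rule Lim_transform_eventually)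
  moreover have "(\<lambda>n. ln (real n) - ln 2 - ln (2 * real n + 1)) \<longlonglongrightarrow> - 2 * ln 2" by real_asymp
  then have "(\<lambda>n. 4 * stirling_defect n - 2 * stirling_defect (2 * n) + (ln (real n) - ln 2 - ln (2 * real n + 1)))
      \<longlonglongrightarrow> 4 * l - 2 * l + (- 2 * ln 2)"
    by (intro tendsto_intros l l2)
  ultimately have "ln (pi / 2) = 4 * l - 2 * l + (- 2 * ln 2)" by (rule LIMSEQ_unique)
  then have "l = ln (2 * pi) / 2" by (simp add: ln_mult ln_div)
  then show ?thesis using l by (simp only:)
qed

lemma ln_fact_stirling:
  "n > 0 \<Longrightarrow> ln (fact n) = real n * ln (real n) - real n + ln (real n) / 2 + stirling_defect n"
  by (simp add: stirling_defect_def algebra_simps)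

text \<open>Unlike the sharp form this covers \<open>n = 0\<close>, so it can be used at the extreme
  overlaps \<open>s = 0\<close> and \<open>s = a\<close>. Far from the maximum a logarithmic error
  is harmless against an exponential rate.\<close>

lemma ln_fact_crude:
  obtains B where "B > 0" "\<And>n. \<bar>ln (fact n) - (real n * ln (real n) - real n)\<bar> \<le> ln (real n + 1) + B"
proof -
  obtain B where B: "B > 0" "\<And>n. \<bar>stirling_defect n\<bar> \<le> B"
    using convergent_imp_Bseq[OF stirling_defect_convergent] by (auto simp: Bseq_def)
  show thesis
  proof (rule that[OF B(1)])
    fix n :: nat
    show "\<bar>ln (fact n) - (real n * ln (real n) - real n)\<bar> \<le> ln (real n + 1) + B"
    proof (cases "n = 0")
      case True then show ?thesis using B(1) by simp
    next
      case False
      then have "0 \<le> ln (real n)" "ln (real n) \<le> ln (real n + 1)" by auto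
      then show ?thesis using ln_fact_stirling[of n] B(2)[of n] False by linarith
    qed
  qed
qed

text \<open>The bell curve is monotone on either side of \<open>\<mu>\<close>, so a term at distance
  at least 1 from \<open>\<mu>\<close> is at most the integral over the unit interval
  \<open>J s\<close> that lies next to \<open>s\<close> on the side of \<open>\<mu>\<close>. These
  half-open intervals are disjoint. At most two naturals are closer to \<open>\<mu>\<close>, and
  each contributes at most 1.\<close>

lemma sum_gaussian_le:
  fixes S :: "nat set"
  assumes "finite S" "\<sigma> > 0"
  shows "(\<Sum>s\<in>S. exp (- (real s - \<mu>)\<^sup>2 / (2 * \<sigma>\<^sup>2))) \<le> sqrt (2 * pi * \<sigma>\<^sup>2) + 2"
proof -
  let ?h = "\<lambda>x::real. exp (- (x - \<mu>)\<^sup>2 / (2 * \<sigma>\<^sup>2))"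
  let ?S = "{s \<in> S. \<bar>real s - \<mu>\<bar> \<ge> 1}"
  define J where "J s = (if real s \<ge> \<mu> then {real s - 1<..real s} else {real s<..real s + 1})" for s :: nat
  have h: "?h x = sqrt (2 * pi * \<sigma>\<^sup>2) * normal_density \<mu> \<sigma> x" for x
    using assms(2) by (simp add: normal_density_def)
  have int: "integrable lborel ?h" "integral\<^sup>L lborel ?h = sqrt (2 * pi * \<sigma>\<^sup>2)"
    unfolding h using assms(2) by simp_all
  have meas: "J s \<in> sets lborel" "emeasure lborel (J s) = 1" for s
    by (auto simp: J_def one_ennreal_def)
  have "(\<Sum>s\<in>?S. ?h (real s)) = (\<Sum>s\<in>?S. integral\<^sup>L lborel (\<lambda>x. ?h (real s) * indicator (J s) x))"
    using meas by (intro sum.cong refl) (simp add: measure_def)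
  also have "\<dots> = integral\<^sup>L lborel (\<lambda>x. \<Sum>s\<in>?S. ?h (real s) * indicator (J s) x)"
    using meas by (intro Bochner_Integration.integral_sum[symmetric] integrable_mult_right integrable_real_indicator) simp_all
  also have "\<dots> \<le> integral\<^sup>L lborel ?h"
  proof (rule integral_mono)
    show "integrable lborel (\<lambda>x. \<Sum>s\<in>?S. ?h (real s) * indicator (J s) x)"
      using meas by (intro Bochner_Integration.integrable_sum integrable_mult_right integrable_real_indicator) simp_all
    fix x
    let ?T = "{s \<in> ?S. x \<in> J s}"
    have "card ?T \<le> 1"
      unfolding One_nat_def
    proof (subst card_le_Suc0_iff_eq)
      show "finite ?T" using assms(1) by simp
      show "\<forall>s\<in>?T. \<forall>t\<in>?T. s = t" by (auto simp: J_def split: if_splits)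
    qed
    have le: "?h (real s) \<le> ?h x" if "s \<in> ?T" for s
    proof -
      have "\<bar>x - \<mu>\<bar> \<le> \<bar>real s - \<mu>\<bar>" using that by (auto simp: J_def split: if_splits)
      then have "(x - \<mu>)\<^sup>2 \<le> (real s - \<mu>)\<^sup>2" by (simp add: abs_le_square_iff)
      then show ?thesis by (simp add: divide_right_mono)
    qed
    have "(\<Sum>s\<in>?S. ?h (real s) * indicator (J s) x) = (\<Sum>s\<in>?T. ?h (real s))"
      using assms(1) by (intro sum.mono_neutral_cong_right) (auto simp: indicator_def)
    also have "\<dots> \<le> (\<Sum>s\<in>?T. ?h x)" using le by (rule sum_mono)
    also have "\<dots> = card ?T * ?h x" by simp
    also have "\<dots> \<le> 1 * ?h x" using \<open>card ?T \<le> 1\<close> by (intro mult_right_mono) auto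
    finally show "(\<Sum>s\<in>?S. ?h (real s) * indicator (J s) x) \<le> ?h x" by simp
  qed (rule int)
  finally have 1: "(\<Sum>s\<in>?S. ?h (real s)) \<le> sqrt (2 * pi * \<sigma>\<^sup>2)" using int by simp
  let ?R = "{s \<in> S. \<bar>real s - \<mu>\<bar> < 1}"
  have "?R \<subseteq> {nat \<lfloor>\<mu>\<rfloor>, nat \<lfloor>\<mu>\<rfloor> + 1}"
  proof
    fix s assume "s \<in> ?R"
    then have "real s < \<mu> + 1" "\<mu> < real s + 1" by auto
    then have "int s \<le> \<lfloor>\<mu>\<rfloor> + 1" "\<lfloor>\<mu>\<rfloor> \<le> int s" by linarith+
    then show "s \<in> {nat \<lfloor>\<mu>\<rfloor>, nat \<lfloor>\<mu>\<rfloor> + 1}" by auto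
  qed
  then have "card ?R \<le> card {nat \<lfloor>\<mu>\<rfloor>, nat \<lfloor>\<mu>\<rfloor> + 1}" by (intro card_mono) auto
  then have "card ?R \<le> 2" by simp
  have "(\<Sum>s\<in>?R. ?h (real s)) \<le> (\<Sum>s\<in>?R. 1)" by (intro sum_mono) simp
  also have "\<dots> \<le> 2" using \<open>card ?R \<le> 2\<close> by simp
  finally have 2: "(\<Sum>s\<in>?R. ?h (real s)) \<le> 2" .
  have "S = ?S \<union> ?R" by auto
  then have "(\<Sum>s\<in>S. ?h (real s)) = (\<Sum>s\<in>?S \<union> ?R. ?h (real s))" by simp
  also have "\<dots> = (\<Sum>s\<in>?S. ?h (real s)) + (\<Sum>s\<in>?R. ?h (real s))"
    using assms(1) by (intro sum.union_disjoint) auto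
  finally show ?thesis using 1 2 by simp
qed

section \<open>The rate function of the overlap\<close>

text \<open>The convention \<open>ln 0 = 0\<close> gives exactly the continuous extension at 0. So
  the rate is continuous on the closed interval and compactness applies up to the endpoints.\<close>

lemma continuous_xlnx: "continuous_on {0..} (\<lambda>x::real. x * ln x)"
  unfolding continuous_on_def
proof
  fix x :: real assume "x \<in> {0..}"
  show "((\<lambda>x. x * ln x) \<longlongrightarrow> x * ln x) (at x within {0..})"
  proof (cases "x = 0")
    case True
    have "((\<lambda>x::real. x * ln x) \<longlongrightarrow> 0) (at_right 0)" by real_asymp
    moreover have "at (0::real) within {0..} = at_right 0"
      by (rule at_within_nhd[of _ UNIV]) auto
    ultimately show ?thesis using True by simp
  next
    case False
    then have "x > 0" using \<open>x \<in> {0..}\<close> by simp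
    then show ?thesis by (intro tendsto_intros) auto
  qed
qed

text \<open>The exponential rate at which pairs of assignments with overlap fraction \<open>x\<close> lose against
  independent pairs.\<close>

definition overlap_rate :: "real \<Rightarrow> real \<Rightarrow> real \<Rightarrow> real" where
  "overlap_rate k d x = x * ln x + (1 - x) * ln (1 - x) + ln k - (1 - x) * ln (k - 1)
     - (d - 1) * ((1 - x) * ln (1 - x) + (k - 2 + x) * ln (k - 2 + x) - (2 * k - 3 + x) * ln (k - 1) + (k - 1) * ln k)"

definition overlap_rate' :: "real \<Rightarrow> real \<Rightarrow> real \<Rightarrow> real" where
  "overlap_rate' k d x = ln x - ln (1 - x) + ln (k - 1) - (d - 1) * (ln (k - 2 + x) - ln (1 - x) - ln (k - 1))"

text \<open>The assumption \<open>dst\<close> is \<open>d < d_star k\<close> with the denominator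
  cleared, since \<open>- ln (1 - 1 / k) = ln k - ln (k - 1)\<close>. The parameters are real here,
  so that the analysis is free of casts.\<close>

context
  fixes k d :: real
  assumes k3: "k \<ge> 3" and d1: "1 \<le> d" and dk: "d < k" and dst: "(d - 1) * ((k - 1) * (ln k - ln (k - 1))) < ln k"
begin

abbreviation "G \<equiv> overlap_rate k d"
abbreviation "G' \<equiv> overlap_rate' k d"

lemma G_cont: "continuous_on {0..1} G"
  unfolding overlap_rate_def
  using k3 by (intro continuous_intros continuous_on_compose2[OF continuous_xlnx]) auto

lemma G_deriv: "0 < x \<Longrightarrow> x < 1 \<Longrightarrow> (G has_real_derivative G' x) (at x)"
proof -
  assume x: "0 < x" "x < 1"
  have gen: "((\<lambda>x. f1 x + f2 x + c1 - (1 - x) * c2 - (d - 1) * (f2 x + f3 x - (2 * k - 3 + x) * c2 + c3))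
      has_real_derivative (D1 + D2 + c2 - (d - 1) * (D2 + D3 - c2))) (at x)"
    if "(f1 has_real_derivative D1) (at x)" "(f2 has_real_derivative D2) (at x)" "(f3 has_real_derivative D3) (at x)"
    for f1 f2 f3 :: "real \<Rightarrow> real" and D1 D2 D3 c1 c2 c3
    by (rule derivative_eq_intros that refl | simp add: algebra_simps)+
  have "((\<lambda>x. x * ln x) has_real_derivative ln x + 1) (at x)"
    using x by (auto intro!: derivative_eq_intros)
  moreover have "((\<lambda>x. (1 - x) * ln (1 - x)) has_real_derivative - ln (1 - x) - 1) (at x)"
    using x by (auto intro!: derivative_eq_intros)
  moreover have "((\<lambda>x. (k - 2 + x) * ln (k - 2 + x)) has_real_derivative ln (k - 2 + x) + 1) (at x)"
    using x k3 by (auto intro!: derivative_eq_intros)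
  ultimately have "(G has_real_derivative ((ln x + 1) + (- ln (1 - x) - 1) + ln (k - 1)
      - (d - 1) * ((- ln (1 - x) - 1) + (ln (k - 2 + x) + 1) - ln (k - 1)))) (at x)"
    unfolding overlap_rate_def by (rule gen)
  then show ?thesis by (simp add: overlap_rate'_def algebra_simps)
qed

text \<open>The numerator is linear in \<open>x\<close> and the denominator is positive, so the rate
  has at most one inflection point inside the unit interval. This determines its whole
  shape.\<close>

lemma G'_deriv:
  "0 < x \<Longrightarrow> x < 1 \<Longrightarrow> (G' has_real_derivative (k - 2 + x - (d - 1) * (k - 1) * x) / (x * (1 - x) * (k - 2 + x))) (at x)"
proof -
  assume x: "0 < x" "x < 1"
  have pos: "k - 2 + x > 0" "1 - x > 0" using x k3 by auto
  have "(G' has_real_derivative (1 / x + 1 / (1 - x) - (d - 1) * (1 / (k - 2 + x) + 1 / (1 - x)))) (at x)"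
    unfolding overlap_rate'_def using x pos by (auto intro!: derivative_eq_intros)
  moreover have "1 / x + 1 / (1 - x) = (k - 2 + x) / (x * (1 - x) * (k - 2 + x))"
    "1 / (k - 2 + x) + 1 / (1 - x) = (k - 1) * x / (x * (1 - x) * (k - 2 + x))"
    using x pos by (simp_all add: divide_simps)
  moreover have "A / q - (d - 1) * (B / q) = (A - (d - 1) * B) / q" for A B q :: real
    by (simp add: diff_divide_distrib)
  ultimately show ?thesis by (simp only: mult.assoc[of "d - 1"])
qed

lemma k_pos: "0 < 1 / k" "1 / k < 1" using k3 by auto

lemma ln_1k: "ln (1 / k) = - ln k" "ln (1 - 1 / k) = ln (k - 1) - ln k" "ln (k - 2 + 1 / k) = 2 * ln (k - 1) - ln k"
proof -
  have "1 - 1 / k = (k - 1) / k" "k - 2 + 1 / k = (k - 1)\<^sup>2 / k" using k3 by (auto simp: field_simps power2_eq_square)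
  then show "ln (1 / k) = - ln k" "ln (1 - 1 / k) = ln (k - 1) - ln k" "ln (k - 2 + 1 / k) = 2 * ln (k - 1) - ln k"
    using k3 by (simp_all add: ln_div ln_realpow)
qed

lemma G_at: "G (1 / k) = 0"
proof -
  have "G (1 / k) = - (1/k) * ln k + (1 - 1/k) * (ln (k - 1) - ln k) + ln k - (1 - 1 / k) * ln (k - 1)
     - (d - 1) * ((1 - 1 / k) * (ln (k - 1) - ln k) + (k - 2 + 1 / k) * (2 * ln (k - 1) - ln k) - (2 * k - 3 + 1 / k) * ln (k - 1) + (k - 1) * ln k)"
    by (simp only: overlap_rate_def ln_1k)
  also have "\<dots> = 0" using k3 by (simp add: algebra_simps)
  finally show ?thesis .
qed

lemma G'_at: "G' (1 / k) = 0"
  by (simp only: overlap_rate'_def ln_1k) simp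

lemma G_1: "G 1 > 0"
  using dst by (simp add: overlap_rate_def algebra_simps)

text \<open>Up to \<open>\<alpha>\<close> the rate is convex with critical point
  \<open>1 / k\<close> and value 0 there, so it is positive elsewhere on this part. Beyond
  \<open>\<alpha>\<close> it is concave, hence above the smaller of its values at
  \<open>\<alpha>\<close> and at 1, and both are positive.\<close>

lemma G_pos:
  assumes "0 \<le> x" "x \<le> 1" "x \<noteq> 1 / k"
  shows "G x > 0"
proof -
  let ?p = "1 / k"
  let ?l = "\<lambda>x. k - 2 + x - (d - 1) * (k - 1) * x"
  have lp: "?l ?p > 0"
  proof -
    have "?l ?p = (k - 1) * (k - d) / k" using k3 by (simp add: field_simps)
    then show ?thesis using k3 dk by simp
  qed
  have den: "x * (1 - x) * (k - 2 + x) > 0" if "0 < x" "x < 1" for x using that k3 by simp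
  \<comment> \<open>The inflection point, capped at 1: the zero \<open>(k - 2) / s\<close> of the
    linear numerator, or 1 if the numerator is still nonnegative at 1. It lies to the right of
    \<open>1 / k\<close> because the numerator is positive at \<open>1 / k\<close>, which is where
    \<open>d < k\<close> enters.\<close>
  obtain \<alpha> where \<alpha>: "?p < \<alpha>" "\<alpha> \<le> 1" "\<And>x. 0 < x \<Longrightarrow> x < \<alpha> \<Longrightarrow> ?l x > 0" "\<And>x. \<alpha> < x \<Longrightarrow> x < 1 \<Longrightarrow> ?l x < 0"
  proof (cases "?l 1 \<ge> 0")
    case True
    show thesis
    proof (rule that[of 1])
      fix x :: real assume x: "0 < x" "x < 1"
      have "?l x = (1 - x) * (k - 2) + x * ?l 1" by (simp add: algebra_simps)
      also have "\<dots> > 0" using True x k3 by (intro add_pos_nonneg mult_pos_pos mult_nonneg_nonneg) auto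
      finally show "?l x > 0" .
    qed (use k_pos in auto)
  next
    case False
    define s where "s = (d - 1) * (k - 1) - 1"
    have l: "?l x = (k - 2) - s * x" for x by (simp add: s_def algebra_simps)
    have s: "s > k - 2" using False by (simp add: s_def)
    then have s0: "s > 0" using k3 by simp
    show thesis
    proof (rule that[of "(k - 2) / s"])
      show "?p < (k - 2) / s" using lp s0 unfolding l by (simp add: field_simps)
      show "(k - 2) / s \<le> 1" using s s0 by simp
      show "?l x > 0" if "0 < x" "x < (k - 2) / s" for x using that s0 unfolding l by (simp add: field_simps)
      show "?l x < 0" if "x > (k - 2) / s" "x < 1" for x using that s0 unfolding l by (simp add: field_simps)
    qed
  qed
  have inc: "G' u < G' v" if "0 < u" "u < v" "v < 1" "v \<le> \<alpha>" for u v
  proof (rule DERIV_pos_imp_increasing_open[OF \<open>u < v\<close>])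
    fix x assume "u < x" "x < v"
    then show "\<exists>y. (G' has_real_derivative y) (at x) \<and> y > 0"
      using that \<alpha>(3)[of x] den[of x] by (intro exI[of _ "?l x / (x * (1 - x) * (k - 2 + x))"] conjI G'_deriv) auto
    next
    show "continuous_on {u..v} G'"
      using that by (intro continuous_at_imp_continuous_on ballI DERIV_isCont[OF G'_deriv]) auto
  qed
  have dec: "G' u > G' v" if "0 < u" "u < v" "v < 1" "\<alpha> \<le> u" for u v
  proof (rule DERIV_neg_imp_decreasing_open[OF \<open>u < v\<close>])
    fix x assume "u < x" "x < v"
    then show "\<exists>y. (G' has_real_derivative y) (at x) \<and> y < 0"
      using that \<alpha>(4)[of x] den[of x] by (intro exI[of _ "?l x / (x * (1 - x) * (k - 2 + x))"] conjI G'_deriv) (auto simp: divide_neg_pos)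
    next
    show "continuous_on {u..v} G'"
      using that by (intro continuous_at_imp_continuous_on ballI DERIV_isCont[OF G'_deriv]) auto
  qed
  have up: "G u < G v" if "0 \<le> u" "u < v" "v \<le> 1" "\<And>x. u < x \<Longrightarrow> x < v \<Longrightarrow> G' x > 0" for u v
  proof (rule DERIV_pos_imp_increasing_open[OF \<open>u < v\<close>])
    fix x assume "u < x" "x < v"
    then show "\<exists>y. (G has_real_derivative y) (at x) \<and> y > 0"
      using that by (intro exI[of _ "G' x"] conjI G_deriv) auto
    next
    show "continuous_on {u..v} G" using that by (intro continuous_on_subset[OF G_cont]) auto
  qed
  have down: "G u > G v" if "0 \<le> u" "u < v" "v \<le> 1" "\<And>x. u < x \<Longrightarrow> x < v \<Longrightarrow> G' x < 0" for u v
  proof (rule DERIV_neg_imp_decreasing_open[OF \<open>u < v\<close>])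
    fix x assume "u < x" "x < v"
    then show "\<exists>y. (G has_real_derivative y) (at x) \<and> y < 0"
      using that by (intro exI[of _ "G' x"] conjI G_deriv) auto
    next
    show "continuous_on {u..v} G" using that by (intro continuous_on_subset[OF G_cont]) auto
  qed
  consider "x < ?p" | "?p < x" "x \<le> \<alpha>" | "\<alpha> < x" "x < 1" | "x = 1" using assms by linarith
  then show ?thesis
  proof cases
    case 1
    have "G x > G ?p"
      by (rule down) (use 1 assms k_pos \<alpha>(1) inc[of _ ?p] G'_at in auto)
    then show ?thesis by (simp add: G_at)
  next
    case 2
    have "G ?p < G x"
      by (rule up) (use 2 assms k_pos \<alpha>(1) inc[of ?p] G'_at in auto)
    then show ?thesis by (simp add: G_at)
  next
    case 3
    have a0: "\<alpha> > 0" using \<alpha>(1) k_pos by linarith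
    have a: "G ?p < G \<alpha>"
      by (rule up) (use 3 assms k_pos \<alpha>(1) inc[of ?p] G'_at in auto)
    show ?thesis
    proof (cases "G' x \<ge> 0")
      case True
      have "G' y > 0" if "\<alpha> < y" "y < x" for y
        using dec[of y x] that 3 True a0 by linarith
      then have "G \<alpha> < G x" using 3 a0 by (intro up) auto
      then show ?thesis using a by (simp add: G_at)
    next
      case False
      have "G' y < 0" if "x < y" "y < 1" for y
        using dec[of x y] that 3 False a0 by linarith
      then have "G x > G 1" using 3 a0 by (intro down) auto
      then show ?thesis using G_1 by simp
    qed
  next
    case 4
    then show ?thesis using G_1 by simp
  qed
qed

lemma G_bounded_below:
  assumes "\<epsilon> > 0"
  obtains g where "g > 0" "\<And>x. 0 \<le> x \<Longrightarrow> x \<le> 1 \<Longrightarrow> \<bar>x - 1 / k\<bar> \<ge> \<epsilon> \<Longrightarrow> G x \<ge> g"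
proof -
  let ?K = "{0..1} \<inter> {x. \<bar>x - 1 / k\<bar> \<ge> \<epsilon>}"
  have cl: "closed {x. \<bar>x - 1 / k\<bar> \<ge> \<epsilon>}" by (intro closed_Collect_le continuous_intros)
  show thesis
  proof (cases "?K = {}")
    case True
    show thesis by (rule that[of 1]) (use True in auto)
  next
    case False
    obtain y where y: "y \<in> ?K" "\<And>x. x \<in> ?K \<Longrightarrow> G y \<le> G x"
      using continuous_attains_inf[OF _ False, of G] cl
      by (meson G_cont compact_Icc compact_Int_closed continuous_on_subset inf_le1)
    show thesis
      by (rule that[of "G y"]) (use y G_pos[of y] assms in auto)
  qed
qed

text \<open>The second derivative of the rate at its minimum \<open>1 / k\<close>.\<close>

definition curvature :: real where "curvature = k\<^sup>2 * (k - d) / (k - 1)\<^sup>2"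

text \<open>By continuity the second derivative exceeds \<open>\<theta> * curvature\<close> near
  \<open>1 / k\<close>. The difference of the rate and the parabola then has an increasing
  derivative that vanishes at \<open>1 / k\<close>, so \<open>1 / k\<close> is its local minimum,
  with value 0.\<close>

lemma G_quadratic:
  assumes "\<theta> < 1"
  obtains \<epsilon> where "\<epsilon> > 0" "\<epsilon> < 1 / k" "\<epsilon> < 1 - 1 / k" "\<And>x. \<bar>x - 1 / k\<bar> < \<epsilon> \<Longrightarrow> G x \<ge> \<theta> * curvature * (x - 1 / k)\<^sup>2 / 2"
proof -
  let ?p = "1 / k"
  let ?G2 = "\<lambda>x. (k - 2 + x - (d - 1) * (k - 1) * x) / (x * (1 - x) * (k - 2 + x))"
  have c: "?G2 ?p = curvature"
  proof -
    have 1: "k - 2 + ?p - (d - 1) * (k - 1) * ?p = (k - 1) * (k - d) / k" using k3 by (simp add: field_simps)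
    have 2: "?p * (1 - ?p) * (k - 2 + ?p) = (k - 1) ^ 3 / k ^ 3"
      using k3 by (simp add: field_simps power3_eq_cube)
    have "(m * e / k) / (m ^ 3 / k ^ 3) = k\<^sup>2 * e / m\<^sup>2" if "m \<noteq> 0" for m e
      using that k3 by (simp add: field_simps power2_eq_square power3_eq_cube)
    then show ?thesis unfolding 1 2 curvature_def using k3 by simp
  qed
  have pos: "curvature > 0" using k3 dk by (simp add: curvature_def)
  have "k - 2 + ?p > 0" using k3 k_pos by linarith
  then have nz: "k - 2 + ?p \<noteq> 0" "?p \<noteq> 0" "1 - ?p \<noteq> 0" using k_pos by linarith+
  have "isCont ?G2 ?p" by (intro continuous_intros no_zero_divisors nz)
  then have "(?G2 \<longlongrightarrow> curvature) (at ?p)" using c by (simp add: isCont_def)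
  moreover have "\<theta> * curvature < curvature" using assms pos by simp
  ultimately have "eventually (\<lambda>x. ?G2 x > \<theta> * curvature) (at ?p)" by (rule order_tendstoD)
  then have "eventually (\<lambda>x. ?G2 x > \<theta> * curvature) (nhds ?p)"
    using c \<open>\<theta> * curvature < curvature\<close> by (simp add: eventually_nhds_conv_at)
  then obtain e where e: "e > 0" "\<And>x. \<bar>x - ?p\<bar> < e \<Longrightarrow> ?G2 x > \<theta> * curvature"
    unfolding eventually_nhds_metric by (auto simp: dist_real_def)
  \<comment> \<open>The two halves keep the neighbourhood strictly inside the unit interval, where
    the derivatives are available.\<close>
  define \<epsilon> where "\<epsilon> = min e (min (?p / 2) ((1 - ?p) / 2))"
  have "min e (min (q / 2) ((1 - q) / 2)) > 0 \<and> min e (min (q / 2) ((1 - q) / 2)) \<le> e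
      \<and> min e (min (q / 2) ((1 - q) / 2)) < q \<and> min e (min (q / 2) ((1 - q) / 2)) < 1 - q" if "0 < q" "q < 1" for q :: real
    using that e(1) by (auto simp: min_def)
  from this[OF k_pos] have \<epsilon>: "\<epsilon> > 0" "\<epsilon> \<le> e" "\<epsilon> < ?p" "\<epsilon> < 1 - ?p"
    unfolding \<epsilon>_def by blast+
  let ?f = "\<lambda>x. G x - \<theta> * curvature * (x - ?p)\<^sup>2 / 2"
  let ?f' = "\<lambda>x. G' x - \<theta> * curvature * (x - ?p)"
  have f: "(?f has_real_derivative ?f' x) (at x)" if "0 < x" "x < 1" for x
    by (auto intro!: derivative_eq_intros G_deriv[OF that])
  have f': "(?f' has_real_derivative ?G2 x - \<theta> * curvature) (at x)" if "0 < x" "x < 1" for x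
    by (auto intro!: derivative_eq_intros G'_deriv[OF that])
  have inc: "?f' u < ?f' v" if "?p - \<epsilon> < u" "u < v" "v < ?p + \<epsilon>" for u v
  proof (rule DERIV_pos_imp_increasing[OF \<open>u < v\<close>])
    fix x assume "u \<le> x" "x \<le> v"
    then have "\<bar>x - ?p\<bar> < e" "0 < x" "x < 1" using that \<epsilon> by auto
    then show "\<exists>y. (?f' has_real_derivative y) (at x) \<and> 0 < y"
      using e(2)[of x] f'[of x] by (intro exI[of _ "?G2 x - \<theta> * curvature"]) auto
  qed
  have f'0: "?f' ?p = 0" and f0: "?f ?p = 0" by (simp_all add: G_at G'_at)
  have "?f x \<ge> 0" if x: "\<bar>x - ?p\<bar> < \<epsilon>" for x
  proof (cases x "?p" rule: linorder_cases)
    case less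
    have "?f ?p \<le> ?f x"
    proof (rule DERIV_nonpos_imp_nonincreasing[of x ?p])
      fix y assume y: "x \<le> y" "y \<le> ?p"
      then have "?f' y \<le> 0" using inc[of y ?p] f'0 x \<epsilon> by (cases "y = ?p") auto
      then show "\<exists>z. (?f has_real_derivative z) (at y) \<and> z \<le> 0"
        using f[of y] y x \<epsilon> less k_pos by (intro exI[of _ "?f' y"]) auto
    qed (use less in auto)
    then show ?thesis using f0 by simp
  next
    case greater
    have "?f ?p \<le> ?f x"
    proof (rule DERIV_nonneg_imp_nondecreasing[of ?p x])
      fix y assume y: "?p \<le> y" "y \<le> x"
      then have "?f' y \<ge> 0" using inc[of ?p y] f'0 x \<epsilon> by (cases "y = ?p") auto
      then show "\<exists>z. (?f has_real_derivative z) (at y) \<and> z \<ge> 0"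
        using f[of y] y x \<epsilon> greater k_pos by (intro exI[of _ "?f' y"]) auto
    qed (use greater in auto)
    then show ?thesis using f0 by simp
  qed (use f0 in simp)
  then show thesis by (intro that[of \<epsilon>]) (use \<epsilon> in auto)
qed

end

section \<open>Asymptotics of the second moment\<close>

text \<open>The leading part of \<open>ln (fact n)\<close>. It scales exactly under multiplication,
  which isolates the contributions \<open>a * ln a\<close> that cancel later.\<close>

definition xlnx_sub :: "real \<Rightarrow> real" where "xlnx_sub x = x * ln x - x"

lemma xlnx_sub_mult: "a > 0 \<Longrightarrow> t \<ge> 0 \<Longrightarrow> xlnx_sub (t * a) = a * xlnx_sub t + t * a * ln a"
  by (cases "t = 0") (auto simp: xlnx_sub_def ln_mult algebra_simps)

text \<open>The arguments are those of the factorials in \<open>overlap_term\<close> at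
  \<open>s = x * a\<close>. All contributions with \<open>ln a\<close> and \<open>ln d\<close>
  cancel, and what is left is \<open>a\<close> times a function of \<open>x\<close> alone.\<close>

lemma overlap_exponent:
  assumes "a > 0" "k > 2" "d > 0" "0 \<le> x" "x \<le> 1"
  shows "2 * xlnx_sub a + 2 * xlnx_sub ((k - 1) * a) - xlnx_sub (k * a) - xlnx_sub (x * a)
     - 2 * xlnx_sub ((1 - x) * a) - xlnx_sub ((k - 2 + x) * a) + xlnx_sub (d * ((1 - x) * a))
     + xlnx_sub (d * ((k - 2 + x) * a)) + xlnx_sub (d * (k * a)) - xlnx_sub (d * a)
     - 2 * xlnx_sub (d * ((k - 1) * a)) - d * a * ln k + d * ((1 - x) * a) * ln (k - 1)
     = - a * overlap_rate k d x"
proof -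
  have m: "xlnx_sub (t * a) = a * xlnx_sub t + t * a * ln a" if "t \<ge> 0" for t
    using xlnx_sub_mult assms(1) that by auto
  have md: "xlnx_sub (d * (t * a)) = d * a * xlnx_sub t + d * t * a * ln a + d * t * a * ln d" if "t \<ge> 0" for t
    using xlnx_sub_mult[of d "t * a"] m[OF that] assms that by (simp add: algebra_simps)
  have m1: "xlnx_sub a = a * xlnx_sub 1 + a * ln a" using m[of 1] by simp
  have md1: "xlnx_sub (d * a) = d * a * xlnx_sub 1 + d * a * ln a + d * a * ln d" using md[of 1] by simp
  have nn: "k - 1 \<ge> 0" "k \<ge> 0" "1 - x \<ge> 0" "k - 2 + x \<ge> 0" using assms by auto
  show ?thesis
    unfolding m1 md1 m[OF nn(1)] m[OF nn(2)] m[OF nn(3)] m[OF nn(4)] m[OF assms(4)] md[OF nn(1)] md[OF nn(2)] md[OF nn(3)] md[OF nn(4)]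
    unfolding xlnx_sub_def overlap_rate_def
    by (simp add: algebra_simps)
qed

context regular_cover
begin

definition overlap_term :: "nat \<Rightarrow> nat \<Rightarrow> real" where
  "overlap_term a s = real (a choose s) * real ((k * a - a) choose (a - s)) * real (pair_count a s)
     * (real (k * a choose a) / fact (d * k * a)) / (mean_X a)\<^sup>2"

lemma mean_X_pos: "mean_X a > 0"
proof -
  have "a \<le> k * a" using k_gt by simp
  then have "(k * a choose a) > 0" by simp
  then show ?thesis using k_gt unfolding mean_X_def by (intro divide_pos_pos mult_pos_pos) auto
qed

lemma second_moment_ratio: "avg a (\<lambda>\<sigma>. (X a \<sigma>)\<^sup>2) / (mean_X a)\<^sup>2 = (\<Sum>s\<le>a. overlap_term a s)"
  unfolding avg_X_sq overlap_term_def by (simp add: sum_divide_distrib sum_distrib_left sum_distrib_right mult_ac)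

definition lnfact :: "nat \<Rightarrow> real" where "lnfact n = ln (fact n)"

lemma ln_choose: "j \<le> n \<Longrightarrow> ln (real (n choose j)) = lnfact n - lnfact j - lnfact (n - j)"
  by (simp add: binomial_fact lnfact_def ln_div ln_mult)

lemma ln_overlap_term:
  assumes s: "s \<le> a"
  shows "overlap_term a s > 0" and "ln (overlap_term a s)
    = 2 * lnfact a + 2 * lnfact ((k - 1) * a) - lnfact (k * a) - lnfact s - 2 * lnfact (a - s) - lnfact ((k - 2) * a + s)
      + lnfact (d * (a - s)) + lnfact (d * ((k - 2) * a + s)) + lnfact (d * (k * a)) - lnfact (d * a) - 2 * lnfact (d * ((k - 1) * a))
      - real d * real a * ln (real k) + real d * real (a - s) * ln (real k - 1)"
proof -
  have a1: "k * a - a = (k - 1) * a" by (simp add: diff_mult_distrib)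
  have a2: "d * k * a - d * a = d * ((k - 1) * a)" by (simp add: diff_mult_distrib diff_mult_distrib2 mult.assoc)
  have "(k - 1) * a = (k - 2) * a + a" using k_gt by (cases k) (auto simp: algebra_simps dest!: less_imp_Suc_add)
  then have a3: "(k - 1) * a - (a - s) = (k - 2) * a + s" and a3': "a - s \<le> (k - 1) * a" using s by simp_all
  have a4: "d * k * a - 2 * d * a + d * s = d * ((k - 2) * a + s)"
    by (simp add: diff_mult_distrib diff_mult_distrib2 mult.assoc add_mult_distrib2 mult.left_commute)
  have a5: "d * a - d * s = d * (a - s)" by (simp add: diff_mult_distrib2)
  have a6: "d * s \<le> d * a" using s by simp
  have a7: "a \<le> k * a" using k_gt by simp
  have pc: "pair_count a s > 0" using k_gt a6 by (simp add: pair_count_def)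
  show pos: "overlap_term a s > 0"
    unfolding overlap_term_def using s a3' a1 a7 pc mean_X_pos[of a]
    by (intro mult_pos_pos divide_pos_pos) auto
  have lpc: "ln (real (pair_count a s)) = real d * real a * ln (real k) + real d * real (a - s) * ln (real k - 1)
     + lnfact (d * a) + lnfact (d * (a - s)) + lnfact (d * ((k - 2) * a + s))"
  proof -
    have "real (pair_count a s) = real k ^ (d * a) * real ((d * a) choose (d * s)) * (real k - 1) ^ (d * (a - s)) *
      (fact (d * s) * fact (d * (a - s)) * fact (d * (a - s)) * fact (d * ((k - 2) * a + s)))"
      using k_gt by (simp add: pair_count_def a4 a5 of_nat_diff)
    moreover have "real ((d * a) choose (d * s)) > 0" "real k - 1 > 0" "real k > 0" using k_gt a6 by auto
    ultimately show ?thesis using ln_choose[OF a6]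
      by (simp only: ln_mult_pos mult_pos_pos zero_less_power fact_gt_zero ln_realpow a5 lnfact_def of_nat_mult)
  qed
  have lm: "ln (mean_X a) = lnfact (k * a) - lnfact a - lnfact ((k - 1) * a) + real d * real a * ln (real k) + lnfact (d * a) + lnfact (d * ((k - 1) * a)) - lnfact (d * (k * a))"
    using k_gt a7 ln_choose[OF a7] unfolding mean_X_def a2
    by (simp add: ln_mult ln_div ln_realpow lnfact_def a1 mult.assoc)
  have "ln (overlap_term a s) = ln (real (a choose s)) + ln (real ((k * a - a) choose (a - s))) + ln (real (pair_count a s))
     + (ln (real (k * a choose a)) - lnfact (d * k * a)) - 2 * ln (mean_X a)"
    unfolding overlap_term_def using s a3' a1 a7 pc mean_X_pos[of a] k_gt
    by (simp add: ln_mult ln_div ln_realpow lnfact_def)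
  also have "\<dots> = 2 * lnfact a + 2 * lnfact ((k - 1) * a) - lnfact (k * a) - lnfact s - 2 * lnfact (a - s) - lnfact ((k - 2) * a + s)
      + lnfact (d * (a - s)) + lnfact (d * ((k - 2) * a + s)) + lnfact (d * (k * a)) - lnfact (d * a) - 2 * lnfact (d * ((k - 1) * a))
      - real d * real a * ln (real k) + real d * real (a - s) * ln (real k - 1)"
    unfolding lpc lm a1 ln_choose[OF s] ln_choose[OF a3'] a3 using ln_choose[OF a7]
    by (simp add: a1 mult.assoc algebra_simps)
  finally show "ln (overlap_term a s)
    = 2 * lnfact a + 2 * lnfact ((k - 1) * a) - lnfact (k * a) - lnfact s - 2 * lnfact (a - s) - lnfact ((k - 2) * a + s)
      + lnfact (d * (a - s)) + lnfact (d * ((k - 2) * a + s)) + lnfact (d * (k * a)) - lnfact (d * a) - 2 * lnfact (d * ((k - 1) * a))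
      - real d * real a * ln (real k) + real d * real (a - s) * ln (real k - 1)" .
qed

text \<open>Of order \<open>ln n\<close>: invisible on the exponential scale, but the source of the
  polynomial prefactors.\<close>

definition lnfact_err :: "nat \<Rightarrow> real" where "lnfact_err n = lnfact n - xlnx_sub (real n)"

lemma ln_overlap_term_rate:
  assumes s: "s \<le> a" and a: "a > 0"
  shows "ln (overlap_term a s) = - real a * overlap_rate (real k) (real d) (real s / real a)
    + (2 * lnfact_err a + 2 * lnfact_err ((k - 1) * a) - lnfact_err (k * a) - lnfact_err s - 2 * lnfact_err (a - s) - lnfact_err ((k - 2) * a + s)
      + lnfact_err (d * (a - s)) + lnfact_err (d * ((k - 2) * a + s)) + lnfact_err (d * (k * a)) - lnfact_err (d * a) - 2 * lnfact_err (d * ((k - 1) * a)))"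
proof -
  let ?x = "real s / real a"
  have k2: "real (k - 1) = real k - 1" "real (k - 2) = real k - 2" using k_gt by auto
  have r: "real s = ?x * real a" "real (a - s) = (1 - ?x) * real a" "real ((k - 2) * a + s) = (real k - 2 + ?x) * real a"
    "real ((k - 1) * a) = (real k - 1) * real a"
    using s a by (simp_all only: of_nat_mult of_nat_add k2 of_nat_diff[OF s]) (simp_all add: field_simps)
  have l: "lnfact n = lnfact_err n + xlnx_sub (real n)" for n by (simp add: lnfact_err_def)
  have rd: "real (d * n) = real d * real n" for n by simp
  have "real a > 0" "real k > 2" "real d > 0" "0 \<le> ?x" "?x \<le> 1" using a k_gt d_pos s by auto
  note ex = overlap_exponent[OF this]
  have aux: "2 * (r1 + x1) + 2 * (r2 + x2) - (r3 + x3) - (r4 + x4) - 2 * (r5 + x5) - (r6 + x6) + (r7 + x7) + (r8 + x8)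
      + (r9 + x9) - (r10 + x10) - 2 * (r11 + x11) - A + B
      = e + (2 * r1 + 2 * r2 - r3 - r4 - 2 * r5 - r6 + r7 + r8 + r9 - r10 - 2 * r11)"
    if "2 * x1 + 2 * x2 - x3 - x4 - 2 * x5 - x6 + x7 + x8 + x9 - x10 - 2 * x11 - A + B = e"
    for r1 r2 r3 r4 r5 r6 r7 r8 r9 r10 r11 x1 x2 x3 x4 x5 x6 x7 x8 x9 x10 x11 A B e :: real
    using that by simp
  show ?thesis
    unfolding ln_overlap_term(2)[OF s] l rd of_nat_mult[of k a] r(3,4) 
    by (rule aux[OF ex[unfolded r(1,2)[symmetric]]])
qed

lemma lnfact_err_crude: obtains B where "B > 0" "\<And>n. \<bar>lnfact_err n\<bar> \<le> ln (real n + 1) + B"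
proof -
  obtain B where "B > 0" "\<And>n. \<bar>ln (fact n) - (real n * ln (real n) - real n)\<bar> \<le> ln (real n + 1) + B"
    by (rule ln_fact_crude) blast
  then show thesis by (intro that[of B]) (simp_all add: lnfact_err_def lnfact_def xlnx_sub_def)
qed

lemma lnfact_err_stirling: "n > 0 \<Longrightarrow> lnfact_err n = ln (real n) / 2 + stirling_defect n"
  by (simp add: lnfact_err_def lnfact_def xlnx_sub_def ln_fact_stirling)

abbreviation "rate \<equiv> overlap_rate (real k) (real d)"

text \<open>The coefficients of the eleven remainders have absolute values 2, 2, 1, 1, 2, 1, 1, 1,
  1, 1, 2 with sum 15. Every argument is at most \<open>d * k * a\<close>, so one logarithm bounds
  all of them.\<close>

lemma overlap_term_le_far:
  obtains B where "\<And>a s. s \<le> a \<Longrightarrow> a > 0 \<Longrightarrow>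
    overlap_term a s \<le> exp (- real a * rate (real s / real a) + 15 * (ln (real (d * k) * real a + 1) + B))"
proof -
  obtain B where B: "B > 0" "\<And>n. \<bar>lnfact_err n\<bar> \<le> ln (real n + 1) + B" by (rule lnfact_err_crude) blast
  show thesis
  proof (rule that[of B])
    fix a s assume s: "s \<le> a" and a: "a > (0::nat)"
    let ?M = "ln (real (d * k) * real a + 1) + B"
    have r: "\<bar>lnfact_err n\<bar> \<le> ?M" if "n \<le> d * k * a" for n
    proof -
      have "real n \<le> real (d * k * a)" using that by (rule of_nat_mono)
      then have "real n \<le> real (d * k) * real a" by simp
      then have "ln (real n + 1) \<le> ln (real (d * k) * real a + 1)" by simp
      then show ?thesis using B(2)[of n] by linarith
    qed
    have ka: "k * a \<le> d * k * a" using d_pos by simp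
    have b1: "(k - 1) * a \<le> k * a" "a \<le> k * a" using k_gt by auto
    have "(k - 2) * a + s \<le> (k - 2) * a + 2 * a" using s by simp
    also have "\<dots> = ((k - 2) + 2) * a" by (rule add_mult_distrib[symmetric])
    also have "(k - 2) + 2 = k" using k_gt by simp
    finally have b2: "(k - 2) * a + s \<le> k * a" .
    have D: "d * n \<le> d * k * a" if "n \<le> k * a" for n using that by (simp add: mult.assoc)
    have as: "a - s \<le> k * a" "s \<le> k * a" using b1(2) s by linarith+
    have le: "a \<le> d * k * a" "(k - 1) * a \<le> d * k * a" "s \<le> d * k * a" "a - s \<le> d * k * a" "(k - 2) * a + s \<le> d * k * a"
      using ka b1 b2 as by linarith+
    note R = r[OF le(1)] r[OF le(2)] r[OF ka] r[OF le(3)] r[OF le(4)] r[OF le(5)]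
      r[OF D[OF as(1)]] r[OF D[OF b2]] r[OF D[OF order_refl]] r[OF D[OF b1(2)]] r[OF D[OF b1(1)]]
    have "ln (overlap_term a s) \<le> - real a * rate (real s / real a) + 15 * ?M"
    proof -
      have aux: "e + (2 * r1 + 2 * r2 - r3 - r4 - 2 * r5 - r6 + r7 + r8 + r9 - r10 - 2 * r11) \<le> e + 15 * M"
        if "\<bar>r1\<bar> \<le> M" "\<bar>r2\<bar> \<le> M" "\<bar>r3\<bar> \<le> M" "\<bar>r4\<bar> \<le> M" "\<bar>r5\<bar> \<le> M" "\<bar>r6\<bar> \<le> M"
          "\<bar>r7\<bar> \<le> M" "\<bar>r8\<bar> \<le> M" "\<bar>r9\<bar> \<le> M" "\<bar>r10\<bar> \<le> M" "\<bar>r11\<bar> \<le> M"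
        for e r1 r2 r3 r4 r5 r6 r7 r8 r9 r10 r11 M :: real
        using that[THEN abs_le_D1] that[THEN abs_le_D2] by linarith
      show ?thesis unfolding ln_overlap_term_rate[OF s a] by (rule aux[OF R])
    qed
    then show "overlap_term a s \<le> exp (- real a * rate (real s / real a) + 15 * ?M)"
      using ln_overlap_term(1)[OF s] by (metis exp_le_cancel_iff exp_ln)
  qed
qed

text \<open>Here all eleven arguments are at least \<open>n0\<close>, so Stirling's formula applies
  to each. The signed coefficients add up to -1, which leaves the single factor
  \<open>1 / sqrt (2 * pi)\<close>; the half logarithms combine to the square root, with every
  \<open>k\<close> and \<open>d\<close> cancelling. The absolute coefficients add up to 15, whence
  \<open>15 * t\<close>.\<close>

lemma overlap_term_le_near:
  assumes n0: "\<And>n. n \<ge> n0 \<Longrightarrow> \<bar>stirling_defect n - ln (2 * pi) / 2\<bar> \<le> t"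
    and s: "n0 \<le> s" "0 < s" "s + n0 \<le> a" "s < a"
  shows "overlap_term a s \<le> exp (- real a * rate (real s / real a)) * sqrt (real a / (real s * real (a - s))) * exp (15 * t) / sqrt (2 * pi)"
proof -
  let ?l = "ln (2 * pi) / 2"
  have k1: "k - 1 \<ge> 1" "k - 2 \<ge> 1" using k_gt by auto
  have ge: "n0 \<le> a" "n0 \<le> a - s" "0 < a" "0 < a - s" using s by auto
  have m: "c * n \<ge> n" if "c \<ge> 1" for c n :: nat using that by simp
  have pos: "0 < (k - 1) * a" "0 < k * a" "0 < (k - 2) * a + s" "0 < d * (a - s)" "0 < d * ((k - 2) * a + s)" "0 < d * (k * a)" "0 < d * a" "0 < d * ((k - 1) * a)"
    using ge k1 d_pos k_gt by auto
  have d1: "d \<ge> 1" "k \<ge> 1" using d_pos k_gt by auto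
  have big: "n0 \<le> (k - 1) * a" "n0 \<le> k * a" "n0 \<le> (k - 2) * a + s" "n0 \<le> d * (a - s)" "n0 \<le> d * ((k - 2) * a + s)" "n0 \<le> d * (k * a)" "n0 \<le> d * a" "n0 \<le> d * ((k - 1) * a)"
    using ge s m[OF k1(1), of a] m[OF d1(2), of a] m[OF d1(1), of "a - s"] m[OF d1(1), of "(k - 2) * a + s"] m[OF d1(1), of "k * a"] m[OF d1(1), of a]
      m[OF d1(1), of "(k - 1) * a"] by linarith+
  have lnd: "ln (real (d * n)) = ln (real d) + ln (real n)" if "n > 0" for n using that d_pos by (simp add: ln_mult)
  have k1r: "real (k - 1) > 0" using k1 by simp
  have lnk: "ln (real (k * a)) = ln (real k) + ln (real a)" "ln (real ((k - 1) * a)) = ln (real (k - 1)) + ln (real a)"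
    using ge k1r k_gt by (simp_all add: ln_mult)
  note rs = lnfact_err_stirling[OF ge(3)] lnfact_err_stirling[OF s(2)] lnfact_err_stirling[OF ge(4)] lnfact_err_stirling[OF pos(1)] lnfact_err_stirling[OF pos(2)] lnfact_err_stirling[OF pos(3)]
     lnfact_err_stirling[OF pos(4)] lnfact_err_stirling[OF pos(5)] lnfact_err_stirling[OF pos(6)] lnfact_err_stirling[OF pos(7)] lnfact_err_stirling[OF pos(8)]
  have R: "2 * lnfact_err a + 2 * lnfact_err ((k - 1) * a) - lnfact_err (k * a) - lnfact_err s - 2 * lnfact_err (a - s) - lnfact_err ((k - 2) * a + s)
      + lnfact_err (d * (a - s)) + lnfact_err (d * ((k - 2) * a + s)) + lnfact_err (d * (k * a)) - lnfact_err (d * a) - 2 * lnfact_err (d * ((k - 1) * a))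
      \<le> (ln (real a) - ln (real s) - ln (real (a - s))) / 2 - ?l + 15 * t"
    unfolding rs lnd[OF ge(4)] lnd[OF pos(3)] lnd[OF pos(2)] lnd[OF ge(3)] lnd[OF pos(1)] lnk
    using n0[OF ge(1)] n0[OF s(1)] n0[OF ge(2)] n0[OF big(1)] n0[OF big(2)] n0[OF big(3)] n0[OF big(4)] n0[OF big(5)] n0[OF big(6)] n0[OF big(7)] n0[OF big(8)]
    unfolding abs_le_iff by (simp add: field_simps)
  have "ln (overlap_term a s) \<le> - real a * rate (real s / real a) + ((ln (real a) - ln (real s) - ln (real (a - s))) / 2 - ?l + 15 * t)"
    using ln_overlap_term_rate[of s a] R s ge by simp
  also have "\<dots> = ln (exp (- real a * rate (real s / real a)) * sqrt (real a / (real s * real (a - s))) * exp (15 * t) / sqrt (2 * pi))"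
    using s ge by (simp add: ln_mult ln_div ln_sqrt diff_divide_distrib add_divide_distrib)
  finally show ?thesis
    using ln_overlap_term(1)[of s a] s ge by (subst (asm) ln_le_cancel_iff) (auto intro!: mult_pos_pos divide_pos_pos)
qed

text \<open>With \<open>D = ln k - ln (k - 1) \<ge> 1 / k\<close>, the bound \<open>d < k\<close>
  follows once \<open>ln k \<le> (k - 1) ^ 2 * D\<close>, and for this
  \<open>ln k \<le> k - 2\<close> suffices.\<close>

lemma below_threshold:
  assumes "real d < d_star k"
  shows "d < k" and "(real d - 1) * ((real k - 1) * (ln (real k) - ln (real k - 1))) < ln (real k)"
proof -
  define D where "D = ln (real k) - ln (real k - 1)"
  have k: "real k \<ge> 4" using k_gt by simp
  have "1 - 1 / real k = (real k - 1) / real k" using k by (simp add: field_simps)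
  then have D: "- ln (1 - 1 / real k) = D" using k by (simp add: D_def ln_div)
  have "ln (1 - 1 / real k) \<le> (1 - 1 / real k) - 1" using k by (intro ln_le_minus_one) simp
  then have Dk: "D \<ge> 1 / real k" using D by simp
  have D0: "D > 0" using Dk k by (smt (verit) zero_less_divide_1_iff)
  have "real d - 1 < ln (real k) / ((real k - 1) * D)"
    using assms unfolding d_star_def D by simp
  then show *: "(real d - 1) * ((real k - 1) * (ln (real k) - ln (real k - 1))) < ln (real k)"
    unfolding D_def[symmetric] using D0 k by (simp add: pos_less_divide_eq)
  \<comment> \<open>The tangent bound is taken at \<open>k / 4\<close>, sharp at the smallest case
    \<open>k = 4\<close>; at \<open>k\<close> itself it would give only
    \<open>ln k \<le> k - 1\<close>, which is too weak. The \<open>4 / 9\<close> below is an upper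
    bound for \<open>2 * ln 2 - 1\<close>.\<close>
  have "ln (real k / 4) \<le> real k / 4 - 1" using k by (intro ln_le_minus_one) simp
  moreover have "ln (real k / 4) = ln (real k) - 2 * ln 2"
    using k ln_realpow[of 2 2] by (simp add: ln_div)
  ultimately have "ln (real k) \<le> real k / 4 + 4 / 9" using ln2_le_25_over_36 by simp
  also have "\<dots> \<le> real k - 2" using k by simp
  also have "\<dots> \<le> (real k - 1)\<^sup>2 * (1 / real k)" using k by (simp add: field_simps power2_eq_square)
  also have "\<dots> \<le> (real k - 1)\<^sup>2 * D" using Dk by (intro mult_left_mono) auto
  finally have "(real d - 1) * ((real k - 1) * D) < (real k - 1) * ((real k - 1) * D)"
    using * unfolding D_def[symmetric] by (simp add: power2_eq_square mult.assoc)
  then have "real d - 1 < real k - 1" using D0 k by (simp add: mult_less_cancel_right)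
  then show "d < k" by simp
qed

text \<open>The error \<open>\<eta>\<close> is split into thirds: one for the loss in the constant,
  one for the two extra terms of the Gaussian sum, and one for the overlaps away from
  \<open>1 / k\<close>, which are polynomially many and exponentially small.\<close>

lemma second_moment_limit:
  assumes dst: "real d < d_star k" and \<eta>: "\<eta> > 0"
  shows "eventually (\<lambda>a. avg a (\<lambda>\<sigma>. (X a \<sigma>)\<^sup>2) / (mean_X a)\<^sup>2 \<le> sqrt ((real k - 1) / (real k - real d)) + \<eta>) sequentially"
proof -
  define K where "K = real k"
  define D where "D = real d"
  define p where "p = 1 / K"
  define q where "q = curvature K D"
  define c0 where "c0 = sqrt ((K - 1) / (K - D))"
  have K: "K \<ge> 4" using k_gt by (simp add: K_def)
  have D1: "D \<ge> 1" using d_pos by (simp add: D_def)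
  have DK: "D < K" and dst': "(D - 1) * ((K - 1) * (ln K - ln (K - 1))) < ln K"
    using below_threshold[OF dst] by (simp_all add: K_def D_def)
  have K3: "K \<ge> 3" using K by simp
  note ctx = K3 D1 DK dst'
  have p: "0 < p" "p < 1" using K by (simp_all add: p_def)
  have q: "q > 0" using K DK by (simp add: q_def curvature_def[OF ctx])
  have pq: "p * (1 - p) * q = (K - D) / (K - 1)"
  proof -
    have "1 - p = (K - 1) / K" using K by (simp add: p_def field_simps)
    moreover have "1 / K * (m / K) * (K\<^sup>2 * e / m\<^sup>2) = e / m" if "m \<noteq> 0" for m e
      using that K by (simp add: field_simps power2_eq_square)
    ultimately show ?thesis using K by (simp add: p_def q_def curvature_def[OF ctx])
  qed
  \<comment> \<open>So the constant is the ratio of the width \<open>sqrt (a / q)\<close> of the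
    overlap, given by the curvature, to the binomial width \<open>sqrt (a * p * (1 - p))\<close>
    that appears in the prefactor.\<close>
  have c0: "c0 = sqrt (1 / (p * (1 - p) * q))" unfolding pq c0_def by simp
  \<comment> \<open>One parameter \<open>t\<close> pays for everything: \<open>exp (15 * t)\<close>
    for Stirling's formula, and two factors \<open>1 / sqrt (1 - t)\<close>, one for the reduced
    curvature and one for the variation of the prefactor.\<close>
  have "((\<lambda>t. exp (15 * t) / (1 - t) * c0) \<longlongrightarrow> exp (15 * 0) / (1 - 0) * c0) (at_right 0)"
    by (intro tendsto_intros) auto
  then have "eventually (\<lambda>t. exp (15 * t) / (1 - t) * c0 < c0 + \<eta> / 3) (at_right 0)"
    using \<eta> by (intro order_tendstoD) auto
  moreover have "eventually (\<lambda>t::real. t \<in> {0<..<1}) (at_right 0)" by (intro eventually_at_right_real) simp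
  ultimately have "eventually (\<lambda>t. exp (15 * t) / (1 - t) * c0 < c0 + \<eta> / 3 \<and> t \<in> {0<..<1}) (at_right 0)"
    by eventually_elim simp
  then obtain t where t: "exp (15 * t) / (1 - t) * c0 < c0 + \<eta> / 3" "0 < t" "t < 1"
    using eventually_happens[of _ "at_right (0::real)"] by fastforce
  obtain e1 where e1: "e1 > 0" "e1 < p" "e1 < 1 - p"
      "\<And>x. \<bar>x - p\<bar> < e1 \<Longrightarrow> overlap_rate K D x \<ge> (1 - t) * q * (x - p)\<^sup>2 / 2"
    using G_quadratic[OF ctx, of "1 - t"] t(2) unfolding p_def q_def by auto
  have "((\<lambda>x. x * (1 - x)) \<longlongrightarrow> p * (1 - p)) (at p)" by (intro tendsto_intros)
  moreover have "(1 - t) * (p * (1 - p)) < p * (1 - p)" using p t by simp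
  ultimately have "eventually (\<lambda>x. x * (1 - x) > (1 - t) * (p * (1 - p))) (at p)" by (rule order_tendstoD)
  then obtain e2 where e2: "e2 > 0" "\<And>x. x \<noteq> p \<Longrightarrow> \<bar>x - p\<bar> < e2 \<Longrightarrow> x * (1 - x) > (1 - t) * (p * (1 - p))"
    unfolding eventually_at by (auto simp: dist_real_def)
  define e where "e = min e1 e2"
  have e: "e > 0" "e \<le> e1" "e < p" "e < 1 - p" using e1 e2 by (auto simp: e_def)
  have e3: "x * (1 - x) \<ge> (1 - t) * (p * (1 - p))" if "\<bar>x - p\<bar> < e" for x
    using e2(2)[of x] that \<open>(1 - t) * (p * (1 - p)) < p * (1 - p)\<close> by (cases "x = p") (auto simp: e_def)
  obtain g where g: "g > 0" "\<And>x. 0 \<le> x \<Longrightarrow> x \<le> 1 \<Longrightarrow> \<bar>x - p\<bar> \<ge> e \<Longrightarrow> overlap_rate K D x \<ge> g"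
    using G_bounded_below[OF ctx e(1)] unfolding p_def by blast
  obtain B where B: "\<And>a s. s \<le> a \<Longrightarrow> a > 0 \<Longrightarrow>
    overlap_term a s \<le> exp (- real a * overlap_rate K D (real s / real a) + 15 * (ln (real (d * k) * real a + 1) + B))"
    using overlap_term_le_far unfolding K_def D_def by blast
  have "eventually (\<lambda>n. \<bar>stirling_defect n - ln (2 * pi) / 2\<bar> < t) sequentially"
    using tendstoD[OF stirling_defect_limit t(2)] by (simp add: dist_real_def)
  then obtain n0 where n0: "\<And>n. n \<ge> n0 \<Longrightarrow> \<bar>stirling_defect n - ln (2 * pi) / 2\<bar> \<le> t"
    unfolding eventually_sequentially by force
  define C where "C = real (d * k)"
  have C: "C > 0" using d_pos k_gt by (simp add: C_def)
  let ?far = "\<lambda>a::nat. (real a + 1) * exp (- real a * g + 15 * (ln (C * real a + 1) + B))"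
  \<comment> \<open>The share of the additive 2 in \<open>sum_gaussian_le\<close>; it decays like
    \<open>1 / sqrt a\<close>.\<close>
  let ?near = "\<lambda>a::nat. exp (15 * t) / sqrt (2 * pi) * sqrt (1 / (real a * ((1 - t) * (p * (1 - p))))) * 2"
  have "?far \<longlonglongrightarrow> 0" using g(1) C by real_asymp
  then have ev1: "eventually (\<lambda>a. ?far a < \<eta> / 3) sequentially" using \<eta> by (intro order_tendstoD) auto
  have "(\<lambda>a. exp (15 * t) / sqrt (2 * pi) * sqrt (1 / (real a * c)) * 2) \<longlonglongrightarrow> 0" if "c > 0" for c
    using that by real_asymp
  moreover have "(1 - t) * (p * (1 - p)) > 0" using t p by simp
  ultimately have "?near \<longlonglongrightarrow> 0" by blast
  then have ev2: "eventually (\<lambda>a. ?near a < \<eta> / 3) sequentially" by (rule order_tendstoD) (use \<eta> in simp)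
  have "filterlim (\<lambda>a. (p - e) * real a) at_top sequentially"
    by (rule filterlim_tendsto_pos_mult_at_top[OF tendsto_const _ filterlim_real_sequentially]) (use e in simp)
  then have ev3: "eventually (\<lambda>a. (p - e) * real a > real n0 + 1) sequentially" by (simp add: filterlim_at_top_dense)
  have "filterlim (\<lambda>a. (1 - p - e) * real a) at_top sequentially"
    by (rule filterlim_tendsto_pos_mult_at_top[OF tendsto_const _ filterlim_real_sequentially]) (use e in simp)
  then have ev4: "eventually (\<lambda>a. (1 - p - e) * real a > real n0 + 1) sequentially" by (simp add: filterlim_at_top_dense)
  from ev1 ev2 ev3 ev4 eventually_gt_at_top[of 0] show ?thesis
  proof eventually_elim
    case (elim a)
    have a: "real a > 0" using elim by simp
    let ?N = "{s \<in> {..a}. \<bar>real s / real a - p\<bar> < e}" and ?F = "{s \<in> {..a}. \<not> \<bar>real s / real a - p\<bar> < e}"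
    have "(\<Sum>s\<in>?F. overlap_term a s) \<le> (\<Sum>s\<in>?F. exp (- real a * g + 15 * (ln (C * real a + 1) + B)))"
    proof (rule sum_mono)
      fix s assume s: "s \<in> ?F"
      then have "overlap_rate K D (real s / real a) \<ge> g" using a by (intro g(2)) auto
      then have "- real a * overlap_rate K D (real s / real a) \<le> - real a * g" using a by simp
      then show "overlap_term a s \<le> exp (- real a * g + 15 * (ln (C * real a + 1) + B))"
        using B[of s a] s elim unfolding C_def by (intro order_trans[OF B]) auto
    qed
    also have "\<dots> = real (card ?F) * exp (- real a * g + 15 * (ln (C * real a + 1) + B))" by simp
    also have "\<dots> \<le> ?far a"
    proof (rule mult_right_mono)
      have "card ?F \<le> card {..a}" by (intro card_mono) auto
      then show "real (card ?F) \<le> real a + 1" by simp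
    qed simp
    finally have far: "(\<Sum>s\<in>?F. overlap_term a s) < \<eta> / 3" using elim by linarith
    \<comment> \<open>The standard deviation that belongs to the reduced curvature
      \<open>(1 - t) * q\<close> after rescaling from \<open>s / a\<close> to
      \<open>s\<close>.\<close>
    define \<sigma> where "\<sigma> = sqrt (real a / ((1 - t) * q))"
    have \<sigma>2: "\<sigma>\<^sup>2 = real a / ((1 - t) * q)" using a t q by (simp add: \<sigma>_def)
    have \<sigma>: "\<sigma> > 0" using a t q by (simp add: \<sigma>_def)
    let ?P = "exp (15 * t) / sqrt (2 * pi) * sqrt (1 / (real a * ((1 - t) * (p * (1 - p)))))"
    have "(\<Sum>s\<in>?N. overlap_term a s) \<le> (\<Sum>s\<in>?N. ?P * exp (- (real s - p * real a)\<^sup>2 / (2 * \<sigma>\<^sup>2)))"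
    proof (rule sum_mono)
      fix s assume s: "s \<in> ?N"
      let ?x = "real s / real a"
      have x: "\<bar>?x - p\<bar> < e" using s by simp
      have sx: "real s = ?x * real a" using a by simp
      have "(p - e) * real a \<le> ?x * real a" using x a by (intro mult_right_mono) auto
      then have s1: "real s > real n0 + 1" using elim sx by linarith
      have "(1 - p - e) * real a \<le> (1 - ?x) * real a" using x a by (intro mult_right_mono) auto
      then have s2: "real a - real s > real n0 + 1" using elim sx by (simp add: algebra_simps)
      have "real n0 < real s" "real s + real n0 < real a" using s1 s2 by linarith+
      then have sn: "n0 \<le> s" "0 < s" "s + n0 \<le> a" "s < a" by linarith+
      have "overlap_term a s \<le> exp (- real a * overlap_rate K D ?x) * sqrt (real a / (real s * real (a - s))) * exp (15 * t) / sqrt (2 * pi)"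
        using overlap_term_le_near[OF n0 sn] by (simp add: K_def D_def)
      also have "\<dots> \<le> exp (- (real s - p * real a)\<^sup>2 / (2 * \<sigma>\<^sup>2)) * sqrt (1 / (real a * ((1 - t) * (p * (1 - p))))) * exp (15 * t) / sqrt (2 * pi)"
      proof (intro divide_right_mono mult_right_mono mult_mono)
        have "- real a * overlap_rate K D ?x \<le> - real a * ((1 - t) * q * (?x - p)\<^sup>2 / 2)"
          using e1(4)[of ?x] x e(2) a by simp
        also have "\<dots> = - (real s - p * real a)\<^sup>2 / (2 * \<sigma>\<^sup>2)"
          unfolding \<sigma>2 using a t q by (simp add: field_simps power2_eq_square)
        finally show "exp (- real a * overlap_rate K D ?x) \<le> exp (- (real s - p * real a)\<^sup>2 / (2 * \<sigma>\<^sup>2))" by simp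
        have "real s * real (a - s) = (real a)\<^sup>2 * (?x * (1 - ?x))" using sn a by (simp add: field_simps power2_eq_square of_nat_diff)
        then have "real a / (real s * real (a - s)) = real a / ((real a)\<^sup>2 * (?x * (1 - ?x)))" by (simp only:)
        also have "\<dots> = 1 / (real a * (?x * (1 - ?x)))" using a by (simp only: power2_eq_square mult.assoc) simp
        also have "\<dots> \<le> 1 / (real a * ((1 - t) * (p * (1 - p))))"
          using e3[OF x] a t p by (intro divide_left_mono mult_left_mono mult_pos_pos) (auto simp: sn)
        finally show "sqrt (real a / (real s * real (a - s))) \<le> sqrt (1 / (real a * ((1 - t) * (p * (1 - p)))))" by simp
      qed auto
      finally show "overlap_term a s \<le> ?P * exp (- (real s - p * real a)\<^sup>2 / (2 * \<sigma>\<^sup>2))" by (simp add: mult_ac)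
    qed
    also have "\<dots> = ?P * (\<Sum>s\<in>?N. exp (- (real s - p * real a)\<^sup>2 / (2 * \<sigma>\<^sup>2)))" by (rule sum_distrib_left[symmetric])
    also have "\<dots> \<le> ?P * (sqrt (2 * pi * \<sigma>\<^sup>2) + 2)"
      using p t a by (intro mult_left_mono sum_gaussian_le \<sigma>) auto
    also have "\<dots> = ?P * sqrt (2 * pi * \<sigma>\<^sup>2) + ?near a" by (rule distrib_left)
    also have "?P * sqrt (2 * pi * \<sigma>\<^sup>2) = exp (15 * t) / (1 - t) * c0"
    proof -
      have "sqrt (1 / (real a * ((1 - t) * (p * (1 - p))))) * sqrt (2 * pi * \<sigma>\<^sup>2) = sqrt (1 / (real a * ((1 - t) * (p * (1 - p)))) * (2 * pi * \<sigma>\<^sup>2))"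
        by (simp only: real_sqrt_mult)
      also have "1 / (real a * ((1 - t) * (p * (1 - p)))) * (2 * pi * \<sigma>\<^sup>2) = 2 * pi * ((1 / (1 - t))\<^sup>2 * (1 / (p * (1 - p) * q)))"
      proof -
        have "1 / (A * (u * P)) * (2 * pi * (A / (u * Q))) = 2 * pi * ((1 / u)\<^sup>2 * (1 / (P * Q)))"
          if "A \<noteq> 0" "u \<noteq> 0" "P \<noteq> 0" "Q \<noteq> 0" for A u P Q :: real
          using that by (simp add: field_simps power2_eq_square)
        from this[of "real a" "1 - t" "p * (1 - p)" q] show ?thesis unfolding \<sigma>2 using a t p q by simp
      qed
      also have "sqrt \<dots> = sqrt (2 * pi) * (1 / (1 - t) * c0)"
        unfolding c0 using t by (simp only: real_sqrt_mult real_sqrt_abs) simp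
      finally have h: "sqrt (1 / (real a * ((1 - t) * (p * (1 - p))))) * sqrt (2 * pi * \<sigma>\<^sup>2) = sqrt (2 * pi) * (1 / (1 - t) * c0)" .
      show ?thesis unfolding mult.assoc[of "exp (15 * t) / sqrt (2 * pi)"] h by simp
    qed
    finally have near: "(\<Sum>s\<in>?N. overlap_term a s) < c0 + 2 * \<eta> / 3" using elim t(1) by linarith
    have "(\<Sum>s\<le>a. overlap_term a s) = (\<Sum>s\<in>?N \<union> ?F. overlap_term a s)" by (intro sum.cong) auto
    also have "\<dots> = (\<Sum>s\<in>?N. overlap_term a s) + (\<Sum>s\<in>?F. overlap_term a s)" by (intro sum.union_disjoint) auto
    finally show ?case
      unfolding second_moment_ratio using near far by (simp add: c0_def K_def D_def)
  qed
qed

end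

section \<open>Sums over conflict-free families\<close>

lemma sum_UN_le:
  fixes f :: "'a \<Rightarrow> real"
  assumes "finite I" "\<And>i. i \<in> I \<Longrightarrow> finite (A i)" "\<And>x. f x \<ge> 0"
  shows "sum f (\<Union>i\<in>I. A i) \<le> (\<Sum>i\<in>I. sum f (A i))"
  using assms(1,2)
proof (induction I rule: finite_induct)
  case (insert i I)
  have "sum f (\<Union>i\<in>insert i I. A i) = sum f (A i \<union> ((\<Union>i\<in>I. A i) - A i))" by (intro sum.cong) auto
  also have "\<dots> = sum f (A i) + sum f ((\<Union>i\<in>I. A i) - A i)"
    using insert by (intro sum.union_disjoint) auto
  also have "\<dots> \<le> sum f (A i) + sum f (\<Union>i\<in>I. A i)"
    using insert assms(3) by (intro add_left_mono sum_mono2) auto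
  also have "\<dots> \<le> sum f (A i) + (\<Sum>i\<in>I. sum f (A i))" using insert by simp
  finally show ?case using insert by simp
qed simp

definition indep_fams :: "'c set \<Rightarrow> ('c \<Rightarrow> 'c \<Rightarrow> bool) \<Rightarrow> nat \<Rightarrow> 'c set set" where
  "indep_fams \<Gamma> meets j = {B. B \<subseteq> \<Gamma> \<and> card B = j \<and> (\<forall>\<gamma>\<in>B. \<forall>\<gamma>'\<in>B. \<gamma> \<noteq> \<gamma>' \<longrightarrow> \<not> meets \<gamma> \<gamma>')}"

text \<open>The elementary symmetric polynomial of degree \<open>j\<close> in the weights,
  restricted to conflict-free families.\<close>

definition fam_sum :: "'c set \<Rightarrow> ('c \<Rightarrow> 'c \<Rightarrow> bool) \<Rightarrow> ('c \<Rightarrow> real) \<Rightarrow> nat \<Rightarrow> real" where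
  "fam_sum \<Gamma> meets z j = (\<Sum>B\<in>indep_fams \<Gamma> meets j. \<Prod>\<gamma>\<in>B. z \<gamma>)"

lemma finite_indep_fams [simp]: "finite \<Gamma> \<Longrightarrow> finite (indep_fams \<Gamma> meets j)"
  by (rule finite_subset[of _ "Pow \<Gamma>"]) (auto simp: indep_fams_def)

lemma indep_fams_finite: "finite \<Gamma> \<Longrightarrow> B \<in> indep_fams \<Gamma> meets j \<Longrightarrow> finite B"
  by (auto simp: indep_fams_def intro: finite_subset)

lemma indep_fams_0: "finite \<Gamma> \<Longrightarrow> indep_fams \<Gamma> meets 0 = {{}}"
  by (auto simp: indep_fams_def dest: finite_subset)

text \<open>Marking one member counts a family of size \<open>j + 1\<close> exactly
  \<open>j + 1\<close> times. Removing the marked member leaves a family of size \<open>j\<close>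
  together with a further element that neither belongs to it nor conflicts with it; the subtracted
  sum corrects for the forbidden elements.\<close>

lemma fam_sum_Suc:
  assumes fin: "finite \<Gamma>" and sym: "\<And>\<gamma> \<gamma>'. meets \<gamma> \<gamma>' \<Longrightarrow> meets \<gamma>' \<gamma>"
  shows "real (Suc j) * fam_sum \<Gamma> meets z (Suc j) = fam_sum \<Gamma> meets z j * (\<Sum>\<gamma>\<in>\<Gamma>. z \<gamma>)
     - (\<Sum>B\<in>indep_fams \<Gamma> meets j. (\<Prod>\<gamma>\<in>B. z \<gamma>) * (\<Sum>\<gamma>\<in>{\<gamma>\<in>\<Gamma>. \<gamma> \<in> B \<or> (\<exists>\<gamma>'\<in>B. meets \<gamma>' \<gamma>)}. z \<gamma>))"
proof -
  let ?D = "indep_fams \<Gamma> meets"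
  let ?bad = "\<lambda>B. {\<gamma>\<in>\<Gamma>. \<gamma> \<in> B \<or> (\<exists>\<gamma>'\<in>B. meets \<gamma>' \<gamma>)}"
  have "real (Suc j) * fam_sum \<Gamma> meets z (Suc j) = (\<Sum>B\<in>?D (Suc j). \<Sum>\<gamma>\<in>B. \<Prod>\<gamma>\<in>B. z \<gamma>)"
    unfolding fam_sum_def sum_distrib_left
    by (intro sum.cong refl) (auto simp: indep_fams_def)
  also have "\<dots> = (\<Sum>(B, \<gamma>)\<in>Sigma (?D (Suc j)) (\<lambda>B. B). \<Prod>\<gamma>\<in>B. z \<gamma>)"
    using fin indep_fams_finite[OF fin] by (intro sum.Sigma) auto
  also have "\<dots> = (\<Sum>(B, \<gamma>)\<in>Sigma (?D j) (\<lambda>B. \<Gamma> - ?bad B). z \<gamma> * (\<Prod>\<gamma>\<in>B. z \<gamma>))"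
  proof (rule sum.reindex_bij_witness[where i = "\<lambda>(B, \<gamma>). (insert \<gamma> B, \<gamma>)" and j = "\<lambda>(B, \<gamma>). (B - {\<gamma>}, \<gamma>)"])
    fix x assume x: "x \<in> Sigma (?D (Suc j)) (\<lambda>B. B)"
    obtain B \<gamma> where [simp]: "x = (B, \<gamma>)" and B: "B \<in> ?D (Suc j)" and g: "\<gamma> \<in> B" using x by (cases x) auto
    have fB: "finite B" using indep_fams_finite[OF fin B] .
    show "(case case x of (B, \<gamma>) \<Rightarrow> (B - {\<gamma>}, \<gamma>) of (B, \<gamma>) \<Rightarrow> (insert \<gamma> B, \<gamma>)) = x" using g by auto
    show "(case x of (B, \<gamma>) \<Rightarrow> (B - {\<gamma>}, \<gamma>)) \<in> Sigma (?D j) (\<lambda>B. \<Gamma> - ?bad B)"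
      using B g fB by (auto simp: indep_fams_def)
    show "(case case x of (B, \<gamma>) \<Rightarrow> (B - {\<gamma>}, \<gamma>) of (B, \<gamma>) \<Rightarrow> z \<gamma> * (\<Prod>\<gamma>\<in>B. z \<gamma>)) = (case x of (B, \<gamma>) \<Rightarrow> \<Prod>\<gamma>\<in>B. z \<gamma>)"
      using prod.remove[OF fB g, of z] by simp
  next
    fix x assume x: "x \<in> Sigma (?D j) (\<lambda>B. \<Gamma> - ?bad B)"
    obtain B \<gamma> where [simp]: "x = (B, \<gamma>)" and B: "B \<in> ?D j" and g: "\<gamma> \<in> \<Gamma>" "\<gamma> \<notin> B" "\<And>\<gamma>'. \<gamma>' \<in> B \<Longrightarrow> \<not> meets \<gamma>' \<gamma>"
      using x by (cases x) auto
    have fB: "finite B" using indep_fams_finite[OF fin B] .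
    show "(case case x of (B, \<gamma>) \<Rightarrow> (insert \<gamma> B, \<gamma>) of (B, \<gamma>) \<Rightarrow> (B - {\<gamma>}, \<gamma>)) = x" using g by auto
    show "(case x of (B, \<gamma>) \<Rightarrow> (insert \<gamma> B, \<gamma>)) \<in> Sigma (?D (Suc j)) (\<lambda>B. B)"
      using B g fB sym by (auto simp: indep_fams_def)
  qed
  also have "\<dots> = (\<Sum>B\<in>?D j. \<Sum>\<gamma>\<in>\<Gamma> - ?bad B. z \<gamma> * (\<Prod>\<gamma>\<in>B. z \<gamma>))"
    using fin by (intro sum.Sigma[symmetric]) auto
  also have "\<dots> = (\<Sum>B\<in>?D j. (\<Prod>\<gamma>\<in>B. z \<gamma>) * (\<Sum>\<gamma>\<in>\<Gamma>. z \<gamma>) - (\<Prod>\<gamma>\<in>B. z \<gamma>) * (\<Sum>\<gamma>\<in>?bad B. z \<gamma>))"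
  proof (intro sum.cong refl)
    fix B
    have "(\<Sum>\<gamma>\<in>\<Gamma> - ?bad B. z \<gamma>) = (\<Sum>\<gamma>\<in>\<Gamma>. z \<gamma>) - (\<Sum>\<gamma>\<in>?bad B. z \<gamma>)"
      using fin by (intro sum_diff) auto
    moreover have "(\<Sum>\<gamma>\<in>\<Gamma> - ?bad B. z \<gamma> * (\<Prod>\<gamma>\<in>B. z \<gamma>)) = (\<Prod>\<gamma>\<in>B. z \<gamma>) * (\<Sum>\<gamma>\<in>\<Gamma> - ?bad B. z \<gamma>)"
      by (simp only: sum_distrib_left mult.commute)
    ultimately show "(\<Sum>\<gamma>\<in>\<Gamma> - ?bad B. z \<gamma> * (\<Prod>\<gamma>\<in>B. z \<gamma>))
       = (\<Prod>\<gamma>\<in>B. z \<gamma>) * (\<Sum>\<gamma>\<in>\<Gamma>. z \<gamma>) - (\<Prod>\<gamma>\<in>B. z \<gamma>) * (\<Sum>\<gamma>\<in>?bad B. z \<gamma>)"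
      by (simp only: right_diff_distrib)
  qed
  also have "\<dots> = fam_sum \<Gamma> meets z j * (\<Sum>\<gamma>\<in>\<Gamma>. z \<gamma>) - (\<Sum>B\<in>?D j. (\<Prod>\<gamma>\<in>B. z \<gamma>) * (\<Sum>\<gamma>\<in>?bad B. z \<gamma>))"
    unfolding sum_subtractf fam_sum_def sum_distrib_right ..
  finally show ?thesis .
qed

lemma fam_sum_nonneg: "(\<And>\<gamma>. z \<gamma> \<ge> 0) \<Longrightarrow> fam_sum \<Gamma> meets z j \<ge> 0"
  unfolding fam_sum_def by (intro sum_nonneg prod_nonneg) auto

text \<open>For nonnegative weights the correction in \<open>fam_sum_Suc\<close> only lowers the sum
  and may be dropped; so may the factor \<open>Suc j\<close> on the left.\<close>

lemma fam_sum_le_power: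
  assumes fin: "finite \<Gamma>" and sym: "\<And>\<gamma> \<gamma>'. meets \<gamma> \<gamma>' \<Longrightarrow> meets \<gamma>' \<gamma>"
    and z: "\<And>\<gamma>. z \<gamma> \<ge> 0" and Z: "(\<Sum>\<gamma>\<in>\<Gamma>. z \<gamma>) \<le> Z"
  shows "fam_sum \<Gamma> meets z j \<le> Z ^ j"
proof (induction j)
  case 0
  then show ?case using fin by (simp add: fam_sum_def indep_fams_0)
next
  case (Suc j)
  have Z0: "Z \<ge> 0" using Z sum_nonneg[of \<Gamma> z] z by (meson order_trans)
  have "fam_sum \<Gamma> meets z (Suc j) \<le> real (Suc j) * fam_sum \<Gamma> meets z (Suc j)"
    using fam_sum_nonneg[of z \<Gamma> meets "Suc j"] z by (simp add: algebra_simps)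
  also have "\<dots> \<le> fam_sum \<Gamma> meets z j * (\<Sum>\<gamma>\<in>\<Gamma>. z \<gamma>)"
  proof -
    have "0 \<le> (\<Sum>B\<in>indep_fams \<Gamma> meets j. (\<Prod>\<gamma>\<in>B. z \<gamma>) * (\<Sum>\<gamma>\<in>{\<gamma>\<in>\<Gamma>. \<gamma> \<in> B \<or> (\<exists>\<gamma>'\<in>B. meets \<gamma>' \<gamma>)}. z \<gamma>))"
      using z by (intro sum_nonneg mult_nonneg_nonneg prod_nonneg) auto
    moreover have "real (Suc j) * fam_sum \<Gamma> meets z (Suc j) = fam_sum \<Gamma> meets z j * (\<Sum>\<gamma>\<in>\<Gamma>. z \<gamma>)
       - (\<Sum>B\<in>indep_fams \<Gamma> meets j. (\<Prod>\<gamma>\<in>B. z \<gamma>) * (\<Sum>\<gamma>\<in>{\<gamma>\<in>\<Gamma>. \<gamma> \<in> B \<or> (\<exists>\<gamma>'\<in>B. meets \<gamma>' \<gamma>)}. z \<gamma>))"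
      by (rule fam_sum_Suc) (use fin sym in auto)
    ultimately show ?thesis by simp
  qed
  also have "\<dots> \<le> Z ^ j * Z"
    using Suc Z z fam_sum_nonneg[of z \<Gamma> meets j] by (intro mult_mono) (auto intro!: sum_nonneg Z0)
  finally show ?case by (simp add: mult.commute)
qed

text \<open>Conflicts are asymptotically negligible, so the elementary symmetric sum over conflict-free
  families behaves like a power divided by a factorial.\<close>

lemma fam_sum_tendsto:
  fixes z :: "nat \<Rightarrow> 'c \<Rightarrow> real"
  assumes fin: "\<And>n. finite (\<Gamma> n)" and sym: "\<And>\<gamma> \<gamma>'. meets \<gamma> \<gamma>' \<Longrightarrow> meets \<gamma>' \<gamma>" and refl: "\<And>n \<gamma>. \<gamma> \<in> \<Gamma> n \<Longrightarrow> meets \<gamma> \<gamma>"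
    and lim: "(\<lambda>n. \<Sum>\<gamma>\<in>\<Gamma> n. z n \<gamma>) \<longlonglongrightarrow> s"
    and Z: "\<And>n. (\<Sum>\<gamma>\<in>\<Gamma> n. \<bar>z n \<gamma>\<bar>) \<le> Z"
    and \<kappa>: "\<And>n \<gamma>. \<gamma> \<in> \<Gamma> n \<Longrightarrow> (\<Sum>\<gamma>'\<in>{\<gamma>'\<in>\<Gamma> n. meets \<gamma> \<gamma>'}. \<bar>z n \<gamma>'\<bar>) \<le> \<kappa> n" and \<kappa>0: "\<kappa> \<longlonglongrightarrow> 0" and \<kappa>p: "\<And>n. \<kappa> n \<ge> 0"
  shows "(\<lambda>n. fam_sum (\<Gamma> n) meets (z n) j) \<longlonglongrightarrow> s ^ j / fact j"
proof (induction j)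
  case 0
  then show ?case using fin by (simp add: fam_sum_def indep_fams_0)
next
  case (Suc j)
  let ?R = "\<lambda>n. (\<Sum>B\<in>indep_fams (\<Gamma> n) meets j. (\<Prod>\<gamma>\<in>B. z n \<gamma>) * (\<Sum>\<gamma>\<in>{\<gamma>\<in>\<Gamma> n. \<gamma> \<in> B \<or> (\<exists>\<gamma>'\<in>B. meets \<gamma>' \<gamma>)}. z n \<gamma>))"
  have R: "norm (?R n) \<le> Z ^ j * (real j * \<kappa> n)" for n
  proof -
    have "\<bar>\<Sum>\<gamma>\<in>{\<gamma>\<in>\<Gamma> n. \<gamma> \<in> B \<or> (\<exists>\<gamma>'\<in>B. meets \<gamma>' \<gamma>)}. z n \<gamma>\<bar> \<le> real j * \<kappa> n" if B: "B \<in> indep_fams (\<Gamma> n) meets j" for B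
    proof -
      have BG: "B \<subseteq> \<Gamma> n" "card B = j" "finite B" using B indep_fams_finite[OF fin B] by (auto simp: indep_fams_def)
      have "\<bar>\<Sum>\<gamma>\<in>{\<gamma>\<in>\<Gamma> n. \<gamma> \<in> B \<or> (\<exists>\<gamma>'\<in>B. meets \<gamma>' \<gamma>)}. z n \<gamma>\<bar> \<le> (\<Sum>\<gamma>\<in>{\<gamma>\<in>\<Gamma> n. \<gamma> \<in> B \<or> (\<exists>\<gamma>'\<in>B. meets \<gamma>' \<gamma>)}. \<bar>z n \<gamma>\<bar>)"
        by (rule sum_abs)
      \<comment> \<open>Since \<open>meets\<close> is reflexive, the neighbourhoods of the members
        of \<open>B\<close> also cover the members themselves.\<close>
      also have "\<dots> \<le> (\<Sum>\<gamma>\<in>(\<Union>\<gamma>'\<in>B. {\<gamma>\<in>\<Gamma> n. meets \<gamma>' \<gamma>}). \<bar>z n \<gamma>\<bar>)"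
        using fin BG refl by (intro sum_mono2) auto
      also have "\<dots> \<le> (\<Sum>\<gamma>'\<in>B. \<Sum>\<gamma>\<in>{\<gamma>\<in>\<Gamma> n. meets \<gamma>' \<gamma>}. \<bar>z n \<gamma>\<bar>)"
        using BG fin by (intro sum_UN_le) auto
      also have "\<dots> \<le> (\<Sum>\<gamma>'\<in>B. \<kappa> n)" using BG by (intro sum_mono \<kappa>) auto
      finally show ?thesis using BG by simp
    qed
    then have "norm (?R n) \<le> (\<Sum>B\<in>indep_fams (\<Gamma> n) meets j. (\<Prod>\<gamma>\<in>B. \<bar>z n \<gamma>\<bar>) * (real j * \<kappa> n))"
      unfolding real_norm_def by (intro order_trans[OF sum_abs] sum_mono) (auto simp: abs_mult abs_prod intro!: mult_left_mono prod_nonneg)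
    also have "\<dots> = fam_sum (\<Gamma> n) meets (\<lambda>\<gamma>. \<bar>z n \<gamma>\<bar>) j * (real j * \<kappa> n)"
      by (simp add: fam_sum_def sum_distrib_right)
    also have "\<dots> \<le> Z ^ j * (real j * \<kappa> n)"
      using fam_sum_le_power[OF fin sym _ Z, where j = j] \<kappa>p by (intro mult_right_mono) auto
    finally show ?thesis .
  qed
  have "(\<lambda>n. Z ^ j * (real j * \<kappa> n)) \<longlonglongrightarrow> Z ^ j * (real j * 0)" by (intro tendsto_intros \<kappa>0)
  then have "(\<lambda>n. Z ^ j * (real j * \<kappa> n)) \<longlonglongrightarrow> 0" by simp
  then have "?R \<longlonglongrightarrow> 0" by (rule Lim_null_comparison[OF always_eventually, rotated]) (use R in blast)
  then have "(\<lambda>n. (fam_sum (\<Gamma> n) meets (z n) j * (\<Sum>\<gamma>\<in>\<Gamma> n. z n \<gamma>) - ?R n) / real (Suc j)) \<longlonglongrightarrow> (s ^ j / fact j * s - 0) / real (Suc j)"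
    by (intro tendsto_intros Suc lim) auto
  moreover have "(fam_sum (\<Gamma> n) meets (z n) j * (\<Sum>\<gamma>\<in>\<Gamma> n. z n \<gamma>) - ?R n) / real (Suc j) = fam_sum (\<Gamma> n) meets (z n) (Suc j)" for n
  proof -
    have "real (Suc j) * fam_sum (\<Gamma> n) meets (z n) (Suc j) = fam_sum (\<Gamma> n) meets (z n) j * (\<Sum>\<gamma>\<in>\<Gamma> n. z n \<gamma>) - ?R n"
      by (rule fam_sum_Suc) (use fin sym in auto)
    then show ?thesis by (simp add: field_simps)
  qed
  ultimately have "(\<lambda>n. fam_sum (\<Gamma> n) meets (z n) (Suc j)) \<longlonglongrightarrow> (s ^ j / fact j * s - 0) / real (Suc j)"
    by (simp only:)
  moreover have "(s ^ j / fact j * s - 0) / real (Suc j) = s ^ Suc j / fact (Suc j)" by (simp add: field_simps)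
  ultimately show ?case by (simp only:)
qed

section \<open>Cycles\<close>

type_synonym edge = "(nat \<times> nat) \<times> (nat \<times> nat)"

abbreviation evar :: "edge \<Rightarrow> nat" where "evar e \<equiv> fst (fst e)"
abbreviation ecl :: "edge \<Rightarrow> nat" where "ecl e \<equiv> fst (snd e)"

text \<open>A step \<open>((v, i, j), (c, p, q))\<close> of a rooted cycle enters the variable \<open>v\<close> through its copy \<open>i\<close>,
  leaves it through \<open>j\<close>, enters the clause \<open>c\<close> through its slot \<open>p\<close> and leaves it through \<open>q\<close>.\<close>

type_synonym step = "(nat \<times> nat \<times> nat) \<times> (nat \<times> nat \<times> nat)"

definition svar :: "step \<Rightarrow> nat" where "svar r = fst (fst r)"
definition scl :: "step \<Rightarrow> nat" where "scl r = fst (snd r)"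
definition sinn :: "step \<Rightarrow> nat" where "sinn r = fst (snd (fst r))"
definition sout :: "step \<Rightarrow> nat" where "sout r = snd (snd (fst r))"
definition pin :: "step \<Rightarrow> nat" where "pin r = fst (snd (snd r))"
definition pout :: "step \<Rightarrow> nat" where "pout r = snd (snd (snd r))"

lemma step_eqI: "svar r = svar r' \<Longrightarrow> scl r = scl r' \<Longrightarrow> sinn r = sinn r' \<Longrightarrow> sout r = sout r' \<Longrightarrow> pin r = pin r' \<Longrightarrow> pout r = pout r' \<Longrightarrow> r = r'"
  by (simp add: prod_eq_iff svar_def scl_def sinn_def sout_def pin_def pout_def)

definition out_edge :: "step \<Rightarrow> edge" where "out_edge r = ((svar r, sout r), (scl r, pin r))"
text \<open>The edge by which the walk passes from the clause of \<open>r\<close> to the variable of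
  the following step \<open>r'\<close>.\<close>

definition in_edge :: "step \<Rightarrow> step \<Rightarrow> edge" where "in_edge r r' = ((svar r', sinn r'), (scl r, pout r))"

text \<open>Passing to the edge set forgets root and direction. For length 1 the two edges are
  parallel: a clause that meets two copies of the same variable is a cycle of length 2.\<close>

definition cyc_edges :: "step list \<Rightarrow> edge set" where
  "cyc_edges rs = (\<lambda>t. out_edge (rs ! t)) ` {..<length rs}
     \<union> (\<lambda>t. in_edge (rs ! t) (rs ! (Suc t mod length rs))) ` {..<length rs}"

definition edge_vars :: "edge set \<Rightarrow> nat set" where "edge_vars E = evar ` E"
definition edge_cls :: "edge set \<Rightarrow> nat set" where "edge_cls E = ecl ` E"

definition distinct_pairs :: "nat \<Rightarrow> (nat \<times> nat) set" where
  "distinct_pairs m = {(i, j). i < m \<and> j < m \<and> i \<noteq> j}"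

context regular_cover
begin

definition steps :: "nat \<Rightarrow> step set" where
  "steps a = ({..<k * a} \<times> distinct_pairs d) \<times> ({..<d * a} \<times> distinct_pairs k)"

definition rooted :: "nat \<Rightarrow> nat \<Rightarrow> step list set" where
  "rooted a l = {rs. length rs = l \<and> set rs \<subseteq> steps a \<and> distinct (map svar rs) \<and> distinct (map scl rs)}"

lemma steps_D: "r \<in> steps a \<Longrightarrow> svar r < k * a \<and> scl r < d * a \<and> sinn r < d \<and> sout r < d \<and> sinn r \<noteq> sout r \<and> pin r < k \<and> pout r < k \<and> pin r \<noteq> pout r"
  by (auto simp: steps_def svar_def scl_def sinn_def sout_def pin_def pout_def distinct_pairs_def)

lemma steps_I: "svar r < k * a \<Longrightarrow> scl r < d * a \<Longrightarrow> sinn r < d \<Longrightarrow> sout r < d \<Longrightarrow> sinn r \<noteq> sout r \<Longrightarrow> pin r < k \<Longrightarrow> pout r < k \<Longrightarrow> pin r \<noteq> pout r \<Longrightarrow> r \<in> steps a"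
  by (cases r) (auto simp: steps_def svar_def scl_def sinn_def sout_def pin_def pout_def distinct_pairs_def)

lemma finite_steps: "finite (steps a)"
proof -
  have "distinct_pairs m \<subseteq> {..<m} \<times> {..<m}" for m by (auto simp: distinct_pairs_def)
  then have "finite (distinct_pairs m)" for m by (rule finite_subset) simp
  then show ?thesis by (simp add: steps_def)
qed

lemma finite_rooted: "finite (rooted a l)"
  by (rule finite_subset[OF _ finite_lists_length_eq[OF finite_steps, of a l]]) (auto simp: rooted_def)

lemma Suc_mod_bij:
  assumes "0 < l"
  shows "bij_betw (\<lambda>t. Suc t mod l) {..<l} {..<l}"
proof -
  have inj: "inj_on (\<lambda>t. Suc t mod l) {..<l}"
  proof (rule inj_onI)
    fix s t assume st: "s \<in> {..<l}" "t \<in> {..<l}" "Suc s mod l = Suc t mod l"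
    have m: "Suc u mod l = (if Suc u = l then 0 else Suc u)" if "u < l" for u using that by auto
    show "s = t" using st m[of s] m[of t] by (auto split: if_splits)
  qed
  have "(\<lambda>t. Suc t mod l) ` {..<l} \<subseteq> {..<l}" using assms by auto
  then have "(\<lambda>t. Suc t mod l) ` {..<l} = {..<l}" by (rule endo_inj_surj[OF finite_lessThan _ inj])
  then show ?thesis using inj by (intro bij_betw_imageI)
qed

context
  fixes a l :: nat and rs :: "step list"
  assumes l: "0 < l" and rs: "rs \<in> rooted a l"
begin

abbreviation "oe t \<equiv> out_edge (rs ! t)"
abbreviation "ie t \<equiv> in_edge (rs ! t) (rs ! (Suc t mod l))"

lemma len: "length rs = l" using rs by (simp add: rooted_def)

lemma nth_steps: "t < l \<Longrightarrow> rs ! t \<in> steps a"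
  using rs by (auto simp: rooted_def)

lemma svar_inj: "s < l \<Longrightarrow> t < l \<Longrightarrow> svar (rs ! s) = svar (rs ! t) \<longleftrightarrow> s = t"
  using rs nth_eq_iff_index_eq[of "map svar rs" s t] by (simp add: rooted_def)

lemma scl_inj: "s < l \<Longrightarrow> t < l \<Longrightarrow> scl (rs ! s) = scl (rs ! t) \<longleftrightarrow> s = t"
  using rs nth_eq_iff_index_eq[of "map scl rs" s t] by (simp add: rooted_def)

lemma Sm: "Suc t mod l < l" using l by simp

lemma Sm_inj: "s < l \<Longrightarrow> t < l \<Longrightarrow> Suc s mod l = Suc t mod l \<longleftrightarrow> s = t"
  by (rule inj_on_eq_iff[OF bij_betw_imp_inj_on[OF Suc_mod_bij[OF l]]]) auto

lemma Sm_surj: "t < l \<Longrightarrow> \<exists>s<l. Suc s mod l = t"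
proof -
  assume "t < l"
  then have "t \<in> (\<lambda>t. Suc t mod l) ` {..<l}" using bij_betw_imp_surj_on[OF Suc_mod_bij[OF l]] by simp
  then obtain s where "t = Suc s mod l" "s \<in> {..<l}" by (rule imageE)
  then show ?thesis by (intro exI[of _ s]) simp
qed

lemma cyc_edges_eq: "cyc_edges rs = oe ` {..<l} \<union> ie ` {..<l}"
  by (simp add: cyc_edges_def len)

lemma cyc_edges_cases:
  assumes "e \<in> cyc_edges rs"
  obtains t where "t < l" "e = oe t" | t where "t < l" "e = ie t"
  using assms unfolding cyc_edges_eq by auto

lemma oe_mem: "t < l \<Longrightarrow> oe t \<in> cyc_edges rs" and ie_mem: "t < l \<Longrightarrow> ie t \<in> cyc_edges rs"
  by (auto simp: cyc_edges_eq)

lemma oe_inj: "s < l \<Longrightarrow> t < l \<Longrightarrow> oe s = oe t \<longleftrightarrow> s = t"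
  by (auto simp: out_edge_def svar_inj)

lemma ie_inj: "s < l \<Longrightarrow> t < l \<Longrightarrow> ie s = ie t \<longleftrightarrow> s = t"
  by (auto simp: in_edge_def scl_inj)

lemma oe_ne_ie: "s < l \<Longrightarrow> t < l \<Longrightarrow> oe s \<noteq> ie t"
  using steps_D[OF nth_steps[of s]] by (auto simp: in_edge_def out_edge_def scl_inj)

lemma cyc_snd_inj: "inj_on snd (cyc_edges rs)"
proof (rule inj_onI)
  fix e e' assume e: "e \<in> cyc_edges rs" "e' \<in> cyc_edges rs" "snd e = snd e'"
  show "e = e'"
    using e(1)
  proof (cases rule: cyc_edges_cases)
    case (1 t)
    show ?thesis using e(2)
      by (cases rule: cyc_edges_cases) (use 1 e(3) steps_D[OF nth_steps[of t]] in \<open>auto simp: in_edge_def out_edge_def scl_inj\<close>)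
  next
    case (2 t)
    show ?thesis using e(2)
      by (cases rule: cyc_edges_cases) (use 2 e(3) steps_D[OF nth_steps[of t]] in \<open>auto simp: in_edge_def out_edge_def scl_inj\<close>)
  qed
qed

lemma cyc_fst_inj: "inj_on fst (cyc_edges rs)"
proof (rule inj_onI)
  fix e e' assume e: "e \<in> cyc_edges rs" "e' \<in> cyc_edges rs" "fst e = fst e'"
  show "e = e'"
    using e(1)
  proof (cases rule: cyc_edges_cases)
    case (1 t)
    show ?thesis using e(2)
      by (cases rule: cyc_edges_cases) (use 1 e(3) steps_D[OF nth_steps[of t]] Sm in \<open>auto simp: in_edge_def out_edge_def svar_inj\<close>)
  next
    case (2 t)
    show ?thesis using e(2)
      by (cases rule: cyc_edges_cases) (use 2 e(3) steps_D[OF nth_steps[OF Sm, of t]] Sm in \<open>auto simp: in_edge_def out_edge_def svar_inj Sm_inj\<close>)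
  qed
qed

lemma cyc_edges_subset: "cyc_edges rs \<subseteq> V a \<times> C a"
proof
  fix e assume "e \<in> cyc_edges rs"
  then show "e \<in> V a \<times> C a"
    by (cases rule: cyc_edges_cases)
      (use steps_D[OF nth_steps] steps_D[OF nth_steps[OF Sm]] in \<open>auto simp: in_edge_def out_edge_def var_copies_def clause_copies_def\<close>)
qed

lemma card_cyc_edges: "card (cyc_edges rs) = 2 * l"
proof -
  have "card (cyc_edges rs) = card (oe ` {..<l}) + card (ie ` {..<l})"
    unfolding cyc_edges_eq
  proof (rule card_Un_disjoint)
    show "oe ` {..<l} \<inter> ie ` {..<l} = {}" using oe_ne_ie by blast
  qed auto
  also have "card (oe ` {..<l}) = l" using oe_inj by (subst card_image) (auto simp: inj_on_def)
  also have "card (ie ` {..<l}) = l" using ie_inj by (subst card_image) (auto simp: inj_on_def)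
  finally show ?thesis by simp
qed

lemma edges_at_clause: "t < l \<Longrightarrow> {e \<in> cyc_edges rs. ecl e = scl (rs ! t)} = {oe t, ie t}"
  by (auto simp: oe_mem ie_mem elim!: cyc_edges_cases) (auto simp: in_edge_def out_edge_def scl_inj)

lemma edges_at_var: "t < l \<Longrightarrow> {e \<in> cyc_edges rs. evar e = svar (rs ! (Suc t mod l))} = {oe (Suc t mod l), ie t}"
  by (auto simp: oe_mem ie_mem Sm elim!: cyc_edges_cases) (auto simp: in_edge_def out_edge_def svar_inj Sm Sm_inj)

lemma edge_cls_cyc: "edge_cls (cyc_edges rs) = (\<lambda>t. scl (rs ! t)) ` {..<l}"
  unfolding edge_cls_def cyc_edges_eq image_Un image_image by (auto simp: in_edge_def out_edge_def)

lemma edge_vars_cyc: "edge_vars (cyc_edges rs) = (\<lambda>t. svar (rs ! t)) ` {..<l}"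
  unfolding edge_vars_def cyc_edges_eq image_Un image_image using Sm by (auto simp: in_edge_def out_edge_def)

lemma card_edges_at_clause: "c \<in> edge_cls (cyc_edges rs) \<Longrightarrow> card {e \<in> cyc_edges rs. ecl e = c} = 2"
  unfolding edge_cls_cyc by (auto simp: edges_at_clause oe_ne_ie)

lemma card_edges_at_var: "v \<in> edge_vars (cyc_edges rs) \<Longrightarrow> card {e \<in> cyc_edges rs. evar e = v} = 2"
proof -
  assume "v \<in> edge_vars (cyc_edges rs)"
  then obtain t where t: "t < l" "v = svar (rs ! t)" unfolding edge_vars_cyc by auto
  then obtain s where "s < l" "Suc s mod l = t" using Sm_surj by blast
  then show ?thesis using edges_at_var[of s] oe_ne_ie[of t s] t by simp
qed

text \<open>The two closure conditions are the moves through a clause and through a variable.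
  Alternating them from any edge of \<open>S\<close> runs once round the cycle.\<close>

lemma cyc_connected:
  assumes cl: "\<And>t. t < l \<Longrightarrow> oe t \<in> S \<Longrightarrow> ie t \<in> S"
    and va: "\<And>t. t < l \<Longrightarrow> ie t \<in> S \<Longrightarrow> oe (Suc t mod l) \<in> S"
    and e: "e \<in> cyc_edges rs" "e \<in> S"
  shows "cyc_edges rs \<subseteq> S"
proof -
  obtain t where t: "t < l" "oe t \<in> S"
    using e(1)
  proof (cases rule: cyc_edges_cases)
    case (1 t) then show ?thesis using that e(2) by blast
  next
    case (2 t) then show ?thesis using that[of "Suc t mod l"] va[of t] e(2) Sm by blast
  qed
  have *: "oe ((t + s) mod l) \<in> S" for s
  proof (induction s)
    case 0 then show ?case using t by simp
  next
    case (Suc s)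
    then have "ie ((t + s) mod l) \<in> S" using cl[of "(t + s) mod l"] l by simp
    then have "oe (Suc ((t + s) mod l) mod l) \<in> S" using va[of "(t + s) mod l"] l by simp
    then show ?case by (simp add: mod_Suc_eq)
  qed
  have "oe u \<in> S" if "u < l" for u
    using *[of "l - t + u"] that t(1) by simp
  then show ?thesis using cl unfolding cyc_edges_eq by auto
qed

end

text \<open>Each clause and each variable on the cycle carries exactly two of its edges, so an edge
  determines its partner there. Following partners from the first edge reproduces the whole
  walk.\<close>

lemma rooted_eqI:
  assumes l: "0 < l" and r: "rs \<in> rooted a l" "rs' \<in> rooted a l" and E: "cyc_edges rs = cyc_edges rs'"
    and 0: "out_edge (rs ! 0) = out_edge (rs' ! 0)"
  shows "rs = rs'"
proof -
  note A = l r(1) and B = l r(2)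
  have in_eq: "ie l rs t = ie l rs' t" if t: "t < l" and o: "out_edge (rs ! t) = out_edge (rs' ! t)" for t
  proof -
    have c: "scl (rs ! t) = scl (rs' ! t)" using o by (simp add: out_edge_def)
    have "{out_edge (rs ! t), ie l rs t} = {out_edge (rs' ! t), ie l rs' t}"
      using edges_at_clause[OF A t] edges_at_clause[OF B t] c E by simp
    then show ?thesis using o oe_ne_ie[OF A t t] oe_ne_ie[OF B t t] by (auto simp: doubleton_eq_iff)
  qed
  have out_eq: "out_edge (rs ! (Suc t mod l)) = out_edge (rs' ! (Suc t mod l))" if t: "t < l" and o: "ie l rs t = ie l rs' t" for t
  proof -
    have c: "svar (rs ! (Suc t mod l)) = svar (rs' ! (Suc t mod l))" using o by (simp add: in_edge_def)
    have "{out_edge (rs ! (Suc t mod l)), ie l rs t} = {out_edge (rs' ! (Suc t mod l)), ie l rs' t}"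
      using edges_at_var[OF A t] edges_at_var[OF B t] c E by simp
    then show ?thesis using o oe_ne_ie[OF A Sm[OF A] t] oe_ne_ie[OF B Sm[OF B] t] by (auto simp: doubleton_eq_iff)
  qed
  have o: "out_edge (rs ! t) = out_edge (rs' ! t)" if "t < l" for t
    using that
  proof (induction t)
    case 0 show ?case by (rule \<open>out_edge (rs ! 0) = out_edge (rs' ! 0)\<close>)
  next
    case (Suc t)
    then show ?case using out_eq[OF _ in_eq, of t] by simp
  qed
  have i: "ie l rs t = ie l rs' t" if "t < l" for t using in_eq[OF that o[OF that]] .
  show ?thesis
  proof (rule nth_equalityI)
    show "length rs = length rs'" using len[OF A] len[OF B] by simp
    fix t assume "t < length rs"
    then have t: "t < l" using len[OF A] by simp
    obtain s where s: "s < l" "Suc s mod l = t" using Sm_surj[OF A t] by blast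
    show "rs ! t = rs' ! t"
      using o[OF t] i[OF t] i[OF s(1)] s(2) by (intro step_eqI) (auto simp: out_edge_def in_edge_def)
  qed
qed

lemma rooted_rotate:
  assumes l: "0 < l" and r: "rs \<in> rooted a l" and t: "t < l"
  obtains rs' where "rs' \<in> rooted a l" "cyc_edges rs' = cyc_edges rs" "out_edge (rs' ! 0) = out_edge (rs ! t)"
proof (rule that[of "rotate t rs"])
  note A = l r
  have le: "length rs = l" by (rule len[OF A])
  show rr: "rotate t rs \<in> rooted a l" using r by (simp add: rooted_def rotate_map[symmetric])
  show "out_edge (rotate t rs ! 0) = out_edge (rs ! t)" using t le l by (simp add: nth_rotate)
  have "cyc_edges (rotate t rs) \<subseteq> cyc_edges rs"
  proof
    fix e assume "e \<in> cyc_edges (rotate t rs)"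
    then show "e \<in> cyc_edges rs"
    proof (cases rule: cyc_edges_cases[OF l rr, consumes 1])
      case (1 s)
      then show ?thesis using oe_mem[OF A, of "(t + s) mod l"] le l by (simp add: nth_rotate)
    next
      case (2 s)
      then show ?thesis using ie_mem[OF A, of "(t + s) mod l"] le l
        by (simp add: nth_rotate mod_Suc_eq mod_add_right_eq)
    qed
  qed
  moreover have "finite (cyc_edges rs)" by (simp add: cyc_edges_def)
  ultimately show "cyc_edges (rotate t rs) = cyc_edges rs"
    using card_cyc_edges[OF A] card_cyc_edges[OF l rr] by (intro card_subset_eq) auto
qed

text \<open>A step of the reversed walk: it enters the variable of \<open>r'\<close> by the copy
  through which the forward walk leaves it, and crosses the clause of \<open>r\<close>
  backwards.\<close>

definition flip :: "step \<Rightarrow> step \<Rightarrow> step" where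
  "flip r r' = ((svar r', sout r', sinn r'), (scl r, pout r, pin r))"

lemma flip_simps [simp]: "svar (flip r r') = svar r'" "sinn (flip r r') = sout r'" "sout (flip r r') = sinn r'"
  "scl (flip r r') = scl r" "pin (flip r r') = pout r" "pout (flip r r') = pin r"
  by (simp_all add: flip_def svar_def scl_def sinn_def sout_def pin_def pout_def)

lemma rooted_reverse:
  assumes l: "0 < l" and r: "rs \<in> rooted a l"
  obtains rs' where "rs' \<in> rooted a l" "cyc_edges rs' = cyc_edges rs" "out_edge (rs' ! 0) = in_edge (rs ! (l - 1)) (rs ! 0)"
proof -
  note A = l r
  have le: "length rs = l" by (rule len[OF A])
  \<comment> \<open>The backward walk starts at the variable of step 0: entry 0 combines it with the
    last clause, because \<open>Suc (l - 1) mod l = 0\<close>.\<close>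
  define g where "g s = flip (rs ! (l - 1 - s)) (rs ! (Suc (l - 1 - s) mod l))" for s
  let ?rs = "map g [0..<l]"
  have gs: "g s \<in> steps a" if "s < l" for s
    using steps_D[OF nth_steps[OF A, of "l - 1 - s"]] steps_D[OF nth_steps[OF A Sm[OF A], of "l - 1 - s"]] l
    by (intro steps_I) (auto simp: g_def)
  have rr: "?rs \<in> rooted a l"
  proof -
    have "distinct (map svar ?rs)" "distinct (map scl ?rs)"
      using svar_inj[OF A Sm[OF A] Sm[OF A]] scl_inj[OF A] Sm_inj[OF A] l
      by (auto simp: distinct_map inj_on_def g_def)
    then show ?thesis using gs by (auto simp: rooted_def)
  qed
  have ns: "?rs ! s = g s" if "s < l" for s using that by simp
  have "cyc_edges ?rs \<subseteq> cyc_edges rs"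
  proof
    fix e assume "e \<in> cyc_edges ?rs"
    then show "e \<in> cyc_edges rs"
    proof (cases rule: cyc_edges_cases[OF l rr, consumes 1])
      case (1 s)
      then have "e = in_edge (rs ! (l - 1 - s)) (rs ! (Suc (l - 1 - s) mod l))"
        using ns[of s] by (simp add: out_edge_def in_edge_def g_def)
      then show ?thesis using ie_mem[OF A, of "l - 1 - s"] l by simp
    next
      case (2 s)
      have idx: "Suc (l - 1 - (Suc s mod l)) mod l = l - 1 - s"
        using \<open>s < l\<close> by (cases "Suc s = l") auto
      have "e = out_edge (rs ! (l - 1 - s))"
        using 2 ns[of s] ns[OF Sm[OF A], of s] idx by (simp add: out_edge_def in_edge_def g_def)
      then show ?thesis using oe_mem[OF A, of "l - 1 - s"] l by simp
    qed
  qed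
  moreover have "finite (cyc_edges rs)" by (simp add: cyc_edges_def)
  ultimately have eq: "cyc_edges ?rs = cyc_edges rs"
    using card_cyc_edges[OF A] card_cyc_edges[OF l rr] by (intro card_subset_eq) auto
  show thesis
    by (rule that[OF rr eq]) (use ns[OF l] l in \<open>simp add: out_edge_def in_edge_def g_def\<close>)
qed

text \<open>By \<open>rooted_eqI\<close> a walk round a given cycle is determined by its first edge,
  and each of the \<open>2 * l\<close> edges is a first edge: outgoing ones after a rotation,
  incoming ones after a reversal.\<close>

lemma card_rooted_fiber:
  assumes l: "0 < l" and r: "rs \<in> rooted a l"
  shows "card {rs' \<in> rooted a l. cyc_edges rs' = cyc_edges rs} = 2 * l"
proof -
  note A = l r
  let ?F = "{rs' \<in> rooted a l. cyc_edges rs' = cyc_edges rs}"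
  have inj: "inj_on (\<lambda>rs'. out_edge (rs' ! 0)) ?F"
    by (rule inj_onI) (auto intro!: rooted_eqI[OF l])
  have "(\<lambda>rs'. out_edge (rs' ! 0)) ` ?F = cyc_edges rs"
  proof (intro equalityI subsetI)
    fix e assume "e \<in> (\<lambda>rs'. out_edge (rs' ! 0)) ` ?F"
    then obtain rs' where "rs' \<in> rooted a l" "cyc_edges rs' = cyc_edges rs" "e = out_edge (rs' ! 0)" by auto
    then show "e \<in> cyc_edges rs" using oe_mem[OF l _ l, of rs' a] by simp
  next
    fix e assume "e \<in> cyc_edges rs"
    then show "e \<in> (\<lambda>rs'. out_edge (rs' ! 0)) ` ?F"
    proof (cases rule: cyc_edges_cases[OF A, consumes 1])
      case (1 t)
      obtain rs' where "rs' \<in> rooted a l" "cyc_edges rs' = cyc_edges rs" "out_edge (rs' ! 0) = out_edge (rs ! t)"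
        using rooted_rotate[OF A 1(1)] .
      then show ?thesis using 1 by (auto simp: image_iff intro!: exI[of _ rs'])
    next
      case (2 t)
      \<comment> \<open>To begin with an incoming edge, rotate its variable to the front and
        reverse; the first edge is then the partner of the outgoing one at that variable.\<close>
      let ?u = "Suc t mod l"
      obtain rs1 where r1: "rs1 \<in> rooted a l" "cyc_edges rs1 = cyc_edges rs" "out_edge (rs1 ! 0) = out_edge (rs ! ?u)"
        using rooted_rotate[OF A Sm[OF A]] .
      obtain rs' where r': "rs' \<in> rooted a l" "cyc_edges rs' = cyc_edges rs1" "out_edge (rs' ! 0) = in_edge (rs1 ! (l - 1)) (rs1 ! 0)"
        using rooted_reverse[OF l r1(1)] .
      have lt: "l - 1 < l" and S0: "Suc (l - 1) mod l = 0" using l by auto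
      have v0: "svar (rs1 ! 0) = svar (rs ! ?u)" using r1(3) by (simp add: out_edge_def)
      have "{out_edge (rs1 ! 0), in_edge (rs1 ! (l - 1)) (rs1 ! 0)} = {out_edge (rs ! ?u), e}"
        using edges_at_var[OF l r1(1) lt] edges_at_var[OF A 2(1)] r1(2) v0 S0 2(2) by simp
      then have "in_edge (rs1 ! (l - 1)) (rs1 ! 0) = e"
        using r1(3) oe_ne_ie[OF A Sm[OF A] 2(1)] oe_ne_ie[OF l r1(1) l lt] S0 2(2) by (auto simp: doubleton_eq_iff)
      then show ?thesis using r' r1 by (auto simp: image_iff intro!: exI[of _ rs'])
    qed
  qed
  then have "card ?F = card (cyc_edges rs)" using card_image[OF inj] by simp
  then show ?thesis using card_cyc_edges[OF A] by simp
qed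

end

section \<open>Transfer matrices and cycle counts\<close>

fun chain :: "('s \<Rightarrow> 's \<Rightarrow> real) \<Rightarrow> 's \<Rightarrow> 's list \<Rightarrow> 's \<Rightarrow> real" where
  "chain A x [] z = A x z"
| "chain A x (y # ys) z = A x y * chain A y ys z"

lemma chain_prod: "chain A x ys z = (\<Prod>t<Suc (length ys). A ((x # ys) ! t) ((ys @ [z]) ! t))"
proof (induction ys arbitrary: x)
  case (Cons y ys)
  have "(\<Prod>t<Suc (length (y # ys)). A ((x # y # ys) ! t) (((y # ys) @ [z]) ! t))
      = A x y * (\<Prod>t<Suc (length ys). A ((y # ys) ! t) ((ys @ [z]) ! t))"
    by (subst prod.lessThan_Suc_shift) (simp del: prod.lessThan_Suc)
  then show ?case unfolding chain.simps Cons.IH by (rule sym)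
qed simp

lemma cyclic_prod_eq_chain:
  "(\<Prod>t<length (x # ys). A ((x # ys) ! t) ((x # ys) ! (Suc t mod length (x # ys)))) = chain A x ys x"
  unfolding chain_prod list.size
proof (intro prod.cong)
  fix t assume t: "t \<in> {..<Suc (length ys)}"
  have "(x # ys) ! (Suc t mod Suc (length ys)) = (ys @ [x]) ! t"
    using t by (cases "t = length ys") (auto simp: nth_append)
  then show "A ((x # ys) ! t) ((x # ys) ! (Suc t mod (length ys + Suc 0))) = A ((x # ys) ! t) ((ys @ [x]) ! t)" by simp
qed simp

definition lists_of :: "'s set \<Rightarrow> nat \<Rightarrow> 's list set" where
  "lists_of W n = {ys. set ys \<subseteq> W \<and> length ys = n}"

lemma lists_of_0: "lists_of W 0 = {[]}" by (auto simp: lists_of_def)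

lemma lists_of_Suc: "lists_of W (Suc n) = (\<lambda>(y, ys). y # ys) ` (W \<times> lists_of W n)"
  by (auto simp: lists_of_def length_Suc_conv image_iff)

lemma Cons_image_iff: "y # ys \<in> (\<lambda>(y, ys). y # ys) ` (A \<times> B) \<longleftrightarrow> y \<in> A \<and> ys \<in> B"
  by (auto simp: image_iff)

lemma finite_lists_of [simp]: "finite W \<Longrightarrow> finite (lists_of W n)"
  unfolding lists_of_def by (rule finite_lists_length_eq)

lemma card_lists_of: "finite W \<Longrightarrow> card (lists_of W n) = card W ^ n"
  unfolding lists_of_def by (rule card_lists_length_eq)

lemma sum_lists_of_Suc: "(\<Sum>ys\<in>lists_of W (Suc n). f ys) = (\<Sum>y\<in>W. \<Sum>ys\<in>lists_of W n. f (y # ys))"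
  unfolding lists_of_Suc by (subst sum.reindex) (auto simp: inj_on_def sum.cartesian_product case_prod_beta)

lemma card_lists_hitting:
  assumes "finite W" "W' \<subseteq> W"
  shows "card {ys \<in> lists_of W n. \<exists>y\<in>set ys. y \<in> W'} \<le> n * card W' * card W ^ (n - 1)"
proof (induction n)
  case 0 then show ?case by (simp add: lists_of_0)
next
  case (Suc n)
  let ?H = "\<lambda>n. {ys \<in> lists_of W n. \<exists>y\<in>set ys. y \<in> W'}"
  have fin: "finite W'" using assms finite_subset by blast
  have "?H (Suc n) \<subseteq> (\<lambda>(y, ys). y # ys) ` (W' \<times> lists_of W n) \<union> (\<lambda>(y, ys). y # ys) ` (W \<times> ?H n)"
    unfolding lists_of_Suc by (auto simp: Cons_image_iff)
  then have "card (?H (Suc n)) \<le> card ((\<lambda>(y, ys). y # ys) ` (W' \<times> lists_of W n) \<union> (\<lambda>(y, ys). y # ys) ` (W \<times> ?H n))"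
    using assms fin by (intro card_mono) auto
  also have "\<dots> \<le> card ((\<lambda>(y, ys). y # ys) ` (W' \<times> lists_of W n)) + card ((\<lambda>(y, ys). y # ys) ` (W \<times> ?H n))"
    by (rule card_Un_le)
  also have "\<dots> \<le> card (W' \<times> lists_of W n) + card (W \<times> ?H n)"
    using assms fin by (intro add_mono card_image_le) auto
  also have "\<dots> \<le> card W' * card W ^ n + card W * (n * card W' * card W ^ (n - 1))"
    using Suc assms by (simp add: card_cartesian_product card_lists_of)
  also have "\<dots> = Suc n * card W' * card W ^ (Suc n - 1)"
    by (cases n) (simp_all add: algebra_simps)
  finally show ?case .
qed

text \<open>A repetition confines one element to the \<open>f\<close>-fibre of one of at most
  \<open>n\<close> others. This replaces a factor \<open>card W\<close> by \<open>n * m\<close>, and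
  the second factor \<open>n\<close> is for the position.\<close>

lemma card_lists_nondistinct:
  assumes "finite W" and m: "\<And>b. card {y \<in> W. f y = b} \<le> m"
  shows "card {ys \<in> lists_of W n. \<not> distinct (map f ys)} \<le> n ^ 2 * m * card W ^ (n - 1)"
proof (induction n)
  case 0 then show ?case by (simp add: lists_of_0)
next
  case (Suc n)
  let ?H = "\<lambda>n. {ys \<in> lists_of W n. \<not> distinct (map f ys)}"
  let ?S = "SIGMA ys : lists_of W n. {y \<in> W. f y \<in> f ` set ys}"
  have "?H (Suc n) \<subseteq> (\<lambda>(y, ys). y # ys) ` (W \<times> ?H n) \<union> (\<lambda>(ys, y). y # ys) ` ?S"
    unfolding lists_of_Suc by (auto simp: image_iff)
  then have "card (?H (Suc n)) \<le> card ((\<lambda>(y, ys). y # ys) ` (W \<times> ?H n) \<union> (\<lambda>(ys, y). y # ys) ` ?S)"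
    using assms by (intro card_mono) auto
  also have "\<dots> \<le> card ((\<lambda>(y, ys). y # ys) ` (W \<times> ?H n)) + card ((\<lambda>(ys, y). y # ys) ` ?S)"
    by (rule card_Un_le)
  also have "\<dots> \<le> card (W \<times> ?H n) + card ?S"
    using assms by (intro add_mono card_image_le) auto
  also have "card ?S = (\<Sum>ys\<in>lists_of W n. card {y \<in> W. f y \<in> f ` set ys})"
    using assms by (intro card_SigmaI) auto
  also have "\<dots> \<le> (\<Sum>ys\<in>lists_of W n. n * m)"
  proof (rule sum_mono)
    fix ys assume ys: "ys \<in> lists_of W n"
    have "{y \<in> W. f y \<in> f ` set ys} = (\<Union>b\<in>f ` set ys. {y \<in> W. f y = b})" by auto
    then have "card {y \<in> W. f y \<in> f ` set ys} \<le> (\<Sum>b\<in>f ` set ys. card {y \<in> W. f y = b})"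
      by (simp only:) (rule card_UN_le, simp)
    also have "\<dots> \<le> card (f ` set ys) * m" using m sum_bounded_above[of "f ` set ys" "\<lambda>b. card {y \<in> W. f y = b}" m] by simp
    also have "card (f ` set ys) \<le> n" using ys card_image_le[of "set ys" f] card_length[of ys] by (simp add: lists_of_def)
    finally show "card {y \<in> W. f y \<in> f ` set ys} \<le> n * m" by simp
  qed
  also have "card (W \<times> ?H n) + \<dots> \<le> card W * (n ^ 2 * m * card W ^ (n - 1)) + card W ^ n * (n * m)"
    using Suc assms by (simp add: card_cartesian_product card_lists_of)
  also have "\<dots> \<le> Suc n ^ 2 * m * card W ^ (Suc n - 1)"
    by (cases n) (simp_all add: algebra_simps power2_eq_square)
  finally show ?case by simp
qed

text \<open>Transfer matrix: summing the kernel over all cyclic lists gives a trace.\<close>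

fun transfer :: "(bool \<Rightarrow> bool \<Rightarrow> real) \<Rightarrow> (bool \<Rightarrow> real) \<Rightarrow> nat \<Rightarrow> bool \<Rightarrow> bool \<Rightarrow> real" where
  "transfer K w 0 u v = K u v"
| "transfer K w (Suc n) u v = w False * K u False * transfer K w n False v + w True * K u True * transfer K w n True v"

lemma sum_types:
  assumes "finite W"
  shows "(\<Sum>y\<in>W. F (\<tau> y)) = real (card {y \<in> W. \<not> \<tau> y}) * F False + real (card {y \<in> W. \<tau> y}) * F True"
proof -
  have "(\<Sum>y\<in>W. F (\<tau> y)) = (\<Sum>y\<in>{y \<in> W. \<not> \<tau> y} \<union> {y \<in> W. \<tau> y}. F (\<tau> y))" by (intro sum.cong) auto
  also have "\<dots> = (\<Sum>y\<in>{y \<in> W. \<not> \<tau> y}. F (\<tau> y)) + (\<Sum>y\<in>{y \<in> W. \<tau> y}. F (\<tau> y))"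
    using assms by (intro sum.union_disjoint) auto
  finally show ?thesis by simp
qed

lemma sum_chain_transfer:
  assumes "finite W"
  shows "(\<Sum>ys\<in>lists_of W n. chain (\<lambda>x y. K (\<tau> x) (\<tau> y)) x ys z)
    = transfer K (\<lambda>b. real (card {y \<in> W. \<tau> y = b})) n (\<tau> x) (\<tau> z)"
proof (induction n arbitrary: x)
  case 0 then show ?case by (simp add: lists_of_0)
next
  case (Suc n)
  let ?w = "\<lambda>b. real (card {y \<in> W. \<tau> y = b})"
  have "(\<Sum>ys\<in>lists_of W (Suc n). chain (\<lambda>x y. K (\<tau> x) (\<tau> y)) x ys z)
      = (\<Sum>y\<in>W. K (\<tau> x) (\<tau> y) * transfer K ?w n (\<tau> y) (\<tau> z))"
    unfolding sum_lists_of_Suc Suc.IH[symmetric] by (simp add: sum_distrib_left)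
  also have "\<dots> = transfer K ?w (Suc n) (\<tau> x) (\<tau> z)"
    using sum_types[OF assms, of "\<lambda>b. K (\<tau> x) b * transfer K ?w n b (\<tau> z)" \<tau>] by (simp add: algebra_simps)
  finally show ?case .
qed

text \<open>The matrix with entries \<open>K u v * w v\<close> has trace \<open>x * (k - 2)\<close>
  and determinant \<open>- x ^ 2 * (k - 1)\<close>, so its eigenvalues are
  \<open>x * (k - 1)\<close> and \<open>- x\<close>. The four formulas are the spectral
  decomposition of its power \<open>n + 1\<close>.\<close>

lemma transfer_closed_form:
  fixes K :: "bool \<Rightarrow> bool \<Rightarrow> real"
  assumes k: "k > 0" and "w False * K False False = x * (k - 2)" "w True * K False True = x"
    "w False * K True False = x * (k - 1)" "K True True = 0"
  shows "w False * transfer K w n False False = x ^ (n + 1) * ((k - 1) ^ (n + 2) - (-1) ^ n) / k"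
    "w False * transfer K w n True False = x ^ (n + 1) * ((k - 1) ^ (n + 2) + (-1) ^ n * (k - 1)) / k"
    "w True * transfer K w n True True = x ^ (n + 1) * ((k - 1) ^ (n + 1) - (-1) ^ n * (k - 1)) / k"
    "w True * transfer K w n False True = x ^ (n + 1) * ((k - 1) ^ (n + 1) + (-1) ^ n) / k"
proof (induction n)
  case 0
  show "w False * transfer K w 0 False False = x ^ (0 + 1) * ((k - 1) ^ (0 + 2) - (-1) ^ 0) / k"
    "w False * transfer K w 0 True False = x ^ (0 + 1) * ((k - 1) ^ (0 + 2) + (-1) ^ 0 * (k - 1)) / k"
    "w True * transfer K w 0 True True = x ^ (0 + 1) * ((k - 1) ^ (0 + 1) - (-1) ^ 0 * (k - 1)) / k"
    "w True * transfer K w 0 False True = x ^ (0 + 1) * ((k - 1) ^ (0 + 1) + (-1) ^ 0) / k"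
    unfolding transfer.simps assms using k by (simp_all add: field_simps power2_eq_square)
next
  case (Suc n)
  have r: "w b * transfer K w (Suc n) False b = x * (k - 2) * (w b * transfer K w n False b) + x * (w b * transfer K w n True b)"
    "w b * transfer K w (Suc n) True b = x * (k - 1) * (w b * transfer K w n False b)" for b
  proof -
    have "w b * transfer K w (Suc n) False b = (w False * K False False) * (w b * transfer K w n False b) + (w True * K False True) * (w b * transfer K w n True b)"
      by (simp add: algebra_simps)
    then show "w b * transfer K w (Suc n) False b = x * (k - 2) * (w b * transfer K w n False b) + x * (w b * transfer K w n True b)"
      unfolding assms .
    have "w b * transfer K w (Suc n) True b = (w False * K True False) * (w b * transfer K w n False b) + w True * K True True * (w b * transfer K w n True b)"
      by (simp add: algebra_simps)
    then show "w b * transfer K w (Suc n) True b = x * (k - 1) * (w b * transfer K w n False b)"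
      unfolding assms by simp
  qed
  show "w False * transfer K w (Suc n) False False = x ^ (Suc n + 1) * ((k - 1) ^ (Suc n + 2) - (-1) ^ Suc n) / k"
    "w False * transfer K w (Suc n) True False = x ^ (Suc n + 1) * ((k - 1) ^ (Suc n + 2) + (-1) ^ Suc n * (k - 1)) / k"
    "w True * transfer K w (Suc n) True True = x ^ (Suc n + 1) * ((k - 1) ^ (Suc n + 1) - (-1) ^ Suc n * (k - 1)) / k"
    "w True * transfer K w (Suc n) False True = x ^ (Suc n + 1) * ((k - 1) ^ (Suc n + 1) + (-1) ^ Suc n) / k"
    unfolding r Suc.IH using k by (simp_all add: field_simps)
qed

lemma transfer_trace:
  fixes K :: "bool \<Rightarrow> bool \<Rightarrow> real"
  assumes k: "k > 0" and "w False * K False False = x * (k - 2)" "w True * K False True = x"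
    "w False * K True False = x * (k - 1)" "K True True = 0"
  shows "w False * transfer K w n False False + w True * transfer K w n True True = x ^ Suc n * ((k - 1) ^ Suc n + (-1) ^ Suc n)"
  unfolding transfer_closed_form[OF assms] using k by (simp add: field_simps)

lemma sum_cyclic_lists:
  assumes "finite W"
  shows "(\<Sum>rs\<in>lists_of W (Suc n). \<Prod>t<Suc n. A (rs ! t) (rs ! (Suc t mod Suc n))) = (\<Sum>x\<in>W. \<Sum>ys\<in>lists_of W n. chain A x ys x)"
  unfolding sum_lists_of_Suc
proof (intro sum.cong refl)
  fix x ys assume "ys \<in> lists_of W n"
  then have "length ys = n" by (simp add: lists_of_def)
  then show "(\<Prod>t<Suc n. A ((x # ys) ! t) ((x # ys) ! (Suc t mod Suc n))) = chain A x ys x"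
    using cyclic_prod_eq_chain[of A x ys] by simp
qed

lemma sum_cyclic_lists_types:
  fixes K :: "bool \<Rightarrow> bool \<Rightarrow> real"
  assumes W: "finite W" and k: "k > 0"
    and "real (card {y \<in> W. \<not> \<tau> y}) * K False False = x * (k - 2)" "real (card {y \<in> W. \<tau> y}) * K False True = x"
    "real (card {y \<in> W. \<not> \<tau> y}) * K True False = x * (k - 1)" "K True True = 0"
    and "l > 0"
  shows "(\<Sum>rs\<in>lists_of W l. \<Prod>t<l. K (\<tau> (rs ! t)) (\<tau> (rs ! (Suc t mod l)))) = x ^ l * ((k - 1) ^ l + (-1) ^ l)"
proof -
  obtain n where n: "l = Suc n" using \<open>l > 0\<close> by (cases l) auto
  let ?w = "\<lambda>b. real (card {y \<in> W. \<tau> y = b})"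
  have "(\<Sum>rs\<in>lists_of W l. \<Prod>t<l. K (\<tau> (rs ! t)) (\<tau> (rs ! (Suc t mod l)))) = (\<Sum>x\<in>W. transfer K ?w n (\<tau> x) (\<tau> x))"
    unfolding n using sum_cyclic_lists[OF W, of "\<lambda>x y. K (\<tau> x) (\<tau> y)"] sum_chain_transfer[OF W, where K = K and \<tau> = \<tau>] by simp
  also have "\<dots> = ?w False * transfer K ?w n False False + ?w True * transfer K ?w n True True"
    using sum_types[OF W, of "\<lambda>b. transfer K ?w n b b" \<tau>] by simp
  also have "\<dots> = x ^ l * ((k - 1) ^ l + (-1) ^ l)"
    unfolding n by (rule transfer_trace[OF k]) (use assms in simp_all)
  finally show ?thesis .
qed

lemma card_distinct_pairs: "card (distinct_pairs m) = m * (m - 1)"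
proof -
  have "distinct_pairs m = (SIGMA i : {..<m}. {..<m} - {i})" by (auto simp: distinct_pairs_def)
  then have "card (distinct_pairs m) = (\<Sum>i<m. card ({..<m} - {i}))" by (simp add: card_SigmaI)
  also have "\<dots> = (\<Sum>i<m. m - 1)" by (intro sum.cong refl) simp
  finally show ?thesis by simp
qed

section \<open>Expected numbers of cycles, uniform and planted\<close>

context regular_cover
begin

definition cycs :: "nat \<Rightarrow> nat \<Rightarrow> edge set set" where "cycs a l = cyc_edges ` rooted a l"
definition Cyc :: "nat \<Rightarrow> nat \<Rightarrow> edge set set" where "Cyc a L = (\<Union>l\<in>{1..L}. cycs a l)"
text \<open>A common vertex already counts as a conflict, even without a common edge: the numbers of
  free slots factor only over cycles with disjoint clauses, and the counting of overlaps is by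
  vertices.\<close>

definition meets :: "edge set \<Rightarrow> edge set \<Rightarrow> bool" where
  "meets \<gamma> \<gamma>' \<longleftrightarrow> edge_vars \<gamma> \<inter> edge_vars \<gamma>' \<noteq> {} \<or> edge_cls \<gamma> \<inter> edge_cls \<gamma>' \<noteq> {}"

lemma meets_sym: "meets \<gamma> \<gamma>' \<Longrightarrow> meets \<gamma>' \<gamma>" by (auto simp: meets_def)

lemma finite_cycs [simp]: "finite (cycs a l)" by (simp add: cycs_def finite_rooted)
lemma finite_Cyc [simp]: "finite (Cyc a L)" by (simp add: Cyc_def)

lemma cycs_card: "0 < l \<Longrightarrow> \<gamma> \<in> cycs a l \<Longrightarrow> card \<gamma> = 2 * l"
  by (auto simp: cycs_def card_cyc_edges)

lemma Cyc_cases: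
  assumes "\<gamma> \<in> Cyc a L"
  obtains l rs where "0 < l" "l \<le> L" "rs \<in> rooted a l" "\<gamma> = cyc_edges rs" "\<gamma> \<in> cycs a l"
proof -
  from assms obtain l where l: "l \<in> {1..L}" "\<gamma> \<in> cycs a l" unfolding Cyc_def by blast
  then obtain rs where "rs \<in> rooted a l" "\<gamma> = cyc_edges rs" unfolding cycs_def by blast
  with l show thesis by (intro that[of l rs]) auto
qed

lemma Cyc_finite_edges: "\<gamma> \<in> Cyc a L \<Longrightarrow> finite \<gamma>"
  by (auto simp: Cyc_def cycs_def cyc_edges_def)

lemma meets_refl: "\<gamma> \<in> Cyc a L \<Longrightarrow> meets \<gamma> \<gamma>"
proof -
  assume "\<gamma> \<in> Cyc a L"
  then obtain l rs where l: "0 < l" and r: "rs \<in> rooted a l" and g: "\<gamma> = cyc_edges rs" by (rule Cyc_cases)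
  have "svar (rs ! 0) \<in> edge_vars \<gamma>" unfolding g edge_vars_cyc[OF l r] using l by blast
  then show "meets \<gamma> \<gamma>" unfolding meets_def by blast
qed

lemma sum_cycs:
  fixes f :: "edge set \<Rightarrow> real"
  assumes l: "0 < l"
  shows "(\<Sum>\<gamma>\<in>cycs a l. f \<gamma>) = (\<Sum>rs\<in>rooted a l. f (cyc_edges rs)) / (2 * real l)"
proof -
  have "(\<Sum>rs\<in>rooted a l. f (cyc_edges rs)) = (\<Sum>\<gamma>\<in>cycs a l. \<Sum>rs\<in>{rs \<in> rooted a l. cyc_edges rs = \<gamma>}. f (cyc_edges rs))"
    unfolding cycs_def by (rule sum.image_gen) (rule finite_rooted)
  also have "\<dots> = (\<Sum>\<gamma>\<in>cycs a l. 2 * real l * f \<gamma>)"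
  proof (intro sum.cong refl)
    fix \<gamma> assume "\<gamma> \<in> cycs a l"
    then obtain rs where rs: "rs \<in> rooted a l" "\<gamma> = cyc_edges rs" by (auto simp: cycs_def)
    have "(\<Sum>rs\<in>{rs \<in> rooted a l. cyc_edges rs = \<gamma>}. f (cyc_edges rs)) = (\<Sum>rs\<in>{rs \<in> rooted a l. cyc_edges rs = \<gamma>}. f \<gamma>)"
      by (intro sum.cong) auto
    also have "\<dots> = real (2 * l) * f \<gamma>" using card_rooted_fiber[OF l rs(1)] rs(2) by simp
    finally show "(\<Sum>rs\<in>{rs \<in> rooted a l. cyc_edges rs = \<gamma>}. f (cyc_edges rs)) = 2 * real l * f \<gamma>" by simp
  qed
  also have "\<dots> = 2 * real l * (\<Sum>\<gamma>\<in>cycs a l. f \<gamma>)" by (rule sum_distrib_left[symmetric])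
  finally show ?thesis using l by simp
qed

lemma sum_Cyc: "(\<Sum>\<gamma>\<in>Cyc a L. f \<gamma>) = (\<Sum>l=1..L. \<Sum>\<gamma>\<in>cycs a l. f \<gamma>)"
  unfolding Cyc_def
proof (rule sum.UNION_disjoint)
  show "\<forall>i\<in>{1..L}. \<forall>j\<in>{1..L}. i \<noteq> j \<longrightarrow> cycs a i \<inter> cycs a j = {}"
  proof (intro ballI impI equals0I)
    fix i j \<gamma> assume ij: "i \<in> {1..L}" "j \<in> {1..L}" "i \<noteq> j" "\<gamma> \<in> cycs a i \<inter> cycs a j"
    then have "card \<gamma> = 2 * i" "card \<gamma> = 2 * j" by (auto intro!: cycs_card)
    then show False using ij by simp
  qed
qed auto

lemma card_steps_svar: "card {r \<in> steps a. svar r \<in> T} = card (T \<inter> {..<k * a}) * (d * (d - 1)) * (d * a * (k * (k - 1)))"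
proof -
  have "{r \<in> steps a. svar r \<in> T} = ((T \<inter> {..<k * a}) \<times> distinct_pairs d) \<times> ({..<d * a} \<times> distinct_pairs k)"
    by (auto simp: steps_def svar_def)
  then show ?thesis by (simp add: card_cartesian_product card_distinct_pairs)
qed

lemma card_steps_scl: "card {r \<in> steps a. scl r \<in> T} = k * a * (d * (d - 1)) * (card (T \<inter> {..<d * a}) * (k * (k - 1)))"
proof -
  have "{r \<in> steps a. scl r \<in> T} = ({..<k * a} \<times> distinct_pairs d) \<times> ((T \<inter> {..<d * a}) \<times> distinct_pairs k)"
    by (auto simp: steps_def scl_def)
  then show ?thesis by (simp add: card_cartesian_product card_distinct_pairs)
qed

lemma card_steps: "card (steps a) = k * a * (d * (d - 1)) * (d * a * (k * (k - 1)))"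
  using card_steps_svar[of a UNIV] by simp

text \<open>A single crude constant for the number of steps and for the number of steps through a
  given vertex; only the powers of \<open>a\<close> matter.\<close>

definition step_bound :: nat where "step_bound = d * d * d * k * k * k"

lemma pair_le: "d * (d - 1) \<le> d * d" "k * (k - 1) \<le> k * k" by simp_all

lemma card_steps_le: "card (steps a) \<le> step_bound * a\<^sup>2"
proof -
  have "card (steps a) \<le> k * a * (d * d) * (d * a * (k * k))" unfolding card_steps
    by (intro mult_mono pair_le order_refl) auto
  then show ?thesis by (simp add: step_bound_def power2_eq_square mult_ac)
qed

lemma card_fiber_le: "card {r \<in> steps a. svar r = v} \<le> step_bound * a" "card {r \<in> steps a. scl r = v} \<le> step_bound * a"
proof -
  have 1: "card ({v} \<inter> A) \<le> 1" for A :: "nat set" by (metis card_mono finite.emptyI finite.insertI inf_le1 is_singletonI is_singleton_altdef)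
  have "card {r \<in> steps a. svar r \<in> {v}} \<le> 1 * (d * d) * (d * a * (k * k))"
    unfolding card_steps_svar by (intro mult_mono pair_le order_refl 1) auto
  also have "\<dots> \<le> step_bound * a" using k_gt by (simp add: step_bound_def mult_ac)
  finally show "card {r \<in> steps a. svar r = v} \<le> step_bound * a" by simp
  have "card {r \<in> steps a. scl r \<in> {v}} \<le> k * a * (d * d) * (1 * (k * k))"
    unfolding card_steps_scl by (intro mult_mono pair_le order_refl 1) auto
  also have "\<dots> \<le> step_bound * a" using d_pos by (simp add: step_bound_def mult_ac)
  finally show "card {r \<in> steps a. scl r = v} \<le> step_bound * a" by simp
qed

lemma card_nonrooted_le:
  "card (lists_of (steps a) l - rooted a l) \<le> 2 * (l ^ 2 * (step_bound * a) * (step_bound * a\<^sup>2) ^ (l - 1))"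
proof -
  let ?A = "{ys \<in> lists_of (steps a) l. \<not> distinct (map svar ys)}" and ?B = "{ys \<in> lists_of (steps a) l. \<not> distinct (map scl ys)}"
  have "lists_of (steps a) l - rooted a l \<subseteq> ?A \<union> ?B" by (auto simp: rooted_def lists_of_def)
  then have "card (lists_of (steps a) l - rooted a l) \<le> card (?A \<union> ?B)" by (intro card_mono) (auto simp: finite_steps)
  also have "\<dots> \<le> card ?A + card ?B" by (rule card_Un_le)
  also have "\<dots> \<le> l ^ 2 * (step_bound * a) * card (steps a) ^ (l - 1) + l ^ 2 * (step_bound * a) * card (steps a) ^ (l - 1)"
    by (intro add_mono card_lists_nondistinct finite_steps card_fiber_le)
  also have "\<dots> \<le> l ^ 2 * (step_bound * a) * (step_bound * a\<^sup>2) ^ (l - 1) + l ^ 2 * (step_bound * a) * (step_bound * a\<^sup>2) ^ (l - 1)"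
    by (intro add_mono mult_left_mono power_mono card_steps_le) auto
  finally show ?thesis by simp
qed

text \<open>A step has order \<open>a ^ 2\<close> choices and weight at most
  \<open>1 / a ^ 2\<close>. A set of lists in which one step has only order \<open>a\<close> choices
  therefore has total weight \<open>O(1 / a)\<close>.\<close>

lemma scaled_count_le:
  assumes "a > 0" "l > 0" "card S \<le> c * (step_bound * a) * (step_bound * a\<^sup>2) ^ (l - 1)"
  shows "real (card S) * (1 / (real a)\<^sup>2) ^ l \<le> real c * real step_bound ^ l / real a"
proof -
  obtain n where n: "l = Suc n" using assms(2) by (cases l) auto
  have "real (card S) \<le> real (c * (step_bound * a) * (step_bound * a\<^sup>2) ^ (l - 1))" using assms(3) by (rule of_nat_mono)
  then have "real (card S) * (1 / (real a)\<^sup>2) ^ l \<le> real (c * (step_bound * a) * (step_bound * a\<^sup>2) ^ (l - 1)) * (1 / (real a)\<^sup>2) ^ l"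
    by (intro mult_right_mono) auto
  also have "\<dots> = real c * real step_bound ^ l / real a"
    using assms(1) unfolding n by (simp add: power_mult_distrib power_divide field_simps power2_eq_square)
  finally show ?thesis .
qed

lemma rooted_sum_error:
  assumes a: "a > 0" and l: "l > 0" and F: "\<And>rs. rs \<in> lists_of (steps a) l \<Longrightarrow> 0 \<le> F rs \<and> F rs \<le> (1 / (real a)\<^sup>2) ^ l"
  shows "\<bar>(\<Sum>rs\<in>rooted a l. F rs) - (\<Sum>rs\<in>lists_of (steps a) l. F rs)\<bar> \<le> real (2 * l\<^sup>2) * real step_bound ^ l / real a"
proof -
  let ?D = "lists_of (steps a) l - rooted a l"
  have sub: "rooted a l \<subseteq> lists_of (steps a) l" by (auto simp: rooted_def lists_of_def)
  have eq: "(\<Sum>rs\<in>lists_of (steps a) l. F rs) - (\<Sum>rs\<in>rooted a l. F rs) = (\<Sum>rs\<in>?D. F rs)"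
    using sub by (intro sum_diff[symmetric]) (simp_all add: finite_steps)
  have "(\<Sum>rs\<in>?D. F rs) \<le> real (card ?D) * (1 / (real a)\<^sup>2) ^ l"
    using F by (intro sum_bounded_above) auto
  also have "\<dots> \<le> real (2 * l\<^sup>2) * real step_bound ^ l / real a"
    using card_nonrooted_le[of a l] by (intro scaled_count_le[OF a l]) (simp add: mult_ac)
  finally have "(\<Sum>rs\<in>?D. F rs) \<le> real (2 * l\<^sup>2) * real step_bound ^ l / real a" .
  moreover have "(\<Sum>rs\<in>?D. F rs) \<ge> 0" using F by (intro sum_nonneg) auto
  ultimately show ?thesis using eq by linarith
qed

text \<open>Lists with a repeated variable or clause have weight \<open>O(1 / a)\<close>, so
  distinctness may be dropped; over unrestricted lists the sum is evaluated exactly.\<close>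

lemma rooted_sum_tendsto:
  assumes l: "l > 0" and F: "\<And>a rs. a > 0 \<Longrightarrow> rs \<in> lists_of (steps a) l \<Longrightarrow> 0 \<le> F a rs \<and> F a rs \<le> (1 / (real a)\<^sup>2) ^ l"
    and S: "\<And>a. a > 0 \<Longrightarrow> (\<Sum>rs\<in>lists_of (steps a) l. F a rs) = s"
  shows "(\<lambda>a. \<Sum>rs\<in>rooted a l. F a rs) \<longlonglongrightarrow> s"
proof -
  have "(\<lambda>a. real (2 * l\<^sup>2) * real step_bound ^ l / real a) \<longlonglongrightarrow> 0" by real_asymp
  moreover have "eventually (\<lambda>a. norm ((\<Sum>rs\<in>rooted a l. F a rs) - s) \<le> real (2 * l\<^sup>2) * real step_bound ^ l / real a) sequentially"
    using eventually_gt_at_top[of 0]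
  proof eventually_elim
    case (elim a)
    show ?case using rooted_sum_error[OF elim l, of "F a"] F[OF elim] S[OF elim] by simp
  qed
  ultimately have "(\<lambda>a. (\<Sum>rs\<in>rooted a l. F a rs) - s) \<longlonglongrightarrow> 0" by (rule Lim_null_comparison[rotated])
  then show ?thesis by (simp add: LIM_zero_iff)
qed

definition uniform_weight :: "nat \<Rightarrow> edge set \<Rightarrow> real" where "uniform_weight a \<gamma> = (1 / real (d * k * a)) ^ card \<gamma>"

text \<open>The reciprocal of the size of the class: a true copy is matched within the
  \<open>d * a\<close> true slots, a false copy within the remaining slots.\<close>

definition copy_weight :: "nat \<Rightarrow> bool \<Rightarrow> real" where "copy_weight a b = (if b then 1 / real (d * a) else 1 / real (d * k * a - d * a))"

text \<open>The idealised probability that the cycle is present given that \<open>T\<close>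
  satisfies the formula: at each clause, the chance that a uniform true slot is compatible with the
  cycle, and for each edge the chance of its slot within its class, as if the edges were
  independent.\<close>

definition planted_weight :: "nat \<Rightarrow> nat set \<Rightarrow> edge set \<Rightarrow> real" where
  "planted_weight a T \<gamma> = (\<Prod>c\<in>edge_cls \<gamma>. real (free_slots T \<gamma> c) / real k) * (\<Prod>e\<in>\<gamma>. copy_weight a (evar e \<in> T))"

lemma copy_weight_bounds: "a > 0 \<Longrightarrow> 0 \<le> copy_weight a b" "a > 0 \<Longrightarrow> copy_weight a b \<le> 1 / real a"
proof -
  assume a: "a > 0"
  have "2 * (d * a) \<le> k * (d * a)" using k_gt by (intro mult_right_mono) auto
  moreover have "k * (d * a) = d * k * a" by simp
  moreover have "a \<le> d * a" using d_pos by simp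
  ultimately have "a \<le> d * k * a - d * a" "a \<le> d * a" by linarith+
  moreover have "1 / real q \<le> 1 / real a" if "a \<le> q" for q using that a by (simp add: frac_le)
  ultimately show "copy_weight a b \<le> 1 / real a" "0 \<le> copy_weight a b" by (auto simp: copy_weight_def simp del: of_nat_mult)
qed

text \<open>The number of positions of the true slot in a clause that the cycle passes between
  variables of truth values \<open>u\<close> and \<open>v\<close>: none if both are true, one if
  exactly one is, and the \<open>k - 2\<close> slots off the cycle if neither is.\<close>

definition slot_choices :: "bool \<Rightarrow> bool \<Rightarrow> real" where
  "slot_choices u v = (if u \<and> v then 0 else if u \<or> v then 1 else real k - 2)"

definition planted_kernel :: "nat \<Rightarrow> bool \<Rightarrow> bool \<Rightarrow> real" where "planted_kernel a u v = slot_choices u v / real k * (copy_weight a u * copy_weight a v)"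

lemma slot_choices_bounds: "0 \<le> slot_choices u v" "slot_choices u v / real k \<le> 1"
  using k_gt by (auto simp: slot_choices_def)

lemma planted_kernel_bounds: "a > 0 \<Longrightarrow> 0 \<le> planted_kernel a u v" "a > 0 \<Longrightarrow> planted_kernel a u v \<le> 1 / (real a)\<^sup>2"
proof -
  assume a: "a > 0"
  show "0 \<le> planted_kernel a u v" using copy_weight_bounds[OF a] slot_choices_bounds k_gt unfolding planted_kernel_def by simp
  have "planted_kernel a u v \<le> 1 * (1 / real a * (1 / real a))"
    unfolding planted_kernel_def using copy_weight_bounds[OF a] slot_choices_bounds k_gt by (intro mult_mono) auto
  then show "planted_kernel a u v \<le> 1 / (real a)\<^sup>2" by (simp add: power2_eq_square)
qed

lemma prod_cyc_edges:
  fixes f :: "edge \<Rightarrow> real"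
  assumes l: "0 < l" and r: "rs \<in> rooted a l"
  shows "(\<Prod>e\<in>cyc_edges rs. f e) = (\<Prod>t<l. f (out_edge (rs ! t)) * f (in_edge (rs ! t) (rs ! (Suc t mod l))))"
proof -
  note A = l r
  have "(\<Prod>e\<in>cyc_edges rs. f e) = (\<Prod>e\<in>oe rs ` {..<l}. f e) * (\<Prod>e\<in>ie l rs ` {..<l}. f e)"
    unfolding cyc_edges_eq[OF A]
  proof (rule prod.union_disjoint)
    show "oe rs ` {..<l} \<inter> ie l rs ` {..<l} = {}" using oe_ne_ie[OF A] by blast
  qed auto
  also have "(\<Prod>e\<in>oe rs ` {..<l}. f e) = (\<Prod>t<l. f (oe rs t))"
    using oe_inj[OF A] by (subst prod.reindex) (auto simp: inj_on_def)
  also have "(\<Prod>e\<in>ie l rs ` {..<l}. f e) = (\<Prod>t<l. f (ie l rs t))"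
    using ie_inj[OF A] by (subst prod.reindex) (auto simp: inj_on_def)
  finally show ?thesis by (simp add: prod.distrib)
qed

lemma free_slots_cyc:
  assumes l: "0 < l" and r: "rs \<in> rooted a l" and t: "t < l"
  shows "real (free_slots T (cyc_edges rs) (scl (rs ! t))) = slot_choices (svar (rs ! t) \<in> T) (svar (rs ! (Suc t mod l)) \<in> T)"
proof -
  note A = l r
  let ?p = "pin (rs ! t)" and ?q = "pout (rs ! t)"
  have pq: "?p < k" "?q < k" "?p \<noteq> ?q" using steps_D[OF nth_steps[OF A t]] by auto
  have "{i \<in> {..<k}. \<forall>e\<in>cyc_edges rs. ecl e = scl (rs ! t) \<longrightarrow> (snd (snd e) = i) = (evar e \<in> T)}
     = {i \<in> {..<k}. \<forall>e\<in>{e \<in> cyc_edges rs. ecl e = scl (rs ! t)}. (snd (snd e) = i) = (evar e \<in> T)}" by blast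
  also have "\<dots> = {i \<in> {..<k}. (?p = i) = (svar (rs ! t) \<in> T) \<and> (?q = i) = (svar (rs ! (Suc t mod l)) \<in> T)}"
    unfolding edges_at_clause[OF A t] by (simp add: out_edge_def in_edge_def)
  also have "real (card \<dots>) = slot_choices (svar (rs ! t) \<in> T) (svar (rs ! (Suc t mod l)) \<in> T)"
  proof (cases "svar (rs ! t) \<in> T"; cases "svar (rs ! (Suc t mod l)) \<in> T")
    assume 1: "svar (rs ! t) \<in> T" "svar (rs ! (Suc t mod l)) \<in> T"
    then have "{i \<in> {..<k}. (?p = i) = (svar (rs ! t) \<in> T) \<and> (?q = i) = (svar (rs ! (Suc t mod l)) \<in> T)} = {}" using pq by auto
    then show ?thesis using 1 by (simp only: slot_choices_def card.empty) simp
  next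
    assume 1: "svar (rs ! t) \<in> T" "svar (rs ! (Suc t mod l)) \<notin> T"
    then have "{i \<in> {..<k}. (?p = i) = (svar (rs ! t) \<in> T) \<and> (?q = i) = (svar (rs ! (Suc t mod l)) \<in> T)} = {?p}" using pq by auto
    then show ?thesis using 1 by (simp only: slot_choices_def) simp
  next
    assume 1: "svar (rs ! t) \<notin> T" "svar (rs ! (Suc t mod l)) \<in> T"
    then have "{i \<in> {..<k}. (?p = i) = (svar (rs ! t) \<in> T) \<and> (?q = i) = (svar (rs ! (Suc t mod l)) \<in> T)} = {?q}" using pq by auto
    then show ?thesis using 1 by (simp only: slot_choices_def) simp
  next
    assume 1: "svar (rs ! t) \<notin> T" "svar (rs ! (Suc t mod l)) \<notin> T"
    then have "{i \<in> {..<k}. (?p = i) = (svar (rs ! t) \<in> T) \<and> (?q = i) = (svar (rs ! (Suc t mod l)) \<in> T)} = {..<k} - {?p, ?q}" by auto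
    moreover have "card ({..<k} - {?p, ?q}) = k - 2" using pq by (subst card_Diff_subset) auto
    ultimately show ?thesis using 1 k_gt by (simp only: slot_choices_def) simp
  qed
  finally show ?thesis unfolding free_slots_def .
qed

lemma planted_weight_cyc:
  assumes l: "0 < l" and r: "rs \<in> rooted a l"
  shows "planted_weight a T (cyc_edges rs) = (\<Prod>t<l. planted_kernel a (svar (rs ! t) \<in> T) (svar (rs ! (Suc t mod l)) \<in> T))"
proof -
  note A = l r
  have "(\<Prod>c\<in>edge_cls (cyc_edges rs). real (free_slots T (cyc_edges rs) c) / real k)
     = (\<Prod>t<l. real (free_slots T (cyc_edges rs) (scl (rs ! t))) / real k)"
    unfolding edge_cls_cyc[OF A] using scl_inj[OF A] by (subst prod.reindex) (auto simp: inj_on_def)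
  also have "\<dots> = (\<Prod>t<l. slot_choices (svar (rs ! t) \<in> T) (svar (rs ! (Suc t mod l)) \<in> T) / real k)"
    using free_slots_cyc[OF A] by (intro prod.cong) auto
  finally show ?thesis
    unfolding planted_weight_def prod_cyc_edges[OF A] planted_kernel_def prod.distrib by (simp only: out_edge_def in_edge_def fst_conv snd_conv)
qed

lemma planted_weight_bounds:
  assumes a: "a > 0" and g: "\<gamma> \<in> cycs a l" and l: "0 < l"
  shows "0 \<le> planted_weight a T \<gamma>" "planted_weight a T \<gamma> \<le> (1 / (real a)\<^sup>2) ^ l"
proof -
  obtain rs where rs: "rs \<in> rooted a l" "\<gamma> = cyc_edges rs" using g by (auto simp: cycs_def)
  show "0 \<le> planted_weight a T \<gamma>" unfolding rs planted_weight_cyc[OF l rs(1)] by (intro prod_nonneg) (simp add: planted_kernel_bounds a)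
  have "planted_weight a T \<gamma> \<le> (\<Prod>t<l. 1 / (real a)\<^sup>2)"
    unfolding rs planted_weight_cyc[OF l rs(1)] using planted_kernel_bounds a by (intro prod_mono) auto
  then show "planted_weight a T \<gamma> \<le> (1 / (real a)\<^sup>2) ^ l" by simp
qed

lemma uniform_weight_bounds:
  assumes a: "a > 0" and g: "\<gamma> \<in> cycs a l" and l: "0 < l"
  shows "0 \<le> uniform_weight a \<gamma>" "uniform_weight a \<gamma> \<le> (1 / (real a)\<^sup>2) ^ l"
proof -
  show "0 \<le> uniform_weight a \<gamma>" by (simp add: uniform_weight_def)
  have "1 * a \<le> d * k * a" using d_pos k_gt by (intro mult_right_mono) auto
  then have "real a \<le> real (d * k * a)" by (metis mult_1 of_nat_mono)
  then have "1 / real (d * k * a) \<le> 1 / real a" using a by (intro divide_left_mono) auto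
  then have "(1 / real (d * k * a)) ^ card \<gamma> \<le> (1 / real a) ^ card \<gamma>" by (intro power_mono) auto
  also have "\<dots> = (1 / (real a)\<^sup>2) ^ l" unfolding cycs_card[OF l g] by (simp add: power_mult power_divide)
  finally show "uniform_weight a \<gamma> \<le> (1 / (real a)\<^sup>2) ^ l" by (simp add: uniform_weight_def)
qed

text \<open>The transfer matrix is \<open>d - 1\<close> times the matrix with rows
  \<open>(k - 2, 1)\<close> and \<open>(k - 1, 0)\<close>, so the trace has the two powers of
  \<open>(d - 1) * (k - 1)\<close> and \<open>- (d - 1)\<close>. The second eigenvalue is the trace
  that the planted assignment leaves in the cycle counts.\<close>

lemma sum_planted_weight_tendsto:
  assumes l: "0 < l" and T: "\<And>a. T a \<in> balanced_sets a"
  shows "(\<lambda>a. \<Sum>\<gamma>\<in>cycs a l. planted_weight a (T a) \<gamma>) \<longlonglongrightarrow> (real d - 1) ^ l * ((real k - 1) ^ l + (- 1) ^ l) / (2 * real l)"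
proof -
  let ?F = "\<lambda>a rs. \<Prod>t<l. planted_kernel a (svar (rs ! t) \<in> T a) (svar (rs ! (Suc t mod l)) \<in> T a)"
  have "(\<lambda>a. \<Sum>rs\<in>rooted a l. ?F a rs) \<longlonglongrightarrow> (real d - 1) ^ l * ((real k - 1) ^ l + (- 1) ^ l)"
  proof (rule rooted_sum_tendsto[OF l])
    fix a :: nat and rs assume a: "a > 0"
    have "?F a rs \<le> (\<Prod>t<l. 1 / (real a)\<^sup>2)" using planted_kernel_bounds[OF a] by (intro prod_mono) auto
    moreover have "?F a rs \<ge> 0" using planted_kernel_bounds[OF a] by (intro prod_nonneg) auto
    ultimately show "0 \<le> ?F a rs \<and> ?F a rs \<le> (1 / (real a)\<^sup>2) ^ l" by simp
  next
    fix a :: nat assume a: "a > 0"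
    have Ta: "card (T a \<inter> {..<k * a}) = a" using T[of a] by (auto simp: balanced_sets_def Int_absorb2)
    have n1: "card {r \<in> steps a. svar r \<in> T a} = a * (d * (d - 1)) * (d * a * (k * (k - 1)))"
      unfolding card_steps_svar Ta ..
    have "{r \<in> steps a. svar r \<notin> T a} = {r \<in> steps a. svar r \<in> {..<k * a} - T a}" using steps_D by auto
    moreover have "card (({..<k * a} - T a) \<inter> {..<k * a}) = (k - 1) * a"
    proof -
      have "({..<k * a} - T a) \<inter> {..<k * a} = {..<k * a} - T a" by auto
      moreover have "card ({..<k * a} - T a) = k * a - a"
        using T[of a] by (subst card_Diff_subset) (auto simp: balanced_sets_def intro: finite_subset)
      ultimately show ?thesis by (simp add: diff_mult_distrib)
    qed
    ultimately have n0: "card {r \<in> steps a. svar r \<notin> T a} = (k - 1) * a * (d * (d - 1)) * (d * a * (k * (k - 1)))"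
      using card_steps_svar[of a "{..<k * a} - T a"] by simp
    have k1: "real (k - 1) = real k - 1" "real (d - 1) = real d - 1" using k_gt d_pos by auto
    have hN: "real (d * k * a - d * a) = real d * (real k - 1) * real a"
    proof -
      have "d * k * a - d * a = d * (k - 1) * a" by (simp add: diff_mult_distrib diff_mult_distrib2)
      then show ?thesis by (simp only: of_nat_mult k1)
    qed
    have pos: "real k - 1 \<noteq> 0" "real k \<noteq> 0" "real d \<noteq> 0" "real a \<noteq> 0" using k_gt d_pos a by auto
    show "(\<Sum>rs\<in>lists_of (steps a) l. ?F a rs) = (real d - 1) ^ l * ((real k - 1) ^ l + (- 1) ^ l)"
    proof (rule sum_cyclic_lists_types[OF finite_steps _ _ _ _ _ l])
      show "0 < real k" using k_gt by simp
      show "real (card {y \<in> steps a. svar y \<notin> T a}) * planted_kernel a False False = (real d - 1) * (real k - 2)"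
      proof -
        have "M * A * (D * E) * (D * A * (B * M)) * (Q / B * (1 / (D * M * A) * (1 / (D * M * A)))) = E * Q"
          if "M \<noteq> 0" "A \<noteq> 0" "D \<noteq> 0" "B \<noteq> 0" for M A D E B Q :: real
          using that by (simp add: field_simps)
        from this[OF pos(1,4,3,2)] show ?thesis
          unfolding n0 planted_kernel_def copy_weight_def hN of_nat_mult k1 slot_choices_def by simp
      qed
      show "real (card {y \<in> steps a. svar y \<in> T a}) * planted_kernel a False True = real d - 1"
        unfolding n1 planted_kernel_def copy_weight_def hN of_nat_mult k1 slot_choices_def using pos by (simp add: field_simps)
      show "real (card {y \<in> steps a. svar y \<notin> T a}) * planted_kernel a True False = (real d - 1) * (real k - 1)"
        unfolding n0 planted_kernel_def copy_weight_def hN of_nat_mult k1 slot_choices_def using pos by (simp add: field_simps)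
      show "planted_kernel a True True = 0" by (simp add: planted_kernel_def slot_choices_def)
    qed
  qed
  moreover have "(\<Sum>\<gamma>\<in>cycs a l. planted_weight a (T a) \<gamma>) = (\<Sum>rs\<in>rooted a l. ?F a rs) / (2 * real l)" for a
    unfolding sum_cycs[OF l] using planted_weight_cyc[OF l] by simp
  ultimately show ?thesis using l by (simp only:) (intro tendsto_intros, auto)
qed

lemma sum_uniform_weight_tendsto:
  assumes l: "0 < l"
  shows "(\<lambda>a. \<Sum>\<gamma>\<in>cycs a l. uniform_weight a \<gamma>) \<longlonglongrightarrow> ((real d - 1) * (real k - 1)) ^ l / (2 * real l)"
proof -
  let ?F = "\<lambda>a (rs :: step list). (1 / (real (d * k * a))\<^sup>2) ^ l"
  have "(\<lambda>a. \<Sum>rs\<in>rooted a l. ?F a rs) \<longlonglongrightarrow> ((real d - 1) * (real k - 1)) ^ l"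
  proof (rule rooted_sum_tendsto[OF l])
    fix a :: nat and rs assume a: "a > 0"
    have "1 * a \<le> d * k * a" using d_pos k_gt by (intro mult_right_mono) auto
    then have "real a \<le> real (d * k * a)" by (metis mult_1 of_nat_mono)
    then have "1 / (real (d * k * a))\<^sup>2 \<le> 1 / (real a)\<^sup>2" using a by (intro frac_le power_mono) auto
    then show "0 \<le> ?F a rs \<and> ?F a rs \<le> (1 / (real a)\<^sup>2) ^ l" by (intro conjI power_mono) auto
  next
    fix a :: nat assume a: "a > 0"
    have k1: "real (k - 1) = real k - 1" "real (d - 1) = real d - 1" using k_gt d_pos by auto
    have "real (card (steps a)) * (1 / (real (d * k * a))\<^sup>2) = (real d - 1) * (real k - 1)"
      unfolding card_steps of_nat_mult k1 using a k_gt d_pos by (simp add: field_simps power2_eq_square)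
    moreover have "(\<Sum>rs\<in>lists_of (steps a) l. ?F a rs) = (real (card (steps a)) * (1 / (real (d * k * a))\<^sup>2)) ^ l"
      by (simp only: sum_constant card_lists_of[OF finite_steps] of_nat_power power_mult_distrib)
    ultimately show "(\<Sum>rs\<in>lists_of (steps a) l. ?F a rs) = ((real d - 1) * (real k - 1)) ^ l" by simp
  qed
  moreover have "(\<Sum>\<gamma>\<in>cycs a l. uniform_weight a \<gamma>) = (\<Sum>rs\<in>rooted a l. ?F a rs) / (2 * real l)" for a
  proof -
    have "uniform_weight a (cyc_edges rs) = ?F a rs" if "rs \<in> rooted a l" for rs
      using card_cyc_edges[OF l that] by (simp add: uniform_weight_def power_mult power_divide)
    then show ?thesis unfolding sum_cycs[OF l] by simp
  qed
  ultimately show ?thesis using l by (simp only:) (intro tendsto_intros, auto)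
qed

text \<open>A cycle that meets \<open>\<gamma>\<close> has a step at one of the at most
  \<open>L\<close> variables or \<open>L\<close> clauses of \<open>\<gamma>\<close>. This restricts
  one step to order \<open>a\<close> choices instead of \<open>a ^ 2\<close>.\<close>

lemma conflict_weight_le:
  assumes a: "a > 0" and g: "\<gamma> \<in> Cyc a L"
    and w: "\<And>l \<gamma>'. l \<in> {1..L} \<Longrightarrow> \<gamma>' \<in> cycs a l \<Longrightarrow> 0 \<le> w \<gamma>' \<and> w \<gamma>' \<le> (1 / (real a)\<^sup>2) ^ l"
  shows "(\<Sum>\<gamma>'\<in>{\<gamma>'\<in>Cyc a L. meets \<gamma> \<gamma>'}. w \<gamma>') \<le> (\<Sum>l=1..L. real (l * (2 * L)) * real step_bound ^ l) / real a"
proof -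
  obtain l0 rs0 where l0: "0 < l0" "l0 \<le> L" and r0: "rs0 \<in> rooted a l0" "\<gamma> = cyc_edges rs0" using g by (rule Cyc_cases)
  let ?W' = "{r \<in> steps a. svar r \<in> edge_vars \<gamma> \<or> scl r \<in> edge_cls \<gamma>}"
  have cv: "card (edge_vars \<gamma>) \<le> L" "card (edge_cls \<gamma>) \<le> L"
    unfolding r0 edge_vars_cyc[OF l0(1) r0(1)] edge_cls_cyc[OF l0(1) r0(1)]
    using l0(2) by (auto intro!: order_trans[OF card_image_le])
  have fin: "finite (edge_vars \<gamma>)" "finite (edge_cls \<gamma>)"
    unfolding r0 edge_vars_cyc[OF l0(1) r0(1)] edge_cls_cyc[OF l0(1) r0(1)] by auto
  have W': "card ?W' \<le> 2 * L * (step_bound * a)"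
  proof -
    have "?W' = (\<Union>v\<in>edge_vars \<gamma>. {r \<in> steps a. svar r = v}) \<union> (\<Union>c\<in>edge_cls \<gamma>. {r \<in> steps a. scl r = c})" by auto
    then have "card ?W' \<le> card (\<Union>v\<in>edge_vars \<gamma>. {r \<in> steps a. svar r = v}) + card (\<Union>c\<in>edge_cls \<gamma>. {r \<in> steps a. scl r = c})"
      by (simp only: card_Un_le)
    also have "\<dots> \<le> (\<Sum>v\<in>edge_vars \<gamma>. card {r \<in> steps a. svar r = v}) + (\<Sum>c\<in>edge_cls \<gamma>. card {r \<in> steps a. scl r = c})"
      using fin by (intro add_mono card_UN_le)
    also have "\<dots> \<le> (\<Sum>v\<in>edge_vars \<gamma>. step_bound * a) + (\<Sum>c\<in>edge_cls \<gamma>. step_bound * a)"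
      by (intro add_mono sum_mono card_fiber_le)
    also have "\<dots> \<le> L * (step_bound * a) + L * (step_bound * a)" using cv by (simp add: add_mono mult_right_mono)
    finally show ?thesis by (simp add: mult_ac)
  qed
  have sub: "{\<gamma>'\<in>Cyc a L. meets \<gamma> \<gamma>'} \<subseteq> (\<Union>l\<in>{1..L}. cyc_edges ` {rs \<in> rooted a l. \<exists>y\<in>set rs. y \<in> ?W'})"
  proof
    fix \<gamma>' assume g': "\<gamma>' \<in> {\<gamma>'\<in>Cyc a L. meets \<gamma> \<gamma>'}"
    then obtain l rs where l: "0 < l" "l \<le> L" and r: "rs \<in> rooted a l" "\<gamma>' = cyc_edges rs" using Cyc_cases by (metis (no_types, lifting) mem_Collect_eq)
    have "\<exists>y\<in>set rs. y \<in> ?W'"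
    proof -
      have "(\<exists>v. v \<in> edge_vars \<gamma> \<and> v \<in> edge_vars \<gamma>') \<or> (\<exists>c. c \<in> edge_cls \<gamma> \<and> c \<in> edge_cls \<gamma>')" using g' by (auto simp: meets_def)
      then obtain t where "t < l" "svar (rs ! t) \<in> edge_vars \<gamma> \<or> scl (rs ! t) \<in> edge_cls \<gamma>"
        unfolding r edge_vars_cyc[OF l(1) r(1)] edge_cls_cyc[OF l(1) r(1)] by auto
      then show ?thesis using nth_steps[OF l(1) r(1), of t] len[OF l(1) r(1)] by (intro bexI[of _ "rs ! t"]) auto
    qed
    then have "rs \<in> {rs \<in> rooted a l. \<exists>y\<in>set rs. y \<in> ?W'}" using r(1) by simp
    then show "\<gamma>' \<in> (\<Union>l\<in>{1..L}. cyc_edges ` {rs \<in> rooted a l. \<exists>y\<in>set rs. y \<in> ?W'})"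
      unfolding r(2) using l by (intro UN_I[of l] imageI) auto
  qed
  let ?I = "\<lambda>l. cyc_edges ` {rs \<in> rooted a l. \<exists>y\<in>set rs. y \<in> ?W'}"
  have finI: "finite (?I l)" for l using finite_rooted by auto
  have Iw: "0 \<le> w \<gamma>' \<and> w \<gamma>' \<le> (1 / (real a)\<^sup>2) ^ l" if "l \<in> {1..L}" "\<gamma>' \<in> ?I l" for l \<gamma>'
    using that w[OF that(1), of \<gamma>'] by (auto simp: cycs_def)
  have "(\<Sum>\<gamma>'\<in>{\<gamma>'\<in>Cyc a L. meets \<gamma> \<gamma>'}. w \<gamma>') = (\<Sum>\<gamma>'\<in>{\<gamma>'\<in>Cyc a L. meets \<gamma> \<gamma>'}. \<bar>w \<gamma>'\<bar>)"
    by (intro sum.cong refl) (use w in \<open>force simp: Cyc_def\<close>)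
  also have "\<dots> \<le> (\<Sum>\<gamma>'\<in>(\<Union>l\<in>{1..L}. ?I l). \<bar>w \<gamma>'\<bar>)"
    using sub finI by (intro sum_mono2) auto
  also have "\<dots> \<le> (\<Sum>l=1..L. \<Sum>\<gamma>'\<in>?I l. \<bar>w \<gamma>'\<bar>)" using finI by (intro sum_UN_le) auto
  also have "\<dots> \<le> (\<Sum>l=1..L. real (l * (2 * L)) * real step_bound ^ l / real a)"
  proof (rule sum_mono)
    fix l assume l: "l \<in> {1..L}"
    have "(\<Sum>\<gamma>'\<in>?I l. \<bar>w \<gamma>'\<bar>) \<le> real (card (?I l)) * (1 / (real a)\<^sup>2) ^ l"
      using Iw[OF l] by (intro sum_bounded_above) auto
    also have "\<dots> \<le> real (l * (2 * L)) * real step_bound ^ l / real a"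
    proof (rule scaled_count_le[OF a])
      have "card (?I l) \<le> card {rs \<in> rooted a l. \<exists>y\<in>set rs. y \<in> ?W'}" by (intro card_image_le) (simp add: finite_rooted)
      also have "\<dots> \<le> card {ys \<in> lists_of (steps a) l. \<exists>y\<in>set ys. y \<in> ?W'}"
      proof (rule card_mono)
        show "finite {ys \<in> lists_of (steps a) l. \<exists>y\<in>set ys. y \<in> ?W'}" by (simp add: finite_steps)
      qed (auto simp: rooted_def lists_of_def)
      also have "\<dots> \<le> l * card ?W' * card (steps a) ^ (l - 1)" by (intro card_lists_hitting finite_steps) auto
      also have "\<dots> \<le> l * (2 * L * (step_bound * a)) * (step_bound * a\<^sup>2) ^ (l - 1)"
        using W' card_steps_le by (intro mult_mono power_mono) auto
      finally show "card (?I l) \<le> l * (2 * L) * (step_bound * a) * (step_bound * a\<^sup>2) ^ (l - 1)" by (simp add: mult_ac)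
    qed (use l in auto)
    finally show "(\<Sum>\<gamma>'\<in>?I l. \<bar>w \<gamma>'\<bar>) \<le> real (l * (2 * L)) * real step_bound ^ l / real a" .
  qed
  finally show ?thesis by (simp add: sum_divide_distrib)
qed

end

section \<open>Joint cycle probabilities\<close>

text \<open>The quotient of \<open>N ^ e\<close> by the falling factorial for
  \<open>e \<le> N\<close>: the correction from independent choices to choices without
  replacement.\<close>

definition fall_ratio :: "nat \<Rightarrow> nat \<Rightarrow> real" where
  "fall_ratio N e = real N ^ e * fact (N - e) / fact N"

lemma fall_ratio_bounds:
  assumes "e \<le> M" "M < N"
  shows "1 \<le> fall_ratio N e" "fall_ratio N e \<le> (real N / (real N - real M)) ^ M"
proof -
  let ?r = "real N / (real N - real M)"
  have r: "1 \<le> ?r" using assms by (simp add: field_simps)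
  have *: "1 \<le> fall_ratio N e \<and> fall_ratio N e \<le> ?r ^ e"
    using assms(1)
  proof (induction e)
    case 0 then show ?case by (simp add: fall_ratio_def)
  next
    case (Suc e)
    have e: "e < N" "e < M" using Suc assms by auto
    have "N - e = Suc (N - Suc e)" using e by simp
    then have fe: "fact (N - e) = (real N - real e) * (fact (N - Suc e) :: real)"
      using e by (simp add: of_nat_diff)
    have "real N - real e \<noteq> 0" using e by simp
    then have eq: "fall_ratio N (Suc e) = fall_ratio N e * (real N / (real N - real e))"
      by (simp add: fall_ratio_def fe)
    have f: "1 \<le> real N / (real N - real e)" "real N / (real N - real e) \<le> ?r"
      using e assms by (auto intro!: divide_left_mono mult_pos_pos)
    have "1 * 1 \<le> fall_ratio N e * (real N / (real N - real e))"
      using Suc f by (intro mult_mono) auto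
    moreover have "fall_ratio N e * (real N / (real N - real e)) \<le> ?r ^ e * ?r"
      using Suc f r by (intro mult_mono) auto
    ultimately show ?case unfolding eq by (simp add: mult.commute)
  qed
  show "1 \<le> fall_ratio N e" using * by simp
  have "?r ^ e \<le> ?r ^ M" using r assms(1) by (rule power_increasing[rotated])
  then show "fall_ratio N e \<le> ?r ^ M" using * by simp
qed

lemma fall_ratio_mult: "real N \<noteq> 0 \<Longrightarrow> fall_ratio N e * (1 / real N) ^ e = fact (N - e) / fact N"
  by (simp add: fall_ratio_def power_divide)

context regular_cover
begin

definition ext :: "(nat \<times> nat \<Rightarrow> nat \<times> nat) \<Rightarrow> edge set \<Rightarrow> bool" where
  "ext \<sigma> E \<longleftrightarrow> (\<forall>(v, c)\<in>E. \<sigma> v = c)"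

lemma ext_Union: "ext \<sigma> (\<Union>B) \<longleftrightarrow> (\<forall>\<gamma>\<in>B. ext \<sigma> \<gamma>)" by (auto simp: ext_def)
lemma ext_Un: "ext \<sigma> (E \<union> E') \<longleftrightarrow> ext \<sigma> E \<and> ext \<sigma> E'" by (simp add: ext_def ball_Un)

abbreviation "fams a L j \<equiv> indep_fams (Cyc a L) meets j"

lemma Cyc_props:
  assumes "\<gamma> \<in> Cyc a L"
  shows "\<gamma> \<subseteq> V a \<times> C a" "inj_on fst \<gamma>" "inj_on snd \<gamma>" "card \<gamma> \<le> 2 * L" "finite \<gamma>"
    "\<And>v. v \<in> edge_vars \<gamma> \<Longrightarrow> card {e \<in> \<gamma>. evar e = v} = 2" "\<And>c. c \<in> edge_cls \<gamma> \<Longrightarrow> card {e \<in> \<gamma>. ecl e = c} = 2"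
proof -
  obtain l rs where l: "0 < l" "l \<le> L" and r: "rs \<in> rooted a l" and g: "\<gamma> = cyc_edges rs" using assms by (rule Cyc_cases)
  show "\<gamma> \<subseteq> V a \<times> C a" unfolding g by (rule cyc_edges_subset[OF l(1) r])
  show "inj_on fst \<gamma>" unfolding g by (rule cyc_fst_inj[OF l(1) r])
  show "inj_on snd \<gamma>" unfolding g by (rule cyc_snd_inj[OF l(1) r])
  show "card \<gamma> \<le> 2 * L" unfolding g card_cyc_edges[OF l(1) r] using l by simp
  show "finite \<gamma>" by (rule Cyc_finite_edges[OF assms])
  show "card {e \<in> \<gamma>. evar e = v} = 2" if "v \<in> edge_vars \<gamma>" for v
    using card_edges_at_var[OF l(1) r] that unfolding g by blast
  show "card {e \<in> \<gamma>. ecl e = c} = 2" if "c \<in> edge_cls \<gamma>" for c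
    using card_edges_at_clause[OF l(1) r] that unfolding g by blast
qed

lemma fams_D: "B \<in> fams a L j \<Longrightarrow> B \<subseteq> Cyc a L \<and> card B = j \<and> finite B"
  using indep_fams_finite[OF finite_Cyc[of a L], of B meets j] by (simp add: indep_fams_def)

lemma fams_indep: "B \<in> fams a L j \<Longrightarrow> \<gamma> \<in> B \<Longrightarrow> \<gamma>' \<in> B \<Longrightarrow> meets \<gamma> \<gamma>' \<Longrightarrow> \<gamma> = \<gamma>'"
  by (auto simp: indep_fams_def)

lemma meets_if_common_edge: "e \<in> \<gamma> \<Longrightarrow> e' \<in> \<gamma>' \<Longrightarrow> evar e = evar e' \<or> ecl e = ecl e' \<Longrightarrow> meets \<gamma> \<gamma>'"
  by (fastforce simp: meets_def edge_vars_def edge_cls_def)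

lemma fams_disjoint: "B \<in> fams a L j \<Longrightarrow> \<gamma> \<in> B \<Longrightarrow> \<gamma>' \<in> B \<Longrightarrow> \<gamma> \<noteq> \<gamma>' \<Longrightarrow> \<gamma> \<inter> \<gamma>' = {}"
  using fams_indep meets_if_common_edge by (metis disjoint_iff)

lemma fams_Union:
  fixes f :: "edge \<Rightarrow> real"
  assumes B: "B \<in> fams a L j"
  shows "\<Union>B \<subseteq> V a \<times> C a" "inj_on fst (\<Union>B)" "inj_on snd (\<Union>B)" "finite (\<Union>B)"
    "card (\<Union>B) = (\<Sum>\<gamma>\<in>B. card \<gamma>)" "card (\<Union>B) \<le> 2 * L * j"
    "(\<Prod>e\<in>\<Union>B. f e) = (\<Prod>\<gamma>\<in>B. \<Prod>e\<in>\<gamma>. f e)"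
proof -
  have BC: "B \<subseteq> Cyc a L" "card B = j" "finite B" using fams_D[OF B] by auto
  note P = Cyc_props[OF subsetD[OF BC(1)]]
  show "\<Union>B \<subseteq> V a \<times> C a" using P(1) by blast
  show "finite (\<Union>B)" using BC P(5) by auto
  have same: "\<gamma> = \<gamma>'" if "e \<in> \<gamma>" "\<gamma> \<in> B" "e' \<in> \<gamma>'" "\<gamma>' \<in> B" "evar e = evar e' \<or> ecl e = ecl e'" for e e' \<gamma> \<gamma>'
    using fams_indep[OF B that(2,4)] meets_if_common_edge[OF that(1,3,5)] .
  show "inj_on fst (\<Union>B)"
  proof (rule inj_onI)
    fix e e' assume e: "e \<in> \<Union>B" "e' \<in> \<Union>B" "fst e = fst e'"
    then obtain \<gamma> \<gamma>' where g: "e \<in> \<gamma>" "\<gamma> \<in> B" "e' \<in> \<gamma>'" "\<gamma>' \<in> B" by blast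
    then have "\<gamma> = \<gamma>'" using same e(3) by simp
    then show "e = e'" using P(2)[OF g(2)] g e(3) by (auto dest: inj_onD)
  qed
  show "inj_on snd (\<Union>B)"
  proof (rule inj_onI)
    fix e e' assume e: "e \<in> \<Union>B" "e' \<in> \<Union>B" "snd e = snd e'"
    then obtain \<gamma> \<gamma>' where g: "e \<in> \<gamma>" "\<gamma> \<in> B" "e' \<in> \<gamma>'" "\<gamma>' \<in> B" by blast
    then have "\<gamma> = \<gamma>'" using same e(3) by simp
    then show "e = e'" using P(3)[OF g(2)] g e(3) by (auto dest: inj_onD)
  qed
  show c: "card (\<Union>B) = (\<Sum>\<gamma>\<in>B. card \<gamma>)"
    by (rule card_Union_disjoint) (auto simp: pairwise_def disjnt_def P(5) fams_disjoint[OF B])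
  have "(\<Sum>\<gamma>\<in>B. card \<gamma>) \<le> (\<Sum>\<gamma>\<in>B. 2 * L)" using P(4) by (intro sum_mono)
  then show "card (\<Union>B) \<le> 2 * L * j" unfolding c using BC by (simp add: mult.commute)
  show "(\<Prod>e\<in>\<Union>B. f e) = (\<Prod>\<gamma>\<in>B. \<Prod>e\<in>\<gamma>. f e)"
    using prod.Union_disjoint[of B f] P(5) fams_disjoint[OF B] by (simp add: o_def)
qed

definition pr_ext :: "nat \<Rightarrow> edge set \<Rightarrow> real" where
  "pr_ext a E = real (card {\<sigma> \<in> Mt a. ext \<sigma> E}) / fact (d * k * a)"

definition planted_pr :: "nat \<Rightarrow> nat set \<Rightarrow> edge set \<Rightarrow> real" where
  "planted_pr a T E = real (card {\<sigma> \<in> Mt a. sat a \<sigma> T \<and> ext \<sigma> E}) / real (card {\<sigma> \<in> Mt a. sat a \<sigma> T})"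

lemma pr_ext_le: "E \<subseteq> V a \<times> C a \<Longrightarrow> pr_ext a E \<le> fact (d * k * a - card E) / fact (d * k * a)"
proof -
  assume "E \<subseteq> V a \<times> C a"
  from of_nat_mono[OF card_Mt_extending_le[OF this]]
  have "real (card {\<sigma> \<in> Mt a. ext \<sigma> E}) \<le> fact (d * k * a - card E)" by (simp only: ext_def of_nat_fact)
  then show ?thesis unfolding pr_ext_def by (rule divide_right_mono) simp
qed

lemma pr_ext_fam:
  assumes B: "B \<in> fams a L j" and a: "a > 0"
  shows "pr_ext a (\<Union>B) = fall_ratio (d * k * a) (card (\<Union>B)) * (\<Prod>\<gamma>\<in>B. uniform_weight a \<gamma>)"
proof -
  note U = fams_Union[OF B]
  have 1: "pr_ext a (\<Union>B) = fact (d * k * a - card (\<Union>B)) / fact (d * k * a)"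
    unfolding pr_ext_def ext_def card_Mt_extending[OF U(1-3)] by simp
  have 2: "(\<Prod>\<gamma>\<in>B. uniform_weight a \<gamma>) = (1 / real (d * k * a)) ^ card (\<Union>B)"
    unfolding uniform_weight_def U(5) by (simp only: power_sum)
  have "real (d * k * a) \<noteq> 0" using a d_pos k_gt by simp
  then show ?thesis unfolding 1 2 by (rule fall_ratio_mult[symmetric])
qed

text \<open>Clauses off the family contribute \<open>k / k = 1\<close>, and a clause on it belongs
  to exactly one member, whose edges alone restrict its slot. Hence the slot factor splits over the
  members; only the falling factorials do not, and they give the two ratios in front.\<close>

lemma planted_pr_fam:
  assumes B: "B \<in> fams a L j" and a: "a > 0" and T: "T \<in> balanced_sets a"
  shows "planted_pr a T (\<Union>B) = fall_ratio (d * a) (card {e \<in> \<Union>B. evar e \<in> T})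
     * fall_ratio (d * k * a - d * a) (card {e \<in> \<Union>B. evar e \<notin> T}) * (\<Prod>\<gamma>\<in>B. planted_weight a T \<gamma>)"
proof -
  note U = fams_Union[OF B]
  let ?E = "\<Union>B" and ?n = "d * a" and ?m = "d * k * a - d * a"
  let ?e1 = "card {e \<in> ?E. evar e \<in> T}" and ?e2 = "card {e \<in> ?E. evar e \<notin> T}"
  have BC: "B \<subseteq> Cyc a L" "card B = j" "finite B" using fams_D[OF B] by auto
  have T': "T \<subseteq> {..<k * a}" "card T = a" using T by (auto simp: balanced_sets_def)
  have n: "real ?n \<noteq> 0" using a d_pos by simp
  have m: "real ?m \<noteq> 0"
  proof -
    have "d * a * 1 < d * a * k" using a d_pos k_gt by (intro mult_strict_left_mono) auto
    then have "?m > 0" by (simp add: mult_ac)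
    then show ?thesis by simp
  qed
  have kk: "real k \<noteq> 0" using k_gt by simp
  have slots: "(\<Prod>c<d * a. real (free_slots T ?E c) / real k) = (\<Prod>\<gamma>\<in>B. \<Prod>c\<in>edge_cls \<gamma>. real (free_slots T \<gamma> c) / real k)"
  proof -
    have fc: "finite (edge_cls \<gamma>)" if "\<gamma> \<in> B" for \<gamma>
      using Cyc_props(5) BC that by (auto simp: edge_cls_def)
    have "(\<Prod>c<d * a. real (free_slots T ?E c) / real k) = (\<Prod>c\<in>(\<Union>\<gamma>\<in>B. edge_cls \<gamma>). real (free_slots T ?E c) / real k)"
    proof (rule prod.mono_neutral_right)
      show "(\<Union>\<gamma>\<in>B. edge_cls \<gamma>) \<subseteq> {..<d * a}" using U(1) by (fastforce simp: edge_cls_def clause_copies_def)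
      show "\<forall>c\<in>{..<d * a} - (\<Union>\<gamma>\<in>B. edge_cls \<gamma>). real (free_slots T ?E c) / real k = 1"
      proof
        fix c assume c: "c \<in> {..<d * a} - (\<Union>\<gamma>\<in>B. edge_cls \<gamma>)"
        have "ecl e \<noteq> c" if "e \<in> ?E" for e using that c by (auto simp: edge_cls_def)
        then have "{i \<in> {..<k}. \<forall>e\<in>?E. ecl e = c \<longrightarrow> (snd (snd e) = i) = (evar e \<in> T)} = {..<k}" by blast
        then have "free_slots T ?E c = k" unfolding free_slots_def by (simp only: card_lessThan)
        then show "real (free_slots T ?E c) / real k = 1" using kk by simp
      qed
    qed simp
    also have "\<dots> = (\<Prod>\<gamma>\<in>B. \<Prod>c\<in>edge_cls \<gamma>. real (free_slots T ?E c) / real k)"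
    proof (rule prod.UNION_disjoint)
      show "\<forall>\<gamma>\<in>B. \<forall>\<gamma>'\<in>B. \<gamma> \<noteq> \<gamma>' \<longrightarrow> edge_cls \<gamma> \<inter> edge_cls \<gamma>' = {}"
        using fams_indep[OF B] by (auto simp: meets_def)
    qed (use BC fc in auto)
    also have "\<dots> = (\<Prod>\<gamma>\<in>B. \<Prod>c\<in>edge_cls \<gamma>. real (free_slots T \<gamma> c) / real k)"
    proof (intro prod.cong refl)
      fix \<gamma> c assume g: "\<gamma> \<in> B" and c: "c \<in> edge_cls \<gamma>"
      have bk: "e \<in> \<gamma>" if eE: "e \<in> ?E" and ec: "ecl e = c" for e
      proof -
        obtain \<gamma>' where g': "e \<in> \<gamma>'" "\<gamma>' \<in> B" using eE by (rule UnionE)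
        obtain e0 where e0: "e0 \<in> \<gamma>" "ecl e0 = c" using c by (auto simp: edge_cls_def)
        have "\<gamma>' = \<gamma>" using fams_indep[OF B g'(2) g] meets_if_common_edge[OF g'(1) e0(1)] e0(2) ec by simp
        then show ?thesis using g' by simp
      qed
      have sub: "e \<in> ?E" if "e \<in> \<gamma>" for e using that g by (rule UnionI[rotated])
      have "(\<forall>e\<in>?E. ecl e = c \<longrightarrow> P e) \<longleftrightarrow> (\<forall>e\<in>\<gamma>. ecl e = c \<longrightarrow> P e)" for P
      proof
        assume h: "\<forall>e\<in>?E. ecl e = c \<longrightarrow> P e"
        show "\<forall>e\<in>\<gamma>. ecl e = c \<longrightarrow> P e" by (intro ballI impI h[rule_format] sub)
      next
        assume h: "\<forall>e\<in>\<gamma>. ecl e = c \<longrightarrow> P e"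
        show "\<forall>e\<in>?E. ecl e = c \<longrightarrow> P e" by (intro ballI impI h[rule_format] bk)
      qed
      then have "free_slots T ?E c = free_slots T \<gamma> c" unfolding free_slots_def by (simp only:)
      then show "real (free_slots T ?E c) / real k = real (free_slots T \<gamma> c) / real k" by simp
    qed
    finally show ?thesis .
  qed
  have hq: "(\<Prod>e\<in>?E. copy_weight a (evar e \<in> T)) = (1 / real ?n) ^ ?e1 * (1 / real ?m) ^ ?e2"
  proof -
    have "(\<Prod>e\<in>?E. copy_weight a (evar e \<in> T)) = (\<Prod>e\<in>{e \<in> ?E. evar e \<in> T} \<union> {e \<in> ?E. evar e \<notin> T}. copy_weight a (evar e \<in> T))"
      by (intro prod.cong) auto
    also have "\<dots> = (\<Prod>e\<in>{e \<in> ?E. evar e \<in> T}. copy_weight a (evar e \<in> T)) * (\<Prod>e\<in>{e \<in> ?E. evar e \<notin> T}. copy_weight a (evar e \<in> T))"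
    proof (rule prod.union_disjoint)
      show "finite {e \<in> ?E. evar e \<in> T}" "finite {e \<in> ?E. evar e \<notin> T}"
        by (rule finite_subset[OF _ U(4)], blast)+
    qed blast
    also have "(\<Prod>e\<in>{e \<in> ?E. evar e \<in> T}. copy_weight a (evar e \<in> T)) = (\<Prod>e\<in>{e \<in> ?E. evar e \<in> T}. 1 / real ?n)"
      by (intro prod.cong) (auto simp: copy_weight_def)
    also have "(\<Prod>e\<in>{e \<in> ?E. evar e \<notin> T}. copy_weight a (evar e \<in> T)) = (\<Prod>e\<in>{e \<in> ?E. evar e \<notin> T}. 1 / real ?m)"
      by (intro prod.cong) (auto simp: copy_weight_def)
    finally show ?thesis by simp
  qed
  have w: "(\<Prod>\<gamma>\<in>B. planted_weight a T \<gamma>) = (\<Prod>c<d * a. real (free_slots T ?E c) / real k) * ((1 / real ?n) ^ ?e1 * (1 / real ?m) ^ ?e2)"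
    unfolding planted_weight_def prod.distrib slots U(7)[symmetric] hq ..
  have c1: "real (card {\<sigma> \<in> Mt a. sat a \<sigma> T \<and> ext \<sigma> ?E}) = (\<Prod>c<d * a. real (free_slots T ?E c)) * fact (?n - ?e1) * fact (?m - ?e2)"
    unfolding ext_def card_sat_extending[OF T' U(1-3)] by simp
  have c2: "real (card {\<sigma> \<in> Mt a. sat a \<sigma> T}) = real k ^ ?n * fact ?n * fact ?m"
    unfolding card_sat[OF T'] by simp
  have pd: "(\<Prod>c<d * a. real (free_slots T ?E c) / real k) = (\<Prod>c<d * a. real (free_slots T ?E c)) / real k ^ ?n"
    by (simp add: prod_dividef)
  have "planted_pr a T ?E = (\<Prod>c<d * a. real (free_slots T ?E c)) / real k ^ ?n * (fact (?n - ?e1) / fact ?n) * (fact (?m - ?e2) / fact ?m)"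
    unfolding planted_pr_def c1 c2 by (simp add: field_simps)
  also have "\<dots> = fall_ratio ?n ?e1 * fall_ratio ?m ?e2 * (\<Prod>\<gamma>\<in>B. planted_weight a T \<gamma>)"
    unfolding w pd fall_ratio_mult[OF n, symmetric] fall_ratio_mult[OF m, symmetric] by (simp only: mult_ac)
  finally show ?thesis .
qed

lemma fall_factor_tendsto:
  assumes "c > 0"
  shows "(\<lambda>a. (real (c * a) / (real (c * a) - real M)) ^ M) \<longlonglongrightarrow> 1"
proof -
  have "(\<lambda>a. real (c * a) / (real (c * a) - real M)) \<longlonglongrightarrow> 1"
    using assms by real_asymp
  from tendsto_power[OF this, of M] show ?thesis by simp
qed

text \<open>The bridge from exact counts to the Poisson limit, used for both distributions: a
  relative error \<open>\<epsilon> a\<close>, uniform over the families, is negligible because the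
  sum of the absolute weights converges. The factor \<open>x\<close> depends on a cycle only through
  its number of edges \<open>2 * l\<close>, so it can be taken out length by length.\<close>

lemma fam_prob_tendsto:
  fixes Pr :: "nat \<Rightarrow> edge set \<Rightarrow> real"
  assumes w: "\<And>a l \<gamma>. a > 0 \<Longrightarrow> l \<in> {1..L} \<Longrightarrow> \<gamma> \<in> cycs a l \<Longrightarrow> 0 \<le> w a \<gamma> \<and> w a \<gamma> \<le> (1 / (real a)\<^sup>2) ^ l"
    and lim: "\<And>l. l \<in> {1..L} \<Longrightarrow> (\<lambda>a. \<Sum>\<gamma>\<in>cycs a l. w a \<gamma>) \<longlonglongrightarrow> lam l"
    and Pr: "eventually (\<lambda>a. \<forall>B\<in>fams a L j. \<bar>Pr a (\<Union>B) - (\<Prod>\<gamma>\<in>B. w a \<gamma>)\<bar> \<le> \<epsilon> a * (\<Prod>\<gamma>\<in>B. w a \<gamma>)) sequentially"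
    and \<epsilon>: "\<epsilon> \<longlonglongrightarrow> 0"
  shows "(\<lambda>a. \<Sum>B\<in>fams a L j. Pr a (\<Union>B) * (\<Prod>\<gamma>\<in>B. x (card \<gamma>))) \<longlonglongrightarrow> (\<Sum>l=1..L. x (2 * l) * lam l) ^ j / fact j"
proof -
  \<comment> \<open>The bounds on the weights are assumed for \<open>a > 0\<close> only, whereas
    \<open>fam_sum_tendsto\<close> asks for all indices; at 0 there is no cycle.\<close>
  have C0: "Cyc 0 L = {}"
  proof -
    have "rooted 0 l = {}" if "l > 0" for l
    proof (rule equals0I)
      fix rs assume "rs \<in> rooted 0 l"
      then have "rs ! 0 \<in> steps 0" using nth_steps[OF that] that by simp
      then show False by (auto simp: steps_def)
    qed
    then show ?thesis by (auto simp: Cyc_def cycs_def)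
  qed
  have w0: "0 \<le> w a \<gamma>" if "\<gamma> \<in> Cyc a L" for a \<gamma>
    using that w[of a _ \<gamma>] C0 by (cases "a = 0") (auto simp: Cyc_def)
  have s: "(\<lambda>a. \<Sum>\<gamma>\<in>Cyc a L. y (card \<gamma>) * w a \<gamma>) \<longlonglongrightarrow> (\<Sum>l=1..L. y (2 * l) * lam l)" for y :: "nat \<Rightarrow> real"
  proof -
    have "(\<Sum>\<gamma>\<in>Cyc a L. y (card \<gamma>) * w a \<gamma>) = (\<Sum>l=1..L. y (2 * l) * (\<Sum>\<gamma>\<in>cycs a l. w a \<gamma>))" for a
      unfolding sum_Cyc sum_distrib_left
    proof (intro sum.cong refl)
      fix l \<gamma> assume "l \<in> {1..L}" "\<gamma> \<in> cycs a l"
      then have "card \<gamma> = 2 * l" by (intro cycs_card) auto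
      then show "y (card \<gamma>) * w a \<gamma> = y (2 * l) * w a \<gamma>" by simp
    qed
    then show ?thesis by (simp only:) (intro tendsto_intros lim)
  qed
  define z where "z a \<gamma> = x (card \<gamma>) * w a \<gamma>" for a \<gamma>
  have zabs: "\<bar>z a \<gamma>\<bar> = \<bar>x (card \<gamma>)\<bar> * w a \<gamma>" if "\<gamma> \<in> Cyc a L" for a \<gamma>
    using w0[OF that] by (simp add: z_def abs_mult)
  have "(\<lambda>a. \<Sum>\<gamma>\<in>Cyc a L. \<bar>z a \<gamma>\<bar>) \<longlonglongrightarrow> (\<Sum>l=1..L. \<bar>x (2 * l)\<bar> * lam l)"
    using s[of "\<lambda>n. \<bar>x n\<bar>"] zabs by simp
  then have "Bseq (\<lambda>a. \<Sum>\<gamma>\<in>Cyc a L. \<bar>z a \<gamma>\<bar>)" by (rule convergent_imp_Bseq[OF convergentI])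
  then obtain Z where Z: "\<And>a. (\<Sum>\<gamma>\<in>Cyc a L. \<bar>z a \<gamma>\<bar>) \<le> Z" unfolding Bseq_def real_norm_def by (meson abs_le_D1)
  define X0 where "X0 = (\<Sum>n\<le>2 * L. \<bar>x n\<bar>)"
  have X0: "\<bar>x (card \<gamma>)\<bar> \<le> X0" if "\<gamma> \<in> Cyc a L" for a \<gamma>
    unfolding X0_def using Cyc_props(4)[OF that] by (intro member_le_sum) auto
  have X00: "X0 \<ge> 0" unfolding X0_def by (intro sum_nonneg) auto
  define CC where "CC = (\<Sum>l=1..L. real (l * (2 * L)) * real step_bound ^ l)"
  \<comment> \<open>Used twice: with the signed weights for the limit itself, and with their
    absolute values to control the error.\<close>
  have fs: "(\<lambda>a. fam_sum (Cyc a L) meets (y a) j) \<longlonglongrightarrow> t ^ j / fact j"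
    if y: "\<And>a \<gamma>. \<gamma> \<in> Cyc a L \<Longrightarrow> \<bar>y a \<gamma>\<bar> = \<bar>z a \<gamma>\<bar>" and t: "(\<lambda>a. \<Sum>\<gamma>\<in>Cyc a L. y a \<gamma>) \<longlonglongrightarrow> t" for y t
  proof (rule fam_sum_tendsto[where Z = Z and \<kappa> = "\<lambda>a. X0 * (CC / real a)"])
    show "(\<Sum>\<gamma>\<in>Cyc a L. \<bar>y a \<gamma>\<bar>) \<le> Z" for a using Z[of a] y by simp
    show "(\<lambda>a. X0 * (CC / real a)) \<longlonglongrightarrow> 0" by real_asymp
    show "0 \<le> X0 * (CC / real a)" for a using X00 unfolding CC_def by (intro mult_nonneg_nonneg divide_nonneg_nonneg sum_nonneg) auto
    fix a \<gamma> assume g: "\<gamma> \<in> Cyc a L"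
    then have a: "a > 0" using C0 by (cases "a = 0") auto
    have "(\<Sum>\<gamma>'\<in>{\<gamma>' \<in> Cyc a L. meets \<gamma> \<gamma>'}. \<bar>y a \<gamma>'\<bar>) \<le> (\<Sum>\<gamma>'\<in>{\<gamma>' \<in> Cyc a L. meets \<gamma> \<gamma>'}. X0 * w a \<gamma>')"
      using y zabs X0 w0 by (intro sum_mono) (auto intro!: mult_right_mono)
    also have "\<dots> = X0 * (\<Sum>\<gamma>'\<in>{\<gamma>' \<in> Cyc a L. meets \<gamma> \<gamma>'}. w a \<gamma>')" by (simp add: sum_distrib_left)
    also have "\<dots> \<le> X0 * (CC / real a)"
      unfolding CC_def by (intro mult_left_mono[OF _ X00] conflict_weight_le[OF a g]) (use w[OF a] in blast)
    finally show "(\<Sum>\<gamma>'\<in>{\<gamma>' \<in> Cyc a L. meets \<gamma> \<gamma>'}. \<bar>y a \<gamma>'\<bar>) \<le> X0 * (CC / real a)" .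
  qed (use t meets_sym meets_refl in auto)
  have main: "(\<lambda>a. fam_sum (Cyc a L) meets (z a) j) \<longlonglongrightarrow> (\<Sum>l=1..L. x (2 * l) * lam l) ^ j / fact j"
    using s[of x] by (intro fs) (auto simp: z_def)
  have mainabs: "(\<lambda>a. fam_sum (Cyc a L) meets (\<lambda>\<gamma>. \<bar>z a \<gamma>\<bar>) j) \<longlonglongrightarrow> (\<Sum>l=1..L. \<bar>x (2 * l)\<bar> * lam l) ^ j / fact j"
    using \<open>(\<lambda>a. \<Sum>\<gamma>\<in>Cyc a L. \<bar>z a \<gamma>\<bar>) \<longlonglongrightarrow> (\<Sum>l=1..L. \<bar>x (2 * l)\<bar> * lam l)\<close> by (intro fs) auto
  let ?S = "\<lambda>a. \<Sum>B\<in>fams a L j. Pr a (\<Union>B) * (\<Prod>\<gamma>\<in>B. x (card \<gamma>))"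
  have "eventually (\<lambda>a. norm (?S a - fam_sum (Cyc a L) meets (z a) j) \<le> \<epsilon> a * fam_sum (Cyc a L) meets (\<lambda>\<gamma>. \<bar>z a \<gamma>\<bar>) j) sequentially"
    using Pr
  proof eventually_elim
    case (elim a)
    have "?S a - fam_sum (Cyc a L) meets (z a) j = (\<Sum>B\<in>fams a L j. (Pr a (\<Union>B) - (\<Prod>\<gamma>\<in>B. w a \<gamma>)) * (\<Prod>\<gamma>\<in>B. x (card \<gamma>)))"
      unfolding fam_sum_def z_def prod.distrib left_diff_distrib sum_subtractf by (simp add: mult.commute)
    also have "\<bar>\<dots>\<bar> \<le> (\<Sum>B\<in>fams a L j. \<epsilon> a * (\<Prod>\<gamma>\<in>B. \<bar>z a \<gamma>\<bar>))"
    proof (rule order_trans[OF sum_abs sum_mono])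
      fix B assume B: "B \<in> fams a L j"
      have "\<bar>(Pr a (\<Union>B) - (\<Prod>\<gamma>\<in>B. w a \<gamma>)) * (\<Prod>\<gamma>\<in>B. x (card \<gamma>))\<bar> \<le> \<epsilon> a * (\<Prod>\<gamma>\<in>B. w a \<gamma>) * (\<Prod>\<gamma>\<in>B. \<bar>x (card \<gamma>)\<bar>)"
        unfolding abs_mult abs_prod using elim B by (intro mult_right_mono prod_nonneg) auto
      also have "\<dots> = \<epsilon> a * (\<Prod>\<gamma>\<in>B. \<bar>x (card \<gamma>)\<bar> * w a \<gamma>)" by (simp add: prod.distrib mult_ac)
      also have "(\<Prod>\<gamma>\<in>B. \<bar>x (card \<gamma>)\<bar> * w a \<gamma>) = (\<Prod>\<gamma>\<in>B. \<bar>z a \<gamma>\<bar>)"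
        using fams_D[OF B] zabs by (intro prod.cong) auto
      finally show "\<bar>(Pr a (\<Union>B) - (\<Prod>\<gamma>\<in>B. w a \<gamma>)) * (\<Prod>\<gamma>\<in>B. x (card \<gamma>))\<bar> \<le> \<epsilon> a * (\<Prod>\<gamma>\<in>B. \<bar>z a \<gamma>\<bar>)" .
    qed
    finally show ?case by (simp add: fam_sum_def sum_distrib_left)
  qed
  moreover have "(\<lambda>a. \<epsilon> a * fam_sum (Cyc a L) meets (\<lambda>\<gamma>. \<bar>z a \<gamma>\<bar>) j) \<longlonglongrightarrow> 0"
    using tendsto_mult[OF \<epsilon> mainabs] by simp
  ultimately have "(\<lambda>a. ?S a - fam_sum (Cyc a L) meets (z a) j) \<longlonglongrightarrow> 0" by (rule Lim_null_comparison)
  from tendsto_add[OF this main] show ?thesis by simp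
qed

text \<open>The limit of the expected number of cycles with \<open>2 * l\<close> edges, and below it
  its planted counterpart. The divisor \<open>2 * l\<close> removes the choice of root and
  direction.\<close>

definition cycle_rate :: "nat \<Rightarrow> real" where "cycle_rate l = ((real d - 1) * (real k - 1)) ^ l / (2 * real l)"
definition planted_cycle_rate :: "nat \<Rightarrow> real" where "planted_cycle_rate l = (real d - 1) ^ l * ((real k - 1) ^ l + (- 1) ^ l) / (2 * real l)"

lemma pr_ext_fam_tendsto:
  "(\<lambda>a. \<Sum>B\<in>fams a L j. pr_ext a (\<Union>B) * (\<Prod>\<gamma>\<in>B. x (card \<gamma>))) \<longlonglongrightarrow> (\<Sum>l=1..L. x (2 * l) * cycle_rate l) ^ j / fact j"
proof (rule fam_prob_tendsto)
  let ?M = "2 * L * j"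
  let ?e = "\<lambda>a. (real (d * k * a) / (real (d * k * a) - real ?M)) ^ ?M - 1"
  show "?e \<longlonglongrightarrow> 0" using tendsto_diff[OF fall_factor_tendsto[of "d * k" ?M] tendsto_const[of 1]] d_pos k_gt by simp
  show "\<And>l. l \<in> {1..L} \<Longrightarrow> (\<lambda>a. \<Sum>\<gamma>\<in>cycs a l. uniform_weight a \<gamma>) \<longlonglongrightarrow> cycle_rate l" unfolding cycle_rate_def by (rule sum_uniform_weight_tendsto) simp
  show "eventually (\<lambda>a. \<forall>B\<in>fams a L j. \<bar>pr_ext a (\<Union>B) - (\<Prod>\<gamma>\<in>B. uniform_weight a \<gamma>)\<bar> \<le> ?e a * (\<Prod>\<gamma>\<in>B. uniform_weight a \<gamma>)) sequentially"
    using eventually_gt_at_top[of ?M]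
  proof eventually_elim
    case (elim a)
    show ?case
    proof
      fix B assume B: "B \<in> fams a L j"
      have "1 * a \<le> d * k * a" using d_pos k_gt by (intro mult_right_mono) auto
      then have M: "?M < d * k * a" using elim by linarith
      note fb = fall_ratio_bounds[OF fams_Union(6)[OF B] M]
      have w: "(\<Prod>\<gamma>\<in>B. uniform_weight a \<gamma>) \<ge> 0" by (intro prod_nonneg) (simp add: uniform_weight_def)
      have a: "a > 0" using elim by simp
      have "pr_ext a (\<Union>B) - (\<Prod>\<gamma>\<in>B. uniform_weight a \<gamma>) = (fall_ratio (d * k * a) (card (\<Union>B)) - 1) * (\<Prod>\<gamma>\<in>B. uniform_weight a \<gamma>)"
        unfolding pr_ext_fam[OF B a] by (simp add: left_diff_distrib)
      then show "\<bar>pr_ext a (\<Union>B) - (\<Prod>\<gamma>\<in>B. uniform_weight a \<gamma>)\<bar> \<le> ?e a * (\<Prod>\<gamma>\<in>B. uniform_weight a \<gamma>)"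
        using fb w by (simp only: abs_mult abs_of_nonneg[OF w]) (intro mult_right_mono, auto)
    qed
  qed
qed (use uniform_weight_bounds in auto)

lemma planted_pr_fam_tendsto:
  assumes T: "\<And>a. T a \<in> balanced_sets a"
  shows "(\<lambda>a. \<Sum>B\<in>fams a L j. planted_pr a (T a) (\<Union>B) * (\<Prod>\<gamma>\<in>B. x (card \<gamma>))) \<longlonglongrightarrow> (\<Sum>l=1..L. x (2 * l) * planted_cycle_rate l) ^ j / fact j"
proof (rule fam_prob_tendsto)
  let ?M = "2 * L * j"
  have dk: "d * k * a - d * a = d * (k - 1) * a" for a by (simp add: diff_mult_distrib diff_mult_distrib2)
  let ?e = "\<lambda>a. (real (d * a) / (real (d * a) - real ?M)) ^ ?M * (real (d * (k - 1) * a) / (real (d * (k - 1) * a) - real ?M)) ^ ?M - 1"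
  show "?e \<longlonglongrightarrow> 0"
    using tendsto_diff[OF tendsto_mult[OF fall_factor_tendsto[of "d" ?M] fall_factor_tendsto[of "d * (k - 1)" ?M]] tendsto_const[of 1]] d_pos k_gt by simp
  show "\<And>l. l \<in> {1..L} \<Longrightarrow> (\<lambda>a. \<Sum>\<gamma>\<in>cycs a l. planted_weight a (T a) \<gamma>) \<longlonglongrightarrow> planted_cycle_rate l"
    unfolding planted_cycle_rate_def using T by (intro sum_planted_weight_tendsto) auto
  show "eventually (\<lambda>a. \<forall>B\<in>fams a L j. \<bar>planted_pr a (T a) (\<Union>B) - (\<Prod>\<gamma>\<in>B. planted_weight a (T a) \<gamma>)\<bar> \<le> ?e a * (\<Prod>\<gamma>\<in>B. planted_weight a (T a) \<gamma>)) sequentially"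
    using eventually_gt_at_top[of ?M]
  proof eventually_elim
    case (elim a)
    show ?case
    proof
      fix B assume B: "B \<in> fams a L j"
      have a: "a > 0" using elim by simp
      have "1 * a \<le> d * a" "1 * a \<le> d * (k - 1) * a" using d_pos k_gt by (auto intro!: mult_right_mono)
      then have M: "?M < d * a" "?M < d * k * a - d * a" unfolding dk using elim by linarith+
      let ?e1 = "card {e \<in> \<Union>B. evar e \<in> T a}" and ?e2 = "card {e \<in> \<Union>B. evar e \<notin> T a}"
      have e: "?e1 \<le> ?M" "?e2 \<le> ?M"
      proof -
        have le: "card {e \<in> \<Union>B. P e} \<le> ?M" for P
          by (rule order_trans[OF card_mono[OF fams_Union(4)[OF B]] fams_Union(6)[OF B]]) blast
        show "?e1 \<le> ?M" "?e2 \<le> ?M" by (rule le)+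
      qed
      note f1 = fall_ratio_bounds[OF e(1) M(1)] and f2 = fall_ratio_bounds[OF e(2) M(2)]
      have w: "(\<Prod>\<gamma>\<in>B. planted_weight a (T a) \<gamma>) \<ge> 0"
        using fams_D[OF B] planted_weight_bounds(1)[OF a] by (intro prod_nonneg) (auto simp: Cyc_def)
      have p: "fall_ratio (d * a) ?e1 * fall_ratio (d * k * a - d * a) ?e2 - 1 \<le> ?e a"
        using f1 f2 unfolding dk by (intro diff_right_mono mult_mono) auto
      have q: "1 * 1 \<le> fall_ratio (d * a) ?e1 * fall_ratio (d * k * a - d * a) ?e2"
        using f1 f2 by (intro mult_mono) auto
      have "planted_pr a (T a) (\<Union>B) - (\<Prod>\<gamma>\<in>B. planted_weight a (T a) \<gamma>) = (fall_ratio (d * a) ?e1 * fall_ratio (d * k * a - d * a) ?e2 - 1) * (\<Prod>\<gamma>\<in>B. planted_weight a (T a) \<gamma>)"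
        unfolding planted_pr_fam[OF B a T] by (simp add: left_diff_distrib)
      then show "\<bar>planted_pr a (T a) (\<Union>B) - (\<Prod>\<gamma>\<in>B. planted_weight a (T a) \<gamma>)\<bar> \<le> ?e a * (\<Prod>\<gamma>\<in>B. planted_weight a (T a) \<gamma>)"
        using p q w by (simp only: abs_mult abs_of_nonneg[OF w]) (intro mult_right_mono, auto)
    qed
  qed
qed (use planted_weight_bounds in auto)

section \<open>Overlapping cycles have more edges than vertices\<close>

lemma edges_by_var: "finite U \<Longrightarrow> card U = (\<Sum>v\<in>edge_vars U. card {e \<in> U. evar e = v})"
  using sum.image_gen[of U "\<lambda>_. 1::nat" evar] by (simp add: edge_vars_def)

lemma edges_by_cl: "finite U \<Longrightarrow> card U = (\<Sum>c\<in>edge_cls U. card {e \<in> U. ecl e = c})"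
  using sum.image_gen[of U "\<lambda>_. 1::nat" ecl] by (simp add: edge_cls_def)

text \<open>A common vertex yields a common edge, since the edges there agree. From this edge one
  walks round \<open>\<gamma>'\<close>: every vertex reached is common, so the next edge lies in
  \<open>\<gamma>\<close> again.\<close>

lemma cycles_eq_if_partners_agree:
  assumes g: "\<gamma> \<in> Cyc a L" "\<gamma>' \<in> Cyc a L" and meets: "meets \<gamma> \<gamma>'"
    and v: "\<And>v. v \<in> edge_vars \<gamma> \<Longrightarrow> v \<in> edge_vars \<gamma>' \<Longrightarrow> {e \<in> \<gamma>. evar e = v} = {e \<in> \<gamma>'. evar e = v}"
    and c: "\<And>c. c \<in> edge_cls \<gamma> \<Longrightarrow> c \<in> edge_cls \<gamma>' \<Longrightarrow> {e \<in> \<gamma>. ecl e = c} = {e \<in> \<gamma>'. ecl e = c}"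
  shows "\<gamma>' \<subseteq> \<gamma>"
proof -
  obtain l rs where l: "0 < l" and r: "rs \<in> rooted a l" and g': "\<gamma>' = cyc_edges rs" using g(2) by (rule Cyc_cases)
  note A = l r
  obtain e where e: "e \<in> \<gamma>" "e \<in> \<gamma>'"
  proof -
    from meets consider v where "v \<in> edge_vars \<gamma>" "v \<in> edge_vars \<gamma>'" | c where "c \<in> edge_cls \<gamma>" "c \<in> edge_cls \<gamma>'"
      by (auto simp: meets_def)
    then show thesis
    proof cases
      case 1
      then obtain e where "e \<in> \<gamma>" "evar e = v" by (auto simp: edge_vars_def)
      moreover from this have "e \<in> {e \<in> \<gamma>'. evar e = v}" using v[OF 1] by blast
      ultimately show thesis using that by blast
    next
      case 2
      then obtain e where "e \<in> \<gamma>" "ecl e = c" by (auto simp: edge_cls_def)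
      moreover from this have "e \<in> {e \<in> \<gamma>'. ecl e = c}" using c[OF 2] by blast
      ultimately show thesis using that by blast
    qed
  qed
  show ?thesis
    unfolding g'
  proof (rule cyc_connected[OF A])
    show "e \<in> cyc_edges rs" "e \<in> \<gamma>" using e g' by auto
    fix t assume t: "t < l"
    show "ie l rs t \<in> \<gamma>" if o: "oe rs t \<in> \<gamma>"
    proof -
      have ie: "ie l rs t \<in> \<gamma>'" and oe: "oe rs t \<in> \<gamma>'" unfolding g' using ie_mem[OF A t] oe_mem[OF A t] by auto
      have eq: "ecl (ie l rs t) = ecl (oe rs t)" by (simp add: in_edge_def out_edge_def)
      have "ecl (oe rs t) \<in> edge_cls \<gamma>" "ecl (oe rs t) \<in> edge_cls \<gamma>'" using o oe by (auto simp: edge_cls_def)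
      from c[OF this] show ?thesis using ie eq by blast
    qed
    show "oe rs (Suc t mod l) \<in> \<gamma>" if o: "ie l rs t \<in> \<gamma>"
    proof -
      have ie: "ie l rs t \<in> \<gamma>'" and oe: "oe rs (Suc t mod l) \<in> \<gamma>'" unfolding g' using ie_mem[OF A t] oe_mem[OF A Sm[OF A]] by auto
      have eq: "evar (oe rs (Suc t mod l)) = evar (ie l rs t)" by (simp add: in_edge_def out_edge_def)
      have "evar (ie l rs t) \<in> edge_vars \<gamma>" "evar (ie l rs t) \<in> edge_vars \<gamma>'" using o ie by (auto simp: edge_vars_def)
      from v[OF this] show ?thesis using oe eq by blast
    qed
  qed
qed

text \<open>In a union of cycles every vertex has degree at least 2. Counting edges once by
  variables and once by clauses gives at least as many edges as vertices, with equality only if all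
  degrees are 2. In that case the cycles through a common vertex use the same two edges there, so
  meeting cycles coincide.\<close>

lemma overlap_excess:
  assumes S: "S \<subseteq> Cyc a L" "finite S" and g: "\<gamma> \<in> S" "\<gamma>' \<in> S" "\<gamma> \<noteq> \<gamma>'" "meets \<gamma> \<gamma>'"
  shows "card (edge_vars (\<Union>S)) + card (edge_cls (\<Union>S)) < card (\<Union>S)"
proof (rule ccontr)
  let ?U = "\<Union>S"
  assume "\<not> ?thesis"
  then have le: "card ?U \<le> card (edge_vars ?U) + card (edge_cls ?U)" by simp
  have U: "finite ?U" using S Cyc_finite_edges by blast
  have dv: "2 \<le> card {e \<in> ?U. evar e = v}" if v: "v \<in> edge_vars ?U" for v
  proof -
    obtain \<delta> where d: "\<delta> \<in> S" "v \<in> edge_vars \<delta>" using v by (auto simp: edge_vars_def)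
    then have "card {e \<in> \<delta>. evar e = v} = 2" using Cyc_props(6) S by blast
    moreover have "card {e \<in> \<delta>. evar e = v} \<le> card {e \<in> ?U. evar e = v}"
    proof (rule card_mono)
      show "finite {e \<in> ?U. evar e = v}" by (rule finite_subset[OF _ U]) blast
    qed (use d in blast)
    ultimately show ?thesis by simp
  qed
  have dc: "2 \<le> card {e \<in> ?U. ecl e = c}" if c: "c \<in> edge_cls ?U" for c
  proof -
    obtain \<delta> where d: "\<delta> \<in> S" "c \<in> edge_cls \<delta>" using c by (auto simp: edge_cls_def)
    then have "card {e \<in> \<delta>. ecl e = c} = 2" using Cyc_props(7) S by blast
    moreover have "card {e \<in> \<delta>. ecl e = c} \<le> card {e \<in> ?U. ecl e = c}"
    proof (rule card_mono)
      show "finite {e \<in> ?U. ecl e = c}" by (rule finite_subset[OF _ U]) blast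
    qed (use d in blast)
    ultimately show ?thesis by simp
  qed
  have fin: "finite (edge_vars ?U)" "finite (edge_cls ?U)" using U by (auto simp: edge_vars_def edge_cls_def)
  have "(\<Sum>v\<in>edge_vars ?U. 2) \<le> card ?U" unfolding edges_by_var[OF U] using dv by (intro sum_mono)
  moreover have "(\<Sum>c\<in>edge_cls ?U. 2) \<le> card ?U" unfolding edges_by_cl[OF U] using dc by (intro sum_mono)
  ultimately have eqs: "card ?U = 2 * card (edge_vars ?U)" "card ?U = 2 * card (edge_cls ?U)" using le by simp_all
  have dv2: "card {e \<in> ?U. evar e = v} = 2" if v: "v \<in> edge_vars ?U" for v
  proof (rule ccontr)
    assume n: "card {e \<in> ?U. evar e = v} \<noteq> 2"
    have "(\<Sum>v\<in>edge_vars ?U. 2) < (\<Sum>v\<in>edge_vars ?U. card {e \<in> ?U. evar e = v})"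
      by (rule sum_strict_mono_ex1[OF fin(1)]) (use dv n v in \<open>force+\<close>)
    then show False using edges_by_var[OF U] eqs(1) by simp
  qed
  have dc2: "card {e \<in> ?U. ecl e = c} = 2" if c: "c \<in> edge_cls ?U" for c
  proof (rule ccontr)
    assume n: "card {e \<in> ?U. ecl e = c} \<noteq> 2"
    have "(\<Sum>c\<in>edge_cls ?U. 2) < (\<Sum>c\<in>edge_cls ?U. card {e \<in> ?U. ecl e = c})"
      by (rule sum_strict_mono_ex1[OF fin(2)]) (use dc n c in \<open>force+\<close>)
    then show False using edges_by_cl[OF U] eqs(2) by simp
  qed
  have ev: "{e \<in> \<delta>. evar e = v} = {e \<in> ?U. evar e = v}" if "\<delta> \<in> S" "v \<in> edge_vars \<delta>" for \<delta> v
  proof (rule card_subset_eq)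
    show "finite {e \<in> ?U. evar e = v}" by (rule finite_subset[OF _ U]) blast
    show "{e \<in> \<delta>. evar e = v} \<subseteq> {e \<in> ?U. evar e = v}" using that by blast
    have "v \<in> edge_vars ?U" using that by (auto simp: edge_vars_def)
    then show "card {e \<in> \<delta>. evar e = v} = card {e \<in> ?U. evar e = v}" using dv2 Cyc_props(6)[OF subsetD[OF S(1) that(1)] that(2)] by simp
  qed
  have ec: "{e \<in> \<delta>. ecl e = c} = {e \<in> ?U. ecl e = c}" if "\<delta> \<in> S" "c \<in> edge_cls \<delta>" for \<delta> c
  proof (rule card_subset_eq)
    show "finite {e \<in> ?U. ecl e = c}" by (rule finite_subset[OF _ U]) blast
    show "{e \<in> \<delta>. ecl e = c} \<subseteq> {e \<in> ?U. ecl e = c}" using that by blast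
    have "c \<in> edge_cls ?U" using that by (auto simp: edge_cls_def)
    then show "card {e \<in> \<delta>. ecl e = c} = card {e \<in> ?U. ecl e = c}" using dc2 Cyc_props(7)[OF subsetD[OF S(1) that(1)] that(2)] by simp
  qed
  have gC: "\<gamma> \<in> Cyc a L" "\<gamma>' \<in> Cyc a L" using g S by auto
  have "\<gamma>' \<subseteq> \<gamma>"
    by (rule cycles_eq_if_partners_agree[OF gC g(4)]) (simp_all add: ev ec g)
  moreover have "\<gamma> \<subseteq> \<gamma>'"
    by (rule cycles_eq_if_partners_agree[OF gC(2,1) meets_sym[OF g(4)]]) (simp_all add: ev ec g)
  ultimately show False using g(3) by blast
qed

definition edge_sets :: "nat \<Rightarrow> nat \<Rightarrow> nat \<Rightarrow> edge set set" where
  "edge_sets a e w = {U. U \<subseteq> V a \<times> C a \<and> card U = e \<and> card (edge_vars U) + card (edge_cls U) = w}"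

lemma finite_edge_sets [simp]: "finite (edge_sets a e w)"
  by (rule finite_subset[of _ "Pow (V a \<times> C a)"]) (auto simp: edge_sets_def)

text \<open>Choose the \<open>w\<close> vertices, as a subset of the disjoint sum of variables and
  clauses, and then any set of edges between their copies. The second choice has a number of
  possibilities independent of \<open>a\<close>.\<close>

lemma card_edge_sets_le: "card (edge_sets a e w) \<le> ((k + d) * a) ^ w * 2 ^ (w * d * (w * k))"
proof -
  let ?X = "{..<k * a} <+> {..<d * a}"
  let ?SS = "{S. S \<subseteq> ?X \<and> card S = w}"
  let ?G = "\<lambda>S. ({v. Inl v \<in> S} \<times> {..<d}) \<times> ({c. Inr c \<in> S} \<times> {..<k})"
  have fX: "finite ?X" by auto
  have Sf: "finite {v. Inl v \<in> S}" "finite {c. Inr c \<in> S}" "card {v. Inl v \<in> S} \<le> w" "card {c. Inr c \<in> S} \<le> w" if "S \<in> ?SS" for S :: "(nat + nat) set"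
  proof -
    have fS: "finite S" using finite_subset[OF _ fX, of S] that by simp
    have i: "Inl ` {v. Inl v \<in> S} \<subseteq> S" "Inr ` {c. Inr c \<in> S} \<subseteq> S" by auto
    have f: "finite ((Inl :: nat \<Rightarrow> nat + nat) ` {v. Inl v \<in> S})" "finite ((Inr :: nat \<Rightarrow> nat + nat) ` {c. Inr c \<in> S})" using finite_subset[OF i(1) fS] finite_subset[OF i(2) fS] by auto
    show "finite {v. Inl v \<in> S}" "finite {c. Inr c \<in> S}" using f by (auto dest: finite_imageD)
    have "card ((Inl :: nat \<Rightarrow> nat + nat) ` {v. Inl v \<in> S}) \<le> card S" "card ((Inr :: nat \<Rightarrow> nat + nat) ` {c. Inr c \<in> S}) \<le> card S" using card_mono[OF fS i(1)] card_mono[OF fS i(2)] by auto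
    then show "card {v. Inl v \<in> S} \<le> w" "card {c. Inr c \<in> S} \<le> w" using that by (simp_all add: card_image)
  qed
  have "edge_sets a e w \<subseteq> (\<Union>S\<in>?SS. Pow (?G S))"
  proof
    fix U assume U: "U \<in> edge_sets a e w"
    have sub: "U \<subseteq> V a \<times> C a" using U by (simp add: edge_sets_def)
    then have fU: "finite U" by (rule finite_subset) simp
    have "edge_vars U <+> edge_cls U \<subseteq> ?X" using sub by (fastforce simp: edge_vars_def edge_cls_def var_copies_def clause_copies_def)
    moreover have "card (edge_vars U <+> edge_cls U) = w"
      using U fU by (subst card_Plus) (auto simp: edge_sets_def edge_vars_def edge_cls_def)
    ultimately have "edge_vars U <+> edge_cls U \<in> ?SS" by blast
    moreover have "U \<subseteq> ?G (edge_vars U <+> edge_cls U)"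
    proof
      fix e assume e: "e \<in> U"
      then have "e \<in> V a \<times> C a" using sub by blast
      then have "snd (fst e) < d" "snd (snd e) < k" by (auto simp: var_copies_def clause_copies_def)
      moreover have "evar e \<in> edge_vars U" "ecl e \<in> edge_cls U" using e by (auto simp: edge_vars_def edge_cls_def)
      ultimately show "e \<in> ?G (edge_vars U <+> edge_cls U)" by (cases e) auto
    qed
    ultimately show "U \<in> (\<Union>S\<in>?SS. Pow (?G S))" by blast
  qed
  moreover have fin: "finite ?SS" using fX by simp
  moreover have fG: "finite (?G S)" if "S \<in> ?SS" for S using Sf[OF that] by auto
  ultimately have "card (edge_sets a e w) \<le> card (\<Union>S\<in>?SS. Pow (?G S))"
    by (intro card_mono) auto
  also have "\<dots> \<le> (\<Sum>S\<in>?SS. card (Pow (?G S)))" by (rule card_UN_le[OF fin])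
  also have "\<dots> \<le> (\<Sum>S\<in>?SS. 2 ^ (w * d * (w * k)))"
  proof (rule sum_mono)
    fix S assume S: "S \<in> ?SS"
    have "card (?G S) \<le> w * d * (w * k)"
      using Sf(3,4)[OF S] by (simp only: card_cartesian_product card_lessThan) (intro mult_mono, auto)
    then show "card (Pow (?G S)) \<le> 2 ^ (w * d * (w * k))" using fG[OF S] by (simp add: card_Pow)
  qed
  also have "\<dots> = card ?SS * 2 ^ (w * d * (w * k))" by simp
  also have "card ?SS = ((k + d) * a) choose w"
    using fX by (simp add: n_subsets card_Plus add_mult_distrib)
  also have "\<dots> \<le> ((k + d) * a) ^ w"
    by (cases "w \<le> (k + d) * a") (simp_all add: binomial_le_pow binomial_eq_0)
  finally show ?thesis by simp
qed

text \<open>There are \<open>O(a ^ w)\<close> edge sets on \<open>w\<close> vertices, and each set of \<open>e\<close> edges is present with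
  probability \<open>O(a ^ - e)\<close>.\<close>

definition excess_sum :: "nat \<Rightarrow> nat \<Rightarrow> real" where
  "excess_sum a M = (\<Sum>e\<le>M. \<Sum>w<e. \<Sum>U\<in>edge_sets a e w. pr_ext a U)"

lemma excess_sum_tendsto: "(\<lambda>a. excess_sum a M) \<longlonglongrightarrow> 0"
proof -
  have "(\<lambda>a. \<Sum>U\<in>edge_sets a e w. pr_ext a U) \<longlonglongrightarrow> 0" if e: "e \<le> M" and w: "w < e" for e w
  proof -
    let ?c = "real ((k + d) ^ w * 2 ^ (w * d * (w * k)))"
    let ?r = "\<lambda>a. (real (d * k * a) / (real (d * k * a) - real M)) ^ M"
    have "eventually (\<lambda>a. norm (\<Sum>U\<in>edge_sets a e w. pr_ext a U) \<le> ?c * ?r a / real a) sequentially"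
      using eventually_gt_at_top[of M]
    proof eventually_elim
      case (elim a)
      then have a: "a > 0" "real a \<ge> 1" by auto
      have aN: "1 * a \<le> d * k * a" using d_pos k_gt by (intro mult_right_mono) auto
      then have M: "M < d * k * a" using elim by linarith
      note fr = fall_ratio_bounds[OF e M]
      have nz: "real (d * k * a) \<noteq> 0" using a d_pos k_gt by simp
      have pp0: "0 \<le> pr_ext a U" for U by (simp add: pr_ext_def)
      have N: "(1 / real (d * k * a)) ^ e \<le> (1 / real a) ^ e"
      proof (rule power_mono)
        have "real a \<le> real (d * k * a)" using aN by (intro of_nat_mono) simp
        then show "1 / real (d * k * a) \<le> 1 / real a" using a by (intro frac_le) auto
      qed simp
      have "(\<Sum>U\<in>edge_sets a e w. pr_ext a U) \<le> (\<Sum>U\<in>edge_sets a e w. ?r a * (1 / real a) ^ e)"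
      proof (rule sum_mono)
        fix U assume U: "U \<in> edge_sets a e w"
        then have "pr_ext a U \<le> fact (d * k * a - e) / fact (d * k * a)" using pr_ext_le[of U a] by (simp add: edge_sets_def)
        also have "\<dots> = fall_ratio (d * k * a) e * (1 / real (d * k * a)) ^ e" by (rule fall_ratio_mult[OF nz, symmetric])
        also have "\<dots> \<le> ?r a * (1 / real a) ^ e" using fr N by (intro mult_mono) auto
        finally show "pr_ext a U \<le> ?r a * (1 / real a) ^ e" .
      qed
      also have "\<dots> = real (card (edge_sets a e w)) * (?r a * (1 / real a) ^ e)" by simp
      also have "\<dots> \<le> real (((k + d) * a) ^ w * 2 ^ (w * d * (w * k))) * (?r a * (1 / real a) ^ e)"
        using fr by (intro mult_right_mono of_nat_mono card_edge_sets_le) (auto intro!: mult_nonneg_nonneg)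
      also have "\<dots> = ?c * ?r a * (real a ^ w * (1 / real a) ^ e)" by (simp add: power_mult_distrib)
      also have "\<dots> \<le> ?c * ?r a * (1 / real a)"
      proof (rule mult_left_mono)
        obtain n where n: "e = Suc (w + n)" using w less_imp_Suc_add by blast
        have "real a ^ w * (1 / real a) ^ e = (1 / real a) * (1 / real a) ^ n"
          unfolding n using a by (simp add: power_add power_divide)
        also have "\<dots> \<le> (1 / real a) * 1" using a by (intro mult_left_mono power_le_one) auto
        finally show "real a ^ w * (1 / real a) ^ e \<le> 1 / real a" by simp
        show "0 \<le> ?c * ?r a" using fr by (intro mult_nonneg_nonneg) auto
      qed
      finally show ?case using pp0 by (simp add: sum_nonneg)
    qed
    moreover have "(\<lambda>a. ?c * ?r a / real a) \<longlonglongrightarrow> 0"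
    proof -
      have "(\<lambda>a. ?c * ?r a * (1 / real a)) \<longlonglongrightarrow> ?c * 1 * 0"
        by (intro tendsto_mult tendsto_const fall_factor_tendsto lim_1_over_n) (use d_pos k_gt in simp)
      then show ?thesis by simp
    qed
    ultimately show ?thesis by (rule Lim_null_comparison)
  qed
  then have "(\<lambda>a. excess_sum a M) \<longlonglongrightarrow> (\<Sum>e\<le>M. \<Sum>w<e. 0)"
    unfolding excess_sum_def by (intro tendsto_sum) auto
  then show ?thesis by simp
qed

definition bad_pairs :: "nat \<Rightarrow> nat \<Rightarrow> nat \<Rightarrow> nat \<Rightarrow> (edge set set \<times> edge set set) set" where
  "bad_pairs a L i j = {(A, A') \<in> fams a L i \<times> fams a L j. \<exists>\<gamma>\<in>A. \<exists>\<gamma>'\<in>A'. \<gamma> \<noteq> \<gamma>' \<and> meets \<gamma> \<gamma>'}"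

lemma finite_bad_pairs [simp]: "finite (bad_pairs a L i j)"
  by (rule finite_subset[of _ "fams a L i \<times> fams a L j"]) (auto simp: bad_pairs_def)

text \<open>By \<open>overlap_excess\<close> the union \<open>U\<close> of a bad pair is one of the
  sets counted in \<open>excess_sum\<close>. Both families consist of subsets of \<open>U\<close>,
  so with at most \<open>M\<close> edges at most \<open>(2 ^ 2 ^ M) ^ 2\<close> pairs share the same
  union.\<close>

lemma bad_pairs_sum_le:
  fixes L i j :: nat
  defines "M \<equiv> 2 * L * i + 2 * L * j"
  shows "(\<Sum>(A, A')\<in>bad_pairs a L i j. pr_ext a (\<Union>A \<union> \<Union>A')) \<le> (2 ^ 2 ^ M)\<^sup>2 * excess_sum a M"
proof -
  let ?U = "\<lambda>(A, A'). \<Union>A \<union> \<Union>A'"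
  have mem: "\<exists>e\<in>{..M}. \<exists>w\<in>{..<e}. ?U p \<in> edge_sets a e w" if p: "p \<in> bad_pairs a L i j" for p
  proof -
    obtain A A' where pA: "p = (A, A')" by (cases p)
    from p pA obtain \<gamma> \<gamma>' where A: "A \<in> fams a L i" "A' \<in> fams a L j" and g: "\<gamma> \<in> A" "\<gamma>' \<in> A'" "\<gamma> \<noteq> \<gamma>'" "meets \<gamma> \<gamma>'"
      by (auto simp: bad_pairs_def)
    have S: "A \<union> A' \<subseteq> Cyc a L" "finite (A \<union> A')" using fams_D[OF A(1)] fams_D[OF A(2)] by auto
    have un: "\<Union>(A \<union> A') = ?U p" by (auto simp: pA)
    have ex: "card (edge_vars (?U p)) + card (edge_cls (?U p)) < card (?U p)"
      using overlap_excess[OF S _ _ g(3,4)] g unfolding un by blast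
    have "card (?U p) \<le> card (\<Union>A) + card (\<Union>A')" unfolding pA by (simp add: card_Un_le)
    also have "\<dots> \<le> M" unfolding M_def by (intro add_mono fams_Union(6)[OF A(1)] fams_Union(6)[OF A(2)])
    finally have "card (?U p) \<le> M" .
    moreover have "?U p \<subseteq> V a \<times> C a" unfolding pA using fams_Union(1)[OF A(1)] fams_Union(1)[OF A(2)] by blast
    ultimately show ?thesis using ex
      by (intro bexI[of _ "card (?U p)"] bexI[of _ "card (edge_vars (?U p)) + card (edge_cls (?U p))"]) (auto simp: edge_sets_def)
  qed
  let ?E = "\<Union>e\<in>{..M}. \<Union>w\<in>{..<e}. edge_sets a e w"
  have im: "?U ` bad_pairs a L i j \<subseteq> ?E" using mem by blast
  have pp0: "0 \<le> pr_ext a U" for U by (simp add: pr_ext_def)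
  have "(\<Sum>p\<in>bad_pairs a L i j. pr_ext a (?U p)) = (\<Sum>U\<in>?U ` bad_pairs a L i j. \<Sum>p\<in>{p \<in> bad_pairs a L i j. ?U p = U}. pr_ext a (?U p))"
    by (rule sum.image_gen) simp
  also have "\<dots> \<le> (\<Sum>U\<in>?U ` bad_pairs a L i j. (2 ^ 2 ^ M)\<^sup>2 * pr_ext a U)"
  proof (rule sum_mono)
    fix U assume U: "U \<in> ?U ` bad_pairs a L i j"
    then obtain e where e: "e \<le> M" "card U = e" "U \<subseteq> V a \<times> C a" using im by (fastforce simp: edge_sets_def)
    have fU: "finite U" using e(3) by (rule finite_subset) simp
    have "{p \<in> bad_pairs a L i j. ?U p = U} \<subseteq> Pow (Pow U) \<times> Pow (Pow U)" by auto
    then have "card {p \<in> bad_pairs a L i j. ?U p = U} \<le> card (Pow (Pow U) \<times> Pow (Pow U))"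
      using fU by (intro card_mono) auto
    also have "\<dots> = (2 ^ 2 ^ e)\<^sup>2" using fU e(2) by (simp add: card_cartesian_product card_Pow power2_eq_square)
    also have "\<dots> \<le> (2 ^ 2 ^ M)\<^sup>2" using e(1) by (intro power_mono power_increasing) auto
    finally have c: "real (card {p \<in> bad_pairs a L i j. ?U p = U}) \<le> (2 ^ 2 ^ M)\<^sup>2"
      using of_nat_mono by fastforce
    have "(\<Sum>p\<in>{p \<in> bad_pairs a L i j. ?U p = U}. pr_ext a (?U p)) = (\<Sum>p\<in>{p \<in> bad_pairs a L i j. ?U p = U}. pr_ext a U)"
      by (intro sum.cong) auto
    also have "\<dots> = real (card {p \<in> bad_pairs a L i j. ?U p = U}) * pr_ext a U" by simp
    also have "\<dots> \<le> (2 ^ 2 ^ M)\<^sup>2 * pr_ext a U" using c pp0 by (intro mult_right_mono)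
    finally show "(\<Sum>p\<in>{p \<in> bad_pairs a L i j. ?U p = U}. pr_ext a (?U p)) \<le> (2 ^ 2 ^ M)\<^sup>2 * pr_ext a U" .
  qed
  also have "\<dots> = (2 ^ 2 ^ M)\<^sup>2 * (\<Sum>U\<in>?U ` bad_pairs a L i j. pr_ext a U)" by (rule sum_distrib_left[symmetric])
  also have "\<dots> \<le> (2 ^ 2 ^ M)\<^sup>2 * (\<Sum>U\<in>?E. pr_ext a U)"
    using im pp0 by (intro mult_left_mono sum_mono2) auto
  also have "\<dots> \<le> (2 ^ 2 ^ M)\<^sup>2 * excess_sum a M"
  proof (rule mult_left_mono)
    have "(\<Sum>U\<in>?E. pr_ext a U) \<le> (\<Sum>e\<le>M. \<Sum>U\<in>(\<Union>w\<in>{..<e}. edge_sets a e w). pr_ext a U)"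
      using pp0 by (intro sum_UN_le) auto
    also have "\<dots> \<le> excess_sum a M"
      unfolding excess_sum_def using pp0 by (intro sum_mono sum_UN_le) auto
    finally show "(\<Sum>U\<in>?E. pr_ext a U) \<le> excess_sum a M" .
  qed simp
  finally show ?thesis by (simp add: case_prod_beta)
qed

lemma bad_pairs_sum_tendsto: "(\<lambda>a. \<Sum>(A, A')\<in>bad_pairs a L i j. pr_ext a (\<Union>A \<union> \<Union>A')) \<longlonglongrightarrow> 0"
proof (rule Lim_null_comparison)
  let ?M = "2 * L * i + 2 * L * j"
  show "(\<lambda>a. (2 ^ 2 ^ ?M)\<^sup>2 * excess_sum a ?M) \<longlonglongrightarrow> 0"
    using tendsto_mult[OF tendsto_const excess_sum_tendsto] by simp
  have "0 \<le> (\<Sum>(A, A')\<in>bad_pairs a L i j. pr_ext a (\<Union>A \<union> \<Union>A'))" for a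
    by (intro sum_nonneg) (auto simp: pr_ext_def)
  then show "eventually (\<lambda>a. norm (\<Sum>(A, A')\<in>bad_pairs a L i j. pr_ext a (\<Union>A \<union> \<Union>A')) \<le> (2 ^ 2 ^ ?M)\<^sup>2 * excess_sum a ?M) sequentially"
    using bad_pairs_sum_le by (intro always_eventually allI) simp
qed

end

section \<open>Small subgraph conditioning\<close>

text \<open>An element of \<open>B\<close> lies in \<open>A\<close> only, in \<open>A'\<close> only,
  or in both, and contributes \<open>f\<close>, \<open>f\<close> or \<open>f ^ 2\<close>. In the
  proof the pair is encoded by \<open>A\<close> and the intersection \<open>D\<close>.\<close>

lemma sum_covering_pairs:
  fixes f :: "'c \<Rightarrow> real"
  assumes B: "finite B"
  shows "(\<Sum>(A, A')\<in>{(A, A'). A \<subseteq> B \<and> A' \<subseteq> B \<and> A \<union> A' = B}. (\<Prod>\<gamma>\<in>A. f \<gamma>) * (\<Prod>\<gamma>\<in>A'. f \<gamma>))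
     = (\<Prod>\<gamma>\<in>B. 2 * f \<gamma> + (f \<gamma>)\<^sup>2)"
proof -
  have fin: "finite A" if "A \<subseteq> B" for A using that B by (rule finite_subset)
  have "(\<Sum>(A, A')\<in>{(A, A'). A \<subseteq> B \<and> A' \<subseteq> B \<and> A \<union> A' = B}. (\<Prod>\<gamma>\<in>A. f \<gamma>) * (\<Prod>\<gamma>\<in>A'. f \<gamma>))
      = (\<Sum>(A, D)\<in>Sigma (Pow B) Pow. (\<Prod>\<gamma>\<in>A. f \<gamma>) * ((\<Prod>\<gamma>\<in>B - A. f \<gamma>) * (\<Prod>\<gamma>\<in>D. f \<gamma>)))"
  proof (rule sum.reindex_bij_witness[where i = "\<lambda>(A, D). (A, (B - A) \<union> D)" and j = "\<lambda>(A, A'). (A, A' \<inter> A)"])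
    fix p assume p: "p \<in> {(A, A'). A \<subseteq> B \<and> A' \<subseteq> B \<and> A \<union> A' = B}"
    obtain A A' where [simp]: "p = (A, A')" and h: "A \<subseteq> B" "A' \<subseteq> B" "A \<union> A' = B" using p by (cases p) auto
    show "(case case p of (A, A') \<Rightarrow> (A, A' \<inter> A) of (A, D) \<Rightarrow> (A, (B - A) \<union> D)) = p" using h by auto
    show "(case p of (A, A') \<Rightarrow> (A, A' \<inter> A)) \<in> Sigma (Pow B) Pow" using h by auto
    have "A' = (B - A) \<union> (A' \<inter> A)" using h by auto
    then have "(\<Prod>\<gamma>\<in>A'. f \<gamma>) = (\<Prod>\<gamma>\<in>(B - A) \<union> (A' \<inter> A). f \<gamma>)" by simp
    also have "\<dots> = (\<Prod>\<gamma>\<in>B - A. f \<gamma>) * (\<Prod>\<gamma>\<in>A' \<inter> A. f \<gamma>)"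
      using B fin[OF h(1)] by (intro prod.union_disjoint) auto
    finally show "(case case p of (A, A') \<Rightarrow> (A, A' \<inter> A) of (A, D) \<Rightarrow> (\<Prod>\<gamma>\<in>A. f \<gamma>) * ((\<Prod>\<gamma>\<in>B - A. f \<gamma>) * (\<Prod>\<gamma>\<in>D. f \<gamma>)))
        = (case p of (A, A') \<Rightarrow> (\<Prod>\<gamma>\<in>A. f \<gamma>) * (\<Prod>\<gamma>\<in>A'. f \<gamma>))" by simp
  next
    fix p assume p: "p \<in> Sigma (Pow B) Pow"
    obtain A D where [simp]: "p = (A, D)" and h: "A \<subseteq> B" "D \<subseteq> A" using p by (cases p) auto
    show "(case case p of (A, D) \<Rightarrow> (A, (B - A) \<union> D) of (A, A') \<Rightarrow> (A, A' \<inter> A)) = p" using h by auto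
    show "(case p of (A, D) \<Rightarrow> (A, (B - A) \<union> D)) \<in> {(A, A'). A \<subseteq> B \<and> A' \<subseteq> B \<and> A \<union> A' = B}" using h by auto
  qed
  also have "\<dots> = (\<Sum>A\<in>Pow B. \<Sum>D\<in>Pow A. (\<Prod>\<gamma>\<in>A. f \<gamma>) * ((\<Prod>\<gamma>\<in>B - A. f \<gamma>) * (\<Prod>\<gamma>\<in>D. f \<gamma>)))"
    using B fin by (intro sum.Sigma[symmetric]) auto
  also have "\<dots> = (\<Sum>A\<in>Pow B. (\<Prod>\<gamma>\<in>A. f \<gamma> * (1 + f \<gamma>)) * (\<Prod>\<gamma>\<in>B - A. f \<gamma>))"
  proof (intro sum.cong refl)
    fix A assume "A \<in> Pow B"
    then have A: "finite A" using fin by auto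
    have "(\<Prod>\<gamma>\<in>A. f \<gamma> + 1) = (\<Sum>D\<in>Pow A. (\<Prod>\<gamma>\<in>D. f \<gamma>) * (\<Prod>\<gamma>\<in>A - D. 1))" by (rule prod_add[OF A])
    then have "(\<Prod>\<gamma>\<in>A. 1 + f \<gamma>) = (\<Sum>D\<in>Pow A. \<Prod>\<gamma>\<in>D. f \<gamma>)" by (simp add: add.commute)
    then show "(\<Sum>D\<in>Pow A. (\<Prod>\<gamma>\<in>A. f \<gamma>) * ((\<Prod>\<gamma>\<in>B - A. f \<gamma>) * (\<Prod>\<gamma>\<in>D. f \<gamma>))) = (\<Prod>\<gamma>\<in>A. f \<gamma> * (1 + f \<gamma>)) * (\<Prod>\<gamma>\<in>B - A. f \<gamma>)"
      by (simp add: prod.distrib sum_distrib_left[symmetric])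
  qed
  also have "\<dots> = (\<Prod>\<gamma>\<in>B. f \<gamma> * (1 + f \<gamma>) + f \<gamma>)" by (rule prod_add[OF B, symmetric])
  also have "\<dots> = (\<Prod>\<gamma>\<in>B. 2 * f \<gamma> + (f \<gamma>)\<^sup>2)" by (intro prod.cong refl) (simp add: algebra_simps power2_eq_square)
  finally show ?thesis .
qed

context regular_cover
begin

lemma avg_sum: "avg a (\<lambda>\<sigma>. \<Sum>i\<in>I. f i \<sigma>) = (\<Sum>i\<in>I. avg a (f i))"
  unfolding avg_def sum_divide_distrib[symmetric] by (subst sum.swap) (rule refl)

lemma avg_cmult: "avg a (\<lambda>\<sigma>. c * f \<sigma>) = c * avg a f"
  by (simp add: avg_def sum_distrib_left)

lemma avg_add: "avg a (\<lambda>\<sigma>. f \<sigma> + g \<sigma>) = avg a f + avg a g"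
  by (simp add: avg_def sum.distrib add_divide_distrib)

lemma avg_diff: "avg a (\<lambda>\<sigma>. f \<sigma> - g \<sigma>) = avg a f - avg a g"
  by (simp add: avg_def sum_subtractf diff_divide_distrib)

lemma avg_const: "avg a (\<lambda>\<sigma>. c) = c"
  by (simp add: avg_def card_Mt)

lemma avg_mono: "(\<And>\<sigma>. \<sigma> \<in> Mt a \<Longrightarrow> f \<sigma> \<le> g \<sigma>) \<Longrightarrow> avg a f \<le> avg a g"
  unfolding avg_def by (intro divide_right_mono sum_mono) auto

lemma avg_ext: "avg a (\<lambda>\<sigma>. of_bool (ext \<sigma> E)) = pr_ext a E"
  by (simp only: avg_of_bool pr_ext_def)

lemma markov:
  assumes t: "t > 0" and f: "\<And>\<sigma>. \<sigma> \<in> Mt a \<Longrightarrow> 0 \<le> f \<sigma>"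
  shows "avg a (\<lambda>\<sigma>. of_bool (f \<sigma> \<ge> t)) \<le> avg a f / t"
proof -
  have "avg a (\<lambda>\<sigma>. of_bool (f \<sigma> \<ge> t)) \<le> avg a (\<lambda>\<sigma>. (1 / t) * f \<sigma>)"
  proof (rule avg_mono)
    fix \<sigma> assume "\<sigma> \<in> Mt a"
    then show "of_bool (f \<sigma> \<ge> t) \<le> (1 / t) * f \<sigma>" using f[of \<sigma>] t by (cases "f \<sigma> \<ge> t") (auto simp: field_simps)
  qed
  then show ?thesis unfolding avg_cmult by simp
qed

text \<open>Planting a satisfying assignment multiplies the expected number of cycles of length \<open>2 l\<close> by
  \<open>1 + cycle_bias (2 l)\<close>, as a comparison of \<open>planted_cycle_rate\<close> with \<open>cycle_rate\<close> shows.\<close>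

definition cycle_bias :: "nat \<Rightarrow> real" where "cycle_bias n = (- 1 / (real k - 1)) ^ (n div 2)"
text \<open>In the Poisson limit \<open>mean_log\<close> and \<open>var_log\<close> are mean and
  variance of the sum of \<open>cycle_bias\<close> over the cycles present. Correspondingly the
  product of \<open>1 + cycle_bias\<close> has mean \<open>exp (mean_log L)\<close> and its square
  has mean \<open>exp (2 * mean_log L + var_log L)\<close>.\<close>

definition mean_log :: "nat \<Rightarrow> real" where "mean_log L = (\<Sum>l=1..L. (- (real d - 1)) ^ l / (2 * real l))"
definition var_log :: "nat \<Rightarrow> real" where "var_log L = (\<Sum>l=1..L. ((real d - 1) / (real k - 1)) ^ l / (2 * real l))"

lemma cycle_bias_even: "cycle_bias (2 * l) = (- 1 / (real k - 1)) ^ l" by (simp add: cycle_bias_def)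

lemma cycle_bias_cycle_rate: "cycle_bias (2 * l) * cycle_rate l = (- (real d - 1)) ^ l / (2 * real l)"
  "(cycle_bias (2 * l))\<^sup>2 * cycle_rate l = ((real d - 1) / (real k - 1)) ^ l / (2 * real l)"
proof -
  have k: "real k - 1 \<noteq> 0" using k_gt by simp
  have "(- 1 / (real k - 1)) * ((real d - 1) * (real k - 1)) = - (real d - 1)" using k by (simp add: field_simps)
  then have "(- 1 / (real k - 1)) ^ l * ((real d - 1) * (real k - 1)) ^ l = (- (real d - 1)) ^ l" by (simp only: power_mult_distrib[symmetric])
  then show "cycle_bias (2 * l) * cycle_rate l = (- (real d - 1)) ^ l / (2 * real l)" unfolding cycle_bias_even cycle_rate_def by simp
  have "((- 1 / m) * (- 1 / m)) * (e * m) = e / m" if "m \<noteq> 0" for m e :: real using that by (simp add: field_simps)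
  from this[OF k, of "real d - 1"]
  have "((- 1 / (real k - 1)) * (- 1 / (real k - 1))) * ((real d - 1) * (real k - 1)) = (real d - 1) / (real k - 1)" .
  then have "((- 1 / (real k - 1)) ^ l * (- 1 / (real k - 1)) ^ l) * ((real d - 1) * (real k - 1)) ^ l = ((real d - 1) / (real k - 1)) ^ l"
    by (simp only: power_mult_distrib[symmetric])
  then show "(cycle_bias (2 * l))\<^sup>2 * cycle_rate l = ((real d - 1) / (real k - 1)) ^ l / (2 * real l)" unfolding cycle_bias_even cycle_rate_def power2_eq_square by simp
qed

text \<open>The planted rate is \<open>1 + cycle_bias\<close> times the uniform one, so the product
  is \<open>cycle_bias\<close> times the rate plus its square times the rate: the summands of
  \<open>mean_log\<close> and \<open>var_log\<close>.\<close>

lemma cycle_bias_planted_cycle_rate: "cycle_bias (2 * l) * planted_cycle_rate l = (- (real d - 1)) ^ l / (2 * real l) + ((real d - 1) / (real k - 1)) ^ l / (2 * real l)"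
proof -
  have k: "real k - 1 \<noteq> 0" using k_gt by simp
  have 1: "(- 1 / (real k - 1)) ^ l * ((real d - 1) ^ l * (real k - 1) ^ l) = (- (real d - 1)) ^ l"
  proof -
    have "(- 1 / (real k - 1)) * ((real d - 1) * (real k - 1)) = - (real d - 1)" using k by (simp add: field_simps)
    then show ?thesis by (simp only: power_mult_distrib[symmetric])
  qed
  have 2: "(- 1 / (real k - 1)) ^ l * ((real d - 1) ^ l * (- 1) ^ l) = ((real d - 1) / (real k - 1)) ^ l"
  proof -
    have "(- 1 / m) * (e * (- 1)) = e / m" for m e :: real by simp
    from this[of "real k - 1" "real d - 1"] have "(- 1 / (real k - 1)) * ((real d - 1) * (- 1)) = (real d - 1) / (real k - 1)" .
    then show ?thesis by (simp only: power_mult_distrib[symmetric])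
  qed
  have "cycle_bias (2 * l) * planted_cycle_rate l = ((- 1 / (real k - 1)) ^ l * ((real d - 1) ^ l * (real k - 1) ^ l) + (- 1 / (real k - 1)) ^ l * ((real d - 1) ^ l * (- 1) ^ l)) / (2 * real l)"
    unfolding cycle_bias_even planted_cycle_rate_def by (simp only: distrib_left times_divide_eq_right)
  then show ?thesis unfolding 1 2 by (simp add: add_divide_distrib)
qed

lemma abs_cycle_bias_le: "\<bar>cycle_bias n\<bar> \<le> 1"
proof -
  have "\<bar>- 1 / (real k - 1)\<bar> \<le> 1" using k_gt by simp
  then have "\<bar>- 1 / (real k - 1)\<bar> ^ (n div 2) \<le> 1" by (intro power_le_one) auto
  then show ?thesis unfolding cycle_bias_def power_abs .
qed

definition fam_weight :: "edge set set \<Rightarrow> real" where "fam_weight B = (\<Prod>\<gamma>\<in>B. cycle_bias (card \<gamma>))"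

text \<open>The expansion of the product of \<open>1 + cycle_bias (card \<gamma>)\<close> over the cycles \<open>\<gamma>\<close> that are present,
  truncated to at most \<open>K\<close> pairwise disjoint cycles. Up to the factor \<open>exp (- mean_log L)\<close> it approximates
  \<open>X a / mean_X a\<close> in the mean square.\<close>

definition cycle_poly :: "nat \<Rightarrow> nat \<Rightarrow> nat \<Rightarrow> (nat \<times> nat \<Rightarrow> nat \<times> nat) \<Rightarrow> real" where
  "cycle_poly L K a \<sigma> = (\<Sum>j\<le>K. \<Sum>B\<in>fams a L j. fam_weight B * of_bool (ext \<sigma> (\<Union>B)))"

text \<open>Weighting by \<open>X\<close> amounts to planting a uniformly random balanced set:
  exchange the sums and use that every such set satisfies equally many matchings.\<close>

lemma avg_X_ext:
  "avg a (\<lambda>\<sigma>. X a \<sigma> * of_bool (ext \<sigma> E)) / mean_X a = (\<Sum>T\<in>balanced_sets a. planted_pr a T E) / real (card (balanced_sets a))"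
proof -
  define c where "c = k ^ (d * a) * fact (d * a) * fact (d * k * a - d * a)"
  have c: "card {\<sigma> \<in> Mt a. sat a \<sigma> T} = c" if "T \<in> balanced_sets a" for T
    using that card_sat[of T a] by (simp add: balanced_sets_def c_def)
  have c0: "c > 0" using k_gt by (simp add: c_def)
  have m: "mean_X a = real (card (balanced_sets a)) * real c / fact (d * k * a)"
    by (simp add: mean_X_def card_balanced_sets c_def mult.assoc)
  have "(\<Sum>\<sigma>\<in>Mt a. X a \<sigma> * of_bool (ext \<sigma> E)) = (\<Sum>\<sigma>\<in>Mt a. \<Sum>T\<in>balanced_sets a. of_bool (sat a \<sigma> T \<and> ext \<sigma> E))"
    by (intro sum.cong refl) (simp only: X_eq sum_distrib_right of_bool_conj)
  also have "\<dots> = (\<Sum>T\<in>balanced_sets a. \<Sum>\<sigma>\<in>Mt a. of_bool (sat a \<sigma> T \<and> ext \<sigma> E))" by (rule sum.swap)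
  also have "\<dots> = (\<Sum>T\<in>balanced_sets a. real (card {\<sigma> \<in> Mt a. sat a \<sigma> T \<and> ext \<sigma> E}))" by (simp add: Int_def)
  also have "\<dots> = (\<Sum>T\<in>balanced_sets a. real c * planted_pr a T E)"
    using c c0 by (intro sum.cong refl) (simp add: planted_pr_def)
  also have "\<dots> = real c * (\<Sum>T\<in>balanced_sets a. planted_pr a T E)" by (rule sum_distrib_left[symmetric])
  finally show ?thesis unfolding avg_def m using c0 by simp
qed

text \<open>An average is at least its minimum. Choosing a minimising set for each \<open>a\<close>
  gives a sequence to which the planted limits apply, in place of an argument that all balanced sets
  are equivalent by symmetry. The lower bound is the direction required, as the mixed term enters
  the mean square with a minus sign.\<close>

lemma avg_X_cycle_poly_lower:
  obtains T where "\<And>a. T a \<in> balanced_sets a"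
    "\<And>a. avg a (\<lambda>\<sigma>. X a \<sigma> * cycle_poly L K a \<sigma>) / mean_X a \<ge> (\<Sum>j\<le>K. \<Sum>B\<in>fams a L j. planted_pr a (T a) (\<Union>B) * fam_weight B)"
proof -
  let ?g = "\<lambda>a T. \<Sum>j\<le>K. \<Sum>B\<in>fams a L j. planted_pr a T (\<Union>B) * fam_weight B"
  have "\<exists>T. T \<in> balanced_sets a \<and> avg a (\<lambda>\<sigma>. X a \<sigma> * cycle_poly L K a \<sigma>) / mean_X a \<ge> ?g a T" for a
  proof -
    have "a \<le> k * a" using k_gt by simp
    then have ne: "card (balanced_sets a) > 0" by (simp add: card_balanced_sets)
    then have ne': "balanced_sets a \<noteq> {}" by auto
    obtain T where T: "T \<in> balanced_sets a" "?g a T = Min (?g a ` balanced_sets a)"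
      using Min_in[of "?g a ` balanced_sets a"] ne' by fastforce
    have min: "?g a T \<le> ?g a T'" if "T' \<in> balanced_sets a" for T' unfolding T(2) using that by (intro Min_le) auto
    have "avg a (\<lambda>\<sigma>. X a \<sigma> * cycle_poly L K a \<sigma>) = (\<Sum>j\<le>K. \<Sum>B\<in>fams a L j. fam_weight B * avg a (\<lambda>\<sigma>. X a \<sigma> * of_bool (ext \<sigma> (\<Union>B))))"
      unfolding cycle_poly_def sum_distrib_left avg_sum avg_cmult[symmetric] by (simp only: mult.left_commute)
    then have "avg a (\<lambda>\<sigma>. X a \<sigma> * cycle_poly L K a \<sigma>) / mean_X a = (\<Sum>j\<le>K. \<Sum>B\<in>fams a L j. fam_weight B * (avg a (\<lambda>\<sigma>. X a \<sigma> * of_bool (ext \<sigma> (\<Union>B))) / mean_X a))"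
      by (simp only: sum_divide_distrib times_divide_eq_right)
    also have "\<dots> = (\<Sum>j\<le>K. \<Sum>B\<in>fams a L j. \<Sum>T\<in>balanced_sets a. planted_pr a T (\<Union>B) * fam_weight B) / real (card (balanced_sets a))"
      unfolding avg_X_ext sum_divide_distrib sum_distrib_left by (simp add: mult.commute)
    also have "(\<Sum>j\<le>K. \<Sum>B\<in>fams a L j. \<Sum>T\<in>balanced_sets a. planted_pr a T (\<Union>B) * fam_weight B) = (\<Sum>j\<le>K. \<Sum>T\<in>balanced_sets a. \<Sum>B\<in>fams a L j. planted_pr a T (\<Union>B) * fam_weight B)"
      by (intro sum.cong refl) (rule sum.swap)
    also have "\<dots> = (\<Sum>T\<in>balanced_sets a. ?g a T)" by (rule sum.swap)
    finally have eq: "avg a (\<lambda>\<sigma>. X a \<sigma> * cycle_poly L K a \<sigma>) / mean_X a = (\<Sum>T\<in>balanced_sets a. ?g a T) / real (card (balanced_sets a))" .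
    have "real (card (balanced_sets a)) * ?g a T \<le> (\<Sum>T\<in>balanced_sets a. ?g a T)" using min by (intro sum_bounded_below) auto
    then have "?g a T \<le> (\<Sum>T\<in>balanced_sets a. ?g a T) / real (card (balanced_sets a))" using ne by (simp add: field_simps)
    then show ?thesis using T(1) eq by (intro exI[of _ T]) simp
  qed
  then have "\<forall>a. \<exists>T. T \<in> balanced_sets a \<and> avg a (\<lambda>\<sigma>. X a \<sigma> * cycle_poly L K a \<sigma>) / mean_X a \<ge> ?g a T" by (rule allI)
  from choice[OF this] obtain T where "\<forall>a. T a \<in> balanced_sets a \<and> avg a (\<lambda>\<sigma>. X a \<sigma> * cycle_poly L K a \<sigma>) / mean_X a \<ge> ?g a (T a)" ..
  then show thesis by (intro that[of T]) auto
qed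

lemma planted_limit:
  assumes "\<eta> > 0"
  shows "eventually (\<lambda>a. avg a (\<lambda>\<sigma>. X a \<sigma> * cycle_poly L K a \<sigma>) / mean_X a \<ge> (\<Sum>j\<le>K. (mean_log L + var_log L) ^ j / fact j) - \<eta>) sequentially"
proof -
  obtain T where T: "\<And>a. T a \<in> balanced_sets a"
    "\<And>a. avg a (\<lambda>\<sigma>. X a \<sigma> * cycle_poly L K a \<sigma>) / mean_X a \<ge> (\<Sum>j\<le>K. \<Sum>B\<in>fams a L j. planted_pr a (T a) (\<Union>B) * fam_weight B)"
    using avg_X_cycle_poly_lower by blast
  have s: "(\<Sum>l=1..L. cycle_bias (2 * l) * planted_cycle_rate l) = mean_log L + var_log L"
    unfolding cycle_bias_planted_cycle_rate mean_log_def var_log_def by (rule sum.distrib)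
  have "(\<lambda>a. \<Sum>j\<le>K. \<Sum>B\<in>fams a L j. planted_pr a (T a) (\<Union>B) * fam_weight B) \<longlonglongrightarrow> (\<Sum>j\<le>K. (mean_log L + var_log L) ^ j / fact j)"
    unfolding fam_weight_def s[symmetric] by (intro tendsto_sum planted_pr_fam_tendsto T(1))
  then have "eventually (\<lambda>a. (\<Sum>j\<le>K. \<Sum>B\<in>fams a L j. planted_pr a (T a) (\<Union>B) * fam_weight B) > (\<Sum>j\<le>K. (mean_log L + var_log L) ^ j / fact j) - \<eta>) sequentially"
    using assms by (intro order_tendstoD) auto
  then show ?thesis
  proof eventually_elim
    case (elim a) then show ?case using T(2)[of a] by linarith
  qed
qed

definition fams_upto :: "nat \<Rightarrow> nat \<Rightarrow> nat \<Rightarrow> edge set set set" where "fams_upto L K a = (\<Union>j\<le>K. fams a L j)"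

lemma finite_fams_upto [simp]: "finite (fams_upto L K a)" by (simp add: fams_upto_def)

lemma fams_upto_iff: "A \<in> fams_upto L K a \<longleftrightarrow> A \<in> fams a L (card A) \<and> card A \<le> K"
  by (auto simp: fams_upto_def indep_fams_def)

lemma sum_fams_upto: "(\<Sum>A\<in>fams_upto L K a. f A) = (\<Sum>j\<le>K. \<Sum>A\<in>fams a L j. f A)"
  unfolding fams_upto_def by (rule sum.UNION_disjoint) (auto simp: indep_fams_def)

lemma abs_fam_weight_le: "\<bar>fam_weight A\<bar> \<le> 1"
  unfolding fam_weight_def abs_prod by (intro prod_le_1) (auto simp: abs_cycle_bias_le)

lemma fams_subset: "B \<in> fams a L j \<Longrightarrow> A \<subseteq> B \<Longrightarrow> A \<in> fams a L (card A)"
proof -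
  assume B: "B \<in> fams a L j" and A: "A \<subseteq> B"
  have h: "\<not> meets \<gamma> \<gamma>'" if "\<gamma> \<in> A" "\<gamma>' \<in> A" "\<gamma> \<noteq> \<gamma>'" for \<gamma> \<gamma>'
    using fams_indep[OF B subsetD[OF A that(1)] subsetD[OF A that(2)]] that(3) by metis
  have "A \<subseteq> Cyc a L" using fams_D[OF B] A by (meson subset_trans)
  then show ?thesis using h by (simp add: indep_fams_def)
qed

lemma avg_cycle_poly_sq: "avg a (\<lambda>\<sigma>. (cycle_poly L K a \<sigma>)\<^sup>2) = (\<Sum>p\<in>fams_upto L K a \<times> fams_upto L K a. fam_weight (fst p) * fam_weight (snd p) * pr_ext a (\<Union>(fst p) \<union> \<Union>(snd p)))"
proof -
  have "avg a (\<lambda>\<sigma>. (cycle_poly L K a \<sigma>)\<^sup>2) = avg a (\<lambda>\<sigma>. \<Sum>p\<in>fams_upto L K a \<times> fams_upto L K a. (fam_weight (fst p) * fam_weight (snd p)) * of_bool (ext \<sigma> (\<Union>(fst p) \<union> \<Union>(snd p))))"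
    unfolding cycle_poly_def sum_fams_upto[symmetric] power2_eq_square sum_product sum.cartesian_product ext_Un of_bool_conj
    by (simp add: case_prod_beta mult_ac)
  then show ?thesis unfolding avg_sum avg_cmult avg_ext .
qed

definition bad_total :: "nat \<Rightarrow> nat \<Rightarrow> nat \<Rightarrow> real" where
  "bad_total L K a = (\<Sum>i\<le>K. \<Sum>j\<le>K. \<Sum>(A, A')\<in>bad_pairs a L i j. pr_ext a (\<Union>A \<union> \<Union>A'))"

lemma bad_total_tendsto: "(\<lambda>a. bad_total L K a) \<longlonglongrightarrow> 0"
proof -
  have "(\<lambda>a. bad_total L K a) \<longlonglongrightarrow> (\<Sum>i\<le>K. \<Sum>j\<le>K. 0)"
    unfolding bad_total_def by (intro tendsto_sum bad_pairs_sum_tendsto)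
  then show ?thesis by simp
qed

text \<open>The square is a sum over pairs of families. Pairs with a conflict go into
  \<open>bad_total\<close>; the others are sorted by their union \<open>B\<close>, again a
  conflict-free family. If \<open>B\<close> has at most \<open>K\<close> members, every covering
  pair of \<open>B\<close> occurs and the sum is a product. For larger \<open>B\<close> the
  truncation removes some pairs, and only a bound by absolute values remains.\<close>

lemma avg_cycle_poly_sq_le:
  "avg a (\<lambda>\<sigma>. (cycle_poly L K a \<sigma>)\<^sup>2) \<le> (\<Sum>j\<le>K. \<Sum>B\<in>fams a L j. pr_ext a (\<Union>B) * (\<Prod>\<gamma>\<in>B. 2 * cycle_bias (card \<gamma>) + (cycle_bias (card \<gamma>))\<^sup>2))
    + (\<Sum>j\<in>{K<..2*K}. \<Sum>B\<in>fams a L j. pr_ext a (\<Union>B) * (\<Prod>\<gamma>\<in>B. 2 * \<bar>cycle_bias (card \<gamma>)\<bar> + \<bar>cycle_bias (card \<gamma>)\<bar>\<^sup>2)) + bad_total L K a"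
proof -
  let ?P = "fams_upto L K a \<times> fams_upto L K a"
  let ?h = "\<lambda>p. fam_weight (fst p) * fam_weight (snd p) * pr_ext a (\<Union>(fst p) \<union> \<Union>(snd p))"
  let ?bad = "{p \<in> ?P. \<exists>\<gamma>\<in>fst p. \<exists>\<gamma>'\<in>snd p. \<gamma> \<noteq> \<gamma>' \<and> meets \<gamma> \<gamma>'}"
  let ?good = "?P - ?bad"
  let ?u = "\<lambda>p. fst p \<union> snd p :: edge set set"
  have pp0: "0 \<le> pr_ext a U" for U by (simp add: pr_ext_def)
  have finP: "finite ?P" by simp
  have split: "(\<Sum>p\<in>?P. ?h p) = (\<Sum>p\<in>?good. ?h p) + (\<Sum>p\<in>?bad. ?h p)"
    by (rule sum.subset_diff) auto
  have bad: "(\<Sum>p\<in>?bad. ?h p) \<le> bad_total L K a"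
  proof -
    have "(\<Sum>p\<in>?bad. ?h p) \<le> (\<Sum>p\<in>?bad. pr_ext a (\<Union>(fst p) \<union> \<Union>(snd p)))"
    proof (rule sum_mono)
      fix p
      have "\<bar>fam_weight (fst p) * fam_weight (snd p)\<bar> \<le> 1 * 1" unfolding abs_mult by (intro mult_mono abs_fam_weight_le) auto
      then have "fam_weight (fst p) * fam_weight (snd p) \<le> 1" by linarith
      then show "?h p \<le> pr_ext a (\<Union>(fst p) \<union> \<Union>(snd p))" using mult_right_mono[OF _ pp0] by fastforce
    qed
    also have "\<dots> \<le> (\<Sum>p\<in>(\<Union>i\<in>{..K}. \<Union>j\<in>{..K}. bad_pairs a L i j). pr_ext a (\<Union>(fst p) \<union> \<Union>(snd p)))"
    proof (rule sum_mono2)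
      show "?bad \<subseteq> (\<Union>i\<in>{..K}. \<Union>j\<in>{..K}. bad_pairs a L i j)"
      proof
        fix p assume p: "p \<in> ?bad"
        obtain A A' where pA: "p = (A, A')" by (cases p)
        have "A \<in> fams_upto L K a" "A' \<in> fams_upto L K a" using p pA by simp_all
        then obtain i j where ij: "i \<le> K" "A \<in> fams a L i" "j \<le> K" "A' \<in> fams a L j" by (auto simp only: fams_upto_def UN_iff atMost_iff)
        have "p \<in> bad_pairs a L i j" using ij p unfolding bad_pairs_def pA by simp
        then show "p \<in> (\<Union>i\<in>{..K}. \<Union>j\<in>{..K}. bad_pairs a L i j)" using ij by (intro UN_I[of i] UN_I[of j]) auto
      qed
    qed (use pp0 in auto)
    also have "\<dots> \<le> (\<Sum>i\<le>K. \<Sum>p\<in>(\<Union>j\<in>{..K}. bad_pairs a L i j). pr_ext a (\<Union>(fst p) \<union> \<Union>(snd p)))"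
      using pp0 by (intro sum_UN_le) auto
    also have "\<dots> \<le> (\<Sum>i\<le>K. \<Sum>j\<le>K. \<Sum>p\<in>bad_pairs a L i j. pr_ext a (\<Union>(fst p) \<union> \<Union>(snd p)))"
      using pp0 by (intro sum_mono sum_UN_le) auto
    finally show ?thesis by (simp add: bad_total_def case_prod_beta)
  qed
  have gu: "?u p \<in> fams_upto L (2 * K) a" if p: "p \<in> ?good" for p
  proof -
    have f: "fst p \<in> fams a L (card (fst p))" "snd p \<in> fams a L (card (snd p))" "card (fst p) \<le> K" "card (snd p) \<le> K"
      using p by (auto simp: fams_upto_iff)
    have nc: "\<gamma> = \<gamma>' \<or> \<not> meets \<gamma> \<gamma>'" if "\<gamma> \<in> fst p" "\<gamma>' \<in> snd p" for \<gamma> \<gamma>' using p that by auto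
    have "?u p \<subseteq> Cyc a L" using fams_D[OF f(1)] fams_D[OF f(2)] by blast
    moreover have "\<gamma> = \<gamma>'" if uu: "\<gamma> \<in> ?u p" "\<gamma>' \<in> ?u p" "meets \<gamma> \<gamma>'" for \<gamma> \<gamma>'
      using uu(1)
    proof
      assume g: "\<gamma> \<in> fst p"
      show ?thesis using uu(2)
      proof
        assume "\<gamma>' \<in> fst p" then show ?thesis using fams_indep[OF f(1) g] uu(3) by simp
      next
        assume g': "\<gamma>' \<in> snd p" then show ?thesis using nc[OF g g'] uu(3) by blast
      qed
    next
      assume g: "\<gamma> \<in> snd p"
      show ?thesis using uu(2)
      proof
        assume g': "\<gamma>' \<in> fst p" then show ?thesis using nc[OF g' g] meets_sym[OF uu(3)] by blast
      next
        assume "\<gamma>' \<in> snd p" then show ?thesis using fams_indep[OF f(2) g] uu(3) by simp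
      qed
    qed
    ultimately have "?u p \<in> fams a L (card (?u p))" unfolding indep_fams_def by blast
    moreover have "card (?u p) \<le> 2 * K" using f card_Un_le[of "fst p" "snd p"] by linarith
    ultimately show ?thesis by (simp add: fams_upto_iff)
  qed
  define I where "I B = (\<Sum>p\<in>{p \<in> ?good. ?u p = B}. fam_weight (fst p) * fam_weight (snd p))" for B
  have "(\<Sum>p\<in>?good. ?h p) = (\<Sum>B\<in>fams_upto L (2 * K) a. \<Sum>p\<in>{p \<in> ?good. ?u p = B}. ?h p)"
  proof (rule sum.group[symmetric])
    show "?u ` ?good \<subseteq> fams_upto L (2 * K) a" by (rule image_subsetI) (rule gu)
  qed simp_all
  also have "\<dots> = (\<Sum>B\<in>fams_upto L (2 * K) a. pr_ext a (\<Union>B) * I B)"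
  proof (intro sum.cong refl)
    fix B
    have "(\<Sum>p\<in>{p \<in> ?good. ?u p = B}. ?h p) = (\<Sum>p\<in>{p \<in> ?good. ?u p = B}. pr_ext a (\<Union>B) * (fam_weight (fst p) * fam_weight (snd p)))"
      by (intro sum.cong refl) (auto simp: Union_Un_distrib[symmetric])
    then show "(\<Sum>p\<in>{p \<in> ?good. ?u p = B}. ?h p) = pr_ext a (\<Union>B) * I B" by (simp add: I_def sum_distrib_left)
  qed
  also have "\<dots> = (\<Sum>j\<le>2 * K. \<Sum>B\<in>fams a L j. pr_ext a (\<Union>B) * I B)" by (rule sum_fams_upto)
  also have "{..2 * K} = {..K} \<union> {K<..2 * K}" by auto
  also have "(\<Sum>j\<in>{..K} \<union> {K<..2 * K}. \<Sum>B\<in>fams a L j. pr_ext a (\<Union>B) * I B)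
      = (\<Sum>j\<le>K. \<Sum>B\<in>fams a L j. pr_ext a (\<Union>B) * I B) + (\<Sum>j\<in>{K<..2*K}. \<Sum>B\<in>fams a L j. pr_ext a (\<Union>B) * I B)"
    by (rule sum.union_disjoint) auto
  finally have good: "(\<Sum>p\<in>?good. ?h p) = (\<Sum>j\<le>K. \<Sum>B\<in>fams a L j. pr_ext a (\<Union>B) * I B) + (\<Sum>j\<in>{K<..2*K}. \<Sum>B\<in>fams a L j. pr_ext a (\<Union>B) * I B)" .
  let ?C = "\<lambda>B. {(A, A'). A \<subseteq> B \<and> A' \<subseteq> B \<and> A \<union> A' = (B :: edge set set)}"
  have subC: "{p \<in> ?good. ?u p = B} \<subseteq> ?C B" for B by auto
  have finC: "finite (?C B)" if "finite B" for B
    by (rule finite_subset[of _ "Pow B \<times> Pow B"]) (use that in auto)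
  have I1: "I B = (\<Prod>\<gamma>\<in>B. 2 * cycle_bias (card \<gamma>) + (cycle_bias (card \<gamma>))\<^sup>2)" if B: "B \<in> fams a L j" "j \<le> K" for B j
  proof -
    have fB: "finite B" "card B = j" using fams_D[OF B(1)] by auto
    have "?C B \<subseteq> {p \<in> ?good. ?u p = B}"
    proof
      fix p assume p: "p \<in> ?C B"
      then have s: "fst p \<subseteq> B" "snd p \<subseteq> B" "?u p = B" by auto
      have "card (fst p) \<le> K" "card (snd p) \<le> K" using card_mono[OF fB(1) s(1)] card_mono[OF fB(1) s(2)] fB B(2) by auto
      then have "p \<in> ?P" using fams_subset[OF B(1) s(1)] fams_subset[OF B(1) s(2)] by (cases p) (auto simp: fams_upto_iff)
      moreover have "p \<notin> ?bad" using fams_indep[OF B(1)] s by blast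
      ultimately have "p \<in> ?good" by (rule DiffI)
      then show "p \<in> {p \<in> ?good. ?u p = B}" using s(3) by (intro CollectI conjI)
    qed
    then have "{p \<in> ?good. ?u p = B} = ?C B" using subC by (rule equalityI[rotated])
    then show ?thesis using sum_covering_pairs[OF fB(1), of "\<lambda>\<gamma>. cycle_bias (card \<gamma>)"] by (simp add: I_def fam_weight_def case_prod_beta)
  qed
  have I2: "I B \<le> (\<Prod>\<gamma>\<in>B. 2 * \<bar>cycle_bias (card \<gamma>)\<bar> + \<bar>cycle_bias (card \<gamma>)\<bar>\<^sup>2)" if B: "B \<in> fams a L j" for B j
  proof -
    have fB: "finite B" using fams_D[OF B] by auto
    have "I B \<le> (\<Sum>p\<in>{p \<in> ?good. ?u p = B}. \<bar>fam_weight (fst p)\<bar> * \<bar>fam_weight (snd p)\<bar>)"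
      unfolding I_def abs_mult[symmetric] by (intro sum_mono) auto
    also have "\<dots> \<le> (\<Sum>p\<in>?C B. \<bar>fam_weight (fst p)\<bar> * \<bar>fam_weight (snd p)\<bar>)"
      by (rule sum_mono2[OF finC[OF fB] subC]) auto
    also have "\<dots> = (\<Prod>\<gamma>\<in>B. 2 * \<bar>cycle_bias (card \<gamma>)\<bar> + \<bar>cycle_bias (card \<gamma>)\<bar>\<^sup>2)"
      using sum_covering_pairs[OF fB, of "\<lambda>\<gamma>. \<bar>cycle_bias (card \<gamma>)\<bar>"] by (simp add: fam_weight_def abs_prod case_prod_beta)
    finally show ?thesis .
  qed
  have "(\<Sum>j\<le>K. \<Sum>B\<in>fams a L j. pr_ext a (\<Union>B) * I B) = (\<Sum>j\<le>K. \<Sum>B\<in>fams a L j. pr_ext a (\<Union>B) * (\<Prod>\<gamma>\<in>B. 2 * cycle_bias (card \<gamma>) + (cycle_bias (card \<gamma>))\<^sup>2))"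
    using I1 by (intro sum.cong refl) auto
  moreover have "(\<Sum>j\<in>{K<..2*K}. \<Sum>B\<in>fams a L j. pr_ext a (\<Union>B) * I B) \<le> (\<Sum>j\<in>{K<..2*K}. \<Sum>B\<in>fams a L j. pr_ext a (\<Union>B) * (\<Prod>\<gamma>\<in>B. 2 * \<bar>cycle_bias (card \<gamma>)\<bar> + \<bar>cycle_bias (card \<gamma>)\<bar>\<^sup>2))"
    using I2 pp0 by (intro sum_mono mult_left_mono) auto
  ultimately show ?thesis unfolding avg_cycle_poly_sq split good using bad by linarith
qed

text \<open>The exponent in the bound for unions of more than \<open>K\<close> cycles. It may grow
  with \<open>L\<close>, but for fixed \<open>L\<close> the corresponding part of the exponential
  series vanishes as \<open>K\<close> grows.\<close>

definition abs_log :: "nat \<Rightarrow> real" where "abs_log L = (\<Sum>l=1..L. (2 * \<bar>cycle_bias (2 * l)\<bar> + \<bar>cycle_bias (2 * l)\<bar>\<^sup>2) * cycle_rate l)"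

lemma cycle_poly_sq_limit:
  assumes "\<eta> > 0"
  shows "eventually (\<lambda>a. avg a (\<lambda>\<sigma>. (cycle_poly L K a \<sigma>)\<^sup>2) \<le> (\<Sum>j\<le>K. (2 * mean_log L + var_log L) ^ j / fact j) + (\<Sum>j\<in>{K<..2*K}. abs_log L ^ j / fact j) + \<eta>) sequentially"
proof -
  have s: "(\<Sum>l=1..L. (2 * cycle_bias (2 * l) + (cycle_bias (2 * l))\<^sup>2) * cycle_rate l) = 2 * mean_log L + var_log L"
    unfolding distrib_right mult.assoc cycle_bias_cycle_rate mean_log_def var_log_def by (simp add: sum.distrib sum_distrib_left)
  have "(\<lambda>a. (\<Sum>j\<le>K. \<Sum>B\<in>fams a L j. pr_ext a (\<Union>B) * (\<Prod>\<gamma>\<in>B. 2 * cycle_bias (card \<gamma>) + (cycle_bias (card \<gamma>))\<^sup>2))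
    + (\<Sum>j\<in>{K<..2*K}. \<Sum>B\<in>fams a L j. pr_ext a (\<Union>B) * (\<Prod>\<gamma>\<in>B. 2 * \<bar>cycle_bias (card \<gamma>)\<bar> + \<bar>cycle_bias (card \<gamma>)\<bar>\<^sup>2)) + bad_total L K a)
    \<longlonglongrightarrow> (\<Sum>j\<le>K. (2 * mean_log L + var_log L) ^ j / fact j) + (\<Sum>j\<in>{K<..2*K}. abs_log L ^ j / fact j) + 0"
    unfolding s[symmetric] abs_log_def
    by (intro tendsto_add tendsto_sum bad_total_tendsto pr_ext_fam_tendsto[where x = "\<lambda>n. 2 * cycle_bias n + (cycle_bias n)\<^sup>2"] pr_ext_fam_tendsto[where x = "\<lambda>n. 2 * \<bar>cycle_bias n\<bar> + \<bar>cycle_bias n\<bar>\<^sup>2"])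
  then have "eventually (\<lambda>a. (\<Sum>j\<le>K. \<Sum>B\<in>fams a L j. pr_ext a (\<Union>B) * (\<Prod>\<gamma>\<in>B. 2 * cycle_bias (card \<gamma>) + (cycle_bias (card \<gamma>))\<^sup>2))
    + (\<Sum>j\<in>{K<..2*K}. \<Sum>B\<in>fams a L j. pr_ext a (\<Union>B) * (\<Prod>\<gamma>\<in>B. 2 * \<bar>cycle_bias (card \<gamma>)\<bar> + \<bar>cycle_bias (card \<gamma>)\<bar>\<^sup>2)) + bad_total L K a
     < (\<Sum>j\<le>K. (2 * mean_log L + var_log L) ^ j / fact j) + (\<Sum>j\<in>{K<..2*K}. abs_log L ^ j / fact j) + 0 + \<eta>) sequentially"
    using assms by (intro order_tendstoD) auto
  then show ?thesis
  proof eventually_elim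
    case (elim a) then show ?case using avg_cycle_poly_sq_le[of a L K] by linarith
  qed
qed

end

section \<open>The cycle polynomial is bounded away from zero\<close>

text \<open>A second-order lower bound for \<open>ln (1 + x)\<close>. It turns the product over the
  cycles present into the exponential of a linear and a quadratic cycle statistic.\<close>

lemma exp_minus_le: "\<bar>x\<bar> \<le> 1/2 \<Longrightarrow> exp (x - 2 * x\<^sup>2) \<le> 1 + (x::real)"
proof -
  assume x: "\<bar>x\<bar> \<le> 1/2"
  have "x - 2 * x\<^sup>2 \<le> ln (1 + x)"
  proof (cases "x \<ge> 0")
    case True
    then have "x - x\<^sup>2 \<le> ln (1 + x)" using x by (intro ln_one_plus_pos_lower_bound) auto
    then show ?thesis using zero_le_power2[of x] by linarith
  next
    case False
    then have "- (- x) - 2 * (- x)\<^sup>2 \<le> ln (1 - (- x))" using x by (intro ln_one_minus_pos_lower_bound) auto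
    then show ?thesis by simp
  qed
  then have "exp (x - 2 * x\<^sup>2) \<le> exp (ln (1 + x))" by simp
  then show ?thesis using x by simp
qed

lemma exp_partial_sums: "(\<lambda>K. \<Sum>j\<le>K. t ^ j / fact j) \<longlonglongrightarrow> exp (t :: real)"
proof -
  have "(\<lambda>n. t ^ n /\<^sub>R fact n) sums exp t" by (rule exp_converges)
  then have "(\<lambda>K. \<Sum>j\<le>K. t ^ j /\<^sub>R fact j) \<longlonglongrightarrow> exp t" by (simp add: sums_def_le)
  then show ?thesis by (simp add: field_simps)
qed

lemma exp_partial_sums_tail: "(\<lambda>K. \<Sum>j\<in>{K<..2*K}. t ^ j / fact j) \<longlonglongrightarrow> (0::real)"
proof -
  have f: "filterlim (\<lambda>K::nat. 2 * K) sequentially sequentially"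
    by (rule filterlim_subseq) (simp add: strict_mono_def)
  have "(\<lambda>K. (\<Sum>j\<le>2*K. t ^ j / fact j) - (\<Sum>j\<le>K. t ^ j / fact j)) \<longlonglongrightarrow> exp t - exp t"
    by (intro tendsto_diff exp_partial_sums filterlim_compose[OF exp_partial_sums f])
  moreover have "(\<Sum>j\<le>2*K. t ^ j / fact j) - (\<Sum>j\<le>K. t ^ j / fact j) = (\<Sum>j\<in>{K<..2*K}. t ^ j / fact j)" for K
  proof -
    have "{..2*K} - {..K} = {K<..2*K}" by auto
    then show ?thesis using sum_diff[of "{..2*K}" "{..K}" "\<lambda>j. t ^ j / fact j"] by simp
  qed
  ultimately show ?thesis by simp
qed

context regular_cover
begin

text \<open>\<open>cycle_lin\<close> and \<open>cycle_sq\<close> are the first and second order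
  parts of the logarithm of the product over the cycles present, up to constant factors;
  \<open>cycle_count\<close> decides whether the truncation at \<open>K\<close> is felt.\<close>

definition cycle_lin :: "nat \<Rightarrow> nat \<Rightarrow> (nat \<times> nat \<Rightarrow> nat \<times> nat) \<Rightarrow> real" where
  "cycle_lin L a \<sigma> = (\<Sum>\<gamma>\<in>Cyc a L. cycle_bias (card \<gamma>) * of_bool (ext \<sigma> \<gamma>))"
definition cycle_sq :: "nat \<Rightarrow> nat \<Rightarrow> (nat \<times> nat \<Rightarrow> nat \<times> nat) \<Rightarrow> real" where
  "cycle_sq L a \<sigma> = (\<Sum>\<gamma>\<in>Cyc a L. (cycle_bias (card \<gamma>))\<^sup>2 * of_bool (ext \<sigma> \<gamma>))"
definition cycle_count :: "nat \<Rightarrow> nat \<Rightarrow> (nat \<times> nat \<Rightarrow> nat \<times> nat) \<Rightarrow> real" where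
  "cycle_count L a \<sigma> = (\<Sum>\<gamma>\<in>Cyc a L. of_bool (ext \<sigma> \<gamma>))"

lemma fams_1: "fams a L 1 = (\<lambda>\<gamma>. {\<gamma>}) ` Cyc a L"
proof (intro set_eqI iffI)
  fix B assume "B \<in> fams a L 1"
  then have "card B = 1" "B \<subseteq> Cyc a L" using fams_D by auto
  then show "B \<in> (\<lambda>\<gamma>. {\<gamma>}) ` Cyc a L" by (auto simp: card_1_singleton_iff)
next
  fix B assume "B \<in> (\<lambda>\<gamma>. {\<gamma>}) ` Cyc a L"
  then obtain \<gamma> where "B = {\<gamma>}" "\<gamma> \<in> Cyc a L" by blast
  then show "B \<in> fams a L 1" by (simp add: indep_fams_def)
qed

lemma sum_fams_1: "(\<Sum>B\<in>fams a L 1. F B) = (\<Sum>\<gamma>\<in>Cyc a L. F {\<gamma>})"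
  unfolding fams_1 by (subst sum.reindex) (auto simp: inj_on_def)

lemma sum_fams_2:
  "(\<Sum>p\<in>{p \<in> Cyc a L \<times> Cyc a L. fst p \<noteq> snd p \<and> \<not> meets (fst p) (snd p)}. F {fst p, snd p}) = 2 * (\<Sum>B\<in>fams a L 2. F B :: real)"
proof -
  let ?P = "{p \<in> Cyc a L \<times> Cyc a L. fst p \<noteq> snd p \<and> \<not> meets (fst p) (snd p)}"
  let ?f = "\<lambda>p. {fst p, snd p}"
  have im: "?f ` ?P = fams a L 2"
  proof (intro set_eqI iffI)
    fix B assume "B \<in> ?f ` ?P"
    then obtain p where p: "B = ?f p" "p \<in> ?P" by (rule imageE)
    define x y where "x = fst p" and "y = snd p"
    have B: "B = {x, y}" using p(1) unfolding x_def y_def .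
    have h: "x \<in> Cyc a L" "y \<in> Cyc a L" "x \<noteq> y" "\<not> meets x y"
      using p(2) unfolding x_def y_def by (simp_all add: mem_Times_iff)
    have "\<not> meets y x" using meets_sym[of y x] h(4) by blast
    then have "\<forall>\<gamma>\<in>B. \<forall>\<gamma>'\<in>B. \<gamma> \<noteq> \<gamma>' \<longrightarrow> \<not> meets \<gamma> \<gamma>'" using h(4) unfolding B by blast
    moreover have "B \<subseteq> Cyc a L" "card B = 2" using h B by simp_all
    ultimately show "B \<in> fams a L 2" by (simp add: indep_fams_def)
  next
    fix B assume B: "B \<in> fams a L 2"
    then obtain x y where xy: "B = {x, y}" "x \<noteq> y" using fams_D[OF B] by (auto simp: card_2_iff)
    have "\<not> meets x y" using fams_indep[OF B, of x y] xy by blast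
    then have "(x, y) \<in> ?P" using xy fams_D[OF B] by simp
    then show "B \<in> ?f ` ?P" using xy by (intro image_eqI[of _ _ "(x, y)"]) simp_all
  qed
  have "(\<Sum>p\<in>?P. F (?f p)) = (\<Sum>B\<in>?f ` ?P. \<Sum>p\<in>{p \<in> ?P. ?f p = B}. F (?f p))"
    by (rule sum.image_gen) (rule finite_subset[of _ "Cyc a L \<times> Cyc a L"], auto)
  also have "\<dots> = (\<Sum>B\<in>fams a L 2. 2 * F B)"
    unfolding im
  proof (intro sum.cong refl)
    fix B assume B: "B \<in> fams a L 2"
    then obtain x y where xy: "B = {x, y}" "x \<noteq> y" using fams_D[OF B] by (auto simp: card_2_iff)
    have nc: "\<not> meets x y" "\<not> meets y x" using fams_indep[OF B, of x y] fams_indep[OF B, of y x] xy by blast+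
    have m: "x \<in> Cyc a L" "y \<in> Cyc a L" using fams_D[OF B] xy by auto
    have "{p \<in> ?P. ?f p = B} = {(x, y), (y, x)}"
    proof (intro set_eqI iffI)
      fix p assume "p \<in> {p \<in> ?P. ?f p = B}"
      then have "{fst p, snd p} = {x, y}" using xy by simp
      then show "p \<in> {(x, y), (y, x)}" by (cases p) (auto simp: doubleton_eq_iff)
    next
      fix p assume "p \<in> {(x, y), (y, x)}"
      then show "p \<in> {p \<in> ?P. ?f p = B}" using nc m xy by (elim insertE emptyE) (simp_all add: insert_commute)
    qed
    moreover have "(\<Sum>p\<in>{p \<in> ?P. ?f p = B}. F (?f p)) = (\<Sum>p\<in>{p \<in> ?P. ?f p = B}. F B)" by (intro sum.cong) auto
    ultimately show "(\<Sum>p\<in>{p \<in> ?P. ?f p = B}. F (?f p)) = 2 * F B" using xy(2) by simp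
  qed
  also have "\<dots> = 2 * (\<Sum>B\<in>fams a L 2. F B)" by (rule sum_distrib_left[symmetric])
  finally show ?thesis .
qed

lemma pr_ext_single_tendsto: "(\<lambda>a. \<Sum>\<gamma>\<in>Cyc a L. x (card \<gamma>) * pr_ext a \<gamma>) \<longlonglongrightarrow> (\<Sum>l=1..L. x (2 * l) * cycle_rate l)"
  using pr_ext_fam_tendsto[where j = 1 and L = L and x = x] unfolding sum_fams_1 by (simp add: mult.commute)

lemma avg_cycle_lin: "(\<lambda>a. avg a (cycle_lin L a)) \<longlonglongrightarrow> mean_log L"
  using pr_ext_single_tendsto[of cycle_bias L] unfolding cycle_bias_cycle_rate mean_log_def cycle_lin_def avg_sum avg_cmult avg_ext .

lemma avg_cycle_sq: "(\<lambda>a. avg a (cycle_sq L a)) \<longlonglongrightarrow> var_log L"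
  using pr_ext_single_tendsto[of "\<lambda>n. (cycle_bias n)\<^sup>2" L] unfolding cycle_bias_cycle_rate var_log_def cycle_sq_def avg_sum avg_cmult avg_ext .

lemma avg_cycle_count: "(\<lambda>a. avg a (cycle_count L a)) \<longlonglongrightarrow> (\<Sum>l=1..L. cycle_rate l)"
  using pr_ext_single_tendsto[of "\<lambda>n. 1" L] unfolding cycle_count_def avg_sum avg_ext by simp

definition conflict :: "nat \<Rightarrow> nat \<Rightarrow> (nat \<times> nat \<Rightarrow> nat \<times> nat) \<Rightarrow> bool" where
  "conflict L a \<sigma> \<longleftrightarrow> (\<exists>\<gamma>\<in>Cyc a L. \<exists>\<gamma>'\<in>Cyc a L. \<gamma> \<noteq> \<gamma>' \<and> meets \<gamma> \<gamma>' \<and> ext \<sigma> \<gamma> \<and> ext \<sigma> \<gamma>')"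

definition meets_pairs :: "nat \<Rightarrow> nat \<Rightarrow> (edge set \<times> edge set) set" where
  "meets_pairs L a = {p \<in> Cyc a L \<times> Cyc a L. fst p \<noteq> snd p \<and> meets (fst p) (snd p)}"

lemma finite_meets_pairs [simp]: "finite (meets_pairs L a)"
  by (rule finite_subset[of _ "Cyc a L \<times> Cyc a L"]) (auto simp: meets_pairs_def)

lemma meets_pairs_tendsto: "(\<lambda>a. \<Sum>p\<in>meets_pairs L a. pr_ext a (fst p \<union> snd p)) \<longlonglongrightarrow> 0"
proof -
  have "(\<Sum>p\<in>meets_pairs L a. pr_ext a (fst p \<union> snd p)) = (\<Sum>(A, A')\<in>bad_pairs a L 1 1. pr_ext a (\<Union>A \<union> \<Union>A'))" for a
  proof -
    have "bad_pairs a L 1 1 = (\<lambda>p. ({fst p}, {snd p})) ` meets_pairs L a"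
    proof (intro set_eqI iffI)
      fix q assume "q \<in> bad_pairs a L 1 1"
      then obtain A A' \<gamma> \<gamma>' where q: "q = (A, A')" "A \<in> fams a L 1" "A' \<in> fams a L 1" "\<gamma> \<in> A" "\<gamma>' \<in> A'" "\<gamma> \<noteq> \<gamma>'" "meets \<gamma> \<gamma>'"
        unfolding bad_pairs_def by blast
      then have "A = {\<gamma>}" "A' = {\<gamma>'}" "\<gamma> \<in> Cyc a L" "\<gamma>' \<in> Cyc a L" unfolding fams_1 by blast+
      then show "q \<in> (\<lambda>p. ({fst p}, {snd p})) ` meets_pairs L a"
        using q by (intro image_eqI[of _ _ "(\<gamma>, \<gamma>')"]) (simp_all add: meets_pairs_def)
    next
      fix q assume "q \<in> (\<lambda>p. ({fst p}, {snd p})) ` meets_pairs L a"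
      then obtain p where q: "q = ({fst p}, {snd p})" and "p \<in> meets_pairs L a" by (rule imageE)
      then have p: "fst p \<in> Cyc a L" "snd p \<in> Cyc a L" "fst p \<noteq> snd p" "meets (fst p) (snd p)"
        by (simp_all add: meets_pairs_def mem_Times_iff)
      then show "q \<in> bad_pairs a L 1 1" unfolding bad_pairs_def fams_1 q by simp
    qed
    moreover have "inj_on (\<lambda>p. ({fst p}, {snd p})) (meets_pairs L a)" by (rule inj_onI) (simp add: prod_eq_iff)
    ultimately show ?thesis by (simp add: sum.reindex)
  qed
  then show ?thesis using bad_pairs_sum_tendsto[of L 1 1] by simp
qed

lemma conflict_tendsto: "(\<lambda>a. avg a (\<lambda>\<sigma>. of_bool (conflict L a \<sigma>))) \<longlonglongrightarrow> 0"
proof (rule tendsto_sandwich[OF _ _ tendsto_const meets_pairs_tendsto[of L]])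
  show "eventually (\<lambda>a. 0 \<le> avg a (\<lambda>\<sigma>. of_bool (conflict L a \<sigma>))) sequentially"
    by (intro always_eventually allI) (simp add: avg_of_bool)
  show "eventually (\<lambda>a. avg a (\<lambda>\<sigma>. of_bool (conflict L a \<sigma>)) \<le> (\<Sum>p\<in>meets_pairs L a. pr_ext a (fst p \<union> snd p))) sequentially"
  proof (intro always_eventually allI)
    fix a
    have "avg a (\<lambda>\<sigma>. of_bool (conflict L a \<sigma>)) \<le> avg a (\<lambda>\<sigma>. \<Sum>p\<in>meets_pairs L a. of_bool (ext \<sigma> (fst p \<union> snd p)))"
    proof (rule avg_mono)
      fix \<sigma>
      show "of_bool (conflict L a \<sigma>) \<le> (\<Sum>p\<in>meets_pairs L a. of_bool (ext \<sigma> (fst p \<union> snd p)) :: real)"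
      proof (cases "conflict L a \<sigma>")
        case True
        then obtain \<gamma> \<gamma>' where h: "\<gamma> \<in> Cyc a L" "\<gamma>' \<in> Cyc a L" "\<gamma> \<noteq> \<gamma>'" "meets \<gamma> \<gamma>'" "ext \<sigma> \<gamma>" "ext \<sigma> \<gamma>'" unfolding conflict_def by blast
        then have m: "(\<gamma>, \<gamma>') \<in> meets_pairs L a" by (simp add: meets_pairs_def)
        have "of_bool (ext \<sigma> (fst (\<gamma>, \<gamma>') \<union> snd (\<gamma>, \<gamma>'))) \<le> (\<Sum>p\<in>meets_pairs L a. of_bool (ext \<sigma> (fst p \<union> snd p)) :: real)"
          by (rule member_le_sum[OF m]) auto
        then show ?thesis using h by (simp add: ext_Un)
      qed (simp add: sum_nonneg)
    qed
    then show "avg a (\<lambda>\<sigma>. of_bool (conflict L a \<sigma>)) \<le> (\<Sum>p\<in>meets_pairs L a. pr_ext a (fst p \<union> snd p))"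
      unfolding avg_sum avg_ext .
  qed
qed

text \<open>Ordered pairs of cycles are equal, disjoint or in conflict. The disjoint ones are the
  families of size 2, each counted twice; for the last kind the weights are at most 1.\<close>

lemma avg_cycle_lin_sq_le:
  "avg a (\<lambda>\<sigma>. (cycle_lin L a \<sigma>)\<^sup>2) \<le> (\<Sum>\<gamma>\<in>Cyc a L. (cycle_bias (card \<gamma>))\<^sup>2 * pr_ext a \<gamma>)
     + 2 * (\<Sum>B\<in>fams a L 2. pr_ext a (\<Union>B) * (\<Prod>\<gamma>\<in>B. cycle_bias (card \<gamma>))) + (\<Sum>p\<in>meets_pairs L a. pr_ext a (fst p \<union> snd p))"
proof -
  let ?C = "Cyc a L"
  let ?h = "\<lambda>p. cycle_bias (card (fst p)) * cycle_bias (card (snd p)) * pr_ext a (fst p \<union> snd p)"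
  let ?D = "{p \<in> ?C \<times> ?C. fst p = snd p}" and ?N = "{p \<in> ?C \<times> ?C. fst p \<noteq> snd p \<and> \<not> meets (fst p) (snd p)}"
  have pp0: "0 \<le> pr_ext a U" for U by (simp add: pr_ext_def)
  have fin: "finite ?D" "finite ?N" by (rule finite_subset[of _ "?C \<times> ?C"]; auto)+
  have "avg a (\<lambda>\<sigma>. (cycle_lin L a \<sigma>)\<^sup>2) = avg a (\<lambda>\<sigma>. \<Sum>p\<in>?C \<times> ?C. (cycle_bias (card (fst p)) * cycle_bias (card (snd p))) * of_bool (ext \<sigma> (fst p \<union> snd p)))"
    unfolding cycle_lin_def power2_eq_square sum_product sum.cartesian_product ext_Un of_bool_conj
    by (simp add: case_prod_beta mult_ac)
  then have "avg a (\<lambda>\<sigma>. (cycle_lin L a \<sigma>)\<^sup>2) = (\<Sum>p\<in>?C \<times> ?C. ?h p)" unfolding avg_sum avg_cmult avg_ext .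
  also have "?C \<times> ?C = ?D \<union> (?N \<union> meets_pairs L a)" by (auto simp: meets_pairs_def)
  also have "(\<Sum>p\<in>?D \<union> (?N \<union> meets_pairs L a). ?h p) = (\<Sum>p\<in>?D. ?h p) + (\<Sum>p\<in>?N \<union> meets_pairs L a. ?h p)"
    using fin by (intro sum.union_disjoint) (auto simp: meets_pairs_def)
  also have "(\<Sum>p\<in>?N \<union> meets_pairs L a. ?h p) = (\<Sum>p\<in>?N. ?h p) + (\<Sum>p\<in>meets_pairs L a. ?h p)"
    using fin by (intro sum.union_disjoint) (auto simp: meets_pairs_def)
  also have "(\<Sum>p\<in>?D. ?h p) = (\<Sum>\<gamma>\<in>?C. (cycle_bias (card \<gamma>))\<^sup>2 * pr_ext a \<gamma>)"
    by (rule sum.reindex_bij_witness[where i = "\<lambda>\<gamma>. (\<gamma>, \<gamma>)" and j = fst])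
      (simp_all add: mem_Times_iff prod_eq_iff power2_eq_square)
  also have "(\<Sum>p\<in>?N. ?h p) = (\<Sum>p\<in>?N. pr_ext a (\<Union>{fst p, snd p}) * (\<Prod>\<gamma>\<in>{fst p, snd p}. cycle_bias (card \<gamma>)))"
    by (intro sum.cong refl) auto
  also have "\<dots> = 2 * (\<Sum>B\<in>fams a L 2. pr_ext a (\<Union>B) * (\<Prod>\<gamma>\<in>B. cycle_bias (card \<gamma>)))" by (rule sum_fams_2)
  finally have eq: "avg a (\<lambda>\<sigma>. (cycle_lin L a \<sigma>)\<^sup>2) = (\<Sum>\<gamma>\<in>?C. (cycle_bias (card \<gamma>))\<^sup>2 * pr_ext a \<gamma>)
     + (2 * (\<Sum>B\<in>fams a L 2. pr_ext a (\<Union>B) * (\<Prod>\<gamma>\<in>B. cycle_bias (card \<gamma>))) + (\<Sum>p\<in>meets_pairs L a. ?h p))" .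
  have "(\<Sum>p\<in>meets_pairs L a. ?h p) \<le> (\<Sum>p\<in>meets_pairs L a. pr_ext a (fst p \<union> snd p))"
  proof (rule sum_mono)
    fix p :: "edge set \<times> edge set"
    have "\<bar>cycle_bias (card (fst p)) * cycle_bias (card (snd p))\<bar> \<le> 1 * 1" unfolding abs_mult by (intro mult_mono abs_cycle_bias_le) auto
    then have "cycle_bias (card (fst p)) * cycle_bias (card (snd p)) \<le> 1" by linarith
    from mult_right_mono[OF this pp0] show "?h p \<le> pr_ext a (fst p \<union> snd p)" by simp
  qed
  then show ?thesis using eq by linarith
qed

text \<open>The diagonal tends to \<open>var_log L\<close>. The disjoint pairs tend to the square of
  \<open>mean_log L\<close>, which the centring removes, and the conflicting pairs vanish.\<close>

lemma cycle_lin_variance_limit: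
  assumes "\<eta> > 0"
  shows "eventually (\<lambda>a. avg a (\<lambda>\<sigma>. (cycle_lin L a \<sigma> - mean_log L)\<^sup>2) \<le> var_log L + \<eta>) sequentially"
proof -
  let ?m = "mean_log L"
  let ?u = "\<lambda>a. (\<Sum>\<gamma>\<in>Cyc a L. (cycle_bias (card \<gamma>))\<^sup>2 * pr_ext a \<gamma>)
     + 2 * (\<Sum>B\<in>fams a L 2. pr_ext a (\<Union>B) * (\<Prod>\<gamma>\<in>B. cycle_bias (card \<gamma>))) + (\<Sum>p\<in>meets_pairs L a. pr_ext a (fst p \<union> snd p)) - 2 * ?m * avg a (cycle_lin L a) + ?m\<^sup>2"
  have s: "(\<Sum>l=1..L. cycle_bias (2 * l) * cycle_rate l) = ?m" unfolding cycle_bias_cycle_rate mean_log_def ..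
  have v: "(\<Sum>l=1..L. (cycle_bias (2 * l))\<^sup>2 * cycle_rate l) = var_log L" unfolding cycle_bias_cycle_rate var_log_def ..
  have "?u \<longlonglongrightarrow> var_log L + 2 * (?m ^ 2 / fact 2) + 0 - 2 * ?m * ?m + ?m\<^sup>2"
    unfolding v[symmetric]
    by (intro tendsto_add tendsto_diff tendsto_mult tendsto_const pr_ext_single_tendsto[where x = "\<lambda>n. (cycle_bias n)\<^sup>2"] meets_pairs_tendsto avg_cycle_lin
        pr_ext_fam_tendsto[where x = cycle_bias and j = 2 and L = L, unfolded s])
  then have "?u \<longlonglongrightarrow> var_log L" by (simp add: power2_eq_square fact_numeral)
  then have "eventually (\<lambda>a. ?u a < var_log L + \<eta>) sequentially" using assms by (intro order_tendstoD) auto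
  then show ?thesis
  proof eventually_elim
    case (elim a)
    have "avg a (\<lambda>\<sigma>. (cycle_lin L a \<sigma> - ?m)\<^sup>2) = avg a (\<lambda>\<sigma>. ((cycle_lin L a \<sigma>)\<^sup>2 - (2 * ?m) * cycle_lin L a \<sigma>) + ?m\<^sup>2)"
      by (simp add: power2_diff algebra_simps)
    also have "\<dots> = avg a (\<lambda>\<sigma>. (cycle_lin L a \<sigma>)\<^sup>2) - 2 * ?m * avg a (cycle_lin L a) + ?m\<^sup>2"
      unfolding avg_add avg_diff avg_cmult avg_const ..
    finally show ?case using avg_cycle_lin_sq_le[of a L] elim by linarith
  qed
qed

lemma cycle_poly_product:
  assumes nc: "\<not> conflict L a \<sigma>" and K: "card {\<gamma> \<in> Cyc a L. ext \<sigma> \<gamma>} \<le> K"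
  shows "cycle_poly L K a \<sigma> = (\<Prod>\<gamma>\<in>{\<gamma> \<in> Cyc a L. ext \<sigma> \<gamma>}. 1 + cycle_bias (card \<gamma>))"
proof -
  let ?C = "{\<gamma> \<in> Cyc a L. ext \<sigma> \<gamma>}"
  have finC: "finite ?C" by simp
  have inner: "(\<Sum>B\<in>fams a L j. fam_weight B * of_bool (ext \<sigma> (\<Union>B))) = (\<Sum>B\<in>{B \<in> Pow ?C. card B = j}. fam_weight B)" for j
  proof -
    have "{B \<in> fams a L j. ext \<sigma> (\<Union>B)} = {B \<in> Pow ?C. card B = j}"
    proof (intro set_eqI iffI)
      fix B assume "B \<in> {B \<in> fams a L j. ext \<sigma> (\<Union>B)}"
      then have B: "B \<in> fams a L j" "\<forall>\<gamma>\<in>B. ext \<sigma> \<gamma>" by (simp_all add: ext_Union)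
      then show "B \<in> {B \<in> Pow ?C. card B = j}" using fams_D[OF B(1)] by blast
    next
      fix B assume "B \<in> {B \<in> Pow ?C. card B = j}"
      then have B: "B \<subseteq> ?C" "card B = j" by simp_all
      have "\<not> meets \<gamma> \<gamma>'" if "\<gamma> \<in> B" "\<gamma>' \<in> B" "\<gamma> \<noteq> \<gamma>'" for \<gamma> \<gamma>'
        using nc that subsetD[OF B(1) that(1)] subsetD[OF B(1) that(2)] unfolding conflict_def by blast
      moreover have "B \<subseteq> Cyc a L" "\<forall>\<gamma>\<in>B. ext \<sigma> \<gamma>" using B by blast+
      ultimately show "B \<in> {B \<in> fams a L j. ext \<sigma> (\<Union>B)}" using B(2) by (simp add: indep_fams_def ext_Union)
    qed
    moreover have "(\<Sum>B\<in>fams a L j. fam_weight B * of_bool (ext \<sigma> (\<Union>B))) = (\<Sum>B\<in>{B \<in> fams a L j. ext \<sigma> (\<Union>B)}. fam_weight B)"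
      by (rule sum.mono_neutral_cong_right) auto
    ultimately show ?thesis by simp
  qed
  have "cycle_poly L K a \<sigma> = (\<Sum>j\<le>K. \<Sum>B\<in>{B \<in> Pow ?C. card B = j}. fam_weight B)" unfolding cycle_poly_def inner ..
  also have "\<dots> = (\<Sum>B\<in>Pow ?C. fam_weight B)"
  proof (rule sum.group)
    show "card ` Pow ?C \<subseteq> {..K}"
    proof (rule image_subsetI)
      fix B assume "B \<in> Pow ?C"
      then have "card B \<le> card ?C" using finC by (intro card_mono) auto
      then show "card B \<in> {..K}" using K by simp
    qed
  qed (use finC in simp_all)
  also have "\<dots> = (\<Prod>\<gamma>\<in>?C. cycle_bias (card \<gamma>) + 1)"
    unfolding prod_add[OF finC] fam_weight_def by simp
  finally show ?thesis by (simp add: add.commute)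
qed

lemma abs_cycle_bias_le_half: "\<gamma> \<in> Cyc a L \<Longrightarrow> \<bar>cycle_bias (card \<gamma>)\<bar> \<le> 1 / 2"
proof -
  assume "\<gamma> \<in> Cyc a L"
  then obtain l rs where l: "0 < l" and r: "rs \<in> rooted a l" and g: "\<gamma> = cyc_edges rs" by (rule Cyc_cases)
  have c: "card \<gamma> = 2 * l" unfolding g by (rule card_cyc_edges[OF l r])
  obtain n where n: "l = Suc n" using l by (cases l) auto
  have b: "\<bar>- 1 / (real k - 1)\<bar> \<le> 1 / 2" using k_gt by (simp add: field_simps)
  then have "\<bar>- 1 / (real k - 1)\<bar> ^ n \<le> 1" by (intro power_le_one) auto
  then have "\<bar>- 1 / (real k - 1)\<bar> * \<bar>- 1 / (real k - 1)\<bar> ^ n \<le> 1 / 2 * 1" using b by (intro mult_mono) auto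
  then show ?thesis unfolding c cycle_bias_even n by (simp add: power_abs abs_mult)
qed

lemma cycle_poly_lower:
  assumes nc: "\<not> conflict L a \<sigma>" and K: "cycle_count L a \<sigma> < real (K + 1)"
  shows "exp (- mean_log L) * cycle_poly L K a \<sigma> \<ge> exp (cycle_lin L a \<sigma> - mean_log L - 2 * cycle_sq L a \<sigma>)"
proof -
  let ?C = "{\<gamma> \<in> Cyc a L. ext \<sigma> \<gamma>}"
  have sC: "(\<Sum>\<gamma>\<in>Cyc a L. f \<gamma> * of_bool (ext \<sigma> \<gamma>)) = (\<Sum>\<gamma>\<in>?C. f \<gamma>)" for f :: "edge set \<Rightarrow> real"
    by (rule sum.mono_neutral_cong_right) auto
  have "cycle_count L a \<sigma> = real (card ?C)" unfolding cycle_count_def using sC[of "\<lambda>_. 1"] by simp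
  then have "card ?C \<le> K" using K by simp
  note Y = cycle_poly_product[OF nc this]
  have "exp (cycle_lin L a \<sigma> - 2 * cycle_sq L a \<sigma>) = exp (\<Sum>\<gamma>\<in>?C. cycle_bias (card \<gamma>) - 2 * (cycle_bias (card \<gamma>))\<^sup>2)"
    unfolding cycle_lin_def cycle_sq_def sC by (simp add: sum_subtractf sum_distrib_left)
  also have "\<dots> = (\<Prod>\<gamma>\<in>?C. exp (cycle_bias (card \<gamma>) - 2 * (cycle_bias (card \<gamma>))\<^sup>2))" by (rule exp_sum) simp
  also have "\<dots> \<le> cycle_poly L K a \<sigma>"
    unfolding Y by (intro prod_mono conjI exp_minus_le abs_cycle_bias_le_half) auto
  finally have "exp (- mean_log L) * exp (cycle_lin L a \<sigma> - 2 * cycle_sq L a \<sigma>) \<le> exp (- mean_log L) * cycle_poly L K a \<sigma>" by simp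
  then show ?thesis by (simp add: exp_add[symmetric] algebra_simps)
qed

text \<open>There are four bad events: more than \<open>K\<close> cycles, \<open>cycle_lin\<close>
  off its limiting mean by \<open>M\<close>, \<open>cycle_sq\<close> at least \<open>M\<close>, or a
  conflict. Off these events the exponent in \<open>cycle_poly_lower\<close> is at least
  \<open>- M - 2 * M\<close>. Markov's inequality handles the first three; the second and third cost
  only multiples of \<open>var_log L\<close>, which is bounded in \<open>L\<close>.\<close>

lemma cycle_poly_small_prob:
  assumes M: "M > 0" and \<epsilon>: "\<epsilon> > 0"
  shows "eventually (\<lambda>a. avg a (\<lambda>\<sigma>. of_bool (exp (- mean_log L) * cycle_poly L K a \<sigma> < exp (- 3 * M)))
     \<le> (\<Sum>l=1..L. cycle_rate l) / real (K + 1) + var_log L / M\<^sup>2 + var_log L / M + \<epsilon>) sequentially"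
proof -
  let ?\<Lambda> = "\<Sum>l=1..L. cycle_rate l"
  have e: "\<epsilon> / 4 > 0" "M\<^sup>2 * (\<epsilon> / 4) > 0" using \<epsilon> M by auto
  have "(\<lambda>a. avg a (cycle_count L a) / real (K + 1)) \<longlonglongrightarrow> ?\<Lambda> / real (K + 1)" by (intro tendsto_divide avg_cycle_count tendsto_const) simp
  then have 1: "eventually (\<lambda>a. avg a (cycle_count L a) / real (K + 1) < ?\<Lambda> / real (K + 1) + \<epsilon> / 4) sequentially" using e by (intro order_tendstoD) auto
  have "(\<lambda>a. avg a (cycle_sq L a) / M) \<longlonglongrightarrow> var_log L / M" using M by (intro tendsto_divide avg_cycle_sq tendsto_const) simp
  then have 2: "eventually (\<lambda>a. avg a (cycle_sq L a) / M < var_log L / M + \<epsilon> / 4) sequentially" using e by (intro order_tendstoD) auto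
  have 3: "eventually (\<lambda>a. avg a (\<lambda>\<sigma>. of_bool (conflict L a \<sigma>)) < \<epsilon> / 4) sequentially"
    by (rule order_tendstoD(2)[OF conflict_tendsto e(1)])
  from 1 2 3 cycle_lin_variance_limit[OF e(2), of L] show ?thesis
  proof eventually_elim
    case (elim a)
    let ?A = "\<lambda>\<sigma>. exp (- mean_log L) * cycle_poly L K a \<sigma> < exp (- 3 * M)"
    have "avg a (\<lambda>\<sigma>. of_bool (?A \<sigma>)) \<le> avg a (\<lambda>\<sigma>. ((of_bool (cycle_count L a \<sigma> \<ge> real (K + 1)) + of_bool ((cycle_lin L a \<sigma> - mean_log L)\<^sup>2 \<ge> M\<^sup>2)) + of_bool (cycle_sq L a \<sigma> \<ge> M)) + of_bool (conflict L a \<sigma>))"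
    proof (rule avg_mono)
      fix \<sigma>
      show "of_bool (?A \<sigma>) \<le> ((of_bool (cycle_count L a \<sigma> \<ge> real (K + 1)) + of_bool ((cycle_lin L a \<sigma> - mean_log L)\<^sup>2 \<ge> M\<^sup>2)) + of_bool (cycle_sq L a \<sigma> \<ge> M)) + (of_bool (conflict L a \<sigma>) :: real)"
      proof (cases "cycle_count L a \<sigma> \<ge> real (K + 1) \<or> (cycle_lin L a \<sigma> - mean_log L)\<^sup>2 \<ge> M\<^sup>2 \<or> cycle_sq L a \<sigma> \<ge> M \<or> conflict L a \<sigma>")
        case True
        then show ?thesis by (cases "?A \<sigma>") auto
      next
        case False
        then have f: "cycle_count L a \<sigma> < real (K + 1)" "(cycle_lin L a \<sigma> - mean_log L)\<^sup>2 < M\<^sup>2" "cycle_sq L a \<sigma> < M" "\<not> conflict L a \<sigma>" by auto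
        have "\<bar>cycle_lin L a \<sigma> - mean_log L\<bar> < M" using f(2) M by (metis abs_le_square_iff abs_of_pos not_le)
        then have "- 3 * M \<le> cycle_lin L a \<sigma> - mean_log L - 2 * cycle_sq L a \<sigma>" using f(3) by linarith
        then have "exp (- 3 * M) \<le> exp (cycle_lin L a \<sigma> - mean_log L - 2 * cycle_sq L a \<sigma>)" by simp
        also have "\<dots> \<le> exp (- mean_log L) * cycle_poly L K a \<sigma>" by (rule cycle_poly_lower[OF f(4) f(1)])
        finally have "\<not> ?A \<sigma>" by simp
        then show ?thesis by simp
      qed
    qed
    also have "\<dots> = avg a (\<lambda>\<sigma>. of_bool (cycle_count L a \<sigma> \<ge> real (K + 1))) + avg a (\<lambda>\<sigma>. of_bool ((cycle_lin L a \<sigma> - mean_log L)\<^sup>2 \<ge> M\<^sup>2))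
        + avg a (\<lambda>\<sigma>. of_bool (cycle_sq L a \<sigma> \<ge> M)) + avg a (\<lambda>\<sigma>. of_bool (conflict L a \<sigma>))"
      unfolding avg_add ..
    also have "\<dots> \<le> avg a (cycle_count L a) / real (K + 1) + avg a (\<lambda>\<sigma>. (cycle_lin L a \<sigma> - mean_log L)\<^sup>2) / M\<^sup>2 + avg a (cycle_sq L a) / M + avg a (\<lambda>\<sigma>. of_bool (conflict L a \<sigma>))"
      using M by (intro add_mono markov order_refl) (auto simp: cycle_count_def cycle_sq_def intro!: sum_nonneg)
    finally have b: "avg a (\<lambda>\<sigma>. of_bool (?A \<sigma>)) \<le> avg a (cycle_count L a) / real (K + 1) + avg a (\<lambda>\<sigma>. (cycle_lin L a \<sigma> - mean_log L)\<^sup>2) / M\<^sup>2 + avg a (cycle_sq L a) / M + avg a (\<lambda>\<sigma>. of_bool (conflict L a \<sigma>))" .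
    have "avg a (\<lambda>\<sigma>. (cycle_lin L a \<sigma> - mean_log L)\<^sup>2) / M\<^sup>2 \<le> (var_log L + M\<^sup>2 * (\<epsilon> / 4)) / M\<^sup>2"
      using elim by (intro divide_right_mono) auto
    also have "\<dots> = var_log L / M\<^sup>2 + \<epsilon> / 4" using M by (simp add: add_divide_distrib)
    finally show ?case using b elim by linarith
  qed
qed

section \<open>The threshold\<close>

lemma incseq_var_log: "incseq var_log"
proof (rule incseq_SucI)
  fix L
  have "var_log (Suc L) = var_log L + ((real d - 1) / (real k - 1)) ^ Suc L / (2 * real (Suc L))"
    by (simp add: var_log_def)
  moreover have "0 \<le> ((real d - 1) / (real k - 1)) ^ Suc L / (2 * real (Suc L))"
    using d_pos k_gt by (intro divide_nonneg_nonneg zero_le_power) auto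
  ultimately show "var_log L \<le> var_log (Suc L)" by linarith
qed

lemma var_log_nonneg: "0 \<le> var_log L"
  using incseqD[OF incseq_var_log, of 0 L] by (simp add: var_log_def)

text \<open>The sum is half the series of \<open>- ln (1 - y)\<close> at
  \<open>y = (d - 1) / (k - 1)\<close>, and \<open>d < k\<close> places \<open>y\<close> inside the
  unit interval.\<close>

lemma var_log_tendsto:
  assumes dk: "d < k"
  shows "var_log \<longlonglongrightarrow> - ln (1 - (real d - 1) / (real k - 1)) / 2"
proof -
  let ?y = "(real d - 1) / (real k - 1)"
  have "real d - 1 \<ge> 0" "real k - 1 > 0" "real d - 1 < real k - 1" using d_pos k_gt dk by simp_all
  then have y: "0 \<le> ?y" "?y < 1" by (simp_all only: divide_nonneg_pos pos_divide_less_eq mult_1)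
  have "\<bar>- ?y\<bar> < 1" unfolding abs_minus_cancel abs_of_nonneg[OF y(1)] by (rule y(2))
  then have "(\<lambda>n. - ((- (- ?y)) ^ n) / of_nat n) sums ln (1 + - ?y)" by (rule ln_series')
  then have "(\<lambda>L. \<Sum>n\<le>L. - (?y ^ n) / real n) \<longlonglongrightarrow> ln (1 - ?y)"
    unfolding sums_def_le minus_minus diff_conv_add_uminus by simp
  then have "(\<lambda>L. (- 1 / 2) * (\<Sum>n\<le>L. - (?y ^ n) / real n)) \<longlonglongrightarrow> (- 1 / 2) * ln (1 - ?y)"
    by (intro tendsto_mult tendsto_const)
  moreover have "(- 1 / 2) * (\<Sum>n\<le>L. - (?y ^ n) / real n) = var_log L" for L
  proof -
    have "(\<Sum>n\<le>L. - (?y ^ n) / real n) = (\<Sum>n=1..L. - (?y ^ n) / real n)"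
      by (rule sum.mono_neutral_right) (auto simp: not_less_eq_eq)
    then show ?thesis unfolding var_log_def by (simp add: sum_distrib_left mult.commute)
  qed
  ultimately show ?thesis by simp
qed

text \<open>Here the Gaussian constant of the second moment meets the constant of the cycles. Their
  equality says that the short cycles account for the whole excess of the second moment.\<close>

lemma exp_var_log_limit:
  assumes dk: "d < k"
  shows "exp (- ln (1 - (real d - 1) / (real k - 1)) / 2) = sqrt ((real k - 1) / (real k - real d))"
proof -
  have e: "1 - (real d - 1) / (real k - 1) = (real k - real d) / (real k - 1)"
    using k_gt by (simp add: field_simps)
  have p: "(real k - real d) / (real k - 1) > 0" using dk k_gt by simp
  have "(exp (- ln ((real k - real d) / (real k - 1)) / 2))\<^sup>2 = exp (- ln ((real k - real d) / (real k - 1)))"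
    by (simp add: power2_eq_square exp_add[symmetric])
  also have "\<dots> = (real k - 1) / (real k - real d)" using p by (simp add: exp_minus)
  finally show ?thesis unfolding e by (intro real_sqrt_unique[symmetric]) auto
qed

text \<open>With \<open>Y = c * cycle_poly L K a\<close>, if \<open>X = 0\<close> then either
  \<open>Y < \<eta>\<close> or the squared distance of \<open>X / mean_X\<close> and
  \<open>Y\<close> is at least \<open>\<eta> ^ 2\<close>. The first event is rare by
  \<open>cycle_poly_small_prob\<close>, the second by Markov's inequality for the mean
  square.\<close>

lemma X_zero_tendsto:
  assumes dst: "real d < d_star k"
  shows "(\<lambda>a. avg a (\<lambda>\<sigma>. of_bool (X a \<sigma> = 0))) \<longlonglongrightarrow> 0"
proof -
  define S where "S = sqrt ((real k - 1) / (real k - real d))"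
  define W where "W = - ln (1 - (real d - 1) / (real k - 1)) / 2"
  have dk: "d < k" by (rule below_threshold(1)[OF dst])
  have Wl: "var_log \<longlonglongrightarrow> W" unfolding W_def by (rule var_log_tendsto[OF dk])
  have WS: "exp W = S" unfolding W_def S_def by (rule exp_var_log_limit[OF dk])
  have bW: "var_log L \<le> W" for L by (rule incseq_le[OF incseq_var_log Wl])
  have W0: "0 \<le> W" using bW[of 0] var_log_nonneg[of 0] by linarith
  have main: "eventually (\<lambda>a. avg a (\<lambda>\<sigma>. of_bool (X a \<sigma> = 0)) < \<epsilon>) sequentially" if \<epsilon>: "\<epsilon> > 0" for \<epsilon> :: real
  proof -
    \<comment> \<open>Chosen from \<open>\<epsilon>\<close> and the supremum \<open>W\<close> of
      \<open>var_log\<close> only, so that \<open>\<eta>\<close> and \<open>\<delta>\<close> are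
      fixed before \<open>L\<close>. The summand with 16 makes \<open>var_log L / M\<close> at most
      \<open>\<epsilon> / 16\<close>; the summand 1 ensures that \<open>var_log L / M ^ 2\<close> is
      no larger.\<close>
    define M where "M = 1 + 16 * W / \<epsilon>"
    define \<eta> where "\<eta> = exp (- 3 * M)"
    \<comment> \<open>A mean square below \<open>2 * \<delta>\<close> bounds the probability of a
      distance of at least \<open>\<eta>\<close> by \<open>\<epsilon> / 4\<close>.\<close>
    define \<delta> where "\<delta> = \<epsilon> * \<eta>\<^sup>2 / 8"
    have M: "M \<ge> 1" using W0 \<epsilon> by (simp add: M_def)
    have \<eta>: "\<eta> > 0" by (simp add: \<eta>_def)
    have \<delta>: "\<delta> > 0" using \<eta> \<epsilon> by (simp add: \<delta>_def)
    have "16 * W \<le> M * \<epsilon>" using \<epsilon> by (simp add: M_def distrib_right)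
    then have WM: "W / M \<le> \<epsilon> / 16" using M by (simp add: field_simps)
    have "(\<lambda>L. exp (var_log L)) \<longlonglongrightarrow> S" using tendsto_exp[OF Wl] unfolding WS .
    then have "eventually (\<lambda>L. exp (var_log L) > S - \<delta>) sequentially" using \<delta> by (intro order_tendstoD) auto
    then obtain L where L: "exp (var_log L) > S - \<delta>" unfolding eventually_sequentially by blast
    define m where "m = mean_log L"
    define b where "b = var_log L"
    define c where "c = exp (- m)"
    define P where "P K = (\<Sum>j\<le>K. (m + b) ^ j / fact j)" for K
    define Q where "Q K = (\<Sum>j\<le>K. (2 * m + b) ^ j / fact j) + (\<Sum>j\<in>{K<..2*K}. abs_log L ^ j / fact j)" for K
    \<comment> \<open>The expression bounds the limiting mean square for a given \<open>K\<close>.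
      As the truncation disappears it becomes \<open>S - 2 * exp b + exp b\<close>, small by the
      choice of \<open>L\<close>.\<close>
    have "(\<lambda>K. S - 2 * c * P K + c\<^sup>2 * Q K) \<longlonglongrightarrow> S - 2 * c * exp (m + b) + c\<^sup>2 * (exp (2 * m + b) + 0)"
      unfolding P_def Q_def
      by (intro tendsto_add tendsto_diff tendsto_mult tendsto_const exp_partial_sums exp_partial_sums_tail)
    moreover have "c * exp (m + b) = exp b" "c\<^sup>2 * exp (2 * m + b) = exp b"
      by (simp_all add: c_def power2_eq_square exp_add[symmetric])
    then have "S - 2 * c * exp (m + b) + c\<^sup>2 * (exp (2 * m + b) + 0) = S - exp b" by (simp add: mult.assoc)
    ultimately have F: "(\<lambda>K. S - 2 * c * P K + c\<^sup>2 * Q K) \<longlonglongrightarrow> S - exp b" by (simp only:)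
    have "S - exp b < \<delta>" using L by (simp add: b_def)
    then have F': "eventually (\<lambda>K. S - 2 * c * P K + c\<^sup>2 * Q K < \<delta>) sequentially" by (rule order_tendstoD(2)[OF F])
    have "(\<lambda>K. x / real (K + 1)) \<longlonglongrightarrow> 0" for x :: real by real_asymp
    from this[of "\<Sum>l=1..L. cycle_rate l"] have "eventually (\<lambda>K. (\<Sum>l=1..L. cycle_rate l) / real (K + 1) < \<epsilon> / 8) sequentially" using \<epsilon> by (intro order_tendstoD) auto
    with F' have "eventually (\<lambda>K. S - 2 * c * P K + c\<^sup>2 * Q K < \<delta> \<and> (\<Sum>l=1..L. cycle_rate l) / real (K + 1) < \<epsilon> / 8) sequentially"
      by (rule eventually_conj)
    then obtain K where K: "S - 2 * c * P K + c\<^sup>2 * Q K < \<delta>" "(\<Sum>l=1..L. cycle_rate l) / real (K + 1) < \<epsilon> / 8"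
      unfolding eventually_sequentially by blast
    have c: "c > 0" by (simp add: c_def)
    \<comment> \<open>The common error of the three limits: they enter the square with weights 1,
      \<open>2 * c\<close> and \<open>c ^ 2\<close>, which add up to
      \<open>(1 + c) ^ 2\<close>.\<close>
    define \<tau> where "\<tau> = \<delta> / (1 + c)\<^sup>2"
    have \<tau>: "\<tau> > 0" "\<tau> + 2 * c * \<tau> + c\<^sup>2 * \<tau> = \<delta>"
    proof -
      show "\<tau> > 0" using \<delta> c by (simp add: \<tau>_def)
      have "\<tau> + 2 * c * \<tau> + c\<^sup>2 * \<tau> = \<tau> * (1 + c)\<^sup>2" by (simp add: power2_eq_square algebra_simps)
      then show "\<tau> + 2 * c * \<tau> + c\<^sup>2 * \<tau> = \<delta>" using c by (simp add: \<tau>_def)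
    qed
    have e8: "\<epsilon> / 8 > 0" and M0: "M > 0" using \<epsilon> M by auto
    from second_moment_limit[OF dst \<tau>(1)] planted_limit[OF \<tau>(1), where L = L and K = K]
      cycle_poly_sq_limit[OF \<tau>(1), where L = L and K = K] cycle_poly_small_prob[OF M0 e8, where L = L and K = K]
    show ?thesis
    proof eventually_elim
      case (elim a)
      let ?Z = "\<lambda>\<sigma>. (X a \<sigma> / mean_X a - c * cycle_poly L K a \<sigma>)\<^sup>2"
      have mp: "mean_X a > 0" by (rule mean_X_pos)
      have "avg a ?Z = avg a (\<lambda>\<sigma>. (1 / (mean_X a)\<^sup>2 * (X a \<sigma>)\<^sup>2 - (2 * c / mean_X a) * (X a \<sigma> * cycle_poly L K a \<sigma>)) + c\<^sup>2 * (cycle_poly L K a \<sigma>)\<^sup>2)"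
        by (simp add: power2_diff power_divide power_mult_distrib algebra_simps)
      also have "\<dots> = avg a (\<lambda>\<sigma>. (X a \<sigma>)\<^sup>2) / (mean_X a)\<^sup>2 - 2 * c * (avg a (\<lambda>\<sigma>. X a \<sigma> * cycle_poly L K a \<sigma>) / mean_X a) + c\<^sup>2 * avg a (\<lambda>\<sigma>. (cycle_poly L K a \<sigma>)\<^sup>2)"
        unfolding avg_add avg_diff avg_cmult by simp
      also have "\<dots> \<le> (S + \<tau>) - 2 * c * (P K - \<tau>) + c\<^sup>2 * (Q K + \<tau>)"
        using elim(1-3) c unfolding S_def[symmetric] P_def Q_def m_def b_def
        by (intro add_mono diff_mono mult_left_mono) auto
      also have "\<dots> = (S - 2 * c * P K + c\<^sup>2 * Q K) + (\<tau> + 2 * c * \<tau> + c\<^sup>2 * \<tau>)" by (simp add: algebra_simps)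
      also have "\<dots> < 2 * \<delta>" using K(1) \<tau>(2) by linarith
      finally have Z: "avg a ?Z / \<eta>\<^sup>2 < \<epsilon> / 4" using \<eta> by (simp add: \<delta>_def field_simps)
      let ?A = "\<lambda>\<sigma>. exp (- mean_log L) * cycle_poly L K a \<sigma> < exp (- 3 * M)"
      have "avg a (\<lambda>\<sigma>. of_bool (X a \<sigma> = 0)) \<le> avg a (\<lambda>\<sigma>. of_bool (?A \<sigma>) + of_bool (?Z \<sigma> \<ge> \<eta>\<^sup>2))"
      proof (rule avg_mono)
        fix \<sigma>
        show "of_bool (X a \<sigma> = 0) \<le> (of_bool (?A \<sigma>) + of_bool (?Z \<sigma> \<ge> \<eta>\<^sup>2) :: real)"
        proof (cases "X a \<sigma> = 0 \<and> \<not> ?A \<sigma>")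
          case True
          then have "\<eta> \<le> c * cycle_poly L K a \<sigma>" by (simp add: \<eta>_def c_def m_def)
          then have "\<eta>\<^sup>2 \<le> (c * cycle_poly L K a \<sigma>)\<^sup>2" using \<eta> by (intro power_mono) auto
          then have "?Z \<sigma> \<ge> \<eta>\<^sup>2" using True by simp
          then show ?thesis by simp
        next
          case False
          then show ?thesis by (cases "X a \<sigma> = 0") auto
        qed
      qed
      also have "\<dots> = avg a (\<lambda>\<sigma>. of_bool (?A \<sigma>)) + avg a (\<lambda>\<sigma>. of_bool (?Z \<sigma> \<ge> \<eta>\<^sup>2))" by (rule avg_add)
      also have "avg a (\<lambda>\<sigma>. of_bool (?Z \<sigma> \<ge> \<eta>\<^sup>2)) \<le> avg a ?Z / \<eta>\<^sup>2" using \<eta> by (intro markov) auto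
      finally have t: "avg a (\<lambda>\<sigma>. of_bool (X a \<sigma> = 0)) \<le> avg a (\<lambda>\<sigma>. of_bool (?A \<sigma>)) + avg a ?Z / \<eta>\<^sup>2" by simp
      have "var_log L / M \<le> W / M" using bW[of L] M by (intro divide_right_mono) auto
      then have v1: "var_log L / M \<le> \<epsilon> / 16" using WM by linarith
      have "var_log L / M\<^sup>2 \<le> var_log L / M"
        using var_log_nonneg[of L] M by (intro divide_left_mono) (auto simp: power2_eq_square)
      then show ?case using t Z v1 K(2) elim(4) \<epsilon> by linarith
    qed
  qed
  show ?thesis
  proof (rule order_tendstoI)
    fix x :: real assume "x < 0"
    then show "eventually (\<lambda>a. x < avg a (\<lambda>\<sigma>. of_bool (X a \<sigma> = 0))) sequentially"
      by (intro always_eventually allI) (simp add: avg_of_bool less_le_trans)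
  qed (rule main)
qed

section \<open>Back to the probability of satisfiability\<close>

lemma prob_satisfiable_eq_avg:
  "prob_satisfiable (k * a) d k = avg a (\<lambda>\<sigma>. of_bool (satisfiable (k * a) d k \<sigma>))"
proof -
  have ne: "Mt a \<noteq> {}" by (rule matchings_nonempty) simp
  have "prob_satisfiable (k * a) d k = real (card (Mt a \<inter> {\<sigma>. satisfiable (k * a) d k \<sigma>})) / real (card (Mt a))"
    unfolding prob_satisfiable_def random_formula_def by (rule measure_pmf_of_set[OF ne finite_Mt])
  then show ?thesis unfolding avg_of_bool card_Mt by (simp add: Int_def)
qed

lemma finite_sat: "finite {T. sat a \<sigma> T}"
  by (rule finite_subset[of _ "Pow {..<k * a}"]) (auto simp: satisfying_assignment_def)

lemma satisfiable_iff_X: "satisfiable (k * a) d k \<sigma> \<longleftrightarrow> X a \<sigma> \<noteq> 0"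
  unfolding satisfiable_def X_def using finite_sat by auto

lemma prob_satisfiable_eq_X_zero:
  "prob_satisfiable (k * a) d k = 1 - avg a (\<lambda>\<sigma>. of_bool (X a \<sigma> = 0))"
proof -
  have "prob_satisfiable (k * a) d k = avg a (\<lambda>\<sigma>. 1 - of_bool (X a \<sigma> = 0))"
    unfolding prob_satisfiable_eq_avg satisfiable_iff_X by (simp only: of_bool_not_iff)
  then show ?thesis unfolding avg_diff avg_const .
qed

lemma prob_satisfiable_le_mean: "prob_satisfiable (k * a) d k \<le> mean_X a"
proof -
  have "of_bool (X a \<sigma> \<noteq> 0) \<le> X a \<sigma>" for \<sigma> by (simp add: X_def of_bool_def)
  then show ?thesis unfolding prob_satisfiable_eq_avg satisfiable_iff_X avg_X[symmetric] by (intro avg_mono)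
qed

lemma above_threshold:
  assumes "real d > d_star k"
  shows "(real d - 1) * ((real k - 1) * (ln (real k) - ln (real k - 1))) > ln (real k)"
proof -
  define D where "D = ln (real k) - ln (real k - 1)"
  have k: "real k \<ge> 4" using k_gt by simp
  have "1 - 1 / real k = (real k - 1) / real k" using k by (simp add: field_simps)
  then have D: "- ln (1 - 1 / real k) = D" using k by (simp add: D_def ln_div)
  have D0: "D > 0" using k by (simp add: D_def)
  have "ln (real k) / ((real k - 1) * D) < real d - 1" using assms unfolding d_star_def D by simp
  then show ?thesis unfolding D_def[symmetric] using D0 k by (simp add: pos_divide_less_eq)
qed

text \<open>As for the overlap terms, all contributions with \<open>ln a\<close> and
  \<open>ln d\<close> cancel. The sign of the remaining factor of \<open>a\<close> is decided by the
  position of \<open>d\<close> relative to \<open>d_star k\<close>.\<close>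

lemma ln_mean_X_rate:
  assumes a: "a > 0"
  shows "ln (mean_X a) = real a * (ln (real k) - (real d - 1) * ((real k - 1) * (ln (real k) - ln (real k - 1))))
     + (lnfact_err (k * a) - lnfact_err a - lnfact_err ((k - 1) * a) + lnfact_err (d * a) + lnfact_err (d * ((k - 1) * a)) - lnfact_err (d * (k * a)))"
proof -
  have k: "real k \<ge> 4" using k_gt by simp
  have le: "a \<le> k * a" using k_gt by simp
  have s: "k * a - a = (k - 1) * a" "d * k * a - d * a = d * ((k - 1) * a)" "d * k * a = d * (k * a)"
    by (simp_all add: diff_mult_distrib diff_mult_distrib2 mult.assoc)
  have ch: "(k * a choose a) > 0" using le by simp
  have "ln (mean_X a) = ln (real (k * a choose a)) + real (d * a) * ln (real k) + lnfact (d * a) + lnfact (d * k * a - d * a) - lnfact (d * k * a)"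
    using ch k_gt unfolding mean_X_def by (simp add: ln_mult ln_div ln_realpow lnfact_def)
  also have "\<dots> = lnfact (k * a) - lnfact a - lnfact ((k - 1) * a) + real (d * a) * ln (real k) + lnfact (d * a) + lnfact (d * ((k - 1) * a)) - lnfact (d * (k * a))"
    unfolding ln_choose[OF le] s(2) unfolding s(1,3) by (simp add: mult.assoc)
  finally have 1: "ln (mean_X a) = \<dots>" .
  have h: "xlnx_sub (real (k * a)) = real a * xlnx_sub (real k) + real k * real a * ln (real a)"
    "xlnx_sub (real a) = real a * xlnx_sub 1 + 1 * real a * ln (real a)"
    "xlnx_sub (real ((k - 1) * a)) = real a * xlnx_sub (real k - 1) + (real k - 1) * real a * ln (real a)"
    "xlnx_sub (real (d * a)) = real a * xlnx_sub (real d) + real d * real a * ln (real a)"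
    "xlnx_sub (real (d * ((k - 1) * a))) = real a * xlnx_sub ((real k - 1) * real d) + ((real k - 1) * real d) * real a * ln (real a)"
    "xlnx_sub (real (d * (k * a))) = real a * xlnx_sub (real k * real d) + (real k * real d) * real a * ln (real a)"
    using xlnx_sub_mult[of "real a" "real k"] xlnx_sub_mult[of "real a" 1] xlnx_sub_mult[of "real a" "real k - 1"]
      xlnx_sub_mult[of "real a" "real d"] xlnx_sub_mult[of "real a" "(real k - 1) * real d"]
      xlnx_sub_mult[of "real a" "real k * real d"] a k
    by (simp_all add: of_nat_diff mult_ac)
  have g: "xlnx_sub ((real k - 1) * real d) = real d * xlnx_sub (real k - 1) + (real k - 1) * real d * ln (real d)"
    "xlnx_sub (real k * real d) = real d * xlnx_sub (real k) + real k * real d * ln (real d)"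
    using xlnx_sub_mult[of "real d" "real k - 1"] xlnx_sub_mult[of "real d" "real k"] d_pos k by simp_all
  have l: "lnfact n = lnfact_err n + xlnx_sub (real n)" for n by (simp add: lnfact_err_def)
  show ?thesis unfolding 1 l h g by (simp add: xlnx_sub_def algebra_simps)
qed

lemma mean_X_tendsto_0:
  assumes dst: "real d > d_star k"
  shows "mean_X \<longlonglongrightarrow> 0"
proof -
  define c where "c = (real d - 1) * ((real k - 1) * (ln (real k) - ln (real k - 1))) - ln (real k)"
  have c: "c > 0" using above_threshold[OF dst] by (simp add: c_def)
  obtain B where "B > 0" and B: "\<And>n. \<bar>lnfact_err n\<bar> \<le> ln (real n + 1) + B" by (rule lnfact_err_crude) blast
  define p where "p = real (d * k)"
  have p: "p > 0" using d_pos k_gt by (simp add: p_def)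
  show ?thesis
  proof (rule tendsto_sandwich)
    show "eventually (\<lambda>a. 0 \<le> mean_X a) sequentially" by (intro always_eventually allI less_imp_le mean_X_pos)
    \<comment> \<open>There are six factorials in \<open>mean_X\<close>, each with a remainder of at
      most one such logarithm plus \<open>B\<close>; together they cannot compensate the linear
      exponent.\<close>
    show "eventually (\<lambda>a. mean_X a \<le> exp (- c * real a + 6 * (ln (p * real a + 1) + B))) sequentially"
      using eventually_gt_at_top[of 0]
    proof eventually_elim
      case (elim a)
      have r: "lnfact_err n \<le> ln (p * real a + 1) + B" "- lnfact_err n \<le> ln (p * real a + 1) + B" if "n \<le> d * (k * a)" for n
      proof -
        have "real n \<le> real (d * (k * a))" using that by (simp only: of_nat_le_iff)
        also have "\<dots> = p * real a" by (simp add: p_def)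
        finally have "ln (real n + 1) \<le> ln (p * real a + 1)" by simp
        then show "lnfact_err n \<le> ln (p * real a + 1) + B" "- lnfact_err n \<le> ln (p * real a + 1) + B" using B[of n] by linarith+
      qed
      have six: "x1 - x2 - x3 + x4 + x5 - x6 \<le> 6 * U"
        if "x1 \<le> U" "- x2 \<le> U" "- x3 \<le> U" "x4 \<le> U" "x5 \<le> U" "- x6 \<le> U" for x1 x2 x3 x4 x5 x6 U :: real
        using that by linarith
      have d1: "x \<le> d * x" for x using d_pos by simp
      have k1: "a \<le> k * a" "(k - 1) * a \<le> k * a" using k_gt by simp_all
      note n = d1[of "k * a"] le_trans[OF k1(1) d1] le_trans[OF k1(2) d1] mult_le_mono2[OF k1(1), of d]
        mult_le_mono2[OF k1(2), of d] order_refl[of "d * (k * a)"]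
      have "ln (mean_X a) = - c * real a
         + (lnfact_err (k * a) - lnfact_err a - lnfact_err ((k - 1) * a) + lnfact_err (d * a) + lnfact_err (d * ((k - 1) * a)) - lnfact_err (d * (k * a)))"
        unfolding ln_mean_X_rate[OF elim] c_def by (simp add: algebra_simps)
      also have "\<dots> \<le> - c * real a + 6 * (ln (p * real a + 1) + B)"
        by (intro add_left_mono six r(1)[OF n(1)] r(2)[OF n(2)] r(2)[OF n(3)] r(1)[OF n(4)] r(1)[OF n(5)] r(2)[OF n(6)])
      finally have "exp (ln (mean_X a)) \<le> exp (- c * real a + 6 * (ln (p * real a + 1) + B))" by simp
      then show ?case using mean_X_pos[of a] by simp
    qed
    show "(\<lambda>a. exp (- c * real a + 6 * (ln (p * real a + 1) + B))) \<longlonglongrightarrow> 0"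
      using c p by real_asymp
  qed simp
qed

lemma prob_satisfiable_tendsto_0:
  assumes "real d > d_star k"
  shows "(\<lambda>a. prob_satisfiable (k * a) d k) \<longlonglongrightarrow> 0"
proof (rule tendsto_sandwich[OF _ _ tendsto_const mean_X_tendsto_0[OF assms]])
  show "eventually (\<lambda>a. 0 \<le> prob_satisfiable (k * a) d k) sequentially"
    by (simp add: prob_satisfiable_def)
  show "eventually (\<lambda>a. prob_satisfiable (k * a) d k \<le> mean_X a) sequentially"
    by (intro always_eventually allI prob_satisfiable_le_mean)
qed

lemma prob_satisfiable_tendsto_1:
  assumes "real d < d_star k"
  shows "(\<lambda>a. prob_satisfiable (k * a) d k) \<longlonglongrightarrow> 1"
proof -
  have "(\<lambda>a. 1 - avg a (\<lambda>\<sigma>. of_bool (X a \<sigma> = 0))) \<longlonglongrightarrow> 1 - 0"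
    by (intro tendsto_diff tendsto_const X_zero_tendsto[OF assms])
  then show ?thesis unfolding prob_satisfiable_eq_X_zero by simp
qed

end

text \<open>Indices that are not multiples of \<open>k\<close> must already carry the limit value.
  For the limit 0 they do, since every formula is then unsatisfiable; for the limit 1 the set
  \<open>A\<close> contains no such index.\<close>

lemma tendsto_along_multiples:
  fixes f :: "nat \<Rightarrow> real"
  assumes k: "k > 0" and lim: "(\<lambda>a. f (k * a)) \<longlonglongrightarrow> l" and off: "\<And>n. n \<in> A \<Longrightarrow> \<not> k dvd n \<Longrightarrow> f n = l"
  shows "(f \<longlongrightarrow> l) (inf sequentially (principal A))"
proof (rule tendstoI)
  fix e :: real assume e: "e > 0"
  then obtain N where N: "\<And>a. a \<ge> N \<Longrightarrow> dist (f (k * a)) l < e"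
    using tendstoD[OF lim] unfolding eventually_sequentially by blast
  have "dist (f n) l < e" if n: "n \<ge> k * N" "n \<in> A" for n
  proof (cases "k dvd n")
    case True
    then obtain a where a: "n = k * a" by (rule dvdE)
    then have "a \<ge> N" using n(1) k by simp
    then show ?thesis unfolding a by (rule N)
  next
    case False
    then show ?thesis using off[OF n(2)] e by simp
  qed
  then show "eventually (\<lambda>n. dist (f n) l < e) (inf sequentially (principal A))"
    unfolding eventually_inf_principal eventually_sequentially by blast
qed

theorem theorem1:
  fixes k d :: nat
  assumes "k > 3" and "d > 0"
  shows "(real d > d_star k \<longrightarrow>
            ((\<lambda>n. prob_satisfiable n d k) \<longlongrightarrow> 0)
              (inf sequentially (principal {n. k dvd d * n}))) \<and>
         (real d < d_star k \<longrightarrow>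
            ((\<lambda>n. prob_satisfiable n d k) \<longlongrightarrow> 1)
              (inf sequentially (principal {n. k dvd n})))"
proof -
  interpret regular_cover k d by unfold_locales (use assms in simp_all)
  have k: "k > 0" using assms(1) by simp
  show ?thesis
  proof (intro conjI impI)
    assume "real d > d_star k"
    then show "((\<lambda>n. prob_satisfiable n d k) \<longlongrightarrow> 0) (inf sequentially (principal {n. k dvd d * n}))"
      by (intro tendsto_along_multiples[OF k] prob_satisfiable_tendsto_0 prob_satisfiable_eq_0 assms(2)) auto
  next
    assume "real d < d_star k"
    then show "((\<lambda>n. prob_satisfiable n d k) \<longlongrightarrow> 1) (inf sequentially (principal {n. k dvd n}))"
      by (intro tendsto_along_multiples[OF k] prob_satisfiable_tendsto_1) auto
  qed
qed

end
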